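(* Let $(X_i)_{i\in\mathbb N}$ be a stationary $\mathbb R^d$-valued process with continuous multidimensional distribution function $F$. Assume there is a vector space $\mathcal G$ of measurable functions $\mathbb R^d\to\mathbb R$, containing the constants, with a seminorm $\|\cdot\|_{\mathcal G}$, such that: (i) for every $f\in\mathcal G$ with $\|f\|_\infty<\infty$ and ${\rm E}f(X_0)=0$ there is $\sigma_f^2<\infty$ with $\frac1{\sqrt n}\sum_{i=1}^n f(X_i)\to N(0,\sigma_f^2)$ in distribution; (ii) $(X_i)$ is $\Theta,r$-multiple mixing with respect to $\mathcal G$ for some $r\ge1$ and some nonincreasing $\Theta:\mathbb N\to\mathbb R_0^+$, and there is an integer $p>dr$ with $\sum_{i=0}^\infty i^{2p-2}\Theta(i)<\infty$; (iii) $\mathcal G$ approximates the indicator functions with a $(\mathcal G,F)$-control function $\Psi$ satisfying $\Psi(z)=\mathcal O(z^{1/\gamma})$ as $z\to\infty$ for some $\gamma>\frac{rp}{p-rd}$. Then there is a centered Gaussian process $(W(t))_{t\in[-\infty,\infty]^d}$ with almost surely continuous sample paths such that $U_n\to W$ in distribution in $\mathbb D([-\infty,\infty]^d)$.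
   Context: Inequalities between vectors are componentwise. $F(t)=P(X_0\le t)$, marginals $F_1,\dots,F_d$. Empirical process $U_n(t)=\frac1{\sqrt n}\sum_{i=1}^n(\mathbf 1\{X_i\le t\}-F(t))$, $t\in[-\infty,\infty]^d$, a random element of $\mathbb D([-\infty,\infty]^d)$ (multidimensional càdlàg functions with the multidimensional Skorokhod metric). Modulus of continuity: $w_g(\delta)=\sup\{|g(t)-g(s)|:\|t-s\|\le\delta\}$. $(\mathcal G,F)$-control function: a nondecreasing $\Psi:\mathbb R_0^+\to\mathbb R_0^+$ such that for every $a<b$ in $[-\infty,\infty]^d$ there is $\phi_{(a,b)}\in\mathcal G$ with $\mathbf 1\{x\le a\}\le\phi_{(a,b)}(x)\le\mathbf 1\{x\le b\}$ for all $x\in\mathbb R^d$ and $\|\phi_{(a,b)}\|_{\mathcal G}\le\Psi\big(1/\min_{i}w_{F_i}(b_i-a_i)\big)$. Multiple mixing: for integers $i_1,\dots,i_j$ write $i_j^*=i_1+\dots+i_j$. $(X_i)$ is $\Theta,r$-multiple mixing with respect to $\mathcal G$ if $r\in[1,\infty)$, $\Theta:\mathbb N\to\mathbb R_0^+$ is nonincreasing, and for every $p\in\mathbb N^*$ there is $K_p<\infty$ such that $$\big|{\rm Cov}\big(f(X_0)f(X_{i_1^*})\cdots f(X_{i_{q-1}^*}),\,f(X_{i_q^*})f(X_{i_{q+1}^*})\cdots f(X_{i_p^*})\big)\big|\le K_p\|f(X_0)\|_r\|f\|_{\mathcal G}\Theta(i_q)$$ for all $f\in\mathcal G$ with $\|f\|_\infty\le1$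 and ${\rm E}f(X_0)=0$, all $i_1,\dots,i_p\in\mathbb N$ and all $q\in\{1,\dots,p\}$. *)

theory Defs
  imports "HOL-Probability.Probability" "HOL-Library.Landau_Symbols"
begin

definition stationary :: "'w measure \<Rightarrow> (nat \<Rightarrow> 'w \<Rightarrow> real^'d) \<Rightarrow> bool" where
  "stationary M X \<longleftrightarrow> (\<forall>k::nat.
     distr M (PiM UNIV (\<lambda>_. borel)) (\<lambda>\<omega> i. X (i + k) \<omega>)
   = distr M (PiM UNIV (\<lambda>_. borel)) (\<lambda>\<omega> i. X i \<omega>))"

definition le_ext :: "real^'d \<Rightarrow> ereal^'d \<Rightarrow> bool" where
  "le_ext x a \<longleftrightarrow> (\<forall>i. ereal (x $ i) \<le> a $ i)"

definition dfun :: "'w measure \<Rightarrow> (nat \<Rightarrow> 'w \<Rightarrow> real^'d) \<Rightarrow> real^'d \<Rightarrow> real" where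
  "dfun M X t = measure M {\<omega> \<in> space M. X 0 \<omega> \<le> t}"

definition dfun_ext :: "'w measure \<Rightarrow> (nat \<Rightarrow> 'w \<Rightarrow> real^'d) \<Rightarrow> ereal^'d \<Rightarrow> real" where
  "dfun_ext M X t = measure M {\<omega> \<in> space M. le_ext (X 0 \<omega>) t}"

definition marg_dfun :: "'w measure \<Rightarrow> (nat \<Rightarrow> 'w \<Rightarrow> real^'d) \<Rightarrow> 'd \<Rightarrow> real \<Rightarrow> real" where
  "marg_dfun M X i x = measure M {\<omega> \<in> space M. X 0 \<omega> $ i \<le> x}"

definition emp_proc :: "'w measure \<Rightarrow> (nat \<Rightarrow> 'w \<Rightarrow> real^'d) \<Rightarrow> nat \<Rightarrow> 'w \<Rightarrow> ereal^'d \<Rightarrow> real" where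
  "emp_proc M X n \<omega> t =
     (\<Sum>i\<in>{1..n}. (if le_ext (X i \<omega>) t then 1 else 0) - dfun_ext M X t) / sqrt (real n)"

definition modcont :: "(real \<Rightarrow> real) \<Rightarrow> ereal \<Rightarrow> real" where
  "modcont g \<delta> = Sup {\<bar>g t - g s\<bar> | t s. ereal \<bar>t - s\<bar> \<le> \<delta>}"

definition gauss_law :: "real \<Rightarrow> real measure" where
  "gauss_law s2 = (if s2 = 0 then return borel 0
                   else density lborel (normal_density 0 (sqrt s2)))"

definition centered_gaussian_process ::
  "'w measure \<Rightarrow> ('t \<Rightarrow> 'w \<Rightarrow> real) \<Rightarrow> bool" where
  "centered_gaussian_process N W \<longleftrightarrow>
     prob_space N \<and> (\<forall>t. W t \<in> borel_measurable N) \<and>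
     (\<forall>(T::'t set) (c::'t \<Rightarrow> real). finite T \<longrightarrow>
        (\<exists>s2\<ge>0. distr N borel (\<lambda>\<omega>. \<Sum>t\<in>T. c t * W t \<omega>) = gauss_law s2))"

definition function_space_with_seminorm ::
  "(real^'d \<Rightarrow> real) set \<Rightarrow> ((real^'d \<Rightarrow> real) \<Rightarrow> real) \<Rightarrow> bool" where
  "function_space_with_seminorm G nG \<longleftrightarrow>
     G \<subseteq> borel_measurable borel \<and>
     (\<forall>c::real. (\<lambda>_. c) \<in> G) \<and>
     (\<forall>f\<in>G. \<forall>g\<in>G. (\<lambda>x. f x + g x) \<in> G) \<and>
     (\<forall>f\<in>G. \<forall>a::real. (\<lambda>x. a * f x) \<in> G) \<and>
     (\<forall>f\<in>G. nG f \<ge> 0) \<and>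
     (\<forall>f\<in>G. \<forall>a::real. nG (\<lambda>x. a * f x) = \<bar>a\<bar> * nG f) \<and>
     (\<forall>f\<in>G. \<forall>g\<in>G. nG (\<lambda>x. f x + g x) \<le> nG f + nG g)"

definition istar :: "(nat \<Rightarrow> nat) \<Rightarrow> nat \<Rightarrow> nat" where
  "istar \<iota> j = (\<Sum>k\<in>{1..j}. \<iota> k)"

definition covariance :: "'w measure \<Rightarrow> ('w \<Rightarrow> real) \<Rightarrow> ('w \<Rightarrow> real) \<Rightarrow> real" where
  "covariance M A B = (\<integral>\<omega>. A \<omega> * B \<omega> \<partial>M) - (\<integral>\<omega>. A \<omega> \<partial>M) * (\<integral>\<omega>. B \<omega> \<partial>M)"

definition Lr_norm :: "'w measure \<Rightarrow> real \<Rightarrow> ('w \<Rightarrow> real) \<Rightarrow> real" where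
  "Lr_norm M r Y = (\<integral>\<omega>. \<bar>Y \<omega>\<bar> powr r \<partial>M) powr (1 / r)"

definition multiple_mixing ::
  "'w measure \<Rightarrow> (nat \<Rightarrow> 'w \<Rightarrow> real^'d) \<Rightarrow> (real^'d \<Rightarrow> real) set \<Rightarrow>
   ((real^'d \<Rightarrow> real) \<Rightarrow> real) \<Rightarrow> (nat \<Rightarrow> real) \<Rightarrow> real \<Rightarrow> bool" where
  "multiple_mixing M X G nG \<Theta> r \<longleftrightarrow>
     r \<ge> 1 \<and> antimono \<Theta> \<and> (\<forall>n. \<Theta> n \<ge> 0) \<and>
     (\<forall>p::nat. p \<ge> 1 \<longrightarrow> (\<exists>K::real.
        \<forall>f\<in>G. (\<forall>x. \<bar>f x\<bar> \<le> 1) \<longrightarrow> (\<integral>\<omega>. f (X 0 \<omega>) \<partial>M) = 0 \<longrightarrow>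
          (\<forall>(\<iota>::nat \<Rightarrow> nat) (q::nat). 1 \<le> q \<and> q \<le> p \<longrightarrow>
             \<bar>covariance M
                 (\<lambda>\<omega>. \<Prod>j\<in>{0..<q}. f (X (istar \<iota> j) \<omega>))
                 (\<lambda>\<omega>. \<Prod>j\<in>{q..p}. f (X (istar \<iota> j) \<omega>))\<bar>
             \<le> K * Lr_norm M r (\<lambda>\<omega>. f (X 0 \<omega>)) * nG f * \<Theta> (\<iota> q))))"

definition control_function ::
  "'w measure \<Rightarrow> (nat \<Rightarrow> 'w \<Rightarrow> real^'d) \<Rightarrow> (real^'d \<Rightarrow> real) set \<Rightarrow>
   ((real^'d \<Rightarrow> real) \<Rightarrow> real) \<Rightarrow> (real \<Rightarrow> real) \<Rightarrow> bool" where
  "control_function M X G nG \<Psi> \<longleftrightarrow>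
     mono_on {0..} \<Psi> \<and> (\<forall>z\<ge>0. \<Psi> z \<ge> 0) \<and>
     (\<forall>a b :: ereal^'d. (\<forall>i. a $ i < b $ i) \<longrightarrow>
        (\<exists>\<phi>\<in>G. (\<forall>x. (if le_ext x a then 1 else 0) \<le> \<phi> x \<and>
                     \<phi> x \<le> (if le_ext x b then 1 else 0)) \<and>
           (let m = Min (range (\<lambda>i. modcont (marg_dfun M X i) (b $ i - a $ i)))
            in m > 0 \<longrightarrow> nG \<phi> \<le> \<Psi> (1 / m))))"

text \<open>A fixed homeomorphism [-oo,oo] -> [-1,1], used to measure the distance of
  time changes from the identity.\<close>
definition eh :: "ereal \<Rightarrow> real" where
  "eh e = (case e of ereal x \<Rightarrow> x / (1 + \<bar>x\<bar>) | PInfty \<Rightarrow> 1 | MInfty \<Rightarrow> -1)"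

definition quadrant :: "'d set \<Rightarrow> ereal^'d \<Rightarrow> (ereal^'d) set" where
  "quadrant S t = {s. \<forall>i. (i \<in> S \<longrightarrow> s $ i < t $ i) \<and> (i \<notin> S \<longrightarrow> t $ i \<le> s $ i)}"

text \<open>Multidimensional cadlag functions (Neuhaus / Bickel-Wichura): limits exist
  along every quadrant, and the function is continuous from above.\<close>
definition Dspace :: "(ereal^'d \<Rightarrow> real) set" where
  "Dspace = {x. \<forall>t. (\<forall>S. \<exists>l. (x \<longlongrightarrow> l) (at t within quadrant S t)) \<and>
                     (x \<longlongrightarrow> x t) (at t within quadrant {} t)}"

definition time_changes :: "(ereal^'d \<Rightarrow> ereal^'d) set" where
  "time_changes = {\<lambda>t. \<chi> i. l i (t $ i) | l :: 'd \<Rightarrow> ereal \<Rightarrow> ereal.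
                      \<forall>i. strict_mono (l i) \<and> bij (l i)}"

definition sk_dist :: "(ereal^'d \<Rightarrow> real) \<Rightarrow> (ereal^'d \<Rightarrow> real) \<Rightarrow> real" where
  "sk_dist x y = Inf {max (SUP t. Max (range (\<lambda>i. \<bar>eh (tc t $ i) - eh (t $ i)\<bar>)))
                          (SUP t. \<bar>x t - y (tc t)\<bar>) | tc. tc \<in> time_changes}"

definition sk_continuous :: "((ereal^'d \<Rightarrow> real) \<Rightarrow> real) \<Rightarrow> bool" where
  "sk_continuous h \<longleftrightarrow> (\<forall>x\<in>Dspace. \<forall>e>0. \<exists>\<delta>>0. \<forall>y\<in>Dspace.
      sk_dist x y < \<delta> \<longrightarrow> \<bar>h x - h y\<bar> < e)"

definition conv_distr_D ::
  "'w measure \<Rightarrow> (nat \<Rightarrow> 'w \<Rightarrow> ereal^'d \<Rightarrow> real) \<Rightarrow> 'v measure \<Rightarrow> ('v \<Rightarrow> ereal^'d \<Rightarrow> real) \<Rightarrow> bool" where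
  "conv_distr_D M U N W \<longleftrightarrow>
     (\<forall>h. (\<exists>B. \<forall>x\<in>Dspace. \<bar>h x\<bar> \<le> B) \<and> sk_continuous h \<longrightarrow>
        (\<lambda>n. \<integral>\<omega>. h (U n \<omega>) \<partial>M) \<longlonglongrightarrow> (\<integral>\<omega>. h (W \<omega>) \<partial>N))"

end

theory Submission
  imports Defs "HOL-Combinatorics.Multiset_Permutations"
begin

text \<open>The mixing hypothesis is applied at the largest gap between consecutive times of a product moment.
  This factorises the sum of the product moments into shorter ones, up to a term controlled by
  \<open>\<Theta>\<close>, so induction gives bounds for the moments of order \<open>2p\<close> of normalised sums over
  bounded functions in \<open>G\<close>. The control function supplies brackets in \<open>G\<close> for the indicators of
  orthants at the points of a dyadic grid in quantile coordinates, with seminorm of order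
  \<open>2\<close> to the power \<open>k / \<gamma>\<close> at level \<open>k\<close>; since the moments decay faster than the size of the
  grid grows, chaining along the levels makes \<open>U\<^sub>n\<close> uniformly close to its values on a fixed level.
  The central limit theorem for functions in \<open>G\<close> and the second moment bounds give the
  characteristic functions of the finite-dimensional limits. The limiting covariance kernel has a
  Cholesky factor along an enumeration of the grids, so the limit is built from white noise, and
  the same moduli of continuity give it continuous paths by Kolmogorov's argument. Finally, a
  Skorokhod-continuous functional is bounded below by its sup-norm Lipschitz regularisations,
  which on a grid level depend on finitely many coordinates and which increase to the functional
  along the continuous paths of the limit.\<close>

section \<open>Moment bounds from multiple mixing\<close>

text \<open>The indicators lie outside \<open>G\<close>, so mixing and the central limit theorem
  reach them only through brackets, whose seminorms grow with the level. A link at level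
  \<open>k\<close> has \<open>mass\<close> of order \<open>2^-k\<close>, so the size entering the
  moment bounds is of order \<open>2^(-k/r) * 2^(k/\<gamma>) = \<rho>^k\<close> with
  \<open>\<rho> = 2^-\<alpha>\<close> and \<open>\<alpha> = 1/r - 1/\<gamma>\<close>. In dimension
  \<open>d\<close>, a union bound over about \<open>2^(d k)\<close> grid points against moments of
  order \<open>2p\<close> leaves the factor \<open>\<beta> = 2^d * \<rho>^p\<close> per level, and
  the condition on \<open>\<gamma>\<close> says exactly that \<open>\<beta> < 1\<close>. The moment
  bound also has a term linear in the size, divided by \<open>n^(p-1)\<close>. It is dominated only
  while \<open>2^k\<close> is at most of order \<open>n\<close>, so the chain must stop. It stops at
  \<open>2^K\<close> of order \<open>sqrt n\<close>, where the bias of the last bracket is small. A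
  further obstacle is that a Skorokhod-continuous \<open>h\<close> of the empirical process is not
  measurable for free; the sample space is cut according to the ties among coordinates to prove it.
  Approximating \<open>h\<close> from below suffices, since the result is applied to
  \<open>- h\<close> too.\<close>

definition box_lists :: "nat \<Rightarrow> nat \<Rightarrow> nat list set" where
  "box_lists n k = {gs. length gs = k \<and> set gs \<subseteq> {..<n}}"

lemma finite_box_lists [simp]: "finite (box_lists n k)"
  using finite_lists_length_eq[of "{..<n}" k] by (simp add: box_lists_def conj_commute)

lemma card_box_lists: "card (box_lists n k) = n ^ k"
  using card_lists_length_eq[of "{..<n}" k] by (simp add: box_lists_def conj_commute)

lemma box_lists_0 [simp]: "box_lists n 0 = {[]}"
  by (auto simp: box_lists_def)

text \<open>A gap list amounts to its entry at position \<open>a\<close> together with the lists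
  before and after it. Through this bijection, sums of products of a left and a right moment
  factorise.\<close>

lemma sum_box_lists_split:
  fixes F :: "nat list \<Rightarrow> nat \<Rightarrow> nat list \<Rightarrow> real"
  assumes "a < k"
  shows "(\<Sum>gs\<in>box_lists n k. F (take a gs) (gs ! a) (drop (Suc a) gs)) =
         (\<Sum>g<n. \<Sum>xs\<in>box_lists n a. \<Sum>ys\<in>box_lists n (k - 1 - a). F xs g ys)"
proof -
  have "(\<Sum>gs\<in>box_lists n k. F (take a gs) (gs ! a) (drop (Suc a) gs)) =
    (\<Sum>(g, xs, ys)\<in>{..<n} \<times> box_lists n a \<times> box_lists n (k - 1 - a). F xs g ys)"
  proof (rule sum.reindex_bij_witness[where i = "\<lambda>(g, xs, ys). xs @ g # ys"
        and j = "\<lambda>gs. (gs ! a, take a gs, drop (Suc a) gs)"])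
    fix gs assume gs: "gs \<in> box_lists n k"
    then show "(case (gs ! a, take a gs, drop (Suc a) gs) of (g, xs, ys) \<Rightarrow> xs @ g # ys) = gs"
      using assms by (auto simp: box_lists_def id_take_nth_drop[symmetric])
    show "(gs ! a, take a gs, drop (Suc a) gs) \<in> {..<n} \<times> box_lists n a \<times> box_lists n (k - 1 - a)"
      using gs assms by (auto simp: box_lists_def dest: in_set_takeD in_set_dropD nth_mem)
  next
    fix z assume "z \<in> {..<n} \<times> box_lists n a \<times> box_lists n (k - 1 - a)"
    then obtain g xs ys where z: "z = (g, xs, ys)" "g < n" "xs \<in> box_lists n a"
      "ys \<in> box_lists n (k - 1 - a)" by auto
    then have "length xs = a" "length ys = k - 1 - a" by (auto simp: box_lists_def)
    then show "((case z of (g, xs, ys) \<Rightarrow> xs @ g # ys) ! a, take a (case z of (g, xs, ys) \<Rightarrow> xs @ g # ys),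
         drop (Suc a) (case z of (g, xs, ys) \<Rightarrow> xs @ g # ys)) = z"
      using z by auto
    show "(case z of (g, xs, ys) \<Rightarrow> xs @ g # ys) \<in> box_lists n k"
      using z assms by (auto simp: box_lists_def)
  qed auto
  also have "\<dots> = (\<Sum>g<n. \<Sum>xs\<in>box_lists n a. \<Sum>ys\<in>box_lists n (k - 1 - a). F xs g ys)"
    by (simp add: sum.cartesian_product split_def)
  finally show ?thesis .
qed

text \<open>A nondecreasing tuple of times is coded by its first time and its increments: mixing is
  stated in terms of the increments, and stationarity removes the first time.\<close>

fun gap_positions :: "nat \<Rightarrow> nat list \<Rightarrow> nat list" where
  "gap_positions i [] = [i]"
| "gap_positions i (g # gs) = i # gap_positions (i + g) gs"

lemma gap_positions_append:
  "gap_positions i (xs @ g # ys) = gap_positions i xs @ gap_positions (i + sum_list xs + g) ys"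
  by (induction xs arbitrary: i) (auto simp: add.assoc)

lemma gap_positions_shift: "gap_positions (i + c) gs = map (\<lambda>x. x + c) (gap_positions i gs)"
proof (induction gs arbitrary: i)
  case (Cons g gs)
  have eq: "i + c + g = i + g + c" by simp
  show ?case by (simp add: eq Cons[of "i + g"])
qed simp

lemma gap_positions_eq_map:
  "gap_positions i gs = map (\<lambda>j. i + sum_list (take j gs)) [0..<Suc (length gs)]"
proof (induction gs arbitrary: i)
  case (Cons g gs)
  have "map (\<lambda>j. i + sum_list (take j (g # gs))) [0..<Suc (length (g # gs))] =
    i # map (\<lambda>j. i + sum_list (take (Suc j) (g # gs))) [0..<Suc (length gs)]"
    by (subst upt_conv_Cons, simp, simp only: list.map, subst map_Suc_upt[symmetric])
       (simp add: comp_def)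
  then show ?case by (simp add: Cons add.assoc del: upt_Suc)
qed simp

lemma sorted_gap_positions:
  assumes "sorted xs" "length xs = Suc k" "set xs \<subseteq> {1..n}"
  shows "\<exists>i\<in>{1..n}. \<exists>gs\<in>box_lists n k. xs = gap_positions i gs"
  using assms
proof (induction k arbitrary: xs)
  case 0
  then obtain i where "xs = [i]" by (auto simp: length_Suc_conv)
  then show ?case using 0 by (auto simp: box_lists_def)
next
  case (Suc k)
  then obtain i ys where xs: "xs = i # ys" "length ys = Suc k" by (cases xs) auto
  with Suc obtain j gs where j: "j \<in> {1..n}" "gs \<in> box_lists n k" "ys = gap_positions j gs"
    by (metis insert_subset list.simps(15) sorted_simps(2))
  have "j \<in> set ys" using j(3) by (cases gs) auto
  then have le: "i \<le> j" using Suc.prems(1) xs by auto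
  \<comment> \<open>Times start at 1, so the gap \<open>j - i\<close> is at most
    \<open>n - 1\<close>, which is the range allowed in \<open>box_lists\<close>.\<close>
  have "i \<ge> 1" using Suc.prems xs by auto
  then have "(j - i) # gs \<in> box_lists n (Suc k)"
    using j le by (auto simp: box_lists_def)
  moreover have "xs = gap_positions i ((j - i) # gs)" using xs j le by simp
  moreover have "i \<in> {1..n}" using Suc.prems xs by auto
  ultimately show ?case by blast
qed

lemma sum_power_lists:
  fixes y :: "'a \<Rightarrow> 'b::comm_semiring_1"
  assumes "finite A"
  shows "(\<Sum>i\<in>A. y i) ^ P = (\<Sum>xs\<in>{xs. set xs \<subseteq> A \<and> length xs = P}. prod_list (map y xs))"
proof (induction P)
  case 0
  have "{xs. set xs \<subseteq> A \<and> length xs = 0} = {[]}" by auto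
  then show ?case by simp
next
  case (Suc P)
  have "(\<Sum>xs\<in>{xs. set xs \<subseteq> A \<and> length xs = Suc P}. prod_list (map y xs)) =
    (\<Sum>(i, xs)\<in>A \<times> {xs. set xs \<subseteq> A \<and> length xs = P}. y i * prod_list (map y xs))"
    by (rule sum.reindex_bij_witness[where i = "\<lambda>(i, xs). i # xs" and j = "\<lambda>xs. (hd xs, tl xs)"])
       (auto simp: length_Suc_conv)
  also have "\<dots> = (\<Sum>i\<in>A. y i) * (\<Sum>xs\<in>{xs. set xs \<subseteq> A \<and> length xs = P}. prod_list (map y xs))"
    by (simp add: sum_product sum.cartesian_product)
  finally show ?case by (simp add: Suc)
qed

lemma sort_fibre_subset: "{xs. sort xs = (ys::nat list)} \<subseteq> permutations_of_multiset (mset ys)"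
  by (auto simp: permutations_of_multiset_def)

lemma card_sort_fibre: "card {xs. sort xs = (ys::nat list)} \<le> fact (length ys)"
proof -
  have "card {xs. sort xs = ys} \<le> card (permutations_of_multiset (mset ys))"
    by (intro card_mono sort_fibre_subset) auto
  also have "\<dots> \<le> fact (length ys)"
    using card_permutations_of_multiset(2)[of "mset ys"]
      card_permutations_of_multiset(1)[of "mset ys"] by (simp add: div_le_dividend)
  finally show ?thesis .
qed

text \<open>A symmetric summand is constant on the lists with a given sorted form, and at most
  \<open>(k + 1)!\<close> lists share one; each sorted form comes from a first time and a gap
  list.\<close>

lemma sum_lists_le_sorted:
  fixes e :: "nat list \<Rightarrow> real"
  assumes nn: "\<And>xs. e xs \<ge> 0" and sym: "\<And>xs. e xs = e (sort xs)"
  shows "(\<Sum>xs\<in>{xs. set xs \<subseteq> {1..n} \<and> length xs = Suc k}. e xs) \<le>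
     fact (Suc k) * (\<Sum>i\<in>{1..n}. \<Sum>gs\<in>box_lists n k. e (gap_positions i gs))"
proof -
  define A where "A = {xs. set xs \<subseteq> {1..n} \<and> length xs = Suc k}"
  have finA: "finite A" unfolding A_def by (rule finite_lists_length_eq) simp
  define S where "S = (\<lambda>(i, gs). gap_positions i gs) ` ({1..n} \<times> box_lists n k)"
  have finS: "finite S" unfolding S_def by simp
  have sub: "sort ` A \<subseteq> S"
  proof
    fix ys assume "ys \<in> sort ` A"
    then have "sorted ys" "length ys = Suc k" "set ys \<subseteq> {1..n}" by (auto simp: A_def)
    then show "ys \<in> S" unfolding S_def using sorted_gap_positions[of ys k n] by force
  qed
  have "(\<Sum>xs\<in>A. e xs) = (\<Sum>ys\<in>sort ` A. \<Sum>xs\<in>{xs\<in>A. sort xs = ys}. e xs)"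
    by (rule sum.image_gen[OF finA])
  also have "\<dots> \<le> (\<Sum>ys\<in>sort ` A. fact (Suc k) * e ys)"
  proof (rule sum_mono)
    fix ys assume ys: "ys \<in> sort ` A"
    have fin: "finite {xs. sort xs = ys}"
      by (rule finite_subset[OF sort_fibre_subset]) simp
    have "(\<Sum>xs\<in>{xs\<in>A. sort xs = ys}. e xs) = real (card {xs\<in>A. sort xs = ys}) * e ys"
      unfolding sum_constant[symmetric]
    proof (rule sum.cong)
      fix xs assume "xs \<in> {xs\<in>A. sort xs = ys}"
      then show "e xs = e ys" using sym[of xs] by simp
    qed simp
    also have "\<dots> \<le> fact (Suc k) * e ys"
    proof (rule mult_right_mono[OF _ nn])
      have "card {xs\<in>A. sort xs = ys} \<le> card {xs. sort xs = ys}"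
        by (rule card_mono[OF fin]) auto
      also have "\<dots> \<le> fact (Suc k)" using card_sort_fibre[of ys] ys by (auto simp: A_def)
      finally have "card {xs\<in>A. sort xs = ys} \<le> fact (Suc k)" .
      then have "real (card {xs\<in>A. sort xs = ys}) \<le> real (fact (Suc k))" by (rule of_nat_mono)
      then show "real (card {xs\<in>A. sort xs = ys}) \<le> fact (Suc k)" by (simp only: of_nat_fact)
    qed
    finally show "(\<Sum>xs\<in>{xs\<in>A. sort xs = ys}. e xs) \<le> fact (Suc k) * e ys" .
  qed
  also have "\<dots> = fact (Suc k) * (\<Sum>ys\<in>sort ` A. e ys)" by (simp add: sum_distrib_left)
  also have "(\<Sum>ys\<in>sort ` A. e ys) \<le> (\<Sum>ys\<in>S. e ys)"
    by (rule sum_mono2[OF finS sub nn])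
  also have "(\<Sum>ys\<in>S. e ys) \<le> (\<Sum>z\<in>{1..n} \<times> box_lists n k. e (case z of (i, gs) \<Rightarrow> gap_positions i gs))"
    unfolding S_def using nn by (intro sum_image_le[where g=e, unfolded comp_def]) auto
  also have "\<dots> = (\<Sum>i\<in>{1..n}. \<Sum>gs\<in>box_lists n k. e (gap_positions i gs))"
    by (simp add: sum.cartesian_product split_def)
  finally show ?thesis by (simp add: A_def)
qed

section \<open>Product moments of a stationary mixing process\<close>

locale mixing_process = prob_space M for M :: "'w measure" +
  fixes X :: "nat \<Rightarrow> 'w \<Rightarrow> real^'d" and G :: "(real^'d \<Rightarrow> real) set"
    and nG :: "(real^'d \<Rightarrow> real) \<Rightarrow> real" and \<Theta> :: "nat \<Rightarrow> real" and r :: real and p :: nat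
  assumes X_meas [measurable]: "\<And>i. X i \<in> borel_measurable M"
    and stat: "stationary M X"
    and fspace: "function_space_with_seminorm G nG"
    and mix: "multiple_mixing M X G nG \<Theta> r"
    and summ: "summable (\<lambda>i. real i ^ (2 * p - 2) * \<Theta> i)"
    and p_pos: "p \<ge> 1"
begin

lemma G_meas: "f \<in> G \<Longrightarrow> f \<in> borel_measurable borel"
  using fspace by (auto simp: function_space_with_seminorm_def)

lemma nG_nonneg: "f \<in> G \<Longrightarrow> nG f \<ge> 0"
  using fspace by (auto simp: function_space_with_seminorm_def)

lemma \<Theta>_nonneg: "\<Theta> n \<ge> 0"
  using mix by (auto simp: multiple_mixing_def)

lemma r_ge_1: "r \<ge> 1"
  using mix by (auto simp: multiple_mixing_def)

definition joint_moment :: "(real^'d \<Rightarrow> real) \<Rightarrow> nat list \<Rightarrow> real" where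
  "joint_moment f xs = \<bar>\<integral>\<omega>. prod_list (map (\<lambda>i. f (X i \<omega>)) xs) \<partial>M\<bar>"

lemma joint_moment_nonneg: "joint_moment f xs \<ge> 0"
  by (simp add: joint_moment_def)

lemma stationary_integral:
  fixes H :: "(nat \<Rightarrow> real^'d) \<Rightarrow> real"
  assumes [measurable]: "H \<in> borel_measurable (PiM UNIV (\<lambda>_. borel))"
  shows "(\<integral>\<omega>. H (\<lambda>i. X (i + k) \<omega>) \<partial>M) = (\<integral>\<omega>. H (\<lambda>i. X i \<omega>) \<partial>M)"
proof -
  have m: "(\<lambda>\<omega> i. X (i + k) \<omega>) \<in> measurable M (PiM UNIV (\<lambda>_. borel))" for k
    by (rule measurable_PiM_single') auto
  have "(\<integral>\<omega>. H (\<lambda>i. X (i + k) \<omega>) \<partial>M) = integral\<^sup>L (distr M (PiM UNIV (\<lambda>_. borel)) (\<lambda>\<omega> i. X (i + k) \<omega>)) H"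
    by (rule integral_distr[symmetric, OF m assms])
  also have "\<dots> = integral\<^sup>L (distr M (PiM UNIV (\<lambda>_. borel)) (\<lambda>\<omega> i. X (i + 0) \<omega>)) H"
    using trans[OF spec[OF stat[unfolded stationary_def], of k] sym[OF spec[OF stat[unfolded stationary_def], of 0]]]
    by (rule arg_cong)
  also have "\<dots> = (\<integral>\<omega>. H (\<lambda>i. X (i + 0) \<omega>) \<partial>M)"
    by (rule integral_distr[OF m assms])
  finally show ?thesis by simp
qed

lemma stationary_integral1:
  fixes h :: "real^'d \<Rightarrow> real"
  assumes [measurable]: "h \<in> borel_measurable borel"
  shows "(\<integral>\<omega>. h (X k \<omega>) \<partial>M) = (\<integral>\<omega>. h (X 0 \<omega>) \<partial>M)"
  using stationary_integral[of "\<lambda>y. h (y 0)" k] by simp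

lemma joint_moment_gap_shift:
  assumes [measurable]: "f \<in> borel_measurable borel"
  shows "joint_moment f (gap_positions i gs) = joint_moment f (gap_positions 0 gs)"
proof -
  have m: "(\<lambda>y. prod_list (map (\<lambda>i. f (y i)) xs)) \<in> borel_measurable (PiM UNIV (\<lambda>_. borel))" for xs :: "nat list"
    by (induction xs) auto
  have "gap_positions i gs = map (\<lambda>x. x + i) (gap_positions 0 gs)"
    using gap_positions_shift[of 0 i gs] by simp
  then show ?thesis
    unfolding joint_moment_def
    using stationary_integral[OF m[of "gap_positions 0 gs"], of i] by (simp add: comp_def)
qed

lemma joint_moment_sort: "joint_moment f xs = joint_moment f (sort xs)"
proof -
  have "prod_list (map (\<lambda>i. f (X i \<omega>)) xs) = prod_list (map (\<lambda>i. f (X i \<omega>)) (sort xs))" for \<omega>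
    by (simp flip: prod_mset_prod_list)
  then show ?thesis by (simp add: joint_moment_def)
qed

text \<open>Mixing bounds the covariance of the products of the factors before and after the gap
  \<open>g\<close>. The product of the two expectations splits off, and its second factor is moved
  back to time 0 by stationarity.\<close>

lemma joint_moment_split:
  "\<exists>K\<ge>0. \<forall>f\<in>G. (\<forall>x. \<bar>f x\<bar> \<le> 1) \<longrightarrow> (\<integral>\<omega>. f (X 0 \<omega>) \<partial>M) = 0 \<longrightarrow>
     (\<forall>xs g ys. length xs + Suc (length ys) = k \<longrightarrow>
        joint_moment f (gap_positions 0 (xs @ g # ys)) \<le>
          K * Lr_norm M r (\<lambda>\<omega>. f (X 0 \<omega>)) * nG f * \<Theta> g
          + joint_moment f (gap_positions 0 xs) * joint_moment f (gap_positions 0 ys))"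
proof (cases "k \<ge> 1")
  case True
  then obtain K where K: "\<forall>f\<in>G. (\<forall>x. \<bar>f x\<bar> \<le> 1) \<longrightarrow> (\<integral>\<omega>. f (X 0 \<omega>) \<partial>M) = 0 \<longrightarrow>
          (\<forall>(\<iota>::nat \<Rightarrow> nat) (q::nat). 1 \<le> q \<and> q \<le> k \<longrightarrow>
             \<bar>covariance M
                 (\<lambda>\<omega>. \<Prod>j\<in>{0..<q}. f (X (istar \<iota> j) \<omega>))
                 (\<lambda>\<omega>. \<Prod>j\<in>{q..k}. f (X (istar \<iota> j) \<omega>))\<bar>
             \<le> K * Lr_norm M r (\<lambda>\<omega>. f (X 0 \<omega>)) * nG f * \<Theta> (\<iota> q))"
    using mix unfolding multiple_mixing_def by meson
  show ?thesis
  proof (intro exI[of _ "\<bar>K\<bar>"] conjI ballI impI allI)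
    fix f and xs ys :: "nat list" and g :: nat
    assume f: "f \<in> G" "\<forall>x. \<bar>f x\<bar> \<le> 1" "(\<integral>\<omega>. f (X 0 \<omega>) \<partial>M) = 0" and len: "length xs + Suc (length ys) = k"
    define gs where "gs = xs @ g # ys"
    \<comment> \<open>\<open>istar\<close> adds up increments numbered from 1, while list entries
      are numbered from 0.\<close>
    define \<iota> where "\<iota> j = gs ! (j - 1)" for j
    define q where "q = Suc (length xs)"
    let ?Y = "\<lambda>j \<omega>. f (X (istar \<iota> j) \<omega>)"
    have lgs: "length gs = k" using len by (simp add: gs_def)
    have istar: "istar \<iota> j = sum_list (take j gs)" if "j \<le> k" for j
    proof -
      have "istar \<iota> j = (\<Sum>i\<in>{0..<j}. gs ! i)"
        unfolding istar_def \<iota>_def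
        by (rule sum.reindex_bij_witness[where i = Suc and j = "\<lambda>i. i - 1"]) auto
      also have "\<dots> = sum_list (take j gs)"
        using that lgs by (simp add: sum_list_sum_nth)
      finally show ?thesis .
    qed
    have pos: "gap_positions 0 gs = map (istar \<iota>) [0..<Suc k]"
      unfolding gap_positions_eq_map lgs by (rule map_cong) (auto simp: istar)
    have "gap_positions 0 gs = gap_positions 0 xs @ gap_positions (sum_list xs + g) ys"
      unfolding gs_def gap_positions_append by simp
    moreover have "[0..<Suc k] = [0..<q] @ [q..<Suc k]"
      using upt_add_eq_append[of 0 q "Suc k - q"] len by (simp add: q_def)
    moreover have "length (gap_positions 0 xs) = q" by (simp add: gap_positions_eq_map q_def)
    ultimately have eqs: "gap_positions 0 xs = map (istar \<iota>) [0..<q]"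
      "gap_positions (sum_list xs + g) ys = map (istar \<iota>) [q..<Suc k]"
      using pos by (auto simp del: upt_Suc)
    have pl: "prod_list (map (\<lambda>i. f (X i \<omega>)) (map (istar \<iota>) [a..<b])) = (\<Prod>j\<in>{a..<b}. ?Y j \<omega>)" for a b \<omega>
      using prod.distinct_set_conv_list[of "[a..<b]" "\<lambda>j. ?Y j \<omega>"] by (simp add: comp_def)
    have jm1: "joint_moment f (gap_positions 0 xs) = \<bar>\<integral>\<omega>. (\<Prod>j\<in>{0..<q}. ?Y j \<omega>) \<partial>M\<bar>"
      by (simp add: joint_moment_def eqs pl del: map_map)
    have jm2: "joint_moment f (gap_positions 0 ys) = \<bar>\<integral>\<omega>. (\<Prod>j\<in>{q..<Suc k}. ?Y j \<omega>) \<partial>M\<bar>"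
      unfolding joint_moment_gap_shift[OF G_meas[OF f(1)], of "sum_list xs + g" ys, symmetric]
      by (simp add: joint_moment_def eqs pl del: map_map upt_Suc)
    have "prod_list (map (\<lambda>i. f (X i \<omega>)) (gap_positions 0 gs)) =
        (\<Prod>j\<in>{0..<q}. ?Y j \<omega>) * (\<Prod>j\<in>{q..<Suc k}. ?Y j \<omega>)" for \<omega>
      unfolding pos pl using len by (simp add: q_def prod.atLeastLessThan_concat del: prod.op_ivl_Suc)
    then have jm: "joint_moment f (gap_positions 0 gs) =
        \<bar>\<integral>\<omega>. (\<Prod>j\<in>{0..<q}. ?Y j \<omega>) * (\<Prod>j\<in>{q..<Suc k}. ?Y j \<omega>) \<partial>M\<bar>"
      by (simp add: joint_moment_def)
    have "\<iota> q = g" by (simp add: \<iota>_def q_def gs_def)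
    moreover have "1 \<le> q \<and> q \<le> k" using len by (simp add: q_def)
    ultimately have "\<bar>covariance M (\<lambda>\<omega>. \<Prod>j\<in>{0..<q}. ?Y j \<omega>) (\<lambda>\<omega>. \<Prod>j\<in>{q..<Suc k}. ?Y j \<omega>)\<bar>
        \<le> K * Lr_norm M r (\<lambda>\<omega>. f (X 0 \<omega>)) * nG f * \<Theta> g"
      using K f by (metis atLeastLessThanSuc_atLeastAtMost)
    also have "\<dots> \<le> \<bar>K\<bar> * Lr_norm M r (\<lambda>\<omega>. f (X 0 \<omega>)) * nG f * \<Theta> g"
      by (intro mult_right_mono nG_nonneg f \<Theta>_nonneg) (auto simp: Lr_norm_def)
    finally show "joint_moment f (gap_positions 0 (xs @ g # ys)) \<le>
          \<bar>K\<bar> * Lr_norm M r (\<lambda>\<omega>. f (X 0 \<omega>)) * nG f * \<Theta> g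
          + joint_moment f (gap_positions 0 xs) * joint_moment f (gap_positions 0 ys)"
      unfolding jm1 jm2 jm[unfolded gs_def] covariance_def abs_mult[symmetric] by linarith
  qed simp
next
  case False
  then show ?thesis by (intro exI[of _ 0]) auto
qed

end

text \<open>Powers of \<open>x\<close> with exponents from 1 to \<open>m\<close> stay below
  \<open>x\<close> if \<open>x \<le> 1\<close> and below \<open>x ^ m\<close> otherwise. The bounds
  for two shorter sums thus multiply to a bound of the same shape, which keeps the induction
  closed.\<close>

lemma power_sum_prod_bound:
  fixes x :: real
  assumes "x \<ge> 0" "1 \<le> a" "1 \<le> b" "a + b \<le> m"
  shows "(x + x ^ a) * (x + x ^ b) \<le> 4 * (x + x ^ m)"
proof -
  have *: "x ^ j \<le> x + x ^ m" if "1 \<le> j" "j \<le> m" for j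
  proof (cases "x \<le> 1")
    case True
    then have "x ^ j \<le> x ^ 1" using assms that by (intro power_decreasing) auto
    then show ?thesis using assms(1) by (simp add: add_increasing2)
  next
    case False
    then have "x ^ j \<le> x ^ m" using that by (intro power_increasing) auto
    then show ?thesis using assms(1) by simp
  qed
  have "(x + x ^ a) * (x + x ^ b) = x ^ 2 + x ^ (1 + a) + x ^ (1 + b) + x ^ (a + b)"
    by (simp add: algebra_simps power2_eq_square power_add)
  also have "\<dots> \<le> 4 * (x + x ^ m)"
    using *[of 2] *[of "1 + a"] *[of "1 + b"] *[of "a + b"] assms by force
  finally show ?thesis .
qed

text \<open>Once the entry \<open>g\<close> at position \<open>a\<close> is the maximum, the other
  \<open>k - 1\<close> entries range freely over \<open>0..g\<close>.\<close>

lemma sum_box_lists_max: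
  fixes h :: "nat \<Rightarrow> real"
  assumes "a < k"
  shows "(\<Sum>gs\<in>box_lists n k. if \<forall>x\<in>set gs. x \<le> gs ! a then h (gs ! a) else 0) =
     (\<Sum>g<n. real (Suc g) ^ (k - 1) * h g)"
proof -
  let ?F = "\<lambda>xs g ys. if (\<forall>x\<in>set xs. x \<le> g) \<and> (\<forall>x\<in>set ys. x \<le> g) then h g else 0"
  have "(if \<forall>x\<in>set gs. x \<le> gs ! a then h (gs ! a) else 0) = ?F (take a gs) (gs ! a) (drop (Suc a) gs)"
    if "gs \<in> box_lists n k" for gs
  proof -
    have "a < length gs" using that assms by (simp add: box_lists_def)
    then have "set gs = set (take a gs) \<union> {gs ! a} \<union> set (drop (Suc a) gs)"
      by (subst id_take_nth_drop[of a gs]) auto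
    then have "(\<forall>x\<in>set gs. x \<le> gs ! a) \<longleftrightarrow> (\<forall>x\<in>set (take a gs). x \<le> gs ! a) \<and> (\<forall>x\<in>set (drop (Suc a) gs). x \<le> gs ! a)"
      by (metis (no_types, lifting) UnE UnI1 UnI2 order_refl singletonD)
    then show ?thesis by simp
  qed
  then have "(\<Sum>gs\<in>box_lists n k. if \<forall>x\<in>set gs. x \<le> gs ! a then h (gs ! a) else 0) =
     (\<Sum>gs\<in>box_lists n k. ?F (take a gs) (gs ! a) (drop (Suc a) gs))"
    by (rule sum.cong[OF refl])
  also have "\<dots> = (\<Sum>g<n. \<Sum>xs\<in>box_lists n a. \<Sum>ys\<in>box_lists n (k - 1 - a). ?F xs g ys)"
    by (rule sum_box_lists_split[OF assms])
  also have "\<dots> = (\<Sum>g<n. real (Suc g) ^ (k - 1) * h g)"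
  proof (rule sum.cong[OF refl])
    fix g assume g: "g \<in> {..<n}"
    have sub: "{xs\<in>box_lists n j. \<forall>x\<in>set xs. x \<le> g} = box_lists (Suc g) j" for j
      using g by (auto simp: box_lists_def)
    have "(\<Sum>xs\<in>box_lists n a. \<Sum>ys\<in>box_lists n (k - 1 - a). ?F xs g ys) =
      (\<Sum>xs\<in>box_lists n a. (if \<forall>x\<in>set xs. x \<le> g then 1 else 0) *
         (\<Sum>ys\<in>box_lists n (k - 1 - a). if \<forall>x\<in>set ys. x \<le> g then h g else 0))"
    proof (rule sum.cong[OF refl])
      fix xs
      have "(\<Sum>ys\<in>B. if b \<and> Q ys then h g else 0) = (if b then 1 else 0) * (\<Sum>ys\<in>B. if Q ys then h g else 0)"
        for b and B :: "nat list set" and Q by auto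
      then show "(\<Sum>ys\<in>box_lists n (k - 1 - a). ?F xs g ys) = (if \<forall>x\<in>set xs. x \<le> g then 1 else 0) *
         (\<Sum>ys\<in>box_lists n (k - 1 - a). if \<forall>x\<in>set ys. x \<le> g then h g else 0)" .
    qed
    also have "\<dots> = (\<Sum>xs\<in>box_lists n a. if \<forall>x\<in>set xs. x \<le> g then 1 else 0) *
         (\<Sum>ys\<in>box_lists n (k - 1 - a). if \<forall>x\<in>set ys. x \<le> g then h g else 0)"
      by (simp add: sum_distrib_right)
    also have "\<dots> = real (Suc g ^ a) * (real (Suc g ^ (k - 1 - a)) * h g)"
      by (simp add: sum.inter_filter[symmetric] sub card_box_lists)
    also have "\<dots> = real (Suc g) ^ (k - 1) * h g"
      using assms by (simp add: power_add[symmetric])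
    finally show "(\<Sum>xs\<in>box_lists n a. \<Sum>ys\<in>box_lists n (k - 1 - a). ?F xs g ys) =
      real (Suc g) ^ (k - 1) * h g" .
  qed
  finally show ?thesis .
qed

section \<open>Induction over the number of gaps\<close>

context mixing_process
begin

abbreviation gap_sum :: "(real^'d \<Rightarrow> real) \<Rightarrow> nat \<Rightarrow> nat \<Rightarrow> real" where
  "gap_sum f n k \<equiv> \<Sum>gs\<in>box_lists n k. joint_moment f (gap_positions 0 gs)"

lemma gap_sum_nonneg: "gap_sum f n k \<ge> 0"
  by (intro sum_nonneg joint_moment_nonneg)

text \<open>Counting lists below a maximal gap \<open>g\<close> produces \<open>Suc g\<close>, while
  the hypothesis has the bare index; for \<open>g \<ge> 1\<close> the ratio is at most 2.\<close>

lemma summable_mixing_weights: "summable (\<lambda>g. real (Suc g) ^ (2 * p - 2) * \<Theta> g)"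
proof (rule summable_comparison_test)
  show "\<exists>N. \<forall>g\<ge>N. norm (real (Suc g) ^ (2 * p - 2) * \<Theta> g) \<le> 2 ^ (2 * p - 2) * (real g ^ (2 * p - 2) * \<Theta> g)"
  proof (intro exI[of _ 1] allI impI)
    fix g :: nat assume "1 \<le> g"
    then have "real (Suc g) ^ (2 * p - 2) \<le> (2 * real g) ^ (2 * p - 2)"
      by (intro power_mono) auto
    then have "real (Suc g) ^ (2 * p - 2) * \<Theta> g \<le> (2 * real g) ^ (2 * p - 2) * \<Theta> g"
      by (intro mult_right_mono \<Theta>_nonneg)
    then show "norm (real (Suc g) ^ (2 * p - 2) * \<Theta> g) \<le> 2 ^ (2 * p - 2) * (real g ^ (2 * p - 2) * \<Theta> g)"
      using \<Theta>_nonneg by (simp add: power_mult_distrib mult.assoc abs_mult)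
  qed
  show "summable (\<lambda>g. 2 ^ (2 * p - 2) * (real g ^ (2 * p - 2) * \<Theta> g))"
    by (intro summable_mult summ)
qed

definition mixing_weight :: real where
  "mixing_weight = (\<Sum>g. real (Suc g) ^ (2 * p - 2) * \<Theta> g)"

text \<open>A moment of order \<open>2 * p\<close> has \<open>2 * p - 1\<close> gaps, and the gaps
  other than the largest account for the exponent \<open>2 * p - 2\<close> in the summability
  hypothesis.\<close>

lemma mixing_weight_bound:
  assumes "k \<le> 2 * p - 1"
  shows "(\<Sum>g<n. real (Suc g) ^ (k - 1) * \<Theta> g) \<le> mixing_weight"
proof -
  have "(\<Sum>g<n. real (Suc g) ^ (k - 1) * \<Theta> g) \<le> (\<Sum>g<n. real (Suc g) ^ (2 * p - 2) * \<Theta> g)"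
    using assms by (intro sum_mono mult_right_mono \<Theta>_nonneg power_increasing) auto
  also have "\<dots> \<le> mixing_weight"
    unfolding mixing_weight_def by (rule sum_le_suminf[OF summable_mixing_weights]) (auto simp: \<Theta>_nonneg)
  finally show ?thesis .
qed

lemma mixing_weight_nonneg: "mixing_weight \<ge> 0"
  unfolding mixing_weight_def by (rule suminf_nonneg[OF summable_mixing_weights]) (auto simp: \<Theta>_nonneg)

text \<open>Each gap list is split at its largest gap \<open>g\<close>, so at most \<open>(g + 1)^(k - 1)\<close> lists share the largest
  gap \<open>g\<close> at a given position.\<close>

lemma gap_sum_recursion:
  assumes "1 \<le> k" "k \<le> 2 * p - 1"
  shows "\<exists>K\<ge>0. \<forall>f\<in>G. (\<forall>x. \<bar>f x\<bar> \<le> 1) \<longrightarrow> (\<integral>\<omega>. f (X 0 \<omega>) \<partial>M) = 0 \<longrightarrow>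
     (\<forall>n. gap_sum f n k \<le> K * (Lr_norm M r (\<lambda>\<omega>. f (X 0 \<omega>)) * nG f)
         + (\<Sum>a<k. real n * gap_sum f n a * gap_sum f n (k - 1 - a)))"
proof -
  obtain K where K: "K \<ge> 0" and split: "\<And>f xs g ys. f \<in> G \<Longrightarrow> (\<forall>x. \<bar>f x\<bar> \<le> 1) \<Longrightarrow>
      (\<integral>\<omega>. f (X 0 \<omega>) \<partial>M) = 0 \<Longrightarrow> length xs + Suc (length ys) = k \<Longrightarrow>
        joint_moment f (gap_positions 0 (xs @ g # ys)) \<le>
          K * Lr_norm M r (\<lambda>\<omega>. f (X 0 \<omega>)) * nG f * \<Theta> g
          + joint_moment f (gap_positions 0 xs) * joint_moment f (gap_positions 0 ys)"
    using joint_moment_split[of k] by blast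
  show ?thesis
  proof (intro exI[of _ "K * (real k * mixing_weight)"] conjI ballI impI allI)
    show "0 \<le> K * (real k * mixing_weight)" using K mixing_weight_nonneg by simp
    fix f n
    assume f: "f \<in> G" "\<forall>x. \<bar>f x\<bar> \<le> 1" "(\<integral>\<omega>. f (X 0 \<omega>) \<partial>M) = 0"
    define B where "B = K * Lr_norm M r (\<lambda>\<omega>. f (X 0 \<omega>)) * nG f"
    have B: "B \<ge> 0" using K nG_nonneg[OF f(1)] by (simp add: B_def Lr_norm_def)
    let ?e = "\<lambda>gs. joint_moment f (gap_positions 0 gs)"
    let ?T = "\<lambda>gs a. (if \<forall>x\<in>set gs. x \<le> gs ! a then B * \<Theta> (gs ! a) else 0)
         + ?e (take a gs) * ?e (drop (Suc a) gs)"
    have nn: "?T gs a \<ge> 0" for gs a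
      using B \<Theta>_nonneg joint_moment_nonneg by (auto intro!: add_nonneg_nonneg)
    have "gap_sum f n k \<le> (\<Sum>gs\<in>box_lists n k. \<Sum>a<k. ?T gs a)"
    proof (rule sum_mono)
      fix gs assume gs: "gs \<in> box_lists n k"
      then have len: "length gs = k" by (simp add: box_lists_def)
      then have "Max (set gs) \<in> set gs" using assms by (intro Max_in) auto
      then obtain a where a: "a < k" "gs ! a = Max (set gs)" using len by (metis in_set_conv_nth)
      have "?e gs \<le> B * \<Theta> (gs ! a) + ?e (take a gs) * ?e (drop (Suc a) gs)"
        unfolding B_def using split[OF f, of "take a gs" "drop (Suc a) gs" "gs ! a"]
          id_take_nth_drop[of a gs] a(1) len by simp
      also have "\<dots> = ?T gs a" using a by simp
      \<comment> \<open>Summing over all positions removes the dependence of \<open>a\<close> on the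
        list, at the price of a factor \<open>k\<close>.\<close>
      also have "\<dots> \<le> (\<Sum>a<k. ?T gs a)"
        by (rule member_le_sum) (use a nn in auto)
      finally show "?e gs \<le> (\<Sum>a<k. ?T gs a)" .
    qed
    also have "\<dots> = (\<Sum>a<k. (\<Sum>gs\<in>box_lists n k. if \<forall>x\<in>set gs. x \<le> gs ! a then B * \<Theta> (gs ! a) else 0))
        + (\<Sum>a<k. \<Sum>gs\<in>box_lists n k. ?e (take a gs) * ?e (drop (Suc a) gs))"
      by (subst sum.swap) (simp add: sum.distrib)
    also have "(\<Sum>a<k. (\<Sum>gs\<in>box_lists n k. if \<forall>x\<in>set gs. x \<le> gs ! a then B * \<Theta> (gs ! a) else 0))
        \<le> (\<Sum>a<k. B * mixing_weight)"
    proof (rule sum_mono)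
      fix a assume "a \<in> {..<k}"
      then have "(\<Sum>gs\<in>box_lists n k. if \<forall>x\<in>set gs. x \<le> gs ! a then B * \<Theta> (gs ! a) else 0)
        = (\<Sum>g<n. real (Suc g) ^ (k - 1) * (B * \<Theta> g))"
        using sum_box_lists_max[where a=a and k=k and n=n and h="\<lambda>g. B * \<Theta> g"] by simp
      also have "\<dots> = B * (\<Sum>g<n. real (Suc g) ^ (k - 1) * \<Theta> g)"
        by (simp add: sum_distrib_left mult_ac)
      also have "\<dots> \<le> B * mixing_weight"
        by (intro mult_left_mono mixing_weight_bound assms B)
      finally show "(\<Sum>gs\<in>box_lists n k. if \<forall>x\<in>set gs. x \<le> gs ! a then B * \<Theta> (gs ! a) else 0)
        \<le> B * mixing_weight" .
    qed
    \<comment> \<open>These products do not involve the gap at position \<open>a\<close> itself; its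
      \<open>n\<close> possible values give the factor \<open>real n\<close>.\<close>
    also have "(\<Sum>a<k. \<Sum>gs\<in>box_lists n k. ?e (take a gs) * ?e (drop (Suc a) gs)) =
        (\<Sum>a<k. real n * gap_sum f n a * gap_sum f n (k - 1 - a))"
    proof (rule sum.cong[OF refl])
      fix a assume "a \<in> {..<k}"
      then show "(\<Sum>gs\<in>box_lists n k. ?e (take a gs) * ?e (drop (Suc a) gs)) =
        real n * gap_sum f n a * gap_sum f n (k - 1 - a)"
        using sum_box_lists_split[where a=a and k=k and n=n and F="\<lambda>xs g ys. ?e xs * ?e ys"]
        by (simp add: sum_product mult.assoc)
    qed
    finally show "gap_sum f n k \<le> K * (real k * mixing_weight) * (Lr_norm M r (\<lambda>\<omega>. f (X 0 \<omega>)) * nG f)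
         + (\<Sum>a<k. real n * gap_sum f n a * gap_sum f n (k - 1 - a))"
      by (simp add: B_def mult_ac)
  qed
qed

abbreviation mix_size :: "(real^'d \<Rightarrow> real) \<Rightarrow> real" where
  "mix_size f \<equiv> Lr_norm M r (\<lambda>\<omega>. f (X 0 \<omega>)) * nG f"

lemma mix_size_nonneg: "f \<in> G \<Longrightarrow> mix_size f \<ge> 0"
  using nG_nonneg[of f] by (simp add: Lr_norm_def)

text \<open>Since \<open>f\<close> is centred, \<open>gap_sum f n 0 = 0\<close>, so in every
  surviving product both blocks have at least two times. By induction the blocks carry the powers
  \<open>Suc a div 2\<close> and \<open>(k - a) div 2\<close> of \<open>real n * mix_size f\<close>,
  whose exponents add up to at most \<open>Suc k div 2\<close>.\<close>

lemma gap_sum_bound: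
  "1 \<le> k \<Longrightarrow> k \<le> 2 * p - 1 \<Longrightarrow> \<exists>C\<ge>0. \<forall>f\<in>G. (\<forall>x. \<bar>f x\<bar> \<le> 1) \<longrightarrow> (\<integral>\<omega>. f (X 0 \<omega>) \<partial>M) = 0 \<longrightarrow>
     (\<forall>n. real n * gap_sum f n k \<le>
        C * (real n * mix_size f + (real n * mix_size f) ^ (Suc k div 2)))"
proof (induction k rule: less_induct)
  case (less k)
  obtain K where K: "K \<ge> 0" and rec: "\<And>f n. f \<in> G \<Longrightarrow> (\<forall>x. \<bar>f x\<bar> \<le> 1) \<Longrightarrow> (\<integral>\<omega>. f (X 0 \<omega>) \<partial>M) = 0 \<Longrightarrow>
     gap_sum f n k \<le> K * mix_size f + (\<Sum>a<k. real n * gap_sum f n a * gap_sum f n (k - 1 - a))"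
    using gap_sum_recursion[OF less.prems] by blast
  have "\<forall>a. \<exists>C\<ge>0. 1 \<le> a \<longrightarrow> a < k \<longrightarrow> (\<forall>f\<in>G. (\<forall>x. \<bar>f x\<bar> \<le> 1) \<longrightarrow> (\<integral>\<omega>. f (X 0 \<omega>) \<partial>M) = 0 \<longrightarrow>
     (\<forall>n. real n * gap_sum f n a \<le> C * (real n * mix_size f + (real n * mix_size f) ^ (Suc a div 2))))"
  proof
    fix a
    show "\<exists>C\<ge>0. 1 \<le> a \<longrightarrow> a < k \<longrightarrow> (\<forall>f\<in>G. (\<forall>x. \<bar>f x\<bar> \<le> 1) \<longrightarrow> (\<integral>\<omega>. f (X 0 \<omega>) \<partial>M) = 0 \<longrightarrow>
     (\<forall>n. real n * gap_sum f n a \<le> C * (real n * mix_size f + (real n * mix_size f) ^ (Suc a div 2))))"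
      using less.IH[of a] less.prems by (cases "1 \<le> a \<and> a < k") auto
  qed
  then obtain C where C: "\<And>a. C a \<ge> 0" and bound: "\<And>a f n. 1 \<le> a \<Longrightarrow> a < k \<Longrightarrow> f \<in> G \<Longrightarrow>
     (\<forall>x. \<bar>f x\<bar> \<le> 1) \<Longrightarrow> (\<integral>\<omega>. f (X 0 \<omega>) \<partial>M) = 0 \<Longrightarrow>
     real n * gap_sum f n a \<le> C a * (real n * mix_size f + (real n * mix_size f) ^ (Suc a div 2))"
    by metis
  define D where "D = K + (\<Sum>a<k. C a * C (k - 1 - a) * 4)"
  show ?case
  proof (intro exI[of _ D] conjI ballI impI allI)
    show "D \<ge> 0" unfolding D_def using K C by (auto intro!: add_nonneg_nonneg sum_nonneg)
    fix f n
    assume f: "f \<in> G" "\<forall>x. \<bar>f x\<bar> \<le> 1" "(\<integral>\<omega>. f (X 0 \<omega>) \<partial>M) = 0"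
    define x where "x = real n * mix_size f"
    have x: "x \<ge> 0" using mix_size_nonneg[OF f(1)] by (simp add: x_def)
    have zero: "gap_sum f n 0 = 0" using f(3) by (simp add: joint_moment_def)
    have "real n * gap_sum f n k \<le> real n * (K * mix_size f + (\<Sum>a<k. real n * gap_sum f n a * gap_sum f n (k - 1 - a)))"
      by (intro mult_left_mono rec f) auto
    also have "\<dots> = K * x + (\<Sum>a<k. (real n * gap_sum f n a) * (real n * gap_sum f n (k - 1 - a)))"
      by (simp add: x_def distrib_left sum_distrib_left[of "real n" _ "{..<k}"] mult_ac)
    also have "(\<Sum>a<k. (real n * gap_sum f n a) * (real n * gap_sum f n (k - 1 - a)))
       \<le> (\<Sum>a<k. C a * C (k - 1 - a) * 4 * (x + x ^ (Suc k div 2)))"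
    proof (rule sum_mono)
      fix a assume a: "a \<in> {..<k}"
      have nn: "0 \<le> C a * C (k - 1 - a) * 4 * (x + x ^ (Suc k div 2))" using x C by simp
      show "(real n * gap_sum f n a) * (real n * gap_sum f n (k - 1 - a))
         \<le> C a * C (k - 1 - a) * 4 * (x + x ^ (Suc k div 2))"
      proof (cases "a = 0 \<or> k - 1 - a = 0")
        case True
        then have "gap_sum f n a = 0 \<or> gap_sum f n (k - 1 - a) = 0" using zero by metis
        then show ?thesis using nn by (metis mult_zero_left mult_zero_right)
      next
        case False
        then have ineq: "1 \<le> a" "a < k" "1 \<le> k - 1 - a" "k - 1 - a < k" using a by auto
        have "(real n * gap_sum f n a) * (real n * gap_sum f n (k - 1 - a)) \<le>
          (C a * (x + x ^ (Suc a div 2))) * (C (k - 1 - a) * (x + x ^ (Suc (k - 1 - a) div 2)))"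
        proof (rule mult_mono)
          show "real n * gap_sum f n a \<le> C a * (x + x ^ (Suc a div 2))"
            unfolding x_def by (rule bound[OF ineq(1,2) f])
          show "real n * gap_sum f n (k - 1 - a) \<le> C (k - 1 - a) * (x + x ^ (Suc (k - 1 - a) div 2))"
            unfolding x_def by (rule bound[OF ineq(3,4) f])
          show "0 \<le> C a * (x + x ^ (Suc a div 2))" using x C by simp
          show "0 \<le> real n * gap_sum f n (k - 1 - a)" by (rule mult_nonneg_nonneg[OF _ gap_sum_nonneg]) simp
        qed
        also have "\<dots> = C a * C (k - 1 - a) * ((x + x ^ (Suc a div 2)) * (x + x ^ (Suc (k - 1 - a) div 2)))"
          by (simp add: mult_ac)
        also have "\<dots> \<le> C a * C (k - 1 - a) * (4 * (x + x ^ (Suc k div 2)))"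
          using ineq C by (intro mult_left_mono power_sum_prod_bound x) auto
        finally show ?thesis by (simp only: mult.assoc)
      qed
    qed
    also have "\<dots> = (\<Sum>a<k. C a * C (k - 1 - a) * 4) * (x + x ^ (Suc k div 2))"
      by (simp add: sum_distrib_right)
    also have "K * x \<le> K * (x + x ^ (Suc k div 2))"
      using K x by (intro mult_left_mono) auto
    finally show "real n * gap_sum f n k \<le> D * (real n * mix_size f + (real n * mix_size f) ^ (Suc k div 2))"
      by (simp add: x_def[symmetric] D_def distrib_right)
  qed
qed

text \<open>The power is expanded over lists of \<open>2 * q\<close> times, which are then sorted:
  they have \<open>k = 2 * q - 1\<close> gaps, and the first time contributes the factor
  \<open>n\<close>.\<close>

theorem moment_bound:
  assumes "1 \<le> q" "q \<le> p"
  shows "\<exists>C\<ge>0. \<forall>f\<in>G. (\<forall>x. \<bar>f x\<bar> \<le> 1) \<longrightarrow> (\<integral>\<omega>. f (X 0 \<omega>) \<partial>M) = 0 \<longrightarrow>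
     (\<forall>n::nat. (\<integral>\<omega>. (\<Sum>i\<in>{1..n}. f (X i \<omega>)) ^ (2 * q) \<partial>M) \<le>
        C * (real n * mix_size f + (real n * mix_size f) ^ q))"
proof -
  define k where "k = 2 * q - 1"
  have k: "1 \<le> k" "k \<le> 2 * p - 1" "Suc k = 2 * q" using assms by (auto simp: k_def)
  obtain C where C: "C \<ge> 0" and bound: "\<And>f n. f \<in> G \<Longrightarrow> (\<forall>x. \<bar>f x\<bar> \<le> 1) \<Longrightarrow> (\<integral>\<omega>. f (X 0 \<omega>) \<partial>M) = 0 \<Longrightarrow>
     real n * gap_sum f n k \<le> C * (real n * mix_size f + (real n * mix_size f) ^ (Suc k div 2))"
    using gap_sum_bound[OF k(1,2)] by blast
  show ?thesis
  proof (intro exI[of _ "fact (Suc k) * C"] conjI ballI impI allI)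
    show "0 \<le> fact (Suc k) * C" using C by simp
    fix f and n :: nat
    assume f: "f \<in> G" "\<forall>x. \<bar>f x\<bar> \<le> 1" "(\<integral>\<omega>. f (X 0 \<omega>) \<partial>M) = 0"
    have [measurable]: "f \<in> borel_measurable borel" by (rule G_meas[OF f(1)])
    let ?A = "{xs. set xs \<subseteq> {1..n} \<and> length xs = Suc k}"
    let ?P = "\<lambda>xs \<omega>. prod_list (map (\<lambda>i. f (X i \<omega>)) xs)"
    have m: "?P xs \<in> borel_measurable M" for xs by (induction xs) auto
    have b: "\<bar>?P xs \<omega>\<bar> \<le> 1" for xs \<omega>
      by (induction xs) (use f in \<open>auto simp: abs_mult intro!: mult_le_one\<close>)
    have int: "integrable M (?P xs)" for xs
      by (rule integrable_const_bound[of _ 1]) (use m b in auto)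
    have "(\<integral>\<omega>. (\<Sum>i\<in>{1..n}. f (X i \<omega>)) ^ (2 * q) \<partial>M) = (\<integral>\<omega>. (\<Sum>xs\<in>?A. ?P xs \<omega>) \<partial>M)"
      unfolding k(3)[symmetric] by (subst sum_power_lists) auto
    also have "\<dots> = (\<Sum>xs\<in>?A. \<integral>\<omega>. ?P xs \<omega> \<partial>M)"
      by (rule Bochner_Integration.integral_sum) (rule int)
    also have "\<dots> \<le> (\<Sum>xs\<in>?A. joint_moment f xs)"
      unfolding joint_moment_def by (intro sum_mono) auto
    also have "\<dots> \<le> fact (Suc k) * (\<Sum>i\<in>{1..n}. \<Sum>gs\<in>box_lists n k. joint_moment f (gap_positions i gs))"
      by (rule sum_lists_le_sorted[where e="joint_moment f", OF joint_moment_nonneg joint_moment_sort])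
    also have "(\<Sum>i\<in>{1..n}. \<Sum>gs\<in>box_lists n k. joint_moment f (gap_positions i gs)) = real n * gap_sum f n k"
      by (subst joint_moment_gap_shift) auto
    also have "fact (Suc k) * (real n * gap_sum f n k) \<le>
        fact (Suc k) * (C * (real n * mix_size f + (real n * mix_size f) ^ (Suc k div 2)))"
      by (intro mult_left_mono bound f) auto
    finally show "(\<integral>\<omega>. (\<Sum>i\<in>{1..n}. f (X i \<omega>)) ^ (2 * q) \<partial>M) \<le>
        fact (Suc k) * C * (real n * mix_size f + (real n * mix_size f) ^ q)"
      unfolding k(3) by (simp add: mult.assoc)
  qed
qed

end

section \<open>Weak convergence of random vectors from characteristic functions\<close>

text \<open>Expectations of these functions are sums of real parts of characteristic functions with
  a phase. The phase \<open>\<theta>\<close> brings in sines, and the product-to-sum formula makes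
  the class an algebra.\<close>

inductive_set trig_poly :: "nat \<Rightarrow> ((nat \<Rightarrow> real) \<Rightarrow> real) set" for k where
  cos: "(\<lambda>y. b * cos ((\<Sum>i<k. c i * y i) + \<theta>)) \<in> trig_poly k"
| add: "f \<in> trig_poly k \<Longrightarrow> g \<in> trig_poly k \<Longrightarrow> (\<lambda>y. f y + g y) \<in> trig_poly k"

lemma trig_poly_const: "(\<lambda>_. b) \<in> trig_poly k"
  using trig_poly.cos[of b "\<lambda>_. 0" k 0] by simp

lemma trig_poly_sin: "i < k \<Longrightarrow> (\<lambda>y. sin (a * y i)) \<in> trig_poly k"
proof -
  assume i: "i < k"
  have "(\<Sum>j<k. (if j = i then a else 0) * y j) = a * y i" for y :: "nat \<Rightarrow> real"
    using i by (simp add: if_distrib[of "\<lambda>x. x * _"] sum.delta cong: if_cong)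
  then show ?thesis
    using trig_poly.cos[of 1 "\<lambda>j. if j = i then a else 0" k "- pi / 2"]
    by (simp add: cos_diff cos_add)
qed

lemma trig_poly_mult_cos:
  "f \<in> trig_poly k \<Longrightarrow> (\<lambda>y. (b * cos ((\<Sum>i<k. c i * y i) + \<theta>)) * f y) \<in> trig_poly k"
proof (induction rule: trig_poly.induct)
  case (cos b' c' \<theta>')
  have eq: "(b * cos ((\<Sum>i<k. c i * y i) + \<theta>)) * (b' * cos ((\<Sum>i<k. c' i * y i) + \<theta>')) =
    (b * b' / 2) * cos ((\<Sum>i<k. (c i - c' i) * y i) + (\<theta> - \<theta>')) + (b * b' / 2) * cos ((\<Sum>i<k. (c i + c' i) * y i) + (\<theta> + \<theta>'))" for y
  proof -
    have s: "(\<Sum>i<k. (c i - c' i) * y i) + (\<theta> - \<theta>') = ((\<Sum>i<k. c i * y i) + \<theta>) - ((\<Sum>i<k. c' i * y i) + \<theta>')"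
      "(\<Sum>i<k. (c i + c' i) * y i) + (\<theta> + \<theta>') = ((\<Sum>i<k. c i * y i) + \<theta>) + ((\<Sum>i<k. c' i * y i) + \<theta>')"
      by (simp_all add: left_diff_distrib distrib_right sum_subtractf sum.distrib)
    have "A * cos u * (B * cos v) = A * B / 2 * cos (u - v) + A * B / 2 * cos (u + v)" for A B u v :: real
      by (simp add: cos_diff cos_add algebra_simps)
    then show ?thesis unfolding s by blast
  qed
  show ?case unfolding eq by (intro trig_poly.add trig_poly.cos)
next
  case (add f g)
  from trig_poly.add[OF add.IH] show ?case by (simp add: distrib_left)
qed

lemma trig_poly_mult: "f \<in> trig_poly k \<Longrightarrow> g \<in> trig_poly k \<Longrightarrow> (\<lambda>y. f y * g y) \<in> trig_poly k"
proof (induction rule: trig_poly.induct)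
  case (cos b c \<theta>)
  then show ?case by (rule trig_poly_mult_cos)
next
  case (add f f')
  from trig_poly.add[OF add.IH(1)[OF add.prems] add.IH(2)[OF add.prems]] show ?case by (simp add: distrib_right)
qed

lemma compact_PiE_real:
  fixes S :: "nat \<Rightarrow> real set"
  assumes "\<And>i. compact (S i)"
  shows "compact (PiE UNIV S)"
proof -
  have "compactin (product_topology (\<lambda>_. euclidean) UNIV) (PiE UNIV S)"
    using assms by (simp add: compactin_PiE)
  then show ?thesis by (simp add: euclidean_product_topology)
qed

text \<open>The Lipschitz bound also says that \<open>h\<close> ignores the coordinates from
  \<open>k\<close> on, so continuity of the first \<open>k\<close> coordinates is enough in the
  product topology.\<close>

lemma continuous_on_Lipschitz_coords:
  fixes h :: "(nat \<Rightarrow> real) \<Rightarrow> real"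
  assumes Lip: "\<And>x y. \<bar>h x - h y\<bar> \<le> C * (\<Sum>i<k. \<bar>x i - y i\<bar>)"
    and g: "\<And>i. i < k \<Longrightarrow> continuous_on S (\<lambda>x. g x i)"
  shows "continuous_on S (\<lambda>x. h (g x))"
  unfolding continuous_on_def
proof
  fix x assume x: "x \<in> S"
  have "((\<lambda>y. C * (\<Sum>i<k. \<bar>g y i - g x i\<bar>)) \<longlongrightarrow> C * (\<Sum>i<k. \<bar>g x i - g x i\<bar>)) (at x within S)"
    by (intro tendsto_intros) (use g x in \<open>auto simp: continuous_on_def\<close>)
  then have "((\<lambda>y. C * (\<Sum>i<k. \<bar>g y i - g x i\<bar>)) \<longlongrightarrow> 0) (at x within S)" by simp
  then have "((\<lambda>y. h (g y) - h (g x)) \<longlongrightarrow> 0) (at x within S)"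
    by (rule Lim_null_comparison[rotated]) (use Lip in auto)
  then show "((\<lambda>x. h (g x)) \<longlongrightarrow> h (g x)) (at x within S)" by (rule LIM_zero_cancel)
qed

lemma continuous_on_coord: "continuous_on S (\<lambda>x::nat \<Rightarrow> real. x i)"
  by (rule continuous_on_subset[OF continuous_on_product_coordinates subset_UNIV])

text \<open>Folding the line by \<^term>\<open>\<lambda>y. arcsin (sin (a * y)) / a\<close> turns a function on
  the cube of side \<^term>\<open>pi / a\<close> into a continuous function of sines, so that the
  approximating trigonometric polynomial stays close on the whole space.\<close>

lemma trig_poly_approx:
  fixes h :: "(nat \<Rightarrow> real) \<Rightarrow> real"
  assumes Lip: "\<And>x y. \<bar>h x - h y\<bar> \<le> C * (\<Sum>i<k. \<bar>x i - y i\<bar>)" and a: "a > 0" and e: "e > 0"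
  shows "\<exists>F\<in>trig_poly k. \<forall>y. \<bar>h (\<lambda>i. arcsin (sin (a * y i)) / a) - F y\<bar> < e"
proof -
  \<comment> \<open>Coordinates from \<open>k\<close> on are pinned to 0, so that points of
    \<open>S\<close> are separated by sines of the first \<open>k\<close> coordinates alone.\<close>
  define S where "S = PiE UNIV (\<lambda>i. if i < k then {-1..1::real} else {0})"
  define R where "R = {g. continuous_on S g \<and> (\<lambda>y. g (\<lambda>i. if i < k then sin (a * y i) else 0)) \<in> trig_poly k}"
  interpret function_ring_on R S
  proof
    show "compact S" unfolding S_def by (rule compact_PiE_real) auto
    show "f \<in> R \<Longrightarrow> continuous_on S f" for f by (simp add: R_def)
    show "f \<in> R \<Longrightarrow> g \<in> R \<Longrightarrow> (\<lambda>x. f x + g x) \<in> R" for f g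
      unfolding R_def mem_Collect_eq by (intro conjI continuous_on_add trig_poly.add) (elim conjE, assumption)+
    show "f \<in> R \<Longrightarrow> g \<in> R \<Longrightarrow> (\<lambda>x. f x * g x) \<in> R" for f g
      unfolding R_def mem_Collect_eq by (intro conjI continuous_on_mult trig_poly_mult) (elim conjE, assumption)+
    show "(\<lambda>_. c) \<in> R" for c by (auto simp: R_def trig_poly_const)
    fix x y assume xS: "x \<in> S" and yS: "y \<in> S" and "x \<noteq> y"
    then obtain i where i: "x i \<noteq> y i" by blast
    have "i < k"
    proof (rule ccontr)
      assume "\<not> i < k"
      moreover have "z i \<in> (if i < k then {-1..1} else {0})" if "z \<in> S" for z
        using that unfolding S_def by (rule PiE_mem) simp
      ultimately have "x i = 0" "y i = 0" using xS yS by simp_all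
      then show False using i by simp
    qed
    then have "(\<lambda>x. x i) \<in> R"
      unfolding R_def mem_Collect_eq using continuous_on_coord trig_poly_sin by simp
    then show "\<exists>f\<in>R. f x \<noteq> f y" using i by (intro bexI[of _ "\<lambda>x. x i"])
  qed
  have rng: "x i \<in> {-1..1}" if "x \<in> S" for x i
    using that by (cases "i < k") (auto simp: S_def PiE_iff split: if_splits)
  have "continuous_on S (\<lambda>s. h (\<lambda>i. arcsin (s i) / a))"
  proof (rule continuous_on_Lipschitz_coords[OF Lip])
    fix i
    have "continuous_on S (\<lambda>x. arcsin (x i))"
      by (rule continuous_on_compose2[OF continuous_on_arcsin' continuous_on_coord]) (use rng in auto)
    then show "continuous_on S (\<lambda>x. arcsin (x i) / a)"
      by (rule continuous_on_divide[OF _ continuous_on_const]) (use a in simp)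
  qed
  from Stone_Weierstrass_basic[OF this e] obtain g where g: "g \<in> R" "\<And>s. s \<in> S \<Longrightarrow> \<bar>h (\<lambda>i. arcsin (s i) / a) - g s\<bar> < e" by blast
  show ?thesis
  proof (intro bexI[of _ "\<lambda>y. g (\<lambda>i. if i < k then sin (a * y i) else 0)"] allI)
    fix y :: "nat \<Rightarrow> real"
    let ?s = "\<lambda>i. if i < k then sin (a * y i) else 0"
    have "?s \<in> S" by (auto simp: S_def PiE_iff)
    moreover have "h (\<lambda>i. arcsin (?s i) / a) = h (\<lambda>i. arcsin (sin (a * y i)) / a)"
    proof -
      have "\<bar>h (\<lambda>i. arcsin (?s i) / a) - h (\<lambda>i. arcsin (sin (a * y i)) / a)\<bar> \<le> C * (\<Sum>i<k. \<bar>arcsin (?s i) / a - arcsin (sin (a * y i)) / a\<bar>)" by (rule Lip)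
      also have "(\<Sum>i<k. \<bar>arcsin (?s i) / a - arcsin (sin (a * y i)) / a\<bar>) = 0" by (rule sum.neutral) auto
      finally show ?thesis by simp
    qed
    ultimately show "\<bar>h (\<lambda>i. arcsin (sin (a * y i)) / a) - g ?s\<bar> < e" using g(2)[of ?s] by metis
  qed (use g in \<open>simp add: R_def\<close>)
qed

lemma (in prob_space) expectation_cos:
  assumes [measurable]: "\<And>i. (\<lambda>\<omega>. V \<omega> i) \<in> borel_measurable M"
  shows "integrable M (\<lambda>\<omega>. b * cos ((\<Sum>i<k. c i * V \<omega> i) + \<theta>))"
    and "(\<integral>\<omega>. b * cos ((\<Sum>i<k. c i * V \<omega> i) + \<theta>) \<partial>M) = b * Re (iexp \<theta> * (CLINT \<omega>|M. iexp (\<Sum>i<k. c i * V \<omega> i)))"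
proof -
  show "integrable M (\<lambda>\<omega>. b * cos ((\<Sum>i<k. c i * V \<omega> i) + \<theta>))"
    by (rule integrable_const_bound[of _ "\<bar>b\<bar>"]) (auto simp: abs_mult intro!: mult_left_le)
  have i: "integrable M (\<lambda>\<omega>. iexp (\<Sum>i<k. c i * V \<omega> i))" by (rule integrable_iexp) auto
  have i2: "integrable M (\<lambda>\<omega>. iexp \<theta> * iexp (\<Sum>i<k. c i * V \<omega> i))" using i by simp
  have "cos (s + \<theta>) = Re (iexp \<theta> * iexp s)" for s :: real
  proof -
    have "iexp \<theta> * iexp s = iexp (s + \<theta>)" by (simp only: exp_add of_real_add distrib_left mult.commute)
    then show ?thesis by (simp add: Re_exp)
  qed
  then have "(\<integral>\<omega>. b * cos ((\<Sum>i<k. c i * V \<omega> i) + \<theta>) \<partial>M) = b * (\<integral>\<omega>. Re (iexp \<theta> * iexp (\<Sum>i<k. c i * V \<omega> i)) \<partial>M)"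
    by simp
  also have "(\<integral>\<omega>. Re (iexp \<theta> * iexp (\<Sum>i<k. c i * V \<omega> i)) \<partial>M) = Re (CLINT \<omega>|M. iexp \<theta> * iexp (\<Sum>i<k. c i * V \<omega> i))"
    using i2 by (rule integral_Re)
  also have "(CLINT \<omega>|M. iexp \<theta> * iexp (\<Sum>i<k. c i * V \<omega> i)) = iexp \<theta> * (CLINT \<omega>|M. iexp (\<Sum>i<k. c i * V \<omega> i))"
    by simp
  finally show "(\<integral>\<omega>. b * cos ((\<Sum>i<k. c i * V \<omega> i) + \<theta>) \<partial>M) = b * Re (iexp \<theta> * (CLINT \<omega>|M. iexp (\<Sum>i<k. c i * V \<omega> i)))" .
qed

lemma trig_poly_integral_conv:
  fixes Y :: "nat \<Rightarrow> 'a \<Rightarrow> nat \<Rightarrow> real" and Z :: "'b \<Rightarrow> nat \<Rightarrow> real"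
  assumes M: "prob_space M" and N: "prob_space N"
    and Y: "\<And>n i. (\<lambda>\<omega>. Y n \<omega> i) \<in> borel_measurable M" and Z: "\<And>i. (\<lambda>\<omega>. Z \<omega> i) \<in> borel_measurable N"
    and char: "\<And>c. (\<lambda>n. CLINT \<omega>|M. iexp (\<Sum>i<k. c i * Y n \<omega> i)) \<longlonglongrightarrow> (CLINT \<omega>|N. iexp (\<Sum>i<k. c i * Z \<omega> i))"
    and F: "F \<in> trig_poly k"
  shows "(\<forall>n. integrable M (\<lambda>\<omega>. F (Y n \<omega>))) \<and> integrable N (\<lambda>\<omega>. F (Z \<omega>)) \<and>
    (\<lambda>n. \<integral>\<omega>. F (Y n \<omega>) \<partial>M) \<longlonglongrightarrow> (\<integral>\<omega>. F (Z \<omega>) \<partial>N)"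
  using F
proof (induction rule: trig_poly.induct)
  case (cos b c \<theta>)
  interpret M: prob_space M by fact
  interpret N: prob_space N by fact
  show ?case
  proof (intro conjI allI)
    show "integrable M (\<lambda>\<omega>. b * cos ((\<Sum>i<k. c i * Y n \<omega> i) + \<theta>))" for n by (rule M.expectation_cos[OF Y])
    show "integrable N (\<lambda>\<omega>. b * cos ((\<Sum>i<k. c i * Z \<omega> i) + \<theta>))" by (rule N.expectation_cos[OF Z])
    have eqY: "(\<integral>\<omega>. b * cos ((\<Sum>i<k. c i * Y n \<omega> i) + \<theta>) \<partial>M) = b * Re (iexp \<theta> * (CLINT \<omega>|M. iexp (\<Sum>i<k. c i * Y n \<omega> i)))" for n
      by (rule M.expectation_cos) (rule Y)
    have eqZ: "(\<integral>\<omega>. b * cos ((\<Sum>i<k. c i * Z \<omega> i) + \<theta>) \<partial>N) = b * Re (iexp \<theta> * (CLINT \<omega>|N. iexp (\<Sum>i<k. c i * Z \<omega> i)))"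
      by (rule N.expectation_cos) (rule Z)
    show "(\<lambda>n. \<integral>\<omega>. b * cos ((\<Sum>i<k. c i * Y n \<omega> i) + \<theta>) \<partial>M) \<longlonglongrightarrow> (\<integral>\<omega>. b * cos ((\<Sum>i<k. c i * Z \<omega> i) + \<theta>) \<partial>N)"
      unfolding eqY eqZ by (intro tendsto_mult tendsto_Re tendsto_const char)
  qed
next
  case (add f g)
  then show ?case by (auto intro!: tendsto_intros)
qed

lemma measurable_Lipschitz_coords:
  fixes h :: "(nat \<Rightarrow> real) \<Rightarrow> real"
  assumes Lip: "\<And>x y. \<bar>h x - h y\<bar> \<le> C * (\<Sum>i<k. \<bar>x i - y i\<bar>)"
    and V: "\<And>i. (\<lambda>\<omega>. V \<omega> i) \<in> borel_measurable P"
  shows "(\<lambda>\<omega>. h (V \<omega>)) \<in> borel_measurable P"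
proof -
  have "continuous_on UNIV (\<lambda>x. h (\<lambda>i. x i))" by (rule continuous_on_Lipschitz_coords[OF Lip continuous_on_coord])
  then have 1: "h \<in> borel_measurable borel" by (intro borel_measurable_continuous_onI) simp
  have "V \<in> measurable P (PiM UNIV (\<lambda>_. borel))" by (rule measurable_PiM_single') (use V in auto)
  then have "V \<in> borel_measurable P" using sets_PiM_equal_borel measurable_cong_sets by blast
  then show ?thesis using 1 by (rule measurable_compose)
qed

lemma fold_measurable: "a > 0 \<Longrightarrow> (\<lambda>u. arcsin (sin (a * u)) / a) \<in> borel_measurable borel"
proof (rule borel_measurable_continuous_onI)
  assume a: "a > 0"
  have "continuous_on UNIV (\<lambda>u. arcsin (sin (a * u)))"
    by (rule continuous_on_arcsin) (auto intro!: continuous_intros)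
  then show "continuous_on UNIV (\<lambda>u. arcsin (sin (a * u)) / a)" by (intro continuous_intros) (use a in auto)
qed

text \<open>With \<open>a = b * pi / 2\<close> the folding is the identity on the cube
  \<open>\<bar>y i\<bar> \<le> 1 / b\<close>. Outside the cube the error is at most
  \<open>2 * B\<close>, and there the sum of the \<open>b\<^sup>2 * (y i)\<^sup>2\<close> is at
  least 1, as in Chebyshev's inequality.\<close>

lemma (in prob_space) fold_expectation:
  fixes V :: "'a \<Rightarrow> nat \<Rightarrow> real" and h :: "(nat \<Rightarrow> real) \<Rightarrow> real"
  assumes V: "\<And>i. (\<lambda>\<omega>. V \<omega> i) \<in> borel_measurable M"
    and sq: "\<And>i. i < k \<Longrightarrow> integrable M (\<lambda>\<omega>. (V \<omega> i)\<^sup>2)" "\<And>i. i < k \<Longrightarrow> (\<integral>\<omega>. (V \<omega> i)\<^sup>2 \<partial>M) \<le> S"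
    and Lip: "\<And>x y. \<bar>h x - h y\<bar> \<le> C * (\<Sum>i<k. \<bar>x i - y i\<bar>)" and B: "\<And>x. \<bar>h x\<bar> \<le> B"
    and b: "b > 0" and a: "a = b * pi / 2" and Fint: "integrable M (\<lambda>\<omega>. F (V \<omega>))"
    and F: "\<And>y. \<bar>h (\<lambda>i. arcsin (sin (a * y i)) / a) - F y\<bar> < e"
  shows "\<bar>(\<integral>\<omega>. h (V \<omega>) \<partial>M) - (\<integral>\<omega>. F (V \<omega>) \<partial>M)\<bar> \<le> b\<^sup>2 * (2 * B * real k * S) + e"
proof -
  let ?\<tau> = "\<lambda>y i. arcsin (sin (a * y i)) / a"
  have B0: "B \<ge> 0" using B[of "\<lambda>_. 0"] by linarith
  have apos: "a > 0" unfolding a using b by simp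
  have fold: "arcsin (sin (a * u)) / a = u" if "\<bar>u\<bar> \<le> 1 / b" for u
  proof -
    have "\<bar>a * u\<bar> \<le> a * (1 / b)" unfolding abs_mult using apos that by (intro mult_mono) auto
    also have "\<dots> = pi / 2" unfolding a using b by simp
    finally have "arcsin (sin (a * u)) = a * u" by (intro arcsin_sin) auto
    then show ?thesis using apos by simp
  qed
  have i1: "integrable M (\<lambda>\<omega>. h (V \<omega>))"
    by (rule integrable_const_bound[of _ B]) (use B measurable_Lipschitz_coords[OF Lip V] in auto)
  have "(\<lambda>\<omega>. h (?\<tau> (V \<omega>))) \<in> borel_measurable M"
    by (rule measurable_Lipschitz_coords[where V="\<lambda>\<omega>. ?\<tau> (V \<omega>)", OF Lip])
       (rule measurable_compose[OF V fold_measurable[OF apos]])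
  then have i2: "integrable M (\<lambda>\<omega>. h (?\<tau> (V \<omega>)))" by (intro integrable_const_bound[of _ B]) (use B in auto)
  have ptw: "\<bar>h y - F y\<bar> \<le> 2 * B * (\<Sum>i<k. b\<^sup>2 * (y i)\<^sup>2) + e" for y
  proof -
    have "\<bar>h y - h (?\<tau> y)\<bar> \<le> 2 * B * (\<Sum>i<k. b\<^sup>2 * (y i)\<^sup>2)"
    proof (cases "\<forall>i<k. \<bar>y i\<bar> \<le> 1 / b")
      case True
      then have "(\<Sum>i<k. \<bar>y i - ?\<tau> y i\<bar>) = 0" using fold by simp
      then have "h y = h (?\<tau> y)" using Lip[of y "?\<tau> y"] by simp
      then show ?thesis using B0 by (simp add: sum_nonneg)
    next
      case False
      then obtain i where i: "i < k" "1 / b < \<bar>y i\<bar>" by auto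
      then have "1 < b * \<bar>y i\<bar>" using b by (simp add: pos_divide_less_eq mult.commute)
      then have "1 \<le> (b * \<bar>y i\<bar>)\<^sup>2" by (simp add: one_le_power)
      then have "1 \<le> b\<^sup>2 * (y i)\<^sup>2" by (simp add: power_mult_distrib)
      also have "\<dots> \<le> (\<Sum>i<k. b\<^sup>2 * (y i)\<^sup>2)" by (rule member_le_sum) (use i in auto)
      finally have "2 * B * 1 \<le> 2 * B * (\<Sum>i<k. b\<^sup>2 * (y i)\<^sup>2)" using B0 by (intro mult_left_mono) auto
      then show ?thesis using B[of y] B[of "?\<tau> y"] by linarith
    qed
    then show ?thesis using F[of y] by linarith
  qed
  have "\<bar>(\<integral>\<omega>. h (V \<omega>) \<partial>M) - (\<integral>\<omega>. F (V \<omega>) \<partial>M)\<bar> = \<bar>\<integral>\<omega>. h (V \<omega>) - F (V \<omega>) \<partial>M\<bar>" using i1 Fint by simp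
  also have "\<dots> \<le> (\<integral>\<omega>. \<bar>h (V \<omega>) - F (V \<omega>)\<bar> \<partial>M)" by (rule integral_abs_bound)
  also have "\<dots> \<le> (\<integral>\<omega>. 2 * B * (\<Sum>i<k. b\<^sup>2 * (V \<omega> i)\<^sup>2) + e \<partial>M)"
  proof (intro integral_mono ptw)
    have "integrable M (\<lambda>\<omega>. \<Sum>i<k. b\<^sup>2 * (V \<omega> i)\<^sup>2)"
      by (intro Bochner_Integration.integrable_sum integrable_mult_right sq(1)) auto
    then show "integrable M (\<lambda>\<omega>. 2 * B * (\<Sum>i<k. b\<^sup>2 * (V \<omega> i)\<^sup>2) + e)"
      by (intro Bochner_Integration.integrable_add integrable_mult_right integrable_const)
  qed (use i1 Fint in auto)
  also have "\<dots> = 2 * B * (\<Sum>i<k. b\<^sup>2 * (\<integral>\<omega>. (V \<omega> i)\<^sup>2 \<partial>M)) + e"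
  proof -
    have "integrable M (\<lambda>\<omega>. \<Sum>i<k. b\<^sup>2 * (V \<omega> i)\<^sup>2)"
      by (intro Bochner_Integration.integrable_sum integrable_mult_right sq(1)) auto
    moreover have "(\<integral>\<omega>. (\<Sum>i<k. b\<^sup>2 * (V \<omega> i)\<^sup>2) \<partial>M) = (\<Sum>i<k. b\<^sup>2 * (\<integral>\<omega>. (V \<omega> i)\<^sup>2 \<partial>M))"
      by (subst Bochner_Integration.integral_sum) (auto intro: integrable_mult_right sq(1))
    ultimately show ?thesis by (simp add: prob_space)
  qed
  also have "\<dots> \<le> 2 * B * (\<Sum>i<k. b\<^sup>2 * S) + e" using sq B0 by (intro add_right_mono mult_left_mono sum_mono) auto
  also have "\<dots> = b\<^sup>2 * (2 * B * real k * S) + e" by simp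
  finally show ?thesis .
qed

text \<open>Uniform second moments replace tightness: they bound the effect of folding for all
  \<open>n\<close> and for the limit alike. After folding, a trigonometric polynomial is uniformly
  close to \<open>h\<close>, and its expectations converge because the characteristic functions
  do.\<close>

theorem weak_conv_of_char:
  fixes Y :: "nat \<Rightarrow> 'a \<Rightarrow> nat \<Rightarrow> real" and Z :: "'b \<Rightarrow> nat \<Rightarrow> real" and h :: "(nat \<Rightarrow> real) \<Rightarrow> real"
  assumes M: "prob_space M" and N: "prob_space N"
    and Y: "\<And>n i. (\<lambda>\<omega>. Y n \<omega> i) \<in> borel_measurable M" and Z: "\<And>i. (\<lambda>\<omega>. Z \<omega> i) \<in> borel_measurable N"
    and char: "\<And>c. (\<lambda>n. CLINT \<omega>|M. iexp (\<Sum>i<k. c i * Y n \<omega> i)) \<longlonglongrightarrow> (CLINT \<omega>|N. iexp (\<Sum>i<k. c i * Z \<omega> i))"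
    and sqY: "\<And>n i. i < k \<Longrightarrow> integrable M (\<lambda>\<omega>. (Y n \<omega> i)\<^sup>2)" "\<And>n i. i < k \<Longrightarrow> (\<integral>\<omega>. (Y n \<omega> i)\<^sup>2 \<partial>M) \<le> S"
    and sqZ: "\<And>i. i < k \<Longrightarrow> integrable N (\<lambda>\<omega>. (Z \<omega> i)\<^sup>2)" "\<And>i. i < k \<Longrightarrow> (\<integral>\<omega>. (Z \<omega> i)\<^sup>2 \<partial>N) \<le> S"
    and S: "S \<ge> 0"
    and Lip: "\<And>x y. \<bar>h x - h y\<bar> \<le> C * (\<Sum>i<k. \<bar>x i - y i\<bar>)" and B: "\<And>x. \<bar>h x\<bar> \<le> B"
  shows "(\<lambda>n. \<integral>\<omega>. h (Y n \<omega>) \<partial>M) \<longlonglongrightarrow> (\<integral>\<omega>. h (Z \<omega>) \<partial>N)"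
proof (rule LIMSEQ_I)
  fix e :: real assume e: "e > 0"
  interpret M: prob_space M by fact
  interpret N: prob_space N by fact
  have B0: "B \<ge> 0" using B[of "\<lambda>_. 0"] by linarith
  define w where "w = 2 * B * real k * S + 1"
  have w: "w > 0" unfolding w_def using B0 S by (intro add_nonneg_pos) auto
  \<comment> \<open>Makes the Chebyshev term \<open>b\<^sup>2 * (2 * B * real k * S)\<close> at most
    \<open>e / 8\<close>; five errors of this size stay below \<open>e\<close>. The summand 1 in
    \<open>w\<close> keeps the denominator positive.\<close>
  define b where "b = sqrt (e / (8 * w))"
  have b: "b > 0" "b\<^sup>2 = e / (8 * w)" unfolding b_def using w e by auto
  define a where "a = b * pi / 2"
  have a: "a > 0" unfolding a_def using b by simp
  have small: "b\<^sup>2 * (2 * B * real k * S) \<le> e / 8"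
  proof -
    have "b\<^sup>2 * (2 * B * real k * S) \<le> b\<^sup>2 * w" unfolding w_def by (intro mult_left_mono) auto
    also have "\<dots> = e / 8" unfolding b(2) using w by simp
    finally show ?thesis .
  qed
  obtain F where F: "F \<in> trig_poly k" "\<And>y. \<bar>h (\<lambda>i. arcsin (sin (a * y i)) / a) - F y\<bar> < e / 8"
    using trig_poly_approx[OF Lip a, of "e / 8"] e by auto
  note conv = trig_poly_integral_conv[OF M N Y Z char F(1)]
  from conv have iY: "\<And>n. integrable M (\<lambda>\<omega>. F (Y n \<omega>))" and iZ: "integrable N (\<lambda>\<omega>. F (Z \<omega>))" by auto
  from conv have "(\<lambda>n. \<integral>\<omega>. F (Y n \<omega>) \<partial>M) \<longlonglongrightarrow> (\<integral>\<omega>. F (Z \<omega>) \<partial>N)" by blast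
  from LIMSEQ_D[OF this, of "e / 8"] e obtain n0 where n0: "\<And>n. n \<ge> n0 \<Longrightarrow> \<bar>(\<integral>\<omega>. F (Y n \<omega>) \<partial>M) - (\<integral>\<omega>. F (Z \<omega>) \<partial>N)\<bar> < e / 8" by auto
  have cZ: "\<bar>(\<integral>\<omega>. h (Z \<omega>) \<partial>N) - (\<integral>\<omega>. F (Z \<omega>) \<partial>N)\<bar> \<le> b\<^sup>2 * (2 * B * real k * S) + e / 8"
    by (rule N.fold_expectation[OF Z sqZ Lip B b(1) a_def iZ F(2)])
  show "\<exists>n0. \<forall>n\<ge>n0. norm ((\<integral>\<omega>. h (Y n \<omega>) \<partial>M) - (\<integral>\<omega>. h (Z \<omega>) \<partial>N)) < e"
  proof (intro exI[of _ n0] allI impI)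
    fix n assume "n0 \<le> n"
    have cY: "\<bar>(\<integral>\<omega>. h (Y n \<omega>) \<partial>M) - (\<integral>\<omega>. F (Y n \<omega>) \<partial>M)\<bar> \<le> b\<^sup>2 * (2 * B * real k * S) + e / 8"
      by (rule M.fold_expectation[where V="Y n" and k=k, OF Y sqY Lip B b(1) a_def iY F(2)])
    from cY cZ small n0[OF \<open>n0 \<le> n\<close>] e
    show "norm ((\<integral>\<omega>. h (Y n \<omega>) \<partial>M) - (\<integral>\<omega>. h (Z \<omega>) \<partial>N)) < e" unfolding real_norm_def by linarith
  qed
qed

section \<open>Quantiles of the marginals and the dyadic grid\<close>

text \<open>A monotone function that attains every value strictly between 0 and 1 has no jumps. The
  order argument applies unchanged at the infinite endpoints.\<close>

lemma mono_surj_continuous_ereal: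
  fixes f :: "ereal \<Rightarrow> real"
  assumes mono: "mono f" and range: "range f \<subseteq> {0..1}" and surj: "\<And>u. 0 < u \<Longrightarrow> u < 1 \<Longrightarrow> \<exists>x. f x = u"
  shows "continuous_on UNIV f"
proof -
  have "(f \<longlongrightarrow> f x) (at x)" for x
  proof (rule order_tendstoI)
    fix a assume a: "a < f x"
    show "\<forall>\<^sub>F y in at x. a < f y"
    proof (cases "a < 0")
      case True
      have "a < f y" for y using range True by (auto simp: image_subset_iff intro: less_le_trans)
      then show ?thesis by simp
    next
      case False
      then obtain u where u: "a < u" "u < f x" using dense a by blast
      moreover have "f x \<le> 1" using range by (auto simp: image_subset_iff)
      ultimately obtain z where z: "f z = u" using surj[of u] False by force
      have "z < x" using u z monoD[OF mono, of x z] by (meson not_le)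
      then have "\<forall>\<^sub>F y in at x. z < y" by (simp add: order_tendstoD(1)[OF tendsto_ident_at])
      then show ?thesis
        by eventually_elim (use u z monoD[OF mono] in \<open>metis less_imp_le less_le_trans\<close>)
    qed
  next
    fix a assume a: "f x < a"
    show "\<forall>\<^sub>F y in at x. f y < a"
    proof (cases "1 < a")
      case True
      have "f y < a" for y using range True by (auto simp: image_subset_iff intro: le_less_trans)
      then show ?thesis by simp
    next
      case False
      then obtain u where u: "f x < u" "u < a" using dense a by blast
      moreover have "f x \<ge> 0" using range by (auto simp: image_subset_iff)
      ultimately obtain z where z: "f z = u" using surj[of u] False by force
      have "x < z" using u z monoD[OF mono, of z x] by (meson not_le)
      then have "\<forall>\<^sub>F y in at x. y < z" by (simp add: order_tendstoD(2)[OF tendsto_ident_at])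
      then show ?thesis
        by eventually_elim (use u z monoD[OF mono] in \<open>metis less_imp_le le_less_trans\<close>)
    qed
  qed
  then show ?thesis by (simp add: continuous_on_def)
qed

definition orthant_ind :: "ereal^'d \<Rightarrow> real^'d \<Rightarrow> real" where
  "orthant_ind t x = (if le_ext x t then 1 else 0)"

lemma orthant_ind_nonneg [simp]: "0 \<le> orthant_ind t x" and orthant_ind_le_1 [simp]: "orthant_ind t x \<le> 1"
  by (auto simp: orthant_ind_def)

lemma borel_measurable_vec_nth [measurable]: "(\<lambda>x::real^'n. x $ i) \<in> borel_measurable borel"
  by (intro borel_measurable_continuous_onI continuous_intros)

lemma le_ext_pred [measurable]: "Measurable.pred borel (\<lambda>x. le_ext x (t::ereal^'d))"
  unfolding le_ext_def by measurable

lemma orthant_ind_meas [measurable]: "orthant_ind t \<in> borel_measurable borel"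
  unfolding orthant_ind_def by measurable

locale emp_clt = mixing_process M X G nG \<Theta> r p
  for M :: "'w measure" and X :: "nat \<Rightarrow> 'w \<Rightarrow> real^'d" and G nG \<Theta> r p +
  fixes \<Psi> :: "real \<Rightarrow> real" and \<gamma> :: real
  assumes contF: "continuous_on UNIV (dfun M X)"
    and clt: "\<forall>f\<in>G. bounded (range f) \<and> (\<integral>\<omega>. f (X 0 \<omega>) \<partial>M) = 0 \<longrightarrow>
           (\<exists>s2\<ge>0. weak_conv_m
              (\<lambda>n. distr M borel (\<lambda>\<omega>. (\<Sum>i\<in>{1..n}. f (X i \<omega>)) / sqrt (real n)))
              (gauss_law s2))"
    and p_gt: "real p > real CARD('d) * r"
    and ctrl: "control_function M X G nG \<Psi>"
    and psi_O: "\<Psi> \<in> O[at_top](\<lambda>z. z powr (1 / \<gamma>))"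
    and gamma_gt: "\<gamma> > r * real p / (real p - r * real CARD('d))"
begin

definition marg :: "'d \<Rightarrow> ereal \<Rightarrow> real" where
  "marg i x = prob {\<omega> \<in> space M. ereal (X 0 \<omega> $ i) \<le> x}"

lemma marg_ereal: "marg i (ereal x) = marg_dfun M X i x"
  by (simp add: marg_def marg_dfun_def)

lemma mono_marg: "mono (marg i)"
  unfolding marg_def by (intro monoI finite_measure_mono) (auto intro: order_trans)

lemma marg_nonneg: "0 \<le> marg i x" and marg_le_1: "marg i x \<le> 1"
  by (auto simp: marg_def)

lemma marg_bot: "marg i (-\<infinity>) = 0" and marg_top: "marg i \<infinity> = 1"
  by (auto simp: marg_def prob_space)

text \<open>The hyperplane is exhausted by the sets \<open>A n\<close>, on which the other
  coordinates are at most \<open>n\<close>. Each of them lies between two orthants that differ by a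
  small shift along axis \<open>i\<close>, so continuity of the joint distribution function at
  \<open>t n\<close> makes it null.\<close>

lemma no_atoms: "prob {\<omega> \<in> space M. X 0 \<omega> $ i = c} = 0"
proof -
  define t where "t n = (\<chi> j. if j = i then c else real n)" for n :: nat
  define A where "A n = {\<omega> \<in> space M. X 0 \<omega> $ i = c \<and> (\<forall>j. j \<noteq> i \<longrightarrow> X 0 \<omega> $ j \<le> real n)}" for n :: nat
  have Am [measurable]: "A n \<in> sets M" for n unfolding A_def by measurable
  have null: "prob (A n) = 0" for n
  proof -
    have lim: "(\<lambda>m. t n - (1 / real (Suc m)) *\<^sub>R axis i 1) \<longlonglongrightarrow> t n - 0 *\<^sub>R axis i 1"
      by (intro tendsto_intros LIMSEQ_Suc[OF lim_1_over_n])
    have "isCont (dfun M X) (t n)" using contF by (simp add: continuous_on_eq_continuous_at)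
    then have l2: "(\<lambda>m. dfun M X (t n) - dfun M X (t n - (1 / real (Suc m)) *\<^sub>R axis i 1)) \<longlonglongrightarrow> dfun M X (t n) - dfun M X (t n)"
      using lim by (intro tendsto_intros isCont_tendsto_compose[of "t n" "dfun M X"]) auto
    have "prob (A n) \<le> dfun M X (t n) - dfun M X (t n - (1 / real (Suc m)) *\<^sub>R axis i 1)" for m
    proof -
      let ?s = "t n - (1 / real (Suc m)) *\<^sub>R axis i 1"
      have st: "?s \<le> t n" by (auto simp: less_eq_vec_def axis_def)
      have "prob (A n) \<le> prob ({\<omega> \<in> space M. X 0 \<omega> \<le> t n} - {\<omega> \<in> space M. X 0 \<omega> \<le> ?s})"
        by (rule finite_measure_mono)
           (auto simp: A_def t_def less_eq_vec_def axis_def intro!: exI[of _ i])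
      also have "\<dots> = prob {\<omega> \<in> space M. X 0 \<omega> \<le> t n} - prob {\<omega> \<in> space M. X 0 \<omega> \<le> ?s}"
        using st by (intro finite_measure_Diff) (auto intro: order_trans)
      finally show ?thesis by (simp add: dfun_def)
    qed
    then have "prob (A n) \<le> dfun M X (t n) - dfun M X (t n)"
      by (intro LIMSEQ_le_const[OF l2]) auto
    then show ?thesis by (simp add: antisym)
  qed
  have "{\<omega> \<in> space M. X 0 \<omega> $ i = c} = (\<Union>n. A n)"
  proof (intro equalityI subsetI)
    fix \<omega> assume w: "\<omega> \<in> {\<omega> \<in> space M. X 0 \<omega> $ i = c}"
    obtain n where "norm (X 0 \<omega>) \<le> real n" using real_arch_simple by blast
    then have "X 0 \<omega> $ j \<le> real n" for j
      using component_le_norm_cart[of "X 0 \<omega>" j] by linarith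
    then show "\<omega> \<in> (\<Union>n. A n)" using w by (auto simp: A_def)
  qed (auto simp: A_def)
  also have "prob \<dots> = 0"
    using null by (intro measure_eq_0_null_sets null_sets_UN') (auto simp: null_sets_def emeasure_eq_measure)
  finally show ?thesis .
qed

lemma marg_surj:
  assumes "0 < u" "u < 1"
  shows "\<exists>x. marg i (ereal x) = u"
proof -
  define D where "D = distr M borel (\<lambda>\<omega>. X 0 \<omega> $ i)"
  interpret D: real_distribution D
    unfolding D_def by (rule real_distribution_distr) measurable
  have cdf: "cdf D x = marg i (ereal x)" for x
    by (auto simp: cdf_def D_def measure_distr marg_def intro!: arg_cong[where f=prob])
  have "isCont (cdf D) x" for x
  proof -
    have "measure D {x} = prob {\<omega> \<in> space M. X 0 \<omega> $ i = x}"
      unfolding D_def by (subst measure_distr) (auto intro!: arg_cong[where f=prob])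
    then show ?thesis using no_atoms by (simp add: D.isCont_cdf)
  qed
  then have cont: "continuous_on UNIV (cdf D)" by (simp add: continuous_at_imp_continuous_on)
  obtain a where a: "cdf D a < u"
    using order_tendstoD(2)[OF D.cdf_lim_at_bot assms(1)] by (metis eventually_at_bot_linorder order_refl)
  obtain b where b: "cdf D b > u"
    using order_tendstoD(1)[OF D.cdf_lim_at_top_prob assms(2)] by (metis eventually_at_top_linorder order_refl)
  have "a \<le> b" using a b D.cdf_nondecreasing[of b a] by linarith
  then obtain x where "cdf D x = u"
    using IVT'[of "cdf D" a u b] a b cont by (meson continuous_on_subset less_imp_le subset_UNIV)
  then show ?thesis using cdf by metis
qed

lemma marg_continuous: "continuous_on UNIV (marg i)"
  using marg_surj by (intro mono_surj_continuous_ereal mono_marg) (auto simp: marg_nonneg marg_le_1)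

text \<open>Generalised inverse of \<open>marg i\<close>. With values in \<open>ereal\<close> the
  infimum always exists, and the quantile of 0 is \<open>- \<infinity>\<close>.\<close>

definition quant :: "'d \<Rightarrow> real \<Rightarrow> ereal" where
  "quant i u = Inf {x. u \<le> marg i x}"

lemma marg_quant_ge: "u \<le> 1 \<Longrightarrow> u \<le> marg i (quant i u)"
proof -
  assume u: "u \<le> 1"
  have "closed {x. u \<le> marg i x}"
    by (intro closed_Collect_le continuous_on_const marg_continuous)
  moreover have "\<infinity> \<in> {x. u \<le> marg i x}" using u marg_top by simp
  ultimately have "Inf {x. u \<le> marg i x} \<in> {x. u \<le> marg i x}"
    by (intro closed_contains_Inf_cl) auto
  then show ?thesis by (simp add: quant_def)
qed

lemma quant_le_iff: "u \<le> 1 \<Longrightarrow> quant i u \<le> x \<longleftrightarrow> u \<le> marg i x"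
  using marg_quant_ge[of u i] monoD[OF mono_marg, of "quant i u" x i]
  by (auto simp: quant_def intro: Inf_lower)

lemma marg_quant:
  assumes "0 \<le> u" "u \<le> 1"
  shows "marg i (quant i u) = u"
proof (rule antisym)
  show "u \<le> marg i (quant i u)" using marg_quant_ge assms by blast
  show "marg i (quant i u) \<le> u"
  proof (cases "u = 0 \<or> u = 1")
    case True
    have "quant i 0 = - \<infinity>" using quant_le_iff[of 0 i "- \<infinity>"] marg_bot[of i] by simp
    then show ?thesis using True marg_le_1 marg_bot by auto
  next
    case False
    then obtain x where "marg i (ereal x) = u" using marg_surj[of u i] assms by auto
    then have "quant i u \<le> ereal x" using assms by (simp add: quant_le_iff)
    then show ?thesis using monoD[OF mono_marg, of "quant i u" "ereal x" i] \<open>marg i (ereal x) = u\<close> by simp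
  qed
qed

lemma marg_quant_real:
  assumes "0 < u" "u < 1"
  obtains x where "quant i u = ereal x" "marg i (ereal x) = u"
  using marg_quant[of u i] assms marg_bot[of i] marg_top[of i] by (cases "quant i u") auto

lemma quant_mono: "u \<le> v \<Longrightarrow> v \<le> 1 \<Longrightarrow> quant i u \<le> quant i v"
  using marg_quant_ge[of v i] by (simp add: quant_le_iff)

lemma quant_strict_mono: "0 \<le> u \<Longrightarrow> u < v \<Longrightarrow> v \<le> 1 \<Longrightarrow> quant i u < quant i v"
  using quant_mono[of u v i] marg_quant[of u i] marg_quant[of v i] by (auto simp: order.strict_iff_order)

text \<open>\<open>modcont\<close> compares real arguments, but the extreme quantiles may be
  infinite. Moving both levels inwards by \<open>d\<close> gives real quantiles whose distance is
  still admissible, at the cost \<open>2 * d \<le> e\<close>.\<close>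

lemma modcont_quant_ge:
  assumes "0 \<le> u" "u < v" "v \<le> 1"
  shows "v - u \<le> modcont (marg_dfun M X i) (quant i v - quant i u)"
proof (rule field_le_epsilon)
  fix e :: real assume e: "e > 0"
  define d where "d = min e (v - u) / 3"
  have d: "d > 0" "2 * d \<le> e" "2 * d < v - u" using e assms by (auto simp: d_def min_def)
  obtain x where x: "quant i (u + d) = ereal x" "marg i (ereal x) = u + d"
    by (rule marg_quant_real[of "u + d" i]) (use d assms in linarith)+
  obtain y where y: "quant i (v - d) = ereal y" "marg i (ereal y) = v - d"
    by (rule marg_quant_real[of "v - d" i]) (use d assms in linarith)+
  have "ereal x \<le> ereal y" unfolding x(1)[symmetric] y(1)[symmetric] using d assms by (intro quant_mono) auto
  then have xy: "x \<le> y" by simp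
  have "ereal y - ereal x \<le> quant i v - quant i u"
    unfolding x(1)[symmetric] y(1)[symmetric] using d assms by (intro ereal_minus_mono quant_mono) auto
  then have "ereal \<bar>y - x\<bar> \<le> quant i v - quant i u" using xy by simp
  then have "\<bar>marg_dfun M X i y - marg_dfun M X i x\<bar> \<le> modcont (marg_dfun M X i) (quant i v - quant i u)"
    unfolding modcont_def
  proof (intro cSup_upper)
    show "bdd_above {\<bar>marg_dfun M X i t - marg_dfun M X i s\<bar> |t s. ereal \<bar>t - s\<bar> \<le> quant i v - quant i u}"
    proof (rule bdd_aboveI[of _ 1])
      fix z assume "z \<in> {\<bar>marg_dfun M X i t - marg_dfun M X i s\<bar> |t s. ereal \<bar>t - s\<bar> \<le> quant i v - quant i u}"
      then obtain t s where z: "z = \<bar>marg_dfun M X i t - marg_dfun M X i s\<bar>" by blast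
      have "0 \<le> marg i (ereal a) \<and> marg i (ereal a) \<le> 1" for a by (simp add: marg_nonneg marg_le_1)
      from this[of t] this[of s] show "z \<le> 1" unfolding z marg_ereal by linarith
    qed
  qed auto
  then have "v - d - (u + d) \<le> modcont (marg_dfun M X i) (quant i v - quant i u)"
    using x y by (simp add: marg_ereal)
  then show "v - u \<le> modcont (marg_dfun M X i) (quant i v - quant i u) + e" using d by linarith
qed

lemma gamma_pos: "\<gamma> > 0"
  using gamma_gt p_gt r_ge_1 p_pos by (smt (verit) divide_nonneg_pos mult_nonneg_nonneg of_nat_0_le_iff mult.commute)

definition \<alpha> :: real where "\<alpha> = 1 / r - 1 / \<gamma>"

text \<open>This is the hypothesis on \<open>\<gamma>\<close> divided by
  \<open>\<gamma> * r\<close>; it will give \<open>\<beta> < 1\<close> in the union bound.\<close>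

lemma alpha_gt: "real p * \<alpha> > real CARD('d)"
proof -
  have pos: "real p - r * real CARD('d) > 0" using p_gt by (simp add: mult.commute)
  have "r * real p < \<gamma> * (real p - r * real CARD('d))"
    using gamma_gt pos by (simp add: pos_divide_less_eq)
  then have "r * real p / \<gamma> < real p - r * real CARD('d)"
    using gamma_pos by (simp add: pos_divide_less_eq mult.commute)
  then have "(r * real p / \<gamma>) / r < (real p - r * real CARD('d)) / r"
    using r_ge_1 by (intro divide_strict_right_mono) auto
  then have "real p / \<gamma> < real p / r - real CARD('d)"
    using r_ge_1 by (simp add: diff_divide_distrib)
  then show ?thesis unfolding \<alpha>_def by (simp add: right_diff_distrib)
qed

lemma alpha_pos: "\<alpha> > 0"
proof -
  have "0 < real p * \<alpha>" using alpha_gt by (smt (verit) of_nat_0_le_iff)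
  then show ?thesis using p_pos by (simp add: zero_less_mult_iff)
qed

lemma alpha_le_1: "\<alpha> \<le> 1"
proof -
  have "1 / r \<le> 1" using r_ge_1 by simp
  moreover have "1 / \<gamma> > 0" using gamma_pos by simp
  ultimately show ?thesis unfolding \<alpha>_def by linarith
qed

text \<open>Makes bounded fourth moments available, through which weak convergence passes to second
  moments.\<close>

lemma p_ge_2: "p \<ge> 2"
proof -
  have "real CARD('d) \<ge> 1" by (simp add: Suc_leI)
  then have "real CARD('d) * r \<ge> 1 * 1" using r_ge_1 by (intro mult_mono) auto
  then have "real p > 1" using p_gt by linarith
  then show ?thesis by linarith
qed

text \<open>The growth condition speaks about large arguments. For the finitely many smaller powers
  of 2, monotonicity bounds \<open>\<Psi>\<close> by \<open>\<Psi> (2 ^ k0)\<close>, and the factor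
  \<open>2 powr (real k / \<gamma>)\<close> is at least 1.\<close>

lemma psi_bound: "\<exists>C>0. \<forall>k. \<Psi> (2 ^ k) \<le> C * 2 powr (real k / \<gamma>)"
proof -
  obtain c where c: "c > 0" "\<forall>\<^sub>F z in at_top. norm (\<Psi> z) \<le> c * norm (z powr (1 / \<gamma>))"
    using psi_O by (auto elim!: landau_o.bigE)
  then obtain z0 where z0: "\<And>z. z \<ge> z0 \<Longrightarrow> \<bar>\<Psi> z\<bar> \<le> c * z powr (1 / \<gamma>)"
    by (auto simp: eventually_at_top_linorder)
  have "\<exists>k0. z0 < 2 ^ k0" by (rule real_arch_pow) simp
  then obtain k0 :: nat where k0: "z0 < 2 ^ k0" by blast
  have mono: "mono_on {0..} \<Psi>" and nn: "\<And>z. z \<ge> 0 \<Longrightarrow> \<Psi> z \<ge> 0" using ctrl by (auto simp: control_function_def)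
  show ?thesis
  proof (intro exI[of _ "c + \<Psi> (2 ^ k0)"] conjI allI)
    show "0 < c + \<Psi> (2 ^ k0)" using c nn[of "2 ^ k0"] by simp
    fix k
    have one: "1 \<le> 2 powr (real k / \<gamma>)" using gamma_pos by (simp add: ge_one_powr_ge_zero)
    have nn0: "\<Psi> (2 ^ k0) \<ge> 0" using nn by simp
    show "\<Psi> (2 ^ k) \<le> (c + \<Psi> (2 ^ k0)) * 2 powr (real k / \<gamma>)"
    proof (cases "k \<ge> k0")
      case True
      then have "(2::real) ^ k0 \<le> 2 ^ k" by (intro power_increasing) auto
      then have "z0 \<le> 2 ^ k" using k0 by linarith
      then have "\<Psi> (2 ^ k) \<le> c * (2 ^ k) powr (1 / \<gamma>)" using z0[of "2 ^ k"] by linarith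
      also have "(2 ^ k) powr (1 / \<gamma>) = 2 powr (real k / \<gamma>)"
        by (simp add: powr_realpow[symmetric] powr_powr)
      also have "c * \<dots> \<le> (c + \<Psi> (2 ^ k0)) * 2 powr (real k / \<gamma>)" using nn0 by (intro mult_right_mono) auto
      finally show ?thesis .
    next
      case False
      then have "(2::real) ^ k \<le> 2 ^ k0" by (intro power_increasing) auto
      then have "\<Psi> (2 ^ k) \<le> \<Psi> (2 ^ k0) * 1" using monotone_onD[OF mono, of "2 ^ k" "2 ^ k0"] by simp
      also have "\<dots> \<le> (c + \<Psi> (2 ^ k0)) * 2 powr (real k / \<gamma>)" using one nn0 c by (intro mult_mono) auto
      finally show ?thesis .
    qed
  qed
qed

end

lemma of_nat_le_pow2: "j \<le> 2 ^ k \<Longrightarrow> real j \<le> 2 ^ k"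
  by (metis of_nat_le_iff of_nat_numeral of_nat_power)

lemma dyadic_le_1: "j \<le> 2 ^ k \<Longrightarrow> real j / 2 ^ k \<le> 1"
  using of_nat_le_pow2[of j k] by simp

lemma le_ext_iff: "le_ext x t \<longleftrightarrow> (\<forall>i. ereal (x $ i) \<le> t $ i)"
  by (simp add: le_ext_def)

definition coord_ind :: "'d::finite \<Rightarrow> ereal \<Rightarrow> real^'d \<Rightarrow> real" where
  "coord_ind i a x = (if ereal (x $ i) \<le> a then 1 else 0)"

text \<open>Where two orthants disagree about a point, some single coordinate disagrees; this
  reduces bounds on \<open>mass\<close> to the marginals.\<close>

lemma orthant_ind_diff_le: "\<bar>orthant_ind s x - orthant_ind t x\<bar> \<le> (\<Sum>i\<in>UNIV. \<bar>coord_ind i (s $ i) x - coord_ind i (t $ i) x\<bar>)"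
proof (cases "le_ext x s \<longleftrightarrow> le_ext x t")
  case True
  then show ?thesis by (simp add: orthant_ind_def sum_nonneg)
next
  case False
  then obtain i where "(ereal (x $ i) \<le> s $ i) \<noteq> (ereal (x $ i) \<le> t $ i)"
    unfolding le_ext_iff by blast
  then have i: "\<bar>coord_ind i (s $ i) x - coord_ind i (t $ i) x\<bar> = 1"
    by (auto simp: coord_ind_def)
  have "\<bar>orthant_ind s x - orthant_ind t x\<bar> \<le> \<bar>coord_ind i (s $ i) x - coord_ind i (t $ i) x\<bar>"
    unfolding i by (simp add: orthant_ind_def)
  also have "\<dots> \<le> (\<Sum>i\<in>UNIV. \<bar>coord_ind i (s $ i) x - coord_ind i (t $ i) x\<bar>)"
    by (rule member_le_sum) auto
  finally show ?thesis .
qed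

section \<open>Even moments of the centred normalised sums\<close>

context mixing_process
begin

definition emp :: "(real^'d \<Rightarrow> real) \<Rightarrow> nat \<Rightarrow> 'w \<Rightarrow> real" where
  "emp f n \<omega> = (\<Sum>i\<in>{1..n}. f (X i \<omega>) - (\<integral>\<omega>. f (X 0 \<omega>) \<partial>M)) / sqrt (real n)"

lemma emp_meas [measurable]:
  assumes [measurable]: "f \<in> borel_measurable borel"
  shows "emp f n \<in> borel_measurable M"
  unfolding emp_def by measurable

lemma integrable_bounded_comp:
  fixes f :: "real^'d \<Rightarrow> real"
  assumes [measurable]: "f \<in> borel_measurable borel" and "\<And>x. \<bar>f x\<bar> \<le> B"
  shows "integrable M (\<lambda>\<omega>. f (X i \<omega>))"
  by (rule integrable_const_bound[of _ B]) (use assms in auto)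

lemma emp_diff:
  assumes "integrable M (\<lambda>\<omega>. f (X 0 \<omega>))" "integrable M (\<lambda>\<omega>. g (X 0 \<omega>))"
  shows "emp (\<lambda>x. f x - g x) n \<omega> = emp f n \<omega> - emp g n \<omega>"
  using assms by (simp add: emp_def Bochner_Integration.integral_diff sum_subtractf[symmetric] diff_divide_distrib[symmetric] algebra_simps)

lemma emp_add:
  assumes "integrable M (\<lambda>\<omega>. f (X 0 \<omega>))" "integrable M (\<lambda>\<omega>. g (X 0 \<omega>))"
  shows "emp (\<lambda>x. f x + g x) n \<omega> = emp f n \<omega> + emp g n \<omega>"
  using assms by (simp add: emp_def sum.distrib[symmetric] add_divide_distrib[symmetric] algebra_simps)

lemma emp_scale: "emp (\<lambda>x. c * f x) n \<omega> = c * emp f n \<omega>"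
  by (simp add: emp_def sum_distrib_left[symmetric] right_diff_distrib[symmetric])

lemma emp_sum:
  assumes "finite I" "\<And>j. j \<in> I \<Longrightarrow> integrable M (\<lambda>\<omega>. f j (X 0 \<omega>))"
  shows "emp (\<lambda>x. \<Sum>j\<in>I. f j x) n \<omega> = (\<Sum>j\<in>I. emp (f j) n \<omega>)"
  using assms
proof (induction I rule: finite_induct)
  case empty
  then show ?case by (simp add: emp_def)
next
  case (insert j I)
  then have "emp (\<lambda>x. \<Sum>j\<in>insert j I. f j x) n \<omega> = emp (\<lambda>x. f j x + (\<Sum>j\<in>I. f j x)) n \<omega>"
    by simp
  also have "\<dots> = emp (f j) n \<omega> + emp (\<lambda>x. \<Sum>j\<in>I. f j x) n \<omega>"
    using insert by (intro emp_add) auto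
  finally show ?case using insert by simp
qed

lemma G_const: "(\<lambda>_. c) \<in> G" and G_add: "f \<in> G \<Longrightarrow> g \<in> G \<Longrightarrow> (\<lambda>x. f x + g x) \<in> G"
  and G_scale: "f \<in> G \<Longrightarrow> (\<lambda>x. a * f x) \<in> G" for a :: real
  using fspace by (auto simp: function_space_with_seminorm_def)

lemma nG_add: "f \<in> G \<Longrightarrow> g \<in> G \<Longrightarrow> nG (\<lambda>x. f x + g x) \<le> nG f + nG g"
  and nG_scale: "f \<in> G \<Longrightarrow> nG (\<lambda>x. a * f x) = \<bar>a\<bar> * nG f" for a :: real
  using fspace by (auto simp: function_space_with_seminorm_def)

lemma G_diff: "f \<in> G \<Longrightarrow> g \<in> G \<Longrightarrow> (\<lambda>x. f x - g x) \<in> G"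
  using G_add[of f "\<lambda>x. - 1 * g x"] G_scale[of g "-1"] by simp

lemma nG_diff: "f \<in> G \<Longrightarrow> g \<in> G \<Longrightarrow> nG (\<lambda>x. f x - g x) \<le> nG f + nG g"
  using nG_add[of f "\<lambda>x. - 1 * g x"] G_scale[of g "-1"] nG_scale[of g "-1"] by simp

lemma nG_const: "nG (\<lambda>_. c) = \<bar>c\<bar> * nG (\<lambda>_. 1)"
  using nG_scale[OF G_const[of 1], of c] by simp

lemma nG_zero: "nG (\<lambda>_. 0) = 0"
  using nG_const[of 0] by simp

text \<open>A bound for \<open>mix_size\<close> of the function centred and divided by 4. That
  function is bounded by 1, so the integral of its \<open>r\<close>-th power is at most a first
  absolute moment. Centring subtracts a constant of modulus at most 2, hence the term
  \<open>2 * nG (\<lambda>_. 1)\<close>.\<close>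

definition link_size :: "(real^'d \<Rightarrow> real) \<Rightarrow> real" where
  "link_size f = (\<integral>\<omega>. \<bar>f (X 0 \<omega>)\<bar> \<partial>M) powr (1 / r) * (nG f + 2 * nG (\<lambda>_. 1))"

lemma link_size_nonneg: "f \<in> G \<Longrightarrow> 0 \<le> link_size f"
  unfolding link_size_def using nG_nonneg[of f] nG_nonneg[OF G_const[of 1]] by simp

lemma emp_moment:
  assumes "1 \<le> q" "q \<le> p"
  shows "\<exists>C\<ge>0. \<forall>f\<in>G. (\<forall>x. \<bar>f x\<bar> \<le> 2) \<longrightarrow> (\<forall>n\<ge>1.
     (\<integral>\<omega>. emp f n \<omega> ^ (2 * q) \<partial>M) \<le> C * (link_size f / real n ^ (q - 1) + link_size f ^ q))"
proof -
  obtain C where C: "C \<ge> 0" and bound: "\<And>f n. f \<in> G \<Longrightarrow> (\<forall>x. \<bar>f x\<bar> \<le> 1) \<Longrightarrow> (\<integral>\<omega>. f (X 0 \<omega>) \<partial>M) = 0 \<Longrightarrow>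
     (\<integral>\<omega>. (\<Sum>i\<in>{1..n::nat}. f (X i \<omega>)) ^ (2 * q) \<partial>M) \<le> C * (real n * mix_size f + (real n * mix_size f) ^ q)"
    using moment_bound[OF assms] by blast
  show ?thesis
  proof (intro exI[of _ "4 ^ (2 * q) * C"] conjI ballI impI allI)
    show "0 \<le> 4 ^ (2 * q) * C" using C by simp
    fix f and n :: nat
    assume f: "f \<in> G" and f2: "\<forall>x. \<bar>f x\<bar> \<le> 2" and n: "n \<ge> 1"
    have [measurable]: "f \<in> borel_measurable borel" by (rule G_meas[OF f])
    define \<mu> where "\<mu> = (\<integral>\<omega>. f (X 0 \<omega>) \<partial>M)"
    \<comment> \<open>\<open>f\<close> and its mean are bounded by 2, so the factor
      \<open>1 / 4\<close> gives \<open>\<bar>g x\<bar> \<le> 1\<close>, which the mixing inequality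
      requires.\<close>
    define g where "g x = (1 / 4) * (f x + (- \<mu>))" for x
    define L where "L = (\<integral>\<omega>. \<bar>f (X 0 \<omega>)\<bar> \<partial>M)"
    have int: "integrable M (\<lambda>\<omega>. f (X 0 \<omega>))" by (rule integrable_bounded_comp) (use f2 in auto)
    have L: "L \<ge> 0" unfolding L_def by simp
    have muL: "\<bar>\<mu>\<bar> \<le> L" unfolding \<mu>_def L_def by (rule integral_abs_bound)
    have "L \<le> (\<integral>\<omega>. 2 \<partial>M)" unfolding L_def using f2 int by (intro integral_mono) auto
    then have L2: "L \<le> 2" by (simp add: prob_space)
    have gG: "g \<in> G" unfolding g_def[abs_def] by (intro G_scale G_add f G_const)
    have [measurable]: "g \<in> borel_measurable borel" by (rule G_meas[OF gG])
    have g1: "\<bar>g x\<bar> \<le> 1" for x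
    proof -
      have "\<bar>f x\<bar> \<le> 2" using f2 by simp
      then show ?thesis using muL L2 unfolding g_def by (simp add: abs_le_iff)
    qed
    have g0: "(\<integral>\<omega>. g (X 0 \<omega>) \<partial>M) = 0" unfolding g_def using int by (simp add: \<mu>_def prob_space)
    have intg: "integrable M (\<lambda>\<omega>. \<bar>g (X 0 \<omega>)\<bar> powr r)"
    proof (rule integrable_const_bound[of _ 1])
      show "AE \<omega> in M. norm (\<bar>g (X 0 \<omega>)\<bar> powr r) \<le> 1"
        using g1 r_ge_1 by (auto intro!: powr_le1)
    qed measurable
    \<comment> \<open>The integrand on the right is
      \<open>\<bar>f\<bar> / 4 + \<bar>\<mu>\<bar> / 4\<close> in another arrangement.\<close>
    have "(\<integral>\<omega>. \<bar>g (X 0 \<omega>)\<bar> powr r \<partial>M) \<le> (\<integral>\<omega>. \<bar>f (X 0 \<omega>)\<bar> / 2 + (\<bar>\<mu>\<bar> - \<bar>f (X 0 \<omega>)\<bar>) / 4 \<partial>M)"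
    proof (rule integral_mono[OF intg])
      show "integrable M (\<lambda>\<omega>. \<bar>f (X 0 \<omega>)\<bar> / 2 + (\<bar>\<mu>\<bar> - \<bar>f (X 0 \<omega>)\<bar>) / 4)" using int by auto
      fix \<omega>
      have "\<bar>g (X 0 \<omega>)\<bar> powr r \<le> \<bar>g (X 0 \<omega>)\<bar> powr 1"
        by (rule powr_mono') (use g1[of "X 0 \<omega>"] r_ge_1 in auto)
      also have "\<dots> = \<bar>g (X 0 \<omega>)\<bar>" by simp
      also have "\<dots> \<le> \<bar>f (X 0 \<omega>)\<bar> / 4 + \<bar>\<mu>\<bar> / 4" unfolding g_def by (simp add: abs_mult)
      finally show "\<bar>g (X 0 \<omega>)\<bar> powr r \<le> \<bar>f (X 0 \<omega>)\<bar> / 2 + (\<bar>\<mu>\<bar> - \<bar>f (X 0 \<omega>)\<bar>) / 4" by (simp add: field_simps)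
    qed
    also have "\<dots> = L / 2 + (\<bar>\<mu>\<bar> - L) / 4" using int by (simp add: L_def prob_space)
    also have "\<dots> = L / 4 + \<bar>\<mu>\<bar> / 4" by (simp add: field_simps)
    also have "\<dots> \<le> L" using muL L by simp
    finally have le: "(\<integral>\<omega>. \<bar>g (X 0 \<omega>)\<bar> powr r \<partial>M) \<le> L" .
    have A: "Lr_norm M r (\<lambda>\<omega>. g (X 0 \<omega>)) \<le> L powr (1 / r)"
      unfolding Lr_norm_def by (rule powr_mono2[OF _ _ le]) (use r_ge_1 in auto)
    have "nG g = (1 / 4) * nG (\<lambda>x. f x + (- \<mu>))" unfolding g_def[abs_def]
      using nG_scale[OF G_add[OF f G_const[of "- \<mu>"]], of "1 / 4"] by simp
    also have "nG (\<lambda>x. f x + (- \<mu>)) \<le> nG f + \<bar>\<mu>\<bar> * nG (\<lambda>_. 1)"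
      using nG_add[OF f G_const[of "- \<mu>"]] nG_const[of "- \<mu>"] by simp
    also have "\<bar>\<mu>\<bar> * nG (\<lambda>_. 1) \<le> 2 * nG (\<lambda>_. 1)"
      using muL L2 nG_nonneg[OF G_const[of 1]] by (intro mult_right_mono) auto
    finally have B: "nG g \<le> nG f + 2 * nG (\<lambda>_. 1)"
      using nG_nonneg[OF f] nG_nonneg[OF G_const[of 1]] by simp
    have ms: "mix_size g \<le> link_size f"
      unfolding link_size_def using A B nG_nonneg[OF gG] by (intro mult_mono) (auto simp: L_def)
    have s: "link_size f \<ge> 0" by (rule link_size_nonneg[OF f])
    have "4 * g x = f x - \<mu>" for x by (simp add: g_def)
    then have emp: "emp f n \<omega> = 4 * (\<Sum>i\<in>{1..n}. g (X i \<omega>)) / sqrt (real n)" for \<omega>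
      by (simp only: emp_def \<mu>_def[symmetric] sum_distrib_left)
    have nn: "real n > 0" using n by simp
    have "(\<integral>\<omega>. emp f n \<omega> ^ (2 * q) \<partial>M) = (\<integral>\<omega>. (4 ^ (2 * q) / real n ^ q) * (\<Sum>i\<in>{1..n}. g (X i \<omega>)) ^ (2 * q) \<partial>M)"
    proof (rule Bochner_Integration.integral_cong[OF refl])
      fix \<omega>
      have "sqrt (real n) ^ (2 * q) = real n ^ q" by (simp add: power_mult)
      then show "emp f n \<omega> ^ (2 * q) = (4 ^ (2 * q) / real n ^ q) * (\<Sum>i\<in>{1..n}. g (X i \<omega>)) ^ (2 * q)"
        by (simp add: emp power_divide power_mult_distrib)
    qed
    also have "\<dots> = (4 ^ (2 * q) / real n ^ q) * (\<integral>\<omega>. (\<Sum>i\<in>{1..n}. g (X i \<omega>)) ^ (2 * q) \<partial>M)" by simp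
    also have "\<dots> \<le> (4 ^ (2 * q) / real n ^ q) * (C * (real n * mix_size g + (real n * mix_size g) ^ q))"
      using g1 by (intro mult_left_mono bound gG g0) auto
    also have "\<dots> \<le> (4 ^ (2 * q) / real n ^ q) * (C * (real n * link_size f + (real n * link_size f) ^ q))"
      using ms mix_size_nonneg[OF gG] C by (intro mult_left_mono add_mono power_mono) auto
    also have "\<dots> = 4 ^ (2 * q) * C * ((real n * link_size f + (real n * link_size f) ^ q) / real n ^ q)"
      by simp
    also have "(real n * link_size f + (real n * link_size f) ^ q) / real n ^ q = link_size f / real n ^ (q - 1) + link_size f ^ q"
      using nn assms by (cases q) (auto simp: add_divide_distrib power_mult_distrib)
    finally show "(\<integral>\<omega>. emp f n \<omega> ^ (2 * q) \<partial>M) \<le> 4 ^ (2 * q) * C * (link_size f / real n ^ (q - 1) + link_size f ^ q)" .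
  qed
qed

end

section \<open>Grid points and brackets\<close>

context emp_clt
begin

lemma quant_0: "quant i 0 = - \<infinity>"
  using quant_le_iff[of 0 i "- \<infinity>"] marg_bot[of i] by simp

definition gridpt :: "nat \<Rightarrow> ('d \<Rightarrow> nat) \<Rightarrow> ereal^'d" where
  "gridpt k j = (\<chi> i. quant i (real (j i) / 2 ^ k))"

definition idx :: "nat \<Rightarrow> ereal^'d \<Rightarrow> 'd \<Rightarrow> nat" where
  "idx k t i = nat \<lfloor>2 ^ k * marg i (t $ i)\<rfloor>"

definition proj :: "nat \<Rightarrow> ereal^'d \<Rightarrow> ereal^'d" where
  "proj k t = gridpt k (idx k t)"

lemma idx_bounds: "real (idx k t i) \<le> 2 ^ k * marg i (t $ i)" "2 ^ k * marg i (t $ i) < real (idx k t i) + 1"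
  using marg_nonneg[of i "t $ i"] by (auto simp: idx_def)

lemma idx_le: "idx k t i \<le> 2 ^ k"
proof -
  have "real (idx k t i) \<le> 2 ^ k * 1"
    using idx_bounds(1)[where k=k and t=t and i=i] marg_le_1[of i "t $ i"] by (meson mult_left_mono order_trans zero_le_numeral zero_le_power)
  then have "real (idx k t i) \<le> real (2 ^ k)" by simp
  then show ?thesis by (simp only: of_nat_le_iff)
qed

lemma idx_le_all: "\<forall>i. idx k t i \<le> 2 ^ k"
  using idx_le by blast

lemma marg_gridpt: "j i \<le> 2 ^ k \<Longrightarrow> marg i (gridpt k j $ i) = real (j i) / 2 ^ k"
  using marg_quant[of "real (j i) / 2 ^ k" i] dyadic_le_1[of "j i" k] by (simp add: gridpt_def)

lemma idx_gridpt: "\<forall>i. j i \<le> 2 ^ k \<Longrightarrow> idx k (gridpt k j) = j"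
  by (rule ext) (simp add: idx_def marg_gridpt)

lemma idx_proj: "idx k (proj k t) = idx k t"
  unfolding proj_def by (rule idx_gridpt[OF idx_le_all])

lemma marg_proj: "marg i (proj k t $ i) = real (idx k t i) / 2 ^ k"
  unfolding proj_def by (rule marg_gridpt[where j="idx k t", OF idx_le])

lemma idx_frac_le: "real (idx k t i) / 2 ^ k \<le> marg i (t $ i)"
  by (rule iffD2[OF pos_divide_le_eq]) (simp, subst mult.commute, rule idx_bounds(1))

lemma idx_frac_ge: "marg i (t $ i) \<le> real (idx k t i) / 2 ^ k + 1 / 2 ^ k"
proof -
  have "marg i (t $ i) \<le> (real (idx k t i) + 1) / 2 ^ k"
    by (rule iffD2[OF pos_le_divide_eq]) (simp, subst mult.commute, rule less_imp_le[OF idx_bounds(2)])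
  then show ?thesis by (simp only: add_divide_distrib)
qed

lemma proj_le: "proj k t $ i \<le> t $ i"
  using idx_frac_le quant_le_iff[OF dyadic_le_1[OF idx_le]] by (simp add: proj_def gridpt_def)

lemma marg_proj_diff: "\<bar>marg i (t $ i) - real (idx k t i) / 2 ^ k\<bar> \<le> 1 / 2 ^ k"
proof -
  have "(0::real) < 1 / 2 ^ k" by simp
  then show ?thesis using idx_frac_le[of k t i] idx_frac_ge[of i t k] by linarith
qed

definition bracket :: "nat \<Rightarrow> ('d \<Rightarrow> nat) \<Rightarrow> (real^'d \<Rightarrow> real) \<Rightarrow> bool" where
  "bracket k j \<phi> \<longleftrightarrow> \<phi> \<in> G \<and>
      (\<forall>x. orthant_ind (gridpt k (\<lambda>i. j i - 1)) x \<le> \<phi> x \<and> \<phi> x \<le> orthant_ind (gridpt k j) x) \<and>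
      nG \<phi> \<le> \<Psi> (2 ^ k)"

text \<open>If some \<^term>\<open>j i = (0::nat)\<close>, the orthant below the grid point is empty and the choice falls back to 0,
  because the control function only brackets between strictly ordered points.\<close>

definition phi :: "nat \<Rightarrow> ('d \<Rightarrow> nat) \<Rightarrow> real^'d \<Rightarrow> real" where
  "phi k j = (if \<exists>i. j i = 0 then (\<lambda>_. 0) else SOME \<phi>. bracket k j \<phi>)"

lemma psi_nonneg: "z \<ge> 0 \<Longrightarrow> \<Psi> z \<ge> 0"
  using ctrl[unfolded control_function_def, THEN conjunct2, THEN conjunct1] by simp

lemma psi_mono: "mono_on {0..} \<Psi>"
  by (rule ctrl[unfolded control_function_def, THEN conjunct1])

text \<open>Neighbouring grid points differ by \<open>1 / 2 ^ k\<close> in each marginal, so by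
  \<open>modcont_quant_ge\<close> the smallest modulus is at least that, and monotonicity of
  \<open>\<Psi>\<close> gives the seminorm bound.\<close>

lemma phi_ex:
  assumes j: "\<forall>i. 1 \<le> j i" "\<forall>i. j i \<le> 2 ^ k"
  shows "\<exists>\<phi>. bracket k j \<phi>"
proof -
  let ?a = "gridpt k (\<lambda>i. j i - 1)" and ?b = "gridpt k j"
  let ?u = "\<lambda>i. real (j i - 1) / 2 ^ k" and ?v = "\<lambda>i. real (j i) / 2 ^ k"
  have uv: "0 \<le> ?u i" "?u i < ?v i" "?v i \<le> 1" "?v i - ?u i = 1 / 2 ^ k" for i
  proof -
    have r: "real (j i - 1) = real (j i) - 1" using j(1)[rule_format, of i] by (simp add: of_nat_diff)
    show "0 \<le> ?u i" by simp
    show "?v i \<le> 1" by (rule dyadic_le_1[OF j(2)[rule_format]])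
    show vu: "?v i - ?u i = 1 / 2 ^ k" unfolding r by (simp add: diff_divide_distrib)
    have "(0::real) < 1 / 2 ^ k" by simp
    then show "?u i < ?v i" using vu by linarith
  qed
  have lt: "?a $ i < ?b $ i" for i
    unfolding gridpt_def using quant_strict_mono[OF uv(1-3), of i i] by simp
  define m where "m = Min (range (\<lambda>i. modcont (marg_dfun M X i) (?b $ i - ?a $ i)))"
  obtain \<phi> where \<phi>: "\<phi> \<in> G" "\<forall>x. (if le_ext x ?a then 1 else 0) \<le> \<phi> x \<and> \<phi> x \<le> (if le_ext x ?b then 1 else 0)"
      "m > 0 \<longrightarrow> nG \<phi> \<le> \<Psi> (1 / m)"
    using ctrl lt unfolding control_function_def m_def Let_def by blast
  have "1 / 2 ^ k \<le> m"
    unfolding m_def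
  proof (rule Min.boundedI)
    fix z assume "z \<in> range (\<lambda>i. modcont (marg_dfun M X i) (?b $ i - ?a $ i))"
    then obtain i where z: "z = modcont (marg_dfun M X i) (?b $ i - ?a $ i)" by blast
    show "1 / 2 ^ k \<le> z" unfolding z using modcont_quant_ge[OF uv(1-3), of i i] uv(4)[of i] by (simp add: gridpt_def)
  qed auto
  moreover have "(0::real) < 1 / 2 ^ k" by simp
  ultimately have m: "m > 0" by linarith
  have "1 / m \<le> 1 / (1 / 2 ^ k)" using \<open>1 / 2 ^ k \<le> m\<close> by (intro divide_left_mono) (use m in auto)
  then have m2: "1 / m \<le> 2 ^ k" by simp
  have "\<Psi> (1 / m) \<le> \<Psi> (2 ^ k)"
    by (rule monotone_onD[OF psi_mono _ _ m2]) (use m in simp_all)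
  with \<phi>(3)[THEN mp, OF m] have "nG \<phi> \<le> \<Psi> (2 ^ k)" by (rule order_trans)
  moreover have "\<forall>x. orthant_ind ?a x \<le> \<phi> x \<and> \<phi> x \<le> orthant_ind ?b x"
    using \<phi>(2) unfolding orthant_ind_def .
  ultimately have "bracket k j \<phi>" using \<phi>(1) unfolding bracket_def by (intro conjI)
  then show ?thesis by blast
qed

lemma phi_zero:
  assumes "j i = 0"
  shows "phi k j = (\<lambda>_. 0)"
  unfolding phi_def using assms by (intro if_P exI)

lemma bracket_phi:
  assumes "\<forall>i. 1 \<le> j i" "\<forall>i. j i \<le> 2 ^ k"
  shows "bracket k j (phi k j)"
proof -
  have "\<not> (\<exists>i. j i = 0)" using assms(1) by (metis not_one_le_zero)
  then have "phi k j = (SOME \<phi>. bracket k j \<phi>)" unfolding phi_def by (rule if_not_P)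
  moreover have "bracket k j (SOME \<phi>. bracket k j \<phi>)" by (rule someI_ex[OF phi_ex[OF assms]])
  ultimately show ?thesis by metis
qed

lemma phi_lower:
  assumes "\<forall>i. 1 \<le> j i" "\<forall>i. j i \<le> 2 ^ k"
  shows "orthant_ind (gridpt k (\<lambda>i. j i - 1)) x \<le> phi k j x"
  using bracket_phi[OF assms] unfolding bracket_def by blast

lemma phi_props:
  assumes j: "\<forall>i. j i \<le> 2 ^ k"
  shows "phi k j \<in> G" "0 \<le> phi k j x" "phi k j x \<le> orthant_ind (gridpt k j) x" "nG (phi k j) \<le> \<Psi> (2 ^ k)"
proof -
  have "phi k j \<in> G \<and> 0 \<le> phi k j x \<and> phi k j x \<le> orthant_ind (gridpt k j) x \<and> nG (phi k j) \<le> \<Psi> (2 ^ k)"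
  proof (cases "\<exists>i. j i = 0")
    case True
    then obtain i where "j i = 0" by blast
    note eq = phi_zero[of j, OF this]
    have "nG (\<lambda>_. 0) \<le> \<Psi> (2 ^ k)" unfolding nG_zero by (rule psi_nonneg) simp
    then show ?thesis unfolding eq by (intro conjI G_const orthant_ind_nonneg order_refl)
  next
    case False
    then have ge: "\<forall>i. 1 \<le> j i" by (metis One_nat_def Suc_leI neq0_conv)
    have "0 \<le> phi k j x" by (rule order_trans[OF orthant_ind_nonneg phi_lower[OF ge j]])
    then show ?thesis using bracket_phi[OF ge j] unfolding bracket_def by blast
  qed
  then show "phi k j \<in> G" "0 \<le> phi k j x" "phi k j x \<le> orthant_ind (gridpt k j) x" "nG (phi k j) \<le> \<Psi> (2 ^ k)"
    by blast+
qed

abbreviation mass :: "(real^'d \<Rightarrow> real) \<Rightarrow> real" where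
  "mass f \<equiv> \<integral>\<omega>. \<bar>f (X 0 \<omega>)\<bar> \<partial>M"

lemma integral_coord_ind: "(\<integral>\<omega>. coord_ind i a (X 0 \<omega>) \<partial>M) = marg i a"
proof -
  have "(\<integral>\<omega>. coord_ind i a (X 0 \<omega>) \<partial>M) = (\<integral>\<omega>. indicator {\<omega> \<in> space M. ereal (X 0 \<omega> $ i) \<le> a} \<omega> \<partial>M)"
    by (intro Bochner_Integration.integral_cong) (auto simp: coord_ind_def indicator_def)
  then show ?thesis by (simp add: marg_def)
qed

lemma integrable_coord_ind [simp]: "integrable M (\<lambda>\<omega>. coord_ind i a (X k \<omega>))"
  by (rule integrable_bounded_comp[of _ 1]) (auto simp: coord_ind_def)

lemma integrable_orthant_ind [simp]: "integrable M (\<lambda>\<omega>. orthant_ind a (X k \<omega>))"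
  by (rule integrable_bounded_comp[of _ 1]) (auto simp: orthant_ind_def)

lemma integral_orthant_ind: "(\<integral>\<omega>. orthant_ind a (X 0 \<omega>) \<partial>M) = dfun_ext M X a"
proof -
  have "(\<integral>\<omega>. orthant_ind a (X 0 \<omega>) \<partial>M) = (\<integral>\<omega>. indicator {\<omega> \<in> space M. le_ext (X 0 \<omega>) a} \<omega> \<partial>M)"
    by (intro Bochner_Integration.integral_cong) (auto simp: orthant_ind_def indicator_def)
  then show ?thesis by (simp add: dfun_ext_def)
qed

lemma emp_proc_eq: "emp_proc M X n \<omega> t = emp (orthant_ind t) n \<omega>"
  by (simp add: emp_proc_def emp_def integral_orthant_ind) (simp add: orthant_ind_def)

lemma mass_coord_diff: "(\<integral>\<omega>. \<bar>coord_ind i a (X 0 \<omega>) - coord_ind i b (X 0 \<omega>)\<bar> \<partial>M) = \<bar>marg i a - marg i b\<bar>"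
proof -
  have *: "(\<integral>\<omega>. \<bar>coord_ind i a (X 0 \<omega>) - coord_ind i b (X 0 \<omega>)\<bar> \<partial>M) = \<bar>marg i a - marg i b\<bar>" if "a \<le> b" for a b
  proof -
    have "(\<integral>\<omega>. \<bar>coord_ind i a (X 0 \<omega>) - coord_ind i b (X 0 \<omega>)\<bar> \<partial>M) = (\<integral>\<omega>. coord_ind i b (X 0 \<omega>) - coord_ind i a (X 0 \<omega>) \<partial>M)"
      using that by (intro Bochner_Integration.integral_cong) (auto simp: coord_ind_def)
    also have "\<dots> = marg i b - marg i a" by (simp add: integral_coord_ind)
    finally show ?thesis using monoD[OF mono_marg that, of i] by simp
  qed
  show ?thesis
  proof (cases "a \<le> b")
    case False
    then have "b \<le> a" by simp
    from *[OF this] show ?thesis by (simp add: abs_minus_commute)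
  qed (rule *)
qed

lemma mass_orthant_diff:
  "mass (\<lambda>x. orthant_ind s x - orthant_ind t x) \<le> (\<Sum>i\<in>UNIV. \<bar>marg i (s $ i) - marg i (t $ i)\<bar>)"
proof -
  have "mass (\<lambda>x. orthant_ind s x - orthant_ind t x) \<le> (\<integral>\<omega>. (\<Sum>i\<in>UNIV. \<bar>coord_ind i (s $ i) (X 0 \<omega>) - coord_ind i (t $ i) (X 0 \<omega>)\<bar>) \<partial>M)"
    by (intro integral_mono orthant_ind_diff_le) auto
  also have "\<dots> = (\<Sum>i\<in>UNIV. \<bar>marg i (s $ i) - marg i (t $ i)\<bar>)"
    by (subst Bochner_Integration.integral_sum) (auto simp: mass_coord_diff)
  finally show ?thesis .
qed

text \<open>The bracket differs from the indicator only in the shell between the orthants at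
  \<open>j - 1\<close> and \<open>j\<close>. The shell is covered by one slab per coordinate, of
  probability at most \<open>1 / 2 ^ k\<close>.\<close>

lemma mass_phi:
  assumes j: "\<forall>i. j i \<le> 2 ^ k"
  shows "mass (\<lambda>x. orthant_ind (gridpt k j) x - phi k j x) \<le> real CARD('d) / 2 ^ k"
proof -
  have [measurable]: "phi k j \<in> borel_measurable borel" by (rule G_meas[OF phi_props(1)[OF j]])
  have ptw: "\<bar>orthant_ind (gridpt k j) x - phi k j x\<bar> \<le>
     (\<Sum>i\<in>UNIV. coord_ind i (gridpt k j $ i) x - coord_ind i (gridpt k (\<lambda>i. j i - 1) $ i) x)" (is "?l \<le> (\<Sum>i\<in>_. ?c i)") for x
  proof -
    have le: "gridpt k (\<lambda>i. j i - 1) $ i \<le> gridpt k j $ i" for i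
      unfolding gridpt_def using dyadic_le_1[OF j[rule_format, of i]]
      by (simp add: quant_mono divide_right_mono)
    have c: "?c i \<ge> 0" for i using le[of i] by (auto simp: coord_ind_def)
    have phi: "0 \<le> phi k j x" "phi k j x \<le> orthant_ind (gridpt k j) x" by (rule phi_props[OF j])+
    have sum_c: "0 \<le> (\<Sum>i\<in>UNIV. ?c i)" by (rule sum_nonneg[OF c])
    show ?thesis
    proof (cases "le_ext x (gridpt k j)")
      case False
      then have "orthant_ind (gridpt k j) x = 0" by (simp only: orthant_ind_def if_False)
      then show ?thesis using phi sum_c by linarith
    next
      case inside: True
      then have o1: "orthant_ind (gridpt k j) x = 1" by (simp only: orthant_ind_def if_True)
      show ?thesis
      proof (cases "le_ext x (gridpt k (\<lambda>i. j i - 1))")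
        case True
        \<comment> \<open>If some \<open>j i\<close> is 0, so is the truncated
          \<open>j i - 1\<close>; its quantile is \<open>- \<infinity>\<close>, and no real point
          lies below it.\<close>
        have ge: "\<forall>i. 1 \<le> j i"
        proof (rule allI, rule ccontr)
          fix i assume "\<not> 1 \<le> j i"
          then have "j i - 1 = 0" by linarith
          then have "gridpt k (\<lambda>i. j i - 1) $ i = - \<infinity>" by (simp add: gridpt_def quant_0)
          moreover have "ereal (x $ i) \<le> gridpt k (\<lambda>i. j i - 1) $ i" using True unfolding le_ext_iff by blast
          ultimately show False by simp
        qed
        have "orthant_ind (gridpt k (\<lambda>i. j i - 1)) x = 1" using True by (simp only: orthant_ind_def if_True)
        then have "1 \<le> phi k j x" using phi_lower[OF ge j, of x] by linarith
        then show ?thesis using phi o1 sum_c by linarith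
      next
        case False
        then obtain i where "\<not> ereal (x $ i) \<le> gridpt k (\<lambda>i. j i - 1) $ i" unfolding le_ext_iff by blast
        moreover have "ereal (x $ i) \<le> gridpt k j $ i" using inside unfolding le_ext_iff by blast
        ultimately have "?c i = 1" by (simp only: coord_ind_def if_True if_False diff_zero)
        moreover have "?c i \<le> (\<Sum>i\<in>UNIV. ?c i)" by (rule member_le_sum[OF UNIV_I c]) simp
        ultimately show ?thesis using phi o1 by linarith
      qed
    qed
  qed
  have int: "integrable M (\<lambda>\<omega>. phi k j (X 0 \<omega>))"
  proof (rule integrable_bounded_comp[of _ 1])
    fix x
    have "phi k j x \<le> 1" by (rule order_trans[OF phi_props(3)[OF j] orthant_ind_le_1])
    then show "\<bar>phi k j x\<bar> \<le> 1" using phi_props(2)[OF j, of x] by simp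
  qed measurable
  have "mass (\<lambda>x. orthant_ind (gridpt k j) x - phi k j x) \<le>
    (\<integral>\<omega>. (\<Sum>i\<in>UNIV. coord_ind i (gridpt k j $ i) (X 0 \<omega>) - coord_ind i (gridpt k (\<lambda>i. j i - 1) $ i) (X 0 \<omega>)) \<partial>M)"
    using int by (intro integral_mono ptw) auto
  also have "\<dots> = (\<Sum>i\<in>UNIV. marg i (gridpt k j $ i) - marg i (gridpt k (\<lambda>i. j i - 1) $ i))"
    by (subst Bochner_Integration.integral_sum) (auto simp: integral_coord_ind)
  also have "\<dots> \<le> (\<Sum>i\<in>(UNIV::'d set). 1 / 2 ^ k)"
  proof (rule sum_mono)
    fix i
    have le: "j i - 1 \<le> 2 ^ k" by (rule le_trans[OF diff_le_self j[rule_format]])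
    have "marg i (gridpt k j $ i) - marg i (gridpt k (\<lambda>i. j i - 1) $ i) = (real (j i) - real (j i - 1)) / 2 ^ k"
      unfolding marg_gridpt[where j=j, OF j[rule_format]] marg_gridpt[where j="\<lambda>i. j i - 1", OF le] diff_divide_distrib ..
    also have "\<dots> \<le> 1 / 2 ^ k" by (intro divide_right_mono) (auto simp: of_nat_diff)
    finally show "marg i (gridpt k j $ i) - marg i (gridpt k (\<lambda>i. j i - 1) $ i) \<le> 1 / 2 ^ k" .
  qed
  also have "\<dots> = real CARD('d) / 2 ^ k" by simp
  finally show ?thesis .
qed

lemma card_ge_1: "real CARD('d) \<ge> 1" by (simp add: Suc_leI)

definition lo :: "nat \<Rightarrow> ereal^'d \<Rightarrow> real^'d \<Rightarrow> real" where
  "lo k t = phi k (idx k t)"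

text \<open>A bracket at index \<open>2^k\<close> dominates only the orthant at index \<open>2^k - 1\<close>; the second summand
  covers the points with some coordinate beyond it.\<close>

definition up :: "nat \<Rightarrow> ereal^'d \<Rightarrow> real^'d \<Rightarrow> real" where
  "up k t x = phi k (\<lambda>i. min (idx k t i + 2) (2 ^ k)) x + (1 - phi k (\<lambda>_. 2 ^ k - 1) x)"

lemma lo_G: "lo k t \<in> G" and lo_nonneg: "0 \<le> lo k t x" and lo_nG: "nG (lo k t) \<le> \<Psi> (2 ^ k)"
  unfolding lo_def by (rule phi_props[OF idx_le_all])+

lemma orthant_ind_mono: "(\<And>i. s $ i \<le> t $ i) \<Longrightarrow> orthant_ind s x \<le> orthant_ind t x"
  unfolding orthant_ind_def le_ext_iff by (auto intro: order_trans)

lemma lo_le: "lo k t x \<le> orthant_ind t x"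
proof -
  have "lo k t x \<le> orthant_ind (proj k t) x"
    unfolding lo_def proj_def by (rule phi_props[OF idx_le_all])
  also have "\<dots> \<le> orthant_ind t x" by (rule orthant_ind_mono) (rule proj_le)
  finally show ?thesis .
qed

lemma lo_le_1: "lo k t x \<le> 1"
  using lo_le[of k t x] orthant_ind_le_1[of t x] by linarith

lemma lo_meas [measurable]: "lo k t \<in> borel_measurable borel"
  by (rule G_meas[OF lo_G])

lemma integrable_lo [simp]: "integrable M (\<lambda>\<omega>. lo k t (X i \<omega>))"
  by (rule integrable_bounded_comp[of _ 1]) (use lo_nonneg[of k t] lo_le_1[of k t] in auto)

lemma sum_marg_proj_diff: "(\<Sum>i\<in>UNIV. \<bar>marg i (t $ i) - marg i (proj k t $ i)\<bar>) \<le> real CARD('d) / 2 ^ k"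
proof -
  have "(\<Sum>i\<in>UNIV. \<bar>marg i (t $ i) - marg i (proj k t $ i)\<bar>) \<le> (\<Sum>i\<in>(UNIV::'d set). 1 / 2 ^ k)"
    unfolding marg_proj by (intro sum_mono marg_proj_diff)
  also have "\<dots> = real CARD('d) / 2 ^ k" by simp
  finally show ?thesis .
qed

lemma mass_add:
  assumes "integrable M (\<lambda>\<omega>. f (X 0 \<omega>))" "integrable M (\<lambda>\<omega>. g (X 0 \<omega>))"
  shows "mass (\<lambda>x. f x + g x) \<le> mass f + mass g"
proof -
  have "mass (\<lambda>x. f x + g x) \<le> (\<integral>\<omega>. \<bar>f (X 0 \<omega>)\<bar> + \<bar>g (X 0 \<omega>)\<bar> \<partial>M)"
    by (intro integral_mono abs_triangle_ineq) (use assms in auto)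
  then show ?thesis using assms by simp
qed

lemma mass_lo: "mass (\<lambda>x. orthant_ind t x - lo k t x) \<le> 2 * real CARD('d) / 2 ^ k"
proof -
  have "mass (\<lambda>x. orthant_ind t x - lo k t x) =
      mass (\<lambda>x. (orthant_ind t x - orthant_ind (proj k t) x) + (orthant_ind (proj k t) x - lo k t x))" by simp
  also have "\<dots> \<le> mass (\<lambda>x. orthant_ind t x - orthant_ind (proj k t) x) + mass (\<lambda>x. orthant_ind (proj k t) x - lo k t x)"
    by (rule mass_add) auto
  also have "mass (\<lambda>x. orthant_ind t x - orthant_ind (proj k t) x) \<le> real CARD('d) / 2 ^ k"
    by (rule order_trans[OF mass_orthant_diff sum_marg_proj_diff])
  also have "mass (\<lambda>x. orthant_ind (proj k t) x - lo k t x) \<le> real CARD('d) / 2 ^ k"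
    unfolding lo_def proj_def by (rule mass_phi[OF idx_le_all])
  finally show ?thesis by simp
qed

lemma up_idx1: "\<forall>i. min (idx k t i + 2) (2 ^ k) \<le> 2 ^ k"
  and up_idx2: "\<forall>i::'d. 2 ^ k - 1 \<le> (2 ^ k :: nat)" by auto

lemma up_G: "up k t \<in> G"
  unfolding up_def[abs_def] by (intro G_add G_diff G_const phi_props[OF up_idx1] phi_props(1)[OF up_idx2])

lemma up_meas [measurable]: "up k t \<in> borel_measurable borel"
  by (rule G_meas[OF up_G])

lemma up_nG: "nG (up k t) \<le> 2 * \<Psi> (2 ^ k) + nG (\<lambda>_. 1)"
proof -
  have "nG (up k t) \<le> nG (phi k (\<lambda>i. min (idx k t i + 2) (2 ^ k))) + nG (\<lambda>x. 1 - phi k (\<lambda>_. 2 ^ k - 1) x)"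
    unfolding up_def[abs_def] by (intro nG_add G_diff G_const phi_props[OF up_idx1] phi_props(1)[OF up_idx2])
  also have "nG (\<lambda>x. 1 - phi k (\<lambda>_. 2 ^ k - 1) x) \<le> nG (\<lambda>_. 1) + nG (phi k (\<lambda>_. 2 ^ k - 1))"
    by (intro nG_diff G_const phi_props(1)[OF up_idx2])
  finally show ?thesis using phi_props(4)[OF up_idx1, of k t] phi_props(4)[OF up_idx2, of k] by linarith
qed

lemma up_le_2: "up k t x \<le> 2"
proof -
  have "phi k (\<lambda>i. min (idx k t i + 2) (2 ^ k)) x \<le> 1"
    by (rule order_trans[OF phi_props(3)[OF up_idx1] orthant_ind_le_1])
  moreover have "0 \<le> phi k (\<lambda>_. 2 ^ k - 1) x" by (rule phi_props(2)[OF up_idx2])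
  ultimately show ?thesis unfolding up_def by linarith
qed

text \<open>\<open>t\<close> lies strictly below the grid index \<open>idx + 1\<close> in every
  coordinate, so the bracket between \<open>idx + 1\<close> and \<open>idx + 2\<close> dominates its
  indicator. A point missed because of the cap at \<open>2 ^ k\<close> exceeds the quantile of index
  \<open>2 ^ k - 1\<close> in some coordinate.\<close>

lemma up_ge: "orthant_ind t x \<le> up k t x"
proof -
  let ?j = "\<lambda>i. min (idx k t i + 2) (2 ^ k)"
  have p1: "0 \<le> phi k ?j x" by (rule phi_props(2)[OF up_idx1])
  have p2: "phi k (\<lambda>_. 2 ^ k - 1) x \<le> orthant_ind (gridpt k (\<lambda>_. 2 ^ k - 1)) x" by (rule phi_props(3)[OF up_idx2])
  note p3 = order_trans[OF p2 orthant_ind_le_1]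
  show ?thesis
  proof (cases "le_ext x t")
    case False
    then have "orthant_ind t x = 0" by (simp only: orthant_ind_def if_False)
    then show ?thesis using p1 p3 unfolding up_def by linarith
  next
    case inside: True
    then have o1: "orthant_ind t x = 1" by (simp only: orthant_ind_def if_True)
    show ?thesis
    proof (cases "le_ext x (gridpt k (\<lambda>i. ?j i - 1))")
      case True
      have "\<forall>i. 1 \<le> ?j i" by simp
      then have "orthant_ind (gridpt k (\<lambda>i. ?j i - 1)) x \<le> phi k ?j x" by (rule phi_lower[OF _ up_idx1])
      moreover have "orthant_ind (gridpt k (\<lambda>i. ?j i - 1)) x = 1" using True by (simp only: orthant_ind_def if_True)
      ultimately show ?thesis using p3 o1 unfolding up_def by linarith
    next
      case False
      then obtain i where i: "\<not> ereal (x $ i) \<le> gridpt k (\<lambda>i. ?j i - 1) $ i" unfolding le_ext_iff by blast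
      have xt: "ereal (x $ i) \<le> t $ i" using inside unfolding le_ext_iff by blast
      have "?j i - 1 = 2 ^ k - 1"
      proof (rule ccontr)
        assume "?j i - 1 \<noteq> 2 ^ k - 1"
        then have j: "?j i - 1 = idx k t i + 1" "idx k t i + 1 \<le> 2 ^ k" by auto
        have "marg i (t $ i) < real (idx k t i + 1) / 2 ^ k"
          by (rule iffD2[OF pos_less_divide_eq])
             (use idx_bounds(2)[where k=k and t=t and i=i] in \<open>simp_all add: mult.commute\<close>)
        then have "\<not> quant i (real (idx k t i + 1) / 2 ^ k) \<le> t $ i"
          unfolding quant_le_iff[OF dyadic_le_1[OF j(2)]] by simp
        then have "t $ i \<le> gridpt k (\<lambda>i. ?j i - 1) $ i" unfolding gridpt_def vec_lambda_beta j(1) by simp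
        then show False using xt i by (metis order_trans)
      qed
      then have "\<not> ereal (x $ i) \<le> gridpt k (\<lambda>_. 2 ^ k - 1) $ i" using i by (simp only: gridpt_def vec_lambda_beta not_False_eq_True)
      then have "orthant_ind (gridpt k (\<lambda>_. 2 ^ k - 1)) x = 0" unfolding orthant_ind_def le_ext_iff by (intro if_not_P) blast
      then show ?thesis using p1 p2 o1 unfolding up_def by linarith
    qed
  qed
qed

lemma integrable_up [simp]: "integrable M (\<lambda>\<omega>. up k t (X i \<omega>))"
proof (rule integrable_bounded_comp[of _ 2])
  fix x show "\<bar>up k t x\<bar> \<le> 2" using up_le_2[of k t x] up_ge[of t x k] orthant_ind_nonneg[of t x] by linarith
qed measurable

lemma integrable_phi: "\<forall>i. j i \<le> 2 ^ k \<Longrightarrow> integrable M (\<lambda>\<omega>. phi k j (X i \<omega>))"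
proof (rule integrable_bounded_comp[of _ 1])
  assume j: "\<forall>i. j i \<le> 2 ^ k"
  show "phi k j \<in> borel_measurable borel" by (rule G_meas[OF phi_props(1)[OF j]])
  fix x show "\<bar>phi k j x\<bar> \<le> 1"
    using phi_props(2)[OF j, of x] order_trans[OF phi_props(3)[OF j] orthant_ind_le_1, of x] by linarith
qed

text \<open>The difference is telescoped through indicators of grid orthants, the constant 1 being
  the indicator of the full orthant. \<open>?B\<close> spans at most two cells per coordinate and
  each of the other four terms one, six cells in all.\<close>

lemma mass_up: "mass (\<lambda>x. up k t x - lo k t x) \<le> 8 * real CARD('d) / 2 ^ k"
proof -
  let ?j = "\<lambda>i. min (idx k t i + 2) (2 ^ k)" and ?l = "\<lambda>_::'d. 2 ^ k - 1 :: nat"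
  let ?A = "\<lambda>x. phi k ?j x - orthant_ind (gridpt k ?j) x"
  let ?B = "\<lambda>x. orthant_ind (gridpt k ?j) x - orthant_ind (gridpt k (idx k t)) x"
  let ?C = "\<lambda>x. orthant_ind (gridpt k (idx k t)) x - phi k (idx k t) x"
  let ?E = "\<lambda>x. orthant_ind (\<chi> i. \<infinity>) x - orthant_ind (gridpt k ?l) x"
  let ?F = "\<lambda>x. orthant_ind (gridpt k ?l) x - phi k ?l x"
  note integrables = Bochner_Integration.integrable_add Bochner_Integration.integrable_diff integrable_orthant_ind
    integrable_phi[OF up_idx1] integrable_phi[OF up_idx2] integrable_phi[OF idx_le_all]
  have one: "orthant_ind (\<chi> i. \<infinity>) x = 1" for x by (simp add: orthant_ind_def le_ext_def)
  have "mass (\<lambda>x. up k t x - lo k t x) = mass (\<lambda>x. ?A x + (?B x + (?C x + (?E x + ?F x))))"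
    by (simp add: up_def lo_def one algebra_simps)
  also have "\<dots> \<le> mass ?A + mass (\<lambda>x. ?B x + (?C x + (?E x + ?F x)))"
    by (rule mass_add) (intro integrables)+
  also have "mass (\<lambda>x. ?B x + (?C x + (?E x + ?F x))) \<le> mass ?B + mass (\<lambda>x. ?C x + (?E x + ?F x))"
    by (rule mass_add) (intro integrables)+
  also have "mass (\<lambda>x. ?C x + (?E x + ?F x)) \<le> mass ?C + mass (\<lambda>x. ?E x + ?F x)"
    by (rule mass_add) (intro integrables)+
  also have "mass (\<lambda>x. ?E x + ?F x) \<le> mass ?E + mass ?F"
    by (rule mass_add) (intro integrables)+
  also have "mass ?A \<le> real CARD('d) / 2 ^ k"
    using mass_phi[OF up_idx1, of k t] by (subst abs_minus_commute)
  also have "mass ?C \<le> real CARD('d) / 2 ^ k" by (rule mass_phi[OF idx_le_all])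
  also have "mass ?F \<le> real CARD('d) / 2 ^ k" by (rule mass_phi[OF up_idx2])
  also have "mass ?B \<le> 2 * real CARD('d) / 2 ^ k"
  proof -
    have "mass ?B \<le> (\<Sum>i\<in>UNIV. \<bar>marg i (gridpt k ?j $ i) - marg i (gridpt k (idx k t) $ i)\<bar>)"
      by (rule mass_orthant_diff)
    also have "\<dots> \<le> (\<Sum>i\<in>(UNIV::'d set). 2 / 2 ^ k)"
    proof (rule sum_mono)
      fix i
      have "?j i \<le> idx k t i + 2" "idx k t i \<le> ?j i" using idx_le[of k t i] by auto
      then have "real (?j i) \<le> real (idx k t i + 2)" "real (idx k t i) \<le> real (?j i)"
        by (simp_all only: of_nat_le_iff)
      then have "\<bar>real (?j i) - real (idx k t i)\<bar> \<le> 2" unfolding of_nat_add of_nat_numeral by linarith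
      then have "\<bar>real (?j i) - real (idx k t i)\<bar> / 2 ^ k \<le> 2 / 2 ^ k" by (intro divide_right_mono) auto
      then show "\<bar>marg i (gridpt k ?j $ i) - marg i (gridpt k (idx k t) $ i)\<bar> \<le> 2 / 2 ^ k"
        unfolding marg_gridpt[where j="?j", OF up_idx1[rule_format]] marg_gridpt[where j="idx k t", OF idx_le]
        by (simp add: diff_divide_distrib[symmetric] abs_divide)
    qed
    also have "\<dots> = 2 * real CARD('d) / 2 ^ k" by simp
    finally show ?thesis .
  qed
  also have "mass ?E \<le> real CARD('d) / 2 ^ k"
  proof -
    have "mass ?E \<le> (\<Sum>i\<in>UNIV. \<bar>marg i ((\<chi> i. \<infinity>) $ i) - marg i (gridpt k ?l $ i)\<bar>)"
      by (rule mass_orthant_diff)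
    also have "\<dots> = (\<Sum>i\<in>(UNIV::'d set). 1 / 2 ^ k)"
    proof (rule sum.cong[OF refl])
      fix i :: 'd
      have "real (2 ^ k - 1) / 2 ^ k = 1 - 1 / (2 ^ k :: real)"
        by (simp add: of_nat_diff diff_divide_distrib)
      then show "\<bar>marg i ((\<chi> i. \<infinity>) $ i) - marg i (gridpt k ?l $ i)\<bar> = 1 / 2 ^ k"
        unfolding marg_gridpt[where j="?l", OF up_idx2[rule_format]] by (simp add: marg_top)
    qed
    also have "\<dots> = real CARD('d) / 2 ^ k" by simp
    finally show ?thesis .
  qed
  finally have "mass (\<lambda>x. up k t x - lo k t x) \<le> 6 * real CARD('d) / 2 ^ k"
    by (simp add: add_divide_distrib[symmetric])
  also have "\<dots> \<le> 8 * real CARD('d) / 2 ^ k" by (intro divide_right_mono mult_right_mono) auto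
  finally show ?thesis .
qed

lemma idx_Suc_div: "idx k t i = idx (Suc k) t i div 2"
proof -
  have "\<lfloor>2 ^ k * marg i (t $ i)\<rfloor> = \<lfloor>2 ^ Suc k * marg i (t $ i)\<rfloor> div 2"
    using floor_divide_real_eq_div[of 2 "2 ^ Suc k * marg i (t $ i)"] by simp
  then show ?thesis unfolding idx_def by (simp only: nat_div_distrib' nat_numeral)
qed

section \<open>Finite grids and the links of the chain\<close>

definition grid :: "nat \<Rightarrow> (ereal^'d) set" where
  "grid k = gridpt k ` {j. \<forall>i. j i \<le> 2 ^ k}"

lemma proj_in_grid: "proj k t \<in> grid k"
  unfolding grid_def proj_def using idx_le by blast

lemma grid_finite_card: "finite (grid k)" "real (card (grid k)) \<le> 2 ^ CARD('d) * (2 ^ CARD('d)) ^ k"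
proof -
  have eq: "{j::'d \<Rightarrow> nat. \<forall>i. j i \<le> 2 ^ k} = PiE UNIV (\<lambda>_. {..2 ^ k})" by (auto simp: PiE_def)
  have fin: "finite {j::'d \<Rightarrow> nat. \<forall>i. j i \<le> 2 ^ k}" unfolding eq by (rule finite_PiE) auto
  then show "finite (grid k)" unfolding grid_def by simp
  have "card (grid k) \<le> card {j::'d \<Rightarrow> nat. \<forall>i. j i \<le> 2 ^ k}"
    unfolding grid_def by (rule card_image_le[OF fin])
  also have "\<dots> = (2 ^ k + 1) ^ CARD('d)" unfolding eq by (subst card_PiE) auto
  also have "\<dots> \<le> (2 * 2 ^ k) ^ CARD('d)" by (rule power_mono) auto
  finally have "real (card (grid k)) \<le> real ((2 * 2 ^ k) ^ CARD('d))" by (rule of_nat_mono)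
  also have "\<dots> = 2 ^ CARD('d) * (2 ^ CARD('d)) ^ k"
    by (simp add: power_mult_distrib power_mult[symmetric] mult.commute)
  finally show "real (card (grid k)) \<le> 2 ^ CARD('d) * (2 ^ CARD('d)) ^ k" .
qed

lemma lo_proj: "lo k (proj k t) = lo k t"
  unfolding lo_def idx_proj ..

lemma up_proj: "up k (proj k t) = up k t"
  unfolding up_def[abs_def] idx_proj ..

text \<open>Rounding is consistent between levels, so an increment from level \<open>k\<close> to
  \<open>Suc k\<close> is a function of the finer grid point. Finitely many events then control all
  \<open>t\<close> at once.\<close>

lemma lo_proj_Suc: "lo k (proj (Suc k) t) = lo k t"
proof -
  have "idx k (proj (Suc k) t) = idx k t"
    by (rule ext) (simp only: idx_Suc_div[of k] idx_proj)
  then show ?thesis unfolding lo_def by simp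
qed

text \<open>A common profile for all increments to be estimated: between consecutive levels, between
  upper and lower bracket, and between the lower brackets of two close points. The constants are
  large enough for all three.\<close>

definition link :: "nat \<Rightarrow> (real^'d \<Rightarrow> real) \<Rightarrow> bool" where
  "link k f \<longleftrightarrow> f \<in> G \<and> (\<forall>x. \<bar>f x\<bar> \<le> 2) \<and> mass f \<le> 10 * real CARD('d) / 2 ^ k \<and> nG f \<le> 3 * \<Psi> (2 ^ k) + nG (\<lambda>_. 1)"

lemma psi_pow_mono: "\<Psi> (2 ^ k) \<le> \<Psi> (2 ^ Suc k)"
  by (rule monotone_onD[OF psi_mono]) (auto intro: power_increasing)

lemma link_lo: "link (Suc k) (\<lambda>x. lo (Suc k) t x - lo k t x)"
  unfolding link_def
proof (intro conjI allI)
  show "(\<lambda>x. lo (Suc k) t x - lo k t x) \<in> G" by (intro G_diff lo_G)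
  show "\<bar>lo (Suc k) t x - lo k t x\<bar> \<le> 2" for x
    using lo_nonneg[of "Suc k" t x] lo_nonneg[of k t x] lo_le_1[of "Suc k" t x] lo_le_1[of k t x] by linarith
  have "mass (\<lambda>x. lo (Suc k) t x - lo k t x) = mass (\<lambda>x. (orthant_ind t x - lo k t x) + (lo (Suc k) t x - orthant_ind t x))"
    by simp
  also have "\<dots> \<le> mass (\<lambda>x. orthant_ind t x - lo k t x) + mass (\<lambda>x. lo (Suc k) t x - orthant_ind t x)"
    by (rule mass_add) auto
  also have "mass (\<lambda>x. lo (Suc k) t x - orthant_ind t x) \<le> 2 * real CARD('d) / 2 ^ Suc k"
    using mass_lo[of t "Suc k"] by (subst abs_minus_commute)
  also have "mass (\<lambda>x. orthant_ind t x - lo k t x) \<le> 4 * real CARD('d) / 2 ^ Suc k"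
    using mass_lo[of t k] by simp
  finally have "mass (\<lambda>x. lo (Suc k) t x - lo k t x) \<le> 6 * real CARD('d) / 2 ^ Suc k" by (simp add: add_divide_distrib[symmetric])
  also have "\<dots> \<le> 10 * real CARD('d) / 2 ^ Suc k" by (intro divide_right_mono mult_right_mono) auto
  finally show "mass (\<lambda>x. lo (Suc k) t x - lo k t x) \<le> 10 * real CARD('d) / 2 ^ Suc k" .
  have "nG (\<lambda>x. lo (Suc k) t x - lo k t x) \<le> nG (lo (Suc k) t) + nG (lo k t)" by (intro nG_diff lo_G)
  moreover have "0 \<le> \<Psi> (2 ^ Suc k)" by (rule psi_nonneg) simp
  ultimately show "nG (\<lambda>x. lo (Suc k) t x - lo k t x) \<le> 3 * \<Psi> (2 ^ Suc k) + nG (\<lambda>_. 1)"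
    using lo_nG[of "Suc k" t] lo_nG[of k t] psi_pow_mono[of k] nG_nonneg[OF G_const[of 1]] by linarith
qed

lemma link_up: "link k (\<lambda>x. up k t x - lo k t x)"
  unfolding link_def
proof (intro conjI allI)
  show "(\<lambda>x. up k t x - lo k t x) \<in> G" by (intro G_diff lo_G up_G)
  show "\<bar>up k t x - lo k t x\<bar> \<le> 2" for x
    using lo_nonneg[of k t x] lo_le[of k t x] up_ge[of t x k] up_le_2[of k t x] orthant_ind_nonneg[of t x] by linarith
  have "8 * real CARD('d) / 2 ^ k \<le> 10 * real CARD('d) / 2 ^ k" by (intro divide_right_mono mult_right_mono) auto
  then show "mass (\<lambda>x. up k t x - lo k t x) \<le> 10 * real CARD('d) / 2 ^ k" using mass_up[of k t] by linarith
  have "nG (\<lambda>x. up k t x - lo k t x) \<le> nG (up k t) + nG (lo k t)" by (intro nG_diff lo_G up_G)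
  then show "nG (\<lambda>x. up k t x - lo k t x) \<le> 3 * \<Psi> (2 ^ k) + nG (\<lambda>_. 1)"
    using lo_nG[of k t] up_nG[of k t] by linarith
qed

definition \<rho> :: real where "\<rho> = 2 powr (- \<alpha>)"

text \<open>The lower bound, which is \<open>\<alpha> \<le> 1\<close>, later compares
  \<open>1 / 2 ^ k\<close> with \<open>\<rho> ^ k\<close> in the linear term of the moment
  bound.\<close>

lemma rho_bounds: "0 < \<rho>" "\<rho> < 1" "1 / 2 \<le> \<rho>"
proof -
  show "0 < \<rho>" unfolding \<rho>_def by simp
  have "2 powr (- \<alpha>) < 2 powr 0" using alpha_pos by (intro powr_less_mono) auto
  then show "\<rho> < 1" unfolding \<rho>_def by simp
  have "2 powr (- 1) \<le> 2 powr (- \<alpha>)" using alpha_le_1 by (intro powr_mono) auto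
  then show "1 / 2 \<le> \<rho>" unfolding \<rho>_def by (simp add: powr_minus_divide)
qed

lemma link_size_bound: "\<exists>C>0. \<forall>k f. link k f \<longrightarrow> link_size f \<le> C * \<rho> ^ k"
proof -
  obtain c where c: "c > 0" "\<And>k. \<Psi> (2 ^ k) \<le> c * 2 powr (real k / \<gamma>)" using psi_bound by blast
  let ?n = "nG (\<lambda>_. 1)"
  have n: "?n \<ge> 0" by (rule nG_nonneg[OF G_const])
  show ?thesis
  proof (intro exI[of _ "(10 * real CARD('d)) powr (1 / r) * (3 * c + 3 * ?n)"] conjI allI impI)
    have "(10 * real CARD('d)) powr (1 / r) > 0" using card_ge_1 by simp
    moreover have "3 * c + 3 * ?n > 0" using c n by linarith
    ultimately show "(10 * real CARD('d)) powr (1 / r) * (3 * c + 3 * ?n) > 0" by (rule mult_pos_pos)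
    fix k f assume f: "link k f"
    have one: "1 \<le> 2 powr (real k / \<gamma>)" using gamma_pos by (intro ge_one_powr_ge_zero) auto
    have "mass f powr (1 / r) \<le> (10 * real CARD('d) / 2 ^ k) powr (1 / r)"
      using f r_ge_1 unfolding link_def by (intro powr_mono2) auto
    also have "\<dots> = (10 * real CARD('d)) powr (1 / r) * 2 powr (- (real k / r))"
      by (simp add: powr_divide powr_minus_divide powr_realpow[symmetric] powr_powr)
    finally have A: "mass f powr (1 / r) \<le> (10 * real CARD('d)) powr (1 / r) * 2 powr (- (real k / r))" .
    have "nG f + 2 * ?n \<le> 3 * (c * 2 powr (real k / \<gamma>)) + 3 * ?n"
      using f c(2)[of k] unfolding link_def by linarith
    also have "\<dots> \<le> 3 * (c * 2 powr (real k / \<gamma>)) + 3 * ?n * 2 powr (real k / \<gamma>)"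
      using mult_left_mono[OF one n] by (simp add: mult.assoc)
    also have "\<dots> = (3 * c + 3 * ?n) * 2 powr (real k / \<gamma>)" by (simp add: algebra_simps)
    finally have B: "nG f + 2 * ?n \<le> (3 * c + 3 * ?n) * 2 powr (real k / \<gamma>)" .
    have "link_size f \<le> ((10 * real CARD('d)) powr (1 / r) * 2 powr (- (real k / r))) * ((3 * c + 3 * ?n) * 2 powr (real k / \<gamma>))"
      unfolding link_size_def using A B n f nG_nonneg[of f] by (intro mult_mono) (auto simp: link_def)
    also have "\<dots> = (10 * real CARD('d)) powr (1 / r) * (3 * c + 3 * ?n) * (2 powr (- (real k / r)) * 2 powr (real k / \<gamma>))"
      by (simp add: mult_ac)
    also have "2 powr (- (real k / r)) * 2 powr (real k / \<gamma>) = \<rho> ^ k"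
      unfolding \<rho>_def by (simp add: powr_add[symmetric] powr_realpow[symmetric] powr_powr \<alpha>_def algebra_simps)
    finally show "link_size f \<le> (10 * real CARD('d)) powr (1 / r) * (3 * c + 3 * ?n) * \<rho> ^ k" .
  qed
qed

lemma link_moment:
  assumes q: "1 \<le> q" "q \<le> p"
  shows "\<exists>C>0. \<forall>k f n. link k f \<longrightarrow> 1 \<le> n \<longrightarrow>
     (\<integral>\<omega>. emp f n \<omega> ^ (2 * q) \<partial>M) \<le> C * (\<rho> ^ k / real n ^ (q - 1) + (\<rho> ^ k) ^ q)"
proof -
  obtain c where c: "c > 0" "\<And>k f. link k f \<Longrightarrow> link_size f \<le> c * \<rho> ^ k" using link_size_bound by blast
  obtain C where C: "C \<ge> 0" "\<And>f n. f \<in> G \<Longrightarrow> (\<forall>x. \<bar>f x\<bar> \<le> 2) \<Longrightarrow> n \<ge> 1 \<Longrightarrow>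
     (\<integral>\<omega>. emp f n \<omega> ^ (2 * q) \<partial>M) \<le> C * (link_size f / real n ^ (q - 1) + link_size f ^ q)"
    using emp_moment[OF q] by blast
  show ?thesis
  proof (intro exI[of _ "(C + 1) * (c + c ^ q)"] conjI allI impI)
    show "(C + 1) * (c + c ^ q) > 0" using C c by (intro mult_pos_pos add_pos_pos add_nonneg_pos) auto
    fix k f and n :: nat assume f: "link k f" and n: "1 \<le> n"
    have s: "0 \<le> link_size f" "link_size f \<le> c * \<rho> ^ k"
      using link_size_nonneg[of f] c(2)[OF f] f by (auto simp: link_def)
    have r0: "0 \<le> \<rho> ^ k" using rho_bounds by simp
    have "(\<integral>\<omega>. emp f n \<omega> ^ (2 * q) \<partial>M) \<le> C * (link_size f / real n ^ (q - 1) + link_size f ^ q)"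
      using C(2) f n by (auto simp: link_def)
    also have "\<dots> \<le> (C + 1) * (c * \<rho> ^ k / real n ^ (q - 1) + (c * \<rho> ^ k) ^ q)"
      using C s by (intro mult_mono add_mono divide_right_mono power_mono) auto
    also have "\<dots> \<le> (C + 1) * ((c + c ^ q) * (\<rho> ^ k / real n ^ (q - 1)) + (c + c ^ q) * (\<rho> ^ k) ^ q)"
    proof (intro mult_left_mono add_mono)
      have "c * (\<rho> ^ k / real n ^ (q - 1)) \<le> (c + c ^ q) * (\<rho> ^ k / real n ^ (q - 1))"
        using c r0 by (intro mult_right_mono) auto
      then show "c * \<rho> ^ k / real n ^ (q - 1) \<le> (c + c ^ q) * (\<rho> ^ k / real n ^ (q - 1))" by simp
      show "(c * \<rho> ^ k) ^ q \<le> (c + c ^ q) * (\<rho> ^ k) ^ q"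
        unfolding power_mult_distrib using c r0 by (intro mult_right_mono) auto
    qed (use C in auto)
    also have "\<dots> = (C + 1) * (c + c ^ q) * (\<rho> ^ k / real n ^ (q - 1) + (\<rho> ^ k) ^ q)"
      by (simp add: algebra_simps add_divide_distrib)
    finally show "(\<integral>\<omega>. emp f n \<omega> ^ (2 * q) \<partial>M) \<le> (C + 1) * (c + c ^ q) * (\<rho> ^ k / real n ^ (q - 1) + (\<rho> ^ k) ^ q)" .
  qed
qed

end

section \<open>Chaining\<close>

lemma (in prob_space) prob_abs_gt_le_moment:
  fixes Z :: "'a \<Rightarrow> real"
  assumes [measurable]: "Z \<in> borel_measurable M" and int: "integrable M (\<lambda>\<omega>. Z \<omega> ^ (2 * q))" and e: "e > 0"
  shows "prob {\<omega> \<in> space M. \<bar>Z \<omega>\<bar> > e} \<le> (\<integral>\<omega>. Z \<omega> ^ (2 * q) \<partial>M) / e ^ (2 * q)"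
proof -
  have "prob {\<omega> \<in> space M. \<bar>Z \<omega>\<bar> > e} \<le> prob {\<omega> \<in> space M. Z \<omega> ^ (2 * q) \<ge> e ^ (2 * q)}"
  proof (rule finite_measure_mono)
    show "{\<omega> \<in> space M. \<bar>Z \<omega>\<bar> > e} \<subseteq> {\<omega> \<in> space M. Z \<omega> ^ (2 * q) \<ge> e ^ (2 * q)}"
    proof
      fix \<omega> assume w: "\<omega> \<in> {\<omega> \<in> space M. \<bar>Z \<omega>\<bar> > e}"
      then have "e ^ (2 * q) \<le> \<bar>Z \<omega>\<bar> ^ (2 * q)" using e by (intro power_mono) auto
      then show "\<omega> \<in> {\<omega> \<in> space M. Z \<omega> ^ (2 * q) \<ge> e ^ (2 * q)}" using w by (simp add: power_even_abs)
    qed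
  qed measurable
  also have "\<dots> \<le> (\<integral>\<omega>. Z \<omega> ^ (2 * q) \<partial>M) / e ^ (2 * q)"
    by (rule integral_Markov_inequality_measure[OF int, of "{}"]) (use e in auto)
  finally show ?thesis .
qed

text \<open>Minkowski's inequality for given bounds on the norms. The weighted inequality with
  \<open>1 + b / a\<close> and \<open>1 + a / b\<close> is tuned so that the bounds recombine to
  \<open>(a + b)\<^sup>2\<close>, without integrating the product.\<close>

lemma (in prob_space) expectation_square_add:
  fixes Y Z :: "'a \<Rightarrow> real"
  assumes Y: "integrable M (\<lambda>\<omega>. (Y \<omega>)\<^sup>2)" "(\<integral>\<omega>. (Y \<omega>)\<^sup>2 \<partial>M) \<le> a\<^sup>2" "a > 0"
    and Z: "integrable M (\<lambda>\<omega>. (Z \<omega>)\<^sup>2)" "(\<integral>\<omega>. (Z \<omega>)\<^sup>2 \<partial>M) \<le> b\<^sup>2" "b > 0"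
  shows "(\<integral>\<omega>. (Y \<omega> + Z \<omega>)\<^sup>2 \<partial>M) \<le> (a + b)\<^sup>2"
proof -
  have "(\<integral>\<omega>. (Y \<omega> + Z \<omega>)\<^sup>2 \<partial>M) \<le> (\<integral>\<omega>. (1 + b / a) * (Y \<omega>)\<^sup>2 + (1 + a / b) * (Z \<omega>)\<^sup>2 \<partial>M)"
  proof (rule integral_mono')
    show "integrable M (\<lambda>\<omega>. (1 + b / a) * (Y \<omega>)\<^sup>2 + (1 + a / b) * (Z \<omega>)\<^sup>2)" using Y Z by auto
    fix \<omega>
    have "0 \<le> (b * Y \<omega> - a * Z \<omega>)\<^sup>2 / (a * b)" using Y Z by simp
    also have "\<dots> = b / a * (Y \<omega>)\<^sup>2 + a / b * (Z \<omega>)\<^sup>2 - 2 * Y \<omega> * Z \<omega>"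
      using Y(3) Z(3) by (simp add: field_simps power2_eq_square)
    finally show "(Y \<omega> + Z \<omega>)\<^sup>2 \<le> (1 + b / a) * (Y \<omega>)\<^sup>2 + (1 + a / b) * (Z \<omega>)\<^sup>2"
      by (simp add: power2_sum algebra_simps)
    then show "0 \<le> (1 + b / a) * (Y \<omega>)\<^sup>2 + (1 + a / b) * (Z \<omega>)\<^sup>2" using zero_le_power2 order_trans by blast
  qed
  also have "\<dots> = (1 + b / a) * (\<integral>\<omega>. (Y \<omega>)\<^sup>2 \<partial>M) + (1 + a / b) * (\<integral>\<omega>. (Z \<omega>)\<^sup>2 \<partial>M)" using Y Z by simp
  also have "\<dots> \<le> (1 + b / a) * a\<^sup>2 + (1 + a / b) * b\<^sup>2" using Y Z by (intro add_mono mult_left_mono) auto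
  also have "\<dots> = (a + b)\<^sup>2" using Y(3) Z(3) by (simp add: field_simps power2_eq_square)
  finally show ?thesis .
qed

section \<open>Elementary bounds for the normalised sums\<close>

context mixing_process
begin

lemma emp_abs_le:
  assumes [measurable]: "f \<in> borel_measurable borel" and f: "\<And>x. \<bar>f x\<bar> \<le> B"
  shows "\<bar>emp f n \<omega>\<bar> \<le> 2 * B * sqrt (real n)"
proof (cases "n = 0")
  case True
  then show ?thesis by (simp add: emp_def)
next
  case False
  have int: "integrable M (\<lambda>\<omega>. f (X 0 \<omega>))" by (rule integrable_bounded_comp[OF assms])
  have "\<bar>\<integral>\<omega>. f (X 0 \<omega>) \<partial>M\<bar> \<le> (\<integral>\<omega>. \<bar>f (X 0 \<omega>)\<bar> \<partial>M)" by (rule integral_abs_bound)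
  also have "\<dots> \<le> (\<integral>\<omega>. B \<partial>M)" using f int by (intro integral_mono) auto
  finally have mu: "\<bar>\<integral>\<omega>. f (X 0 \<omega>) \<partial>M\<bar> \<le> B" by (simp add: prob_space)
  have "\<bar>\<Sum>i\<in>{1..n}. f (X i \<omega>) - (\<integral>\<omega>. f (X 0 \<omega>) \<partial>M)\<bar> \<le> (\<Sum>i\<in>{1..n}. \<bar>f (X i \<omega>) - (\<integral>\<omega>. f (X 0 \<omega>) \<partial>M)\<bar>)"
    by (rule sum_abs)
  also have "\<dots> \<le> (\<Sum>i\<in>{1..n}. 2 * B)"
  proof (rule sum_mono)
    fix i show "\<bar>f (X i \<omega>) - (\<integral>\<omega>. f (X 0 \<omega>) \<partial>M)\<bar> \<le> 2 * B" using f[of "X i \<omega>"] mu by linarith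
  qed
  also have "\<dots> = 2 * B * real n" by simp
  finally have "\<bar>emp f n \<omega>\<bar> \<le> 2 * B * real n / sqrt (real n)"
    unfolding emp_def abs_divide by (simp add: divide_right_mono)
  also have "\<dots> = 2 * B * sqrt (real n)" using False by (simp add: real_div_sqrt flip: times_divide_eq_right)
  finally show ?thesis .
qed

lemma integrable_emp_pow:
  assumes [measurable]: "f \<in> borel_measurable borel" and f: "\<And>x. \<bar>f x\<bar> \<le> B"
  shows "integrable M (\<lambda>\<omega>. emp f n \<omega> ^ q)"
proof (rule integrable_const_bound[of _ "(2 * B * sqrt (real n)) ^ q"])
  have "\<bar>emp f n \<omega>\<bar> ^ q \<le> (2 * B * sqrt (real n)) ^ q" for \<omega>
    by (rule power_mono[OF emp_abs_le[OF assms]]) auto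
  then show "AE \<omega> in M. norm (emp f n \<omega> ^ q) \<le> (2 * B * sqrt (real n)) ^ q" by (simp add: power_abs)
qed measurable

text \<open>A bound that grows with \<open>n\<close> but applies outside \<open>G\<close>. It serves
  for the remainder of a chain that is extended with \<open>n\<close> fixed until the absolute
  moment is small.\<close>

lemma expectation_emp_square_le:
  assumes [measurable]: "f \<in> borel_measurable borel" and f: "\<And>x. \<bar>f x\<bar> \<le> 1"
  shows "(\<integral>\<omega>. (emp f n \<omega>)\<^sup>2 \<partial>M) \<le> 4 * real n * (\<integral>\<omega>. \<bar>f (X 0 \<omega>)\<bar> \<partial>M)"
proof (cases "n = 0")
  case True
  then show ?thesis by (simp add: emp_def)
next
  case False
  let ?L = "\<integral>\<omega>. \<bar>f (X 0 \<omega>)\<bar> \<partial>M"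
  have int: "integrable M (\<lambda>\<omega>. f (X i \<omega>))" for i by (rule integrable_bounded_comp[OF assms])
  have mu: "\<bar>\<integral>\<omega>. f (X 0 \<omega>) \<partial>M\<bar> \<le> ?L" by (rule integral_abs_bound)
  have "(emp f n \<omega>)\<^sup>2 \<le> 2 * (\<Sum>i\<in>{1..n}. \<bar>f (X i \<omega>)\<bar> + ?L)" for \<omega>
  proof -
    have a: "\<bar>emp f n \<omega>\<bar> \<le> (\<Sum>i\<in>{1..n}. \<bar>f (X i \<omega>)\<bar> + ?L) / sqrt (real n)"
      unfolding emp_def abs_divide
    proof (simp only: abs_of_nonneg[OF real_sqrt_ge_zero[OF of_nat_0_le_iff]], rule divide_right_mono)
      have "\<bar>\<Sum>i\<in>{1..n}. f (X i \<omega>) - (\<integral>\<omega>. f (X 0 \<omega>) \<partial>M)\<bar> \<le> (\<Sum>i\<in>{1..n}. \<bar>f (X i \<omega>) - (\<integral>\<omega>. f (X 0 \<omega>) \<partial>M)\<bar>)"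
        by (rule sum_abs)
      also have "\<dots> \<le> (\<Sum>i\<in>{1..n}. \<bar>f (X i \<omega>)\<bar> + ?L)" using mu by (intro sum_mono) linarith
      finally show "\<bar>\<Sum>i\<in>{1..n}. f (X i \<omega>) - (\<integral>\<omega>. f (X 0 \<omega>) \<partial>M)\<bar> \<le> (\<Sum>i\<in>{1..n}. \<bar>f (X i \<omega>)\<bar> + ?L)" .
    qed simp
    have b: "\<bar>emp f n \<omega>\<bar> \<le> 2 * sqrt (real n)" using emp_abs_le[OF assms] by simp
    have nn: "0 \<le> (\<Sum>i\<in>{1..n}. \<bar>f (X i \<omega>)\<bar> + ?L) / sqrt (real n)" using a by linarith
    \<comment> \<open>One factor is bounded by \<open>2 * sqrt n\<close> and the other by an average
      of \<open>\<bar>f\<bar>\<close>, so the expectation becomes linear in the absolute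
      moment.\<close>
    have "(emp f n \<omega>)\<^sup>2 = \<bar>emp f n \<omega>\<bar> * \<bar>emp f n \<omega>\<bar>" by (simp add: power2_eq_square)
    also have "\<dots> \<le> (2 * sqrt (real n)) * ((\<Sum>i\<in>{1..n}. \<bar>f (X i \<omega>)\<bar> + ?L) / sqrt (real n))"
      by (rule mult_mono[OF b a]) auto
    also have "\<dots> = 2 * (\<Sum>i\<in>{1..n}. \<bar>f (X i \<omega>)\<bar> + ?L)" using False by simp
    finally show ?thesis .
  qed
  then have "(\<integral>\<omega>. (emp f n \<omega>)\<^sup>2 \<partial>M) \<le> (\<integral>\<omega>. 2 * (\<Sum>i\<in>{1..n}. \<bar>f (X i \<omega>)\<bar> + ?L) \<partial>M)"
    using int by (intro integral_mono integrable_emp_pow[OF assms]) auto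
  also have "\<dots> = 2 * (\<Sum>i\<in>{1..n}. (\<integral>\<omega>. \<bar>f (X i \<omega>)\<bar> \<partial>M) + ?L)"
    using int by (simp add: Bochner_Integration.integral_sum prob_space)
  also have "(\<Sum>i\<in>{1..n}. (\<integral>\<omega>. \<bar>f (X i \<omega>)\<bar> \<partial>M) + ?L) = (\<Sum>i\<in>{1..n}. ?L + ?L)"
    by (intro sum.cong refl arg_cong2[where f="(+)"] stationary_integral1[where h="\<lambda>x. \<bar>f x\<bar>"]) measurable
  also have "2 * (\<Sum>i\<in>{1..n}. ?L + ?L) = 4 * real n * ?L" by simp
  finally show ?thesis .
qed

end

section \<open>Chaining along the levels\<close>

context emp_clt
begin

text \<open>Uncentred sums are monotone in the function, so the sum for \<open>?g\<close> lies
  between 0 and that for \<open>?h\<close>. The centring terms differ by at most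
  \<open>sqrt n\<close> times the \<open>mass\<close> of the bracket.\<close>

lemma emp_chain_end:
  assumes n: "n \<ge> 1"
  shows "\<bar>emp (orthant_ind t) n \<omega> - emp (lo k t) n \<omega>\<bar> \<le>
     \<bar>emp (\<lambda>x. up k t x - lo k t x) n \<omega>\<bar> + 8 * real CARD('d) / 2 ^ k * sqrt (real n)"
proof -
  let ?g = "\<lambda>x. orthant_ind t x - lo k t x" and ?h = "\<lambda>x. up k t x - lo k t x"
  let ?m = "8 * real CARD('d) / 2 ^ k"
  have g: "0 \<le> ?g x" "?g x \<le> ?h x" for x using lo_le[of k t x] up_ge[of t x k] by auto
  have sq: "real n / sqrt (real n) = sqrt (real n)" by (rule real_div_sqrt) simp
  have expand: "emp f n \<omega> = (\<Sum>i\<in>{1..n}. f (X i \<omega>)) / sqrt (real n) - (\<integral>\<omega>. f (X 0 \<omega>) \<partial>M) * sqrt (real n)" for f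
  proof -
    have "(\<Sum>i\<in>{1..n}. \<integral>\<omega>. f (X 0 \<omega>) \<partial>M) = (\<integral>\<omega>. f (X 0 \<omega>) \<partial>M) * real n" by simp
    then have "(\<Sum>i\<in>{1..n}. \<integral>\<omega>. f (X 0 \<omega>) \<partial>M) / sqrt (real n) = (\<integral>\<omega>. f (X 0 \<omega>) \<partial>M) * (real n / sqrt (real n))"
      by (simp only: times_divide_eq_right)
    then show ?thesis unfolding emp_def sum_subtractf diff_divide_distrib sq by (simp only:)
  qed
  have Eh: "(\<integral>\<omega>. ?h (X 0 \<omega>) \<partial>M) \<le> ?m"
    by (rule order_trans[OF _ mass_up[where k=k and t=t]]) (intro integral_mono, auto)
  have "(\<integral>\<omega>. ?g (X 0 \<omega>) \<partial>M) \<le> (\<integral>\<omega>. ?h (X 0 \<omega>) \<partial>M)" by (intro integral_mono g) auto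
  then have Eg: "(\<integral>\<omega>. ?g (X 0 \<omega>) \<partial>M) \<le> ?m" using Eh by linarith
  have Eg0: "0 \<le> (\<integral>\<omega>. ?g (X 0 \<omega>) \<partial>M)" using g(1) by (intro Bochner_Integration.integral_nonneg) auto
  have s0: "0 \<le> (\<Sum>i\<in>{1..n}. ?g (X i \<omega>)) / sqrt (real n)" using g by (intro divide_nonneg_nonneg sum_nonneg) auto
  have s1: "(\<Sum>i\<in>{1..n}. ?g (X i \<omega>)) / sqrt (real n) \<le> (\<Sum>i\<in>{1..n}. ?h (X i \<omega>)) / sqrt (real n)"
    using g by (intro divide_right_mono sum_mono) auto
  have m1: "(\<integral>\<omega>. ?g (X 0 \<omega>) \<partial>M) * sqrt (real n) \<le> ?m * sqrt (real n)" using Eg by (intro mult_right_mono) auto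
  have m2: "(\<integral>\<omega>. ?h (X 0 \<omega>) \<partial>M) * sqrt (real n) \<le> ?m * sqrt (real n)" using Eh by (intro mult_right_mono) auto
  have m3: "0 \<le> (\<integral>\<omega>. ?g (X 0 \<omega>) \<partial>M) * sqrt (real n)" using Eg0 by (intro mult_nonneg_nonneg) auto
  have "emp (orthant_ind t) n \<omega> - emp (lo k t) n \<omega> = emp ?g n \<omega>" by (rule emp_diff[symmetric]) auto
  moreover have "emp ?g n \<omega> \<le> emp ?h n \<omega> + ?m * sqrt (real n)"
    unfolding expand[of ?g] expand[of ?h] using s1 m2 m3 by linarith
  moreover have "- (?m * sqrt (real n)) \<le> emp ?g n \<omega>"
    unfolding expand[of ?g] using s0 m1 by linarith
  moreover have "0 \<le> ?m * sqrt (real n)" by simp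
  ultimately show ?thesis by linarith
qed

lemma emp_chain_telescope:
  "emp (lo (m + j) t) n \<omega> - emp (lo m t) n \<omega> = (\<Sum>i<j. emp (\<lambda>x. lo (Suc (m + i)) t x - lo (m + i) t x) n \<omega>)"
proof -
  have "(\<Sum>i<j. emp (\<lambda>x. lo (Suc (m + i)) t x - lo (m + i) t x) n \<omega>) =
    (\<Sum>i<j. emp (lo (m + Suc i) t) n \<omega> - emp (lo (m + i) t) n \<omega>)"
    by (intro sum.cong refl) (simp add: emp_diff)
  also have "\<dots> = emp (lo (m + j) t) n \<omega> - emp (lo (m + 0) t) n \<omega>"
    by (rule sum_lessThan_telescope)
  finally show ?thesis by simp
qed

text \<open>Growth of the grid times decay of the moment of order \<open>2 * p\<close> per level:
  the ratio of the union bound.\<close>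

definition \<beta> :: real where "\<beta> = 2 ^ CARD('d) * \<rho> ^ p"

lemma beta_bounds: "0 < \<beta>" "\<beta> < 1"
proof -
  show "0 < \<beta>" unfolding \<beta>_def using rho_bounds by simp
  have "\<beta> = 2 powr (real CARD('d) - real p * \<alpha>)"
    unfolding \<beta>_def \<rho>_def by (simp add: powr_realpow[symmetric] powr_powr powr_diff powr_minus field_simps)
  also have "\<dots> < 2 powr 0" using alpha_gt by (intro powr_less_mono) auto
  finally show "\<beta> < 1" by simp
qed

lemma link_meas: "link k f \<Longrightarrow> f \<in> borel_measurable borel"
  by (auto simp: link_def intro: G_meas)

lemma link_prob:
  assumes "link k f" "e > 0"
  shows "prob {\<omega> \<in> space M. \<bar>emp f n \<omega>\<bar> > e} \<le> (\<integral>\<omega>. emp f n \<omega> ^ (2 * p) \<partial>M) / e ^ (2 * p)"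
proof (rule prob_abs_gt_le_moment)
  show "emp f n \<in> borel_measurable M" by (intro emp_meas link_meas[OF assms(1)])
  show "integrable M (\<lambda>\<omega>. emp f n \<omega> ^ (2 * p))"
    by (rule integrable_emp_pow[OF link_meas[OF assms(1)], of 2]) (use assms in \<open>auto simp: link_def\<close>)
qed fact

text \<open>The least admissible exponent satisfies \<open>2 ^ K < 2 * y\<close> if it is positive;
  the summand 2 covers exponent 0.\<close>

lemma chain_depth_ex:
  assumes "y \<ge> 0"
  shows "\<exists>K::nat. y \<le> 2 ^ K \<and> 2 ^ K \<le> 2 + 2 * (y::real)"
proof -
  define K where "K = (LEAST K::nat. y \<le> 2 ^ K)"
  have "\<exists>K::nat. y < 2 ^ K" by (rule real_arch_pow) simp
  then have ex: "\<exists>K::nat. y \<le> 2 ^ K" using less_imp_le by blast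
  then have 1: "y \<le> 2 ^ K" unfolding K_def by (rule LeastI_ex)
  have "2 ^ K \<le> 2 + 2 * y"
  proof (cases K)
    case 0
    then show ?thesis using assms by simp
  next
    case (Suc j)
    then have "j < (LEAST K::nat. y \<le> 2 ^ K)" by (simp add: K_def)
    from not_less_Least[OF this] have "2 ^ j < y" by simp
    then show ?thesis unfolding Suc by simp
  qed
  with 1 show ?thesis by blast
qed

text \<open>Union bound over all links from level \<open>m\<close> to \<open>K\<close> and over the
  closing bracket at \<open>K\<close>. Only grid points occur in the union, since \<open>lo\<close>
  and \<open>up\<close> depend on \<open>t\<close> through its projection. The thresholds
  \<open>e i\<close> and \<open>e0\<close> stay free here.\<close>

lemma chain_event:
  fixes m K n :: nat and \<eta> e0 C1 :: real and e :: "nat \<Rightarrow> real"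
  assumes n: "n \<ge> 1" and K: "m \<le> K" and e: "\<And>i. e i > 0" "e0 > 0" and C1: "C1 \<ge> 0"
    and mom: "\<And>k f. k \<le> K \<Longrightarrow> link k f \<Longrightarrow> (\<integral>\<omega>. emp f n \<omega> ^ (2 * p) \<partial>M) \<le> C1 * (\<rho> ^ k) ^ p"
  shows "\<exists>A\<in>sets M. prob A \<le> C1 * 2 ^ CARD('d) * ((\<Sum>i<K - m. \<beta> ^ Suc (m + i) / e i ^ (2 * p)) + \<beta> ^ K / e0 ^ (2 * p)) \<and>
     (\<forall>\<omega>\<in>space M - A. \<forall>t. \<bar>emp (orthant_ind t) n \<omega> - emp (lo m t) n \<omega>\<bar> \<le>
        (\<Sum>i<K - m. e i) + e0 + 8 * real CARD('d) / 2 ^ K * sqrt (real n))"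
proof -
  define B where "B i s = {\<omega> \<in> space M. \<bar>emp (\<lambda>x. lo (Suc (m + i)) s x - lo (m + i) s x) n \<omega>\<bar> > e i}" for i s
  define E where "E s = {\<omega> \<in> space M. \<bar>emp (\<lambda>x. up K s x - lo K s x) n \<omega>\<bar> > e0}" for s
  define A1 where "A1 = (\<Union>i\<in>{..<K - m}. \<Union>s\<in>grid (Suc (m + i)). B i s)"
  define A2 where "A2 = (\<Union>s\<in>grid K. E s)"
  have Bm [measurable]: "B i s \<in> sets M" for i s unfolding B_def by measurable
  have Em [measurable]: "E s \<in> sets M" for s unfolding E_def by measurable
  have A1m: "A1 \<in> sets M" unfolding A1_def using grid_finite_card(1) by (intro sets.finite_UN) auto
  have A2m: "A2 \<in> sets M" unfolding A2_def using grid_finite_card(1) by (intro sets.finite_UN) auto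
  have cardb: "real (card (grid k)) * (C1 * (\<rho> ^ k) ^ p / d) \<le> C1 * 2 ^ CARD('d) * (\<beta> ^ k / d)" if "d > 0" for k d
  proof -
    have "real (card (grid k)) * (C1 * (\<rho> ^ k) ^ p / d) \<le> (2 ^ CARD('d) * (2 ^ CARD('d)) ^ k) * (C1 * (\<rho> ^ k) ^ p / d)"
      using C1 rho_bounds that by (intro mult_right_mono grid_finite_card) auto
    also have "\<dots> = C1 * 2 ^ CARD('d) * (((2 ^ CARD('d)) ^ k * (\<rho> ^ k) ^ p) / d)" by (simp add: mult_ac)
    also have "(2 ^ CARD('d)) ^ k * (\<rho> ^ k) ^ p = \<beta> ^ k"
      unfolding \<beta>_def by (simp add: power_mult_distrib power_mult[symmetric] mult.commute)
    finally show ?thesis .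
  qed
  have "prob A1 \<le> (\<Sum>i\<in>{..<K - m}. prob (\<Union>s\<in>grid (Suc (m + i)). B i s))"
    unfolding A1_def using grid_finite_card(1)
    by (intro finite_measure_subadditive_finite) (auto intro!: sets.finite_UN)
  also have "\<dots> \<le> (\<Sum>i\<in>{..<K - m}. C1 * 2 ^ CARD('d) * (\<beta> ^ Suc (m + i) / e i ^ (2 * p)))"
  proof (rule sum_mono)
    fix i assume i: "i \<in> {..<K - m}"
    have "prob (\<Union>s\<in>grid (Suc (m + i)). B i s) \<le> (\<Sum>s\<in>grid (Suc (m + i)). prob (B i s))"
      using grid_finite_card(1) by (intro finite_measure_subadditive_finite) auto
    also have "\<dots> \<le> (\<Sum>s\<in>grid (Suc (m + i)). C1 * (\<rho> ^ Suc (m + i)) ^ p / e i ^ (2 * p))"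
    proof (rule sum_mono)
      fix s
      have "prob (B i s) \<le> (\<integral>\<omega>. emp (\<lambda>x. lo (Suc (m + i)) s x - lo (m + i) s x) n \<omega> ^ (2 * p) \<partial>M) / e i ^ (2 * p)"
        unfolding B_def by (rule link_prob[OF link_lo e(1)])
      also have "\<dots> \<le> C1 * (\<rho> ^ Suc (m + i)) ^ p / e i ^ (2 * p)"
        using i e(1)[of i] by (intro divide_right_mono mom link_lo) auto
      finally show "prob (B i s) \<le> C1 * (\<rho> ^ Suc (m + i)) ^ p / e i ^ (2 * p)" .
    qed
    also have "\<dots> = real (card (grid (Suc (m + i)))) * (C1 * (\<rho> ^ Suc (m + i)) ^ p / e i ^ (2 * p))"
      by (rule sum_constant)
    also have "\<dots> \<le> C1 * 2 ^ CARD('d) * (\<beta> ^ Suc (m + i) / e i ^ (2 * p))"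
      using e(1)[of i] by (intro cardb) auto
    finally show "prob (\<Union>s\<in>grid (Suc (m + i)). B i s) \<le> C1 * 2 ^ CARD('d) * (\<beta> ^ Suc (m + i) / e i ^ (2 * p))" .
  qed
  finally have p1: "prob A1 \<le> C1 * 2 ^ CARD('d) * (\<Sum>i<K - m. \<beta> ^ Suc (m + i) / e i ^ (2 * p))"
    by (simp only: sum_distrib_left)
  have "prob A2 \<le> (\<Sum>s\<in>grid K. prob (E s))"
    unfolding A2_def using grid_finite_card(1) by (intro finite_measure_subadditive_finite) auto
  also have "\<dots> \<le> (\<Sum>s\<in>grid K. C1 * (\<rho> ^ K) ^ p / e0 ^ (2 * p))"
  proof (rule sum_mono)
    fix s
    have "prob (E s) \<le> (\<integral>\<omega>. emp (\<lambda>x. up K s x - lo K s x) n \<omega> ^ (2 * p) \<partial>M) / e0 ^ (2 * p)"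
      unfolding E_def by (rule link_prob[OF link_up e(2)])
    also have "\<dots> \<le> C1 * (\<rho> ^ K) ^ p / e0 ^ (2 * p)"
      using e(2) by (intro divide_right_mono mom link_up) auto
    finally show "prob (E s) \<le> C1 * (\<rho> ^ K) ^ p / e0 ^ (2 * p)" .
  qed
  also have "\<dots> = real (card (grid K)) * (C1 * (\<rho> ^ K) ^ p / e0 ^ (2 * p))" by (rule sum_constant)
  also have "\<dots> \<le> C1 * 2 ^ CARD('d) * (\<beta> ^ K / e0 ^ (2 * p))" using e(2) by (intro cardb) auto
  finally have p2: "prob A2 \<le> C1 * 2 ^ CARD('d) * (\<beta> ^ K / e0 ^ (2 * p))" .
  show ?thesis
  proof (intro bexI[of _ "A1 \<union> A2"] conjI ballI allI)
    have "prob (A1 \<union> A2) \<le> prob A1 + prob A2" using A1m A2m by (rule measure_Un_le)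
    then show "prob (A1 \<union> A2) \<le> C1 * 2 ^ CARD('d) * ((\<Sum>i<K - m. \<beta> ^ Suc (m + i) / e i ^ (2 * p)) + \<beta> ^ K / e0 ^ (2 * p))"
      unfolding distrib_left using p1 p2 by linarith
    show "A1 \<union> A2 \<in> sets M" using A1m A2m by (rule sets.Un)
    fix \<omega> t assume w: "\<omega> \<in> space M - (A1 \<union> A2)"
    have l: "\<bar>emp (\<lambda>x. lo (Suc (m + i)) t x - lo (m + i) t x) n \<omega>\<bar> \<le> e i" if "i < K - m" for i
    proof -
      have "\<omega> \<notin> B i (proj (Suc (m + i)) t)"
        using w that proj_in_grid[of "Suc (m + i)" t] unfolding A1_def by blast
      then have "\<not> \<bar>emp (\<lambda>x. lo (Suc (m + i)) t x - lo (m + i) t x) n \<omega>\<bar> > e i"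
        using w unfolding B_def lo_proj lo_proj_Suc by blast
      then show ?thesis by simp
    qed
    have u: "\<bar>emp (\<lambda>x. up K t x - lo K t x) n \<omega>\<bar> \<le> e0"
    proof -
      have "\<omega> \<notin> E (proj K t)" using w proj_in_grid[of K t] unfolding A2_def by blast
      then have "\<not> \<bar>emp (\<lambda>x. up K t x - lo K t x) n \<omega>\<bar> > e0"
        using w unfolding E_def lo_proj up_proj by blast
      then show ?thesis by simp
    qed
    have "\<bar>emp (lo K t) n \<omega> - emp (lo m t) n \<omega>\<bar> \<le> (\<Sum>i<K - m. e i)"
    proof -
      have "\<bar>emp (lo (m + (K - m)) t) n \<omega> - emp (lo m t) n \<omega>\<bar> \<le> (\<Sum>i<K - m. \<bar>emp (\<lambda>x. lo (Suc (m + i)) t x - lo (m + i) t x) n \<omega>\<bar>)"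
        unfolding emp_chain_telescope by (rule sum_abs)
      also have "\<dots> \<le> (\<Sum>i<K - m. e i)" by (intro sum_mono l) auto
      finally show ?thesis using K by simp
    qed
    then show "\<bar>emp (orthant_ind t) n \<omega> - emp (lo m t) n \<omega>\<bar> \<le> (\<Sum>i<K - m. e i) + e0 + 8 * real CARD('d) / 2 ^ K * sqrt (real n)"
      using emp_chain_end[OF n, of t \<omega> K] u by linarith
  qed
qed

text \<open>The three parts \<open>\<eta>\<close> are the thresholds of the links, the closing
  bracket and its bias. \<open>2 ^ K\<close> is kept between \<open>b * sqrt n\<close> and
  \<open>c * sqrt n\<close>: the lower bound controls the bias, the upper one the linear term of the
  moment bound. \<open>C\<close> precedes \<open>m\<close> because \<open>m\<close> is later chosen
  to make \<open>C * \<beta> ^ m\<close> small.\<close>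

theorem chaining:
  assumes \<eta>: "\<eta> > 0"
  shows "\<exists>C. \<forall>m. \<exists>N. \<forall>n\<ge>N. \<exists>A\<in>sets M. prob A \<le> C * \<beta> ^ m \<and>
     (\<forall>\<omega>\<in>space M - A. \<forall>t. \<bar>emp (orthant_ind t) n \<omega> - emp (lo m t) n \<omega>\<bar> \<le> 3 * \<eta>)"
proof -
  obtain C0 where C0: "C0 > 0" and mom: "\<And>k f n. link k f \<Longrightarrow> 1 \<le> n \<Longrightarrow>
     (\<integral>\<omega>. emp f n \<omega> ^ (2 * p) \<partial>M) \<le> C0 * (\<rho> ^ k / real n ^ (p - 1) + (\<rho> ^ k) ^ p)"
    using link_moment[of p] p_pos by blast
  \<comment> \<open>\<open>2 ^ K \<ge> b * sqrt n\<close> says that the bias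
    \<open>8 * real CARD('d) / 2 ^ K * sqrt n\<close> is at most \<open>\<eta>\<close>.\<close>
  define b where "b = 8 * real CARD('d) / \<eta>"
  define c where "c = 2 + 2 * b"
  define C1 where "C1 = C0 * (c ^ (p - 1) + 1)"
  define s where "s = sqrt \<beta>"
  \<comment> \<open>As \<open>\<theta> ^ (2 * p) = sqrt \<beta>\<close>, the thresholds are summable
    while the ratio of \<open>\<beta> ^ i\<close> to their power \<open>2 * p\<close> still decays
    like \<open>s ^ i\<close>. The factor \<open>1 - \<theta>\<close> in \<open>e\<close> keeps
    their sum below \<open>\<eta>\<close>.\<close>
  define \<theta> where "\<theta> = s powr (1 / (2 * real p))"
  define e where "e i = \<eta> * (1 - \<theta>) * \<theta> ^ i" for i :: nat
  have b: "b > 0" unfolding b_def using \<eta> card_ge_1 by simp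
  have c: "c > 0" unfolding c_def using b by simp
  have C1: "C1 \<ge> 0" unfolding C1_def using C0 c by simp
  have s: "0 < s" "s < 1" "s * s = \<beta>" unfolding s_def using beta_bounds by auto
  have p0: "real p > 0" using p_pos by simp
  have th0: "0 < \<theta>" unfolding \<theta>_def using s by simp
  have "\<theta> < 1 powr (1 / (2 * real p))" unfolding \<theta>_def using s p0 by (intro powr_less_mono2) auto
  then have th: "0 < \<theta>" "\<theta> < 1" using th0 by simp_all
  have thp: "\<theta> ^ (2 * p) = s"
    unfolding \<theta>_def using s p0 by (simp add: powr_powr powr_realpow[symmetric])
  have e: "e i > 0" for i unfolding e_def using \<eta> th by simp
  have sume: "(\<Sum>i<j. e i) \<le> \<eta>" for j
  proof -
    have "(\<Sum>i<j. e i) = \<eta> * ((1 - \<theta>) * (\<Sum>i<j. \<theta> ^ i))" unfolding e_def by (simp add: sum_distrib_left mult.assoc)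
    also have "(1 - \<theta>) * (\<Sum>i<j. \<theta> ^ i) = 1 - \<theta> ^ j" by (simp only: one_diff_power_eq)
    also have "\<eta> * (1 - \<theta> ^ j) \<le> \<eta> * 1" using \<eta> th by (intro mult_left_mono) auto
    finally show ?thesis by simp
  qed
  define C where "C = C1 * 2 ^ CARD('d) * (1 / (\<eta> * (1 - \<theta>)) ^ (2 * p) * (1 / (1 - s)) + 1 / \<eta> ^ (2 * p))"
  have sums: "(\<Sum>i<j. \<beta> ^ Suc (m + i) / e i ^ (2 * p)) \<le> (1 / (\<eta> * (1 - \<theta>)) ^ (2 * p) * (1 / (1 - s))) * \<beta> ^ m" for j m
  proof -
    let ?d = "(\<eta> * (1 - \<theta>)) ^ (2 * p)"
    have d: "?d > 0" using \<eta> th by simp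
    have "\<beta> ^ Suc (m + i) / e i ^ (2 * p) \<le> 1 / ?d * \<beta> ^ m * s ^ i" for i
    proof -
      have "e i ^ (2 * p) = ?d * s ^ i"
        unfolding e_def power_mult_distrib thp[symmetric] by (simp add: power_mult[symmetric] mult.commute)
      moreover have "\<beta> ^ Suc (m + i) = \<beta> ^ m * (s ^ i * s ^ i * \<beta>)"
        unfolding s(3)[symmetric] by (simp add: power_add power_mult_distrib mult_ac)
      ultimately have "\<beta> ^ Suc (m + i) / e i ^ (2 * p) = \<beta> ^ m * (s ^ i * s ^ i * \<beta>) / (?d * s ^ i)"
        by (simp only:)
      also have "\<dots> = 1 / ?d * \<beta> ^ m * s ^ i * \<beta>" using s(1) by simp
      also have "\<dots> \<le> 1 / ?d * \<beta> ^ m * s ^ i * 1"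
        using beta_bounds d s by (intro mult_left_mono) auto
      finally show ?thesis by simp
    qed
    then have "(\<Sum>i<j. \<beta> ^ Suc (m + i) / e i ^ (2 * p)) \<le> (\<Sum>i<j. 1 / ?d * \<beta> ^ m * s ^ i)" by (intro sum_mono)
    also have "\<dots> = 1 / ?d * \<beta> ^ m * (\<Sum>i<j. s ^ i)" by (simp only: sum_distrib_left)
    also have "(\<Sum>i<j. s ^ i) \<le> 1 / (1 - s)"
    proof -
      have "(1 - s) * (\<Sum>i<j. s ^ i) = 1 - s ^ j" by (simp only: one_diff_power_eq)
      also have "\<dots> \<le> 1" using s by simp
      finally show ?thesis using s by (simp add: pos_le_divide_eq mult.commute)
    qed
    then have "1 / ?d * \<beta> ^ m * (\<Sum>i<j. s ^ i) \<le> 1 / ?d * \<beta> ^ m * (1 / (1 - s))"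
      using d beta_bounds by (intro mult_left_mono) auto
    also have "\<dots> = (1 / ?d * (1 / (1 - s))) * \<beta> ^ m" by simp
    finally show ?thesis .
  qed
  show ?thesis
  proof (intro exI[of _ C] allI)
    fix m :: nat
    \<comment> \<open>From here on \<open>2 ^ m \<le> b * sqrt n\<close>, which ensures
      \<open>m \<le> K\<close>.\<close>
    define N where "N = nat \<lceil>(2 ^ m / b)\<^sup>2\<rceil> + 1"
    show "\<exists>N. \<forall>n\<ge>N. \<exists>A\<in>sets M. prob A \<le> C * \<beta> ^ m \<and>
     (\<forall>\<omega>\<in>space M - A. \<forall>t. \<bar>emp (orthant_ind t) n \<omega> - emp (lo m t) n \<omega>\<bar> \<le> 3 * \<eta>)"
    proof (intro exI[of _ N] allI impI)
      fix n :: nat assume nN: "N \<le> n"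
      then have n: "n \<ge> 1" by (simp add: N_def)
      have "(2 ^ m / b)\<^sup>2 \<le> real (nat \<lceil>(2 ^ m / b)\<^sup>2\<rceil>)" by (rule real_nat_ceiling_ge)
      also have "\<dots> \<le> real N" unfolding N_def by (simp only: of_nat_le_iff le_add1)
      finally have "(2 ^ m / b)\<^sup>2 \<le> real n" using nN by (meson of_nat_mono order_trans)
      then have "2 ^ m / b \<le> sqrt (real n)" by (rule real_le_rsqrt)
      then have mK: "2 ^ m \<le> b * sqrt (real n)" using b by (simp add: pos_divide_le_eq mult.commute)
      have sn: "1 \<le> sqrt (real n)" "sqrt (real n) \<le> real n"
        using n by (auto intro!: real_le_lsqrt simp: power2_eq_square)
      have "0 \<le> b * sqrt (real n)" using b by simp
      then obtain K where K: "b * sqrt (real n) \<le> 2 ^ K" "2 ^ K \<le> 2 + 2 * (b * sqrt (real n))"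
        using chain_depth_ex by blast
      have "(2::real) ^ m \<le> 2 ^ K" using mK K(1) by linarith
      then have "m \<le> K" by (rule power_le_imp_le_exp[rotated]) simp
      have "c * sqrt (real n) = 2 * sqrt (real n) + 2 * (b * sqrt (real n))" unfolding c_def by (simp add: distrib_right)
      then have "2 ^ K \<le> c * sqrt (real n)" using K(2) sn(1) by linarith
      also have "\<dots> \<le> c * real n" using c sn by (intro mult_left_mono) auto
      finally have cn: "2 ^ K \<le> c * real n" .
      have bias: "8 * real CARD('d) / 2 ^ K * sqrt (real n) \<le> \<eta>"
      proof -
        have "8 * real CARD('d) * sqrt (real n) \<le> \<eta> * 2 ^ K"
          using K(1) \<eta> unfolding b_def by (simp add: pos_divide_le_eq mult.commute)
        then show ?thesis by (simp add: pos_divide_le_eq mult.commute)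
      qed
      have mom1: "(\<integral>\<omega>. emp f n \<omega> ^ (2 * p) \<partial>M) \<le> C1 * (\<rho> ^ k) ^ p" if k: "k \<le> K" and f: "link k f" for k f
      proof -
        have rk: "0 < \<rho> ^ k" using rho_bounds by simp
        \<comment> \<open>Uses \<open>2 ^ k \<le> c * n\<close> and
          \<open>1 / 2 \<le> \<rho>\<close>. Raised to the power \<open>p - 1\<close>, it lets
          \<open>(\<rho> ^ k) ^ p\<close> absorb \<open>\<rho> ^ k / n ^ (p - 1)\<close>.\<close>
        have "1 / real n \<le> c * \<rho> ^ k"
        proof -
          have "(2::real) ^ k \<le> 2 ^ K" using k by (intro power_increasing) auto
          then have "2 ^ k \<le> c * real n" using cn by linarith
          moreover have "0 < c * real n" using c n by simp
          ultimately have "1 / (c * real n) \<le> 1 / 2 ^ k" by (intro divide_left_mono) (use c n in auto)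
          also have "\<dots> = (1 / 2) ^ k" by (simp add: power_one_over)
          also have "\<dots> \<le> \<rho> ^ k" using rho_bounds by (intro power_mono) auto
          finally have "c * (1 / (c * real n)) \<le> c * \<rho> ^ k" using c by (intro mult_left_mono) auto
          then show ?thesis using c by simp
        qed
        then have "(1 / real n) ^ (p - 1) \<le> (c * \<rho> ^ k) ^ (p - 1)" by (intro power_mono) auto
        then have "\<rho> ^ k * (1 / real n) ^ (p - 1) \<le> \<rho> ^ k * (c * \<rho> ^ k) ^ (p - 1)" using rk by (intro mult_left_mono) auto
        also have "\<dots> = c ^ (p - 1) * (\<rho> ^ k * (\<rho> ^ k) ^ (p - 1))" by (simp add: power_mult_distrib mult_ac)
        also have "\<rho> ^ k * (\<rho> ^ k) ^ (p - 1) = (\<rho> ^ k) ^ p" using p_pos by (simp add: power_eq_if)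
        finally have le: "\<rho> ^ k / real n ^ (p - 1) \<le> c ^ (p - 1) * (\<rho> ^ k) ^ p" by (simp only: power_one_over times_divide_eq_right mult_1_right)
        have "(\<integral>\<omega>. emp f n \<omega> ^ (2 * p) \<partial>M) \<le> C0 * (\<rho> ^ k / real n ^ (p - 1) + (\<rho> ^ k) ^ p)" by (rule mom[OF f n])
        also have "\<dots> \<le> C0 * (c ^ (p - 1) * (\<rho> ^ k) ^ p + (\<rho> ^ k) ^ p)" by (rule mult_left_mono[OF add_right_mono[OF le]]) (use C0 in simp)
        also have "\<dots> = C1 * (\<rho> ^ k) ^ p" unfolding C1_def by (simp only: distrib_left distrib_right mult.assoc mult_1_left)
        finally show ?thesis .
      qed
      have e_all: "\<And>i. e i > 0" by (rule e)
      from chain_event[where e=e and m=m and K=K and n=n, OF n \<open>m \<le> K\<close> e_all \<eta> C1]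
      have "\<exists>A\<in>sets M. prob A \<le> C1 * 2 ^ CARD('d) * ((\<Sum>i<K - m. \<beta> ^ Suc (m + i) / e i ^ (2 * p)) + \<beta> ^ K / \<eta> ^ (2 * p)) \<and>
        (\<forall>\<omega>\<in>space M - A. \<forall>t. \<bar>emp (orthant_ind t) n \<omega> - emp (lo m t) n \<omega>\<bar> \<le>
          (\<Sum>i<K - m. e i) + \<eta> + 8 * real CARD('d) / 2 ^ K * sqrt (real n))" using mom1 by blast
      then obtain A where A1: "A \<in> sets M" and A2: "prob A \<le> C1 * 2 ^ CARD('d) * ((\<Sum>i<K - m. \<beta> ^ Suc (m + i) / e i ^ (2 * p)) + \<beta> ^ K / \<eta> ^ (2 * p))"
        and off: "\<forall>\<omega>\<in>space M - A. \<forall>t. \<bar>emp (orthant_ind t) n \<omega> - emp (lo m t) n \<omega>\<bar> \<le>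
          (\<Sum>i<K - m. e i) + \<eta> + 8 * real CARD('d) / 2 ^ K * sqrt (real n)"
        by (elim bexE conjE) (rule that)
      have "\<beta> ^ K \<le> \<beta> ^ m" using \<open>m \<le> K\<close> beta_bounds by (intro power_decreasing) auto
      then have "\<beta> ^ K / \<eta> ^ (2 * p) \<le> \<beta> ^ m / \<eta> ^ (2 * p)"
        by (rule divide_right_mono) (use \<eta> in simp)
      also have "\<dots> = 1 / \<eta> ^ (2 * p) * \<beta> ^ m" by simp
      finally have last: "\<beta> ^ K / \<eta> ^ (2 * p) \<le> 1 / \<eta> ^ (2 * p) * \<beta> ^ m" .
      have "(\<Sum>i<K - m. \<beta> ^ Suc (m + i) / e i ^ (2 * p)) + \<beta> ^ K / \<eta> ^ (2 * p) \<le>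
        (1 / (\<eta> * (1 - \<theta>)) ^ (2 * p) * (1 / (1 - s)) + 1 / \<eta> ^ (2 * p)) * \<beta> ^ m"
        unfolding distrib_right by (rule add_mono[OF sums last])
      then have "C1 * 2 ^ CARD('d) * ((\<Sum>i<K - m. \<beta> ^ Suc (m + i) / e i ^ (2 * p)) + \<beta> ^ K / \<eta> ^ (2 * p)) \<le>
        C1 * 2 ^ CARD('d) * ((1 / (\<eta> * (1 - \<theta>)) ^ (2 * p) * (1 / (1 - s)) + 1 / \<eta> ^ (2 * p)) * \<beta> ^ m)"
        by (rule mult_left_mono) (use C1 in simp)
      then have "prob A \<le> C * \<beta> ^ m" using A2 unfolding C_def mult.assoc by linarith
      moreover have "\<bar>emp (orthant_ind t) n \<omega> - emp (lo m t) n \<omega>\<bar> \<le> 3 * \<eta>" if "\<omega> \<in> space M - A" for \<omega> t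
        using off[rule_format, OF that, of t] sume[of "K - m"] bias by linarith
      ultimately show "\<exists>A\<in>sets M. prob A \<le> C * \<beta> ^ m \<and>
         (\<forall>\<omega>\<in>space M - A. \<forall>t. \<bar>emp (orthant_ind t) n \<omega> - emp (lo m t) n \<omega>\<bar> \<le> 3 * \<eta>)"
        by (intro bexI[OF _ A1] conjI ballI allI)
    qed
  qed
qed

text \<open>For moments of order 2 the linear and the leading term are both
  \<open>\<rho> ^ k\<close>, uniformly in \<open>n\<close>. The chain may therefore run to any
  depth, and the norms of its links form a geometric series with ratio
  \<open>sqrt \<rho>\<close>.\<close>

lemma square_chain:
  "\<exists>C>0. \<forall>m t n. 1 \<le> n \<longrightarrow> (\<integral>\<omega>. (emp (orthant_ind t) n \<omega> - emp (lo m t) n \<omega>)\<^sup>2 \<partial>M) \<le> C * \<rho> ^ m"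
proof -
  obtain C where C: "C > 0" and mom: "\<And>k f n. link k f \<Longrightarrow> 1 \<le> n \<Longrightarrow>
     (\<integral>\<omega>. emp f n \<omega> ^ (2 * 1) \<partial>M) \<le> C * (\<rho> ^ k / real n ^ (1 - 1) + (\<rho> ^ k) ^ 1)"
    using link_moment[of 1] p_pos by blast
  define \<tau> where "\<tau> = sqrt \<rho>"
  define c where "c = sqrt (2 * C)"
  have t: "0 < \<tau>" "\<tau> < 1" "\<tau>\<^sup>2 = \<rho>" unfolding \<tau>_def using rho_bounds by auto
  have c: "c > 0" "c\<^sup>2 = 2 * C" unfolding c_def using C by auto
  have lk: "(\<integral>\<omega>. (emp f n \<omega>)\<^sup>2 \<partial>M) \<le> (c * \<tau> ^ k)\<^sup>2" if "link k f" "1 \<le> n" for k f n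
  proof -
    have "(c * \<tau> ^ k)\<^sup>2 = c\<^sup>2 * (\<tau>\<^sup>2) ^ k" by (simp add: power_mult_distrib power_mult[symmetric] mult.commute)
    also have "\<dots> = C * (\<rho> ^ k + \<rho> ^ k)" unfolding t(3) c(2) by simp
    finally show ?thesis using mom[OF that] by simp
  qed
  define B where "B m = c * \<tau> ^ m * (1 / (1 - \<tau>))" for m
  have B: "B m > 0" for m unfolding B_def using c t by simp
  note intsq = integrable_emp_pow[where q=2]
  have steps: "(\<integral>\<omega>. (emp (lo (m + j) t) n \<omega> - emp (lo m t) n \<omega>)\<^sup>2 \<partial>M) \<le> (c * \<tau> ^ m * (\<Sum>i<Suc j. \<tau> ^ i))\<^sup>2"
    if n: "1 \<le> n" for m j t n
  proof (induction j)
    case 0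
    then show ?case by simp
  next
    case (Suc j)
    let ?f = "\<lambda>x. lo (Suc (m + j)) t x - lo (m + j) t x"
    have lf: "link (Suc (m + j)) ?f" by (rule link_lo)
    have eq: "emp (lo (m + Suc j) t) n \<omega> - emp (lo m t) n \<omega> = (emp (lo (m + j) t) n \<omega> - emp (lo m t) n \<omega>) + emp ?f n \<omega>" for \<omega>
      by (simp add: emp_diff)
    have eq2: "emp (lo (m + j) t) n \<omega> - emp (lo m t) n \<omega> = emp (\<lambda>x. lo (m + j) t x - lo m t x) n \<omega>" for \<omega>
      by (simp add: emp_diff)
    have pos: "0 < (\<Sum>i<Suc j. \<tau> ^ i)" using t by (intro sum_pos) auto
    have "(\<integral>\<omega>. ((emp (lo (m + j) t) n \<omega> - emp (lo m t) n \<omega>) + emp ?f n \<omega>)\<^sup>2 \<partial>M) \<le>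
      (c * \<tau> ^ m * (\<Sum>i<Suc j. \<tau> ^ i) + c * \<tau> ^ Suc (m + j))\<^sup>2"
    proof (rule expectation_square_add)
      show "integrable M (\<lambda>\<omega>. (emp (lo (m + j) t) n \<omega> - emp (lo m t) n \<omega>)\<^sup>2)"
        unfolding eq2
      proof (rule intsq[of _ 1])
        fix x show "\<bar>lo (m + j) t x - lo m t x\<bar> \<le> 1"
          using lo_nonneg[of "m + j" t x] lo_nonneg[of m t x] lo_le_1[of "m + j" t x] lo_le_1[of m t x] by linarith
      qed measurable
      show "integrable M (\<lambda>\<omega>. (emp ?f n \<omega>)\<^sup>2)"
        by (rule intsq[OF link_meas[OF lf], of 2]) (use lf in \<open>auto simp: link_def\<close>)
      show "(\<integral>\<omega>. (emp ?f n \<omega>)\<^sup>2 \<partial>M) \<le> (c * \<tau> ^ Suc (m + j))\<^sup>2" by (rule lk[OF lf n])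
      show "0 < c * \<tau> ^ m * (\<Sum>i<Suc j. \<tau> ^ i)" by (intro mult_pos_pos pos c zero_less_power t)
      show "0 < c * \<tau> ^ Suc (m + j)" by (intro mult_pos_pos c zero_less_power t)
    qed (rule Suc)
    also have "c * \<tau> ^ m * (\<Sum>i<Suc j. \<tau> ^ i) + c * \<tau> ^ Suc (m + j) = c * \<tau> ^ m * (\<Sum>i<Suc (Suc j). \<tau> ^ i)"
      by (simp add: algebra_simps power_add)
    finally show ?case unfolding eq .
  qed
  have le: "(\<integral>\<omega>. (emp (orthant_ind t) n \<omega> - emp (lo m t) n \<omega>)\<^sup>2 \<partial>M) \<le> (B m + e)\<^sup>2"
    if n: "1 \<le> n" and e: "e > 0" for m t n e
  proof -
    \<comment> \<open>The remainder contains the indicator, so it gets the bound that grows with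
      \<open>n\<close>; the depth \<open>j\<close> may depend on \<open>n\<close> and
      \<open>e\<close> and brings it down to the square of \<open>e\<close>.\<close>
    have "\<exists>j::nat. 8 * real n * real CARD('d) / e\<^sup>2 < 2 ^ j" by (rule real_arch_pow) simp
    then obtain j :: nat where j: "8 * real n * real CARD('d) / e\<^sup>2 < 2 ^ j" by blast
    let ?g = "\<lambda>x. orthant_ind t x - lo (m + j) t x" and ?h = "\<lambda>x. lo (m + j) t x - lo m t x"
    have eqg: "emp (orthant_ind t) n \<omega> - emp (lo (m + j) t) n \<omega> = emp ?g n \<omega>" for \<omega> by (simp add: emp_diff)
    have eqh: "emp (lo (m + j) t) n \<omega> - emp (lo m t) n \<omega> = emp ?h n \<omega>" for \<omega> by (simp add: emp_diff)
    have eq: "emp (orthant_ind t) n \<omega> - emp (lo m t) n \<omega> = emp ?h n \<omega> + emp ?g n \<omega>" for \<omega>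
      by (simp add: eqg[symmetric] eqh[symmetric])
    have g1: "\<bar>?g x\<bar> \<le> 1" for x using lo_nonneg[of "m + j" t x] lo_le[of "m + j" t x] orthant_ind_le_1[of t x] by linarith
    have h1: "\<bar>?h x\<bar> \<le> 1" for x
      using lo_nonneg[of "m + j" t x] lo_nonneg[of m t x] lo_le_1[of "m + j" t x] lo_le_1[of m t x] by linarith
    show ?thesis unfolding eq
    proof (rule expectation_square_add)
      show "integrable M (\<lambda>\<omega>. (emp ?h n \<omega>)\<^sup>2)" by (rule intsq[OF _ h1]) measurable
      show "integrable M (\<lambda>\<omega>. (emp ?g n \<omega>)\<^sup>2)" by (rule intsq[OF _ g1]) measurable
      have "(1 - \<tau>) * (\<Sum>i<Suc j. \<tau> ^ i) = 1 - \<tau> ^ Suc j" by (simp only: one_diff_power_eq)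
      also have "\<dots> \<le> 1" using t by simp
      finally have "(\<Sum>i<Suc j. \<tau> ^ i) \<le> 1 / (1 - \<tau>)" using t by (simp only: pos_le_divide_eq mult.commute diff_gt_0_iff_gt)
      then have "c * \<tau> ^ m * (\<Sum>i<Suc j. \<tau> ^ i) \<le> B m" unfolding B_def using c t by (intro mult_left_mono) auto
      moreover have "0 \<le> c * \<tau> ^ m * (\<Sum>i<Suc j. \<tau> ^ i)" using c t by (intro mult_nonneg_nonneg sum_nonneg) auto
      ultimately have "(c * \<tau> ^ m * (\<Sum>i<Suc j. \<tau> ^ i))\<^sup>2 \<le> (B m)\<^sup>2" by (rule power_mono)
      with steps[OF n, of m j t] show "(\<integral>\<omega>. (emp ?h n \<omega>)\<^sup>2 \<partial>M) \<le> (B m)\<^sup>2"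
        unfolding eqh by linarith
      have "(\<integral>\<omega>. (emp ?g n \<omega>)\<^sup>2 \<partial>M) \<le> 4 * real n * mass ?g"
        by (rule expectation_emp_square_le[OF _ g1]) measurable
      also have "\<dots> \<le> 4 * real n * (2 * real CARD('d) / 2 ^ (m + j))" by (intro mult_left_mono mass_lo) auto
      also have "\<dots> \<le> 4 * real n * (2 * real CARD('d) / 2 ^ j)"
        by (intro mult_left_mono divide_left_mono power_increasing) auto
      also have "\<dots> \<le> e\<^sup>2"
      proof -
        have "8 * real n * real CARD('d) \<le> e\<^sup>2 * 2 ^ j" using j e by (simp add: pos_divide_less_eq mult.commute less_imp_le)
        then show ?thesis by (simp add: pos_divide_le_eq)
      qed
      finally show "(\<integral>\<omega>. (emp ?g n \<omega>)\<^sup>2 \<partial>M) \<le> e\<^sup>2" .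
    qed (use B e in auto)
  qed
  show ?thesis
  proof (intro exI[of _ "(c / (1 - \<tau>))\<^sup>2"] conjI allI impI)
    show "0 < (c / (1 - \<tau>))\<^sup>2" using c t by simp
    fix m t and n :: nat assume n: "1 \<le> n"
    have "((\<lambda>e. (B m + e)\<^sup>2) \<longlongrightarrow> (B m + 0)\<^sup>2) (at_right 0)" by (intro tendsto_intros)
    then have "(\<integral>\<omega>. (emp (orthant_ind t) n \<omega> - emp (lo m t) n \<omega>)\<^sup>2 \<partial>M) \<le> (B m + 0)\<^sup>2"
    proof (rule tendsto_lowerbound)
      show "\<forall>\<^sub>F e in at_right 0. (\<integral>\<omega>. (emp (orthant_ind t) n \<omega> - emp (lo m t) n \<omega>)\<^sup>2 \<partial>M) \<le> (B m + e)\<^sup>2"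
        using eventually_at_right_less[of 0] by eventually_elim (rule le[OF n])
    qed simp
    also have "(B m + 0)\<^sup>2 = (c / (1 - \<tau>))\<^sup>2 * \<rho> ^ m"
      unfolding B_def t(3)[symmetric] by (simp add: power_mult_distrib power_divide power_mult[symmetric] mult.commute)
    finally show "(\<integral>\<omega>. (emp (orthant_ind t) n \<omega> - emp (lo m t) n \<omega>)\<^sup>2 \<partial>M) \<le> (c / (1 - \<tau>))\<^sup>2 * \<rho> ^ m" .
  qed
qed

text \<open>The difference of the two lower brackets is again a link, since the orthants of close
  points differ by \<open>mass\<close> at most \<open>real CARD('d) / 2 ^ k\<close>. The errors of
  the two brackets come from \<open>square_chain\<close>.\<close>

lemma square_modulus:
  "\<exists>C>0. \<forall>k s t n. 1 \<le> n \<longrightarrow> (\<forall>i. \<bar>marg i (s $ i) - marg i (t $ i)\<bar> \<le> 1 / 2 ^ k) \<longrightarrow>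
     (\<integral>\<omega>. (emp (orthant_ind s) n \<omega> - emp (orthant_ind t) n \<omega>)\<^sup>2 \<partial>M) \<le> C * \<rho> ^ k"
proof -
  obtain C1 where C1: "C1 > 0" and sq: "\<And>m t n. 1 \<le> n \<Longrightarrow>
     (\<integral>\<omega>. (emp (orthant_ind t) n \<omega> - emp (lo m t) n \<omega>)\<^sup>2 \<partial>M) \<le> C1 * \<rho> ^ m"
    using square_chain by blast
  obtain C where C: "C > 0" and mom: "\<And>k f n. link k f \<Longrightarrow> 1 \<le> n \<Longrightarrow>
     (\<integral>\<omega>. emp f n \<omega> ^ (2 * 1) \<partial>M) \<le> C * (\<rho> ^ k / real n ^ (1 - 1) + (\<rho> ^ k) ^ 1)"
    using link_moment[of 1] p_pos by blast
  show ?thesis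
  proof (intro exI[of _ "6 * C1 + 6 * C"] conjI allI impI)
    show "0 < 6 * C1 + 6 * C" using C C1 by simp
    fix k s t and n :: nat
    assume n: "1 \<le> n" and st: "\<forall>i. \<bar>marg i (s $ i) - marg i (t $ i)\<bar> \<le> 1 / 2 ^ k"
    let ?f = "\<lambda>x. lo k s x - lo k t x"
    have l: "link k ?f"
      unfolding link_def
    proof (intro conjI allI)
      show "?f \<in> G" by (intro G_diff lo_G)
      show "\<bar>?f x\<bar> \<le> 2" for x
        using lo_nonneg[of k s x] lo_nonneg[of k t x] lo_le_1[of k s x] lo_le_1[of k t x] by linarith
      let ?A = "\<lambda>x. lo k s x - orthant_ind s x" and ?B = "\<lambda>x. orthant_ind s x - orthant_ind t x"
        and ?E = "\<lambda>x. orthant_ind t x - lo k t x"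
      have "mass ?f = mass (\<lambda>x. ?A x + (?B x + ?E x))" by simp
      also have "\<dots> \<le> mass ?A + mass (\<lambda>x. ?B x + ?E x)" by (rule mass_add) auto
      also have "mass (\<lambda>x. ?B x + ?E x) \<le> mass ?B + mass ?E" by (rule mass_add) auto
      also have "mass ?A \<le> 2 * real CARD('d) / 2 ^ k" using mass_lo[of s k] by (subst abs_minus_commute)
      also have "mass ?E \<le> 2 * real CARD('d) / 2 ^ k" by (rule mass_lo)
      also have "mass ?B \<le> real CARD('d) / 2 ^ k"
      proof -
        have "mass ?B \<le> (\<Sum>i\<in>UNIV. \<bar>marg i (s $ i) - marg i (t $ i)\<bar>)" by (rule mass_orthant_diff)
        also have "\<dots> \<le> (\<Sum>i\<in>(UNIV::'d set). 1 / 2 ^ k)" using st by (intro sum_mono) auto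
        also have "\<dots> = real CARD('d) / 2 ^ k" by simp
        finally show ?thesis .
      qed
      finally have "mass ?f \<le> 5 * real CARD('d) / 2 ^ k" by (simp add: add_divide_distrib[symmetric])
      also have "\<dots> \<le> 10 * real CARD('d) / 2 ^ k" by (intro divide_right_mono mult_right_mono) auto
      finally show "mass ?f \<le> 10 * real CARD('d) / 2 ^ k" .
      have "nG ?f \<le> nG (lo k s) + nG (lo k t)" by (intro nG_diff lo_G)
      moreover have "0 \<le> \<Psi> (2 ^ k)" by (rule psi_nonneg) simp
      ultimately show "nG ?f \<le> 3 * \<Psi> (2 ^ k) + nG (\<lambda>_. 1)"
        using lo_nG[of k s] lo_nG[of k t] nG_nonneg[OF G_const[of 1]] by linarith
    qed
    let ?Y = "\<lambda>\<omega>. emp (orthant_ind s) n \<omega> - emp (lo k s) n \<omega>" and ?Z = "\<lambda>\<omega>. emp (orthant_ind t) n \<omega> - emp (lo k t) n \<omega>"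
    have i1: "integrable M (\<lambda>\<omega>. (emp (orthant_ind u) n \<omega> - emp (lo k u) n \<omega>)\<^sup>2)" for u
    proof -
      have "integrable M (\<lambda>\<omega>. (emp (\<lambda>x. orthant_ind u x - lo k u x) n \<omega>)\<^sup>2)"
      proof (rule integrable_emp_pow[of _ 1])
        fix x show "\<bar>orthant_ind u x - lo k u x\<bar> \<le> 1"
          using lo_nonneg[of k u x] lo_le[of k u x] orthant_ind_le_1[of u x] by linarith
      qed measurable
      then show ?thesis by (simp add: emp_diff)
    qed
    have i2: "integrable M (\<lambda>\<omega>. (emp ?f n \<omega>)\<^sup>2)"
      by (rule integrable_emp_pow[OF link_meas[OF l], of 2]) (use l in \<open>auto simp: link_def\<close>)
    have "(\<integral>\<omega>. (emp (orthant_ind s) n \<omega> - emp (orthant_ind t) n \<omega>)\<^sup>2 \<partial>M) \<le>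
      (\<integral>\<omega>. 3 * (?Y \<omega>)\<^sup>2 + 3 * (emp ?f n \<omega>)\<^sup>2 + 3 * (?Z \<omega>)\<^sup>2 \<partial>M)"
    proof (rule integral_mono')
      show "integrable M (\<lambda>\<omega>. 3 * (?Y \<omega>)\<^sup>2 + 3 * (emp ?f n \<omega>)\<^sup>2 + 3 * (?Z \<omega>)\<^sup>2)" using i1 i2 by auto
      fix \<omega>
      have eq: "emp (orthant_ind s) n \<omega> - emp (orthant_ind t) n \<omega> = ?Y \<omega> + emp ?f n \<omega> - ?Z \<omega>" by (simp add: emp_diff)
      have 3: "(a + b - c)\<^sup>2 \<le> 3 * a\<^sup>2 + 3 * b\<^sup>2 + 3 * c\<^sup>2" for a b c :: real
      proof -
        have "0 \<le> (a - b)\<^sup>2 + (a + c)\<^sup>2 + (b + c)\<^sup>2" by simp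
        then show ?thesis by (simp add: power2_eq_square algebra_simps)
      qed
      show "(emp (orthant_ind s) n \<omega> - emp (orthant_ind t) n \<omega>)\<^sup>2 \<le> 3 * (?Y \<omega>)\<^sup>2 + 3 * (emp ?f n \<omega>)\<^sup>2 + 3 * (?Z \<omega>)\<^sup>2"
        unfolding eq by (rule 3)
      show "0 \<le> 3 * (?Y \<omega>)\<^sup>2 + 3 * (emp ?f n \<omega>)\<^sup>2 + 3 * (?Z \<omega>)\<^sup>2" by simp
    qed
    also have "\<dots> = 3 * (\<integral>\<omega>. (?Y \<omega>)\<^sup>2 \<partial>M) + 3 * (\<integral>\<omega>. (emp ?f n \<omega>)\<^sup>2 \<partial>M) + 3 * (\<integral>\<omega>. (?Z \<omega>)\<^sup>2 \<partial>M)"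
      using i1 i2 by simp
    also have "\<dots> \<le> (6 * C1 + 6 * C) * \<rho> ^ k"
    proof -
      have "(\<integral>\<omega>. (emp ?f n \<omega>)\<^sup>2 \<partial>M) \<le> 2 * (C * \<rho> ^ k)" using mom[OF l n] by simp
      moreover have "(6 * C1 + 6 * C) * \<rho> ^ k = 6 * (C1 * \<rho> ^ k) + 6 * (C * \<rho> ^ k)" by (simp add: algebra_simps)
      ultimately show ?thesis using sq[OF n, of s k] sq[OF n, of t k] by linarith
    qed
    finally show "(\<integral>\<omega>. (emp (orthant_ind s) n \<omega> - emp (orthant_ind t) n \<omega>)\<^sup>2 \<partial>M) \<le> (6 * C1 + 6 * C) * \<rho> ^ k" .
  qed
qed

end

section \<open>Finite-dimensional limits\<close>

text \<open>Writing the law as a scaled standard normal treats the point mass at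
  \<open>s2 = 0\<close> and the densities alike.\<close>

lemma gauss_law_eq_distr:
  assumes "s2 \<ge> 0"
  shows "gauss_law s2 = distr std_normal_distribution borel (\<lambda>x. sqrt s2 * x)"
proof -
  interpret N: prob_space std_normal_distribution by (rule prob_space_normal_density) simp
  show ?thesis
  proof (cases "s2 = 0")
    case True
    have "distr std_normal_distribution borel (\<lambda>x. 0::real) = return borel 0"
      by (rule N.distr_const) simp
    then show ?thesis using True by (simp add: gauss_law_def)
  next
    case False
    have "distributed std_normal_distribution lborel (\<lambda>x. x) (normal_density 0 1)"
      by (auto simp: distributed_def distr_id2 density_density_eq)
    from N.normal_density_affine[OF this, of "sqrt s2" 0] False assms
    have "distributed std_normal_distribution lborel (\<lambda>x. sqrt s2 * x) (normal_density 0 (sqrt s2))" by simp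
    then have "distr std_normal_distribution lborel (\<lambda>x. sqrt s2 * x) = density lborel (normal_density 0 (sqrt s2))"
      by (simp add: distributed_def)
    moreover have "distr std_normal_distribution lborel (\<lambda>x. sqrt s2 * x) = distr std_normal_distribution borel (\<lambda>x. sqrt s2 * x)"
      by (rule distr_cong) auto
    ultimately show ?thesis using False by (simp add: gauss_law_def)
  qed
qed

lemma real_distribution_gauss_law:
  assumes "s2 \<ge> 0"
  shows "real_distribution (gauss_law s2)"
proof -
  interpret N: prob_space std_normal_distribution by (rule prob_space_normal_density) simp
  show ?thesis unfolding gauss_law_eq_distr[OF assms] by (rule N.real_distribution_distr) simp
qed

lemma char_gauss_law:
  assumes "s2 \<ge> 0"
  shows "char (gauss_law s2) t = complex_of_real (exp (- (s2 * t\<^sup>2) / 2))"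
proof -
  have "char (gauss_law s2) t = char std_normal_distribution (sqrt s2 * t)"
    unfolding gauss_law_eq_distr[OF assms] char_def
    by (subst integral_distr) (auto simp: mult_ac)
  also have "\<dots> = complex_of_real (exp (- ((sqrt s2 * t)\<^sup>2) / 2))" by (simp add: char_std_normal_distribution)
  also have "(sqrt s2 * t)\<^sup>2 = s2 * t\<^sup>2" using assms by (simp add: power_mult_distrib)
  finally show ?thesis .
qed

lemma gauss_law_moment:
  assumes "s2 \<ge> 0"
  shows "integrable (gauss_law s2) (\<lambda>x. x ^ (2 * k))"
    and "(\<integral>x. x ^ (2 * k) \<partial>gauss_law s2) = s2 ^ k * (fact (2 * k) / (2 ^ k * fact k))"
proof -
  have eq: "(sqrt s2 * x) ^ (2 * k) = s2 ^ k * x ^ (2 * k)" for x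
    using assms by (simp add: power_mult_distrib power_mult)
  show "integrable (gauss_law s2) (\<lambda>x. x ^ (2 * k))"
    unfolding gauss_law_eq_distr[OF assms]
    by (subst integrable_distr_eq) (auto simp: eq std_normal_distribution_even_moments(2))
  show "(\<integral>x. x ^ (2 * k) \<partial>gauss_law s2) = s2 ^ k * (fact (2 * k) / (2 ^ k * fact k))"
    unfolding gauss_law_eq_distr[OF assms]
    by (subst integral_distr) (auto simp: eq std_normal_distribution_even_moments(1))
qed

lemma square_truncation:
  assumes "L > 0"
  shows "\<bar>y\<^sup>2 - min (y\<^sup>2) L\<bar> \<le> y ^ 4 / (L::real)"
proof (cases "y\<^sup>2 \<le> L")
  case False
  then have "L * y\<^sup>2 \<le> y\<^sup>2 * y\<^sup>2" by (intro mult_right_mono) auto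
  also have "y\<^sup>2 * y\<^sup>2 = y ^ 4" by (simp add: power_add[symmetric])
  finally have "y\<^sup>2 \<le> y ^ 4 / L" using assms by (simp add: pos_le_divide_eq mult.commute)
  then show ?thesis using False assms by (auto simp: min_def)
qed (use assms in auto)

text \<open>Bounded fourth moments make the squares uniformly integrable: truncating them at
  \<open>L\<close> costs at most \<open>C / L\<close>, and the truncated square is bounded and
  continuous.\<close>

lemma weak_conv_second_moment:
  fixes \<mu> :: "nat \<Rightarrow> real measure"
  assumes \<mu>: "\<And>n. real_distribution (\<mu> n)" and \<nu>: "real_distribution \<nu>" and conv: "weak_conv_m \<mu> \<nu>"
    and int: "\<And>n. integrable (\<mu> n) (\<lambda>y. y ^ 4)" "integrable \<nu> (\<lambda>y. y ^ 4)"
    and bd: "\<And>n. (\<integral>y. y ^ 4 \<partial>\<mu> n) \<le> C" "(\<integral>y. y ^ 4 \<partial>\<nu>) \<le> C"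
  shows "(\<lambda>n. \<integral>y. y\<^sup>2 \<partial>\<mu> n) \<longlonglongrightarrow> (\<integral>y. y\<^sup>2 \<partial>\<nu>)"
proof (rule LIMSEQ_I)
  fix e :: real assume e: "e > 0"
  have C: "C \<ge> 0" using bd(2) by (rule order_trans[rotated]) simp
  define L where "L = 3 * (C + 1) / e"
  have L: "L > 0" unfolding L_def using C e by simp
  have CL: "C / L < e / 3" unfolding L_def using C e by (simp add: field_simps)
  have trunc: "\<bar>(\<integral>y. y\<^sup>2 \<partial>P) - (\<integral>y. min (y\<^sup>2) L \<partial>P)\<bar> \<le> C / L"
    if "real_distribution P" "integrable P (\<lambda>y. y ^ 4)" "(\<integral>y. y ^ 4 \<partial>P) \<le> C" for P
  proof -
    interpret real_distribution P by fact
    have i1: "integrable P (\<lambda>y. y\<^sup>2)"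
    proof (rule Bochner_Integration.integrable_bound)
      show "integrable P (\<lambda>y. 1 + y ^ 4)" using that by simp
      have "\<bar>y\<^sup>2\<bar> \<le> \<bar>1 + y ^ 4\<bar>" for y :: real
      proof -
        have "0 \<le> (y\<^sup>2 - 1)\<^sup>2 + 1 + y ^ 4" by simp
        also have "\<dots> = 2 * (1 + y ^ 4 - y\<^sup>2)" by (simp add: power2_eq_square power4_eq_xxxx algebra_simps)
        finally show ?thesis by simp
      qed
      then show "AE y in P. norm (y\<^sup>2) \<le> norm (1 + y ^ 4)" by simp
    qed simp
    have i2: "integrable P (\<lambda>y. min (y\<^sup>2) L)"
      by (rule integrable_const_bound[of _ L]) (use L in \<open>auto simp: min_def\<close>)
    have "\<bar>(\<integral>y. y\<^sup>2 \<partial>P) - (\<integral>y. min (y\<^sup>2) L \<partial>P)\<bar> = \<bar>\<integral>y. y\<^sup>2 - min (y\<^sup>2) L \<partial>P\<bar>" using i1 i2 by simp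
    also have "\<dots> \<le> (\<integral>y. \<bar>y\<^sup>2 - min (y\<^sup>2) L\<bar> \<partial>P)" by (rule integral_abs_bound)
    also have "\<dots> \<le> (\<integral>y. y ^ 4 / L \<partial>P)"
      by (intro integral_mono square_truncation L) (use i1 i2 that in auto)
    also have "\<dots> \<le> C / L" using that L by (simp add: divide_right_mono)
    finally show ?thesis .
  qed
  have "(\<lambda>n. \<integral>y. min (y\<^sup>2) L \<partial>\<mu> n) \<longlonglongrightarrow> (\<integral>y. min (y\<^sup>2) L \<partial>\<nu>)"
  proof (rule weak_conv_imp_integral_bdd_continuous_conv[OF \<mu> \<nu> conv])
    show "isCont (\<lambda>y. min (y\<^sup>2) L) x" for x by (intro continuous_intros)
    show "norm (min (x\<^sup>2) L) \<le> L" for x using L by (auto simp: min_def)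
  qed
  from LIMSEQ_D[OF this, of "e / 3"] e obtain N where N: "\<And>n. n \<ge> N \<Longrightarrow> \<bar>(\<integral>y. min (y\<^sup>2) L \<partial>\<mu> n) - (\<integral>y. min (y\<^sup>2) L \<partial>\<nu>)\<bar> < e / 3"
    by auto
  show "\<exists>N. \<forall>n\<ge>N. norm ((\<integral>y. y\<^sup>2 \<partial>\<mu> n) - (\<integral>y. y\<^sup>2 \<partial>\<nu>)) < e"
  proof (intro exI[of _ N] allI impI)
    fix n assume "N \<le> n"
    from N[OF this] trunc[OF \<mu> int(1) bd(1), of n] trunc[OF \<nu> int(2) bd(2)] CL
    show "norm ((\<integral>y. y\<^sup>2 \<partial>\<mu> n) - (\<integral>y. y\<^sup>2 \<partial>\<nu>)) < e" unfolding real_norm_def by linarith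
  qed
qed

text \<open>Interchange of two limits under uniform approximation: \<open>x\<close> is Cauchy
  because each \<open>x' m\<close> is, and its limit is within \<open>\<delta> m\<close> of
  \<open>l m\<close>. Index 0 is left out because the moment bounds start at
  \<open>n = 1\<close>.\<close>

lemma uniform_approx_limit:
  fixes x :: "nat \<Rightarrow> 'a::{banach}"
  assumes appr: "\<And>m n. n \<ge> 1 \<Longrightarrow> norm (x n - x' m n) \<le> \<delta> m" and \<delta>: "\<delta> \<longlonglongrightarrow> 0"
    and lim: "\<And>m. x' m \<longlonglongrightarrow> l m"
  shows "\<exists>L. x \<longlonglongrightarrow> L \<and> l \<longlonglongrightarrow> L"
proof -
  have "Cauchy x"
  proof (rule CauchyI)
    fix e :: real assume e: "e > 0"
    then obtain m where m: "\<bar>\<delta> m\<bar> < e / 3" using LIMSEQ_D[OF \<delta>, of "e / 3"] by auto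
    have "Cauchy (x' m)" using lim[of m] by (rule LIMSEQ_imp_Cauchy)
    from CauchyD[OF this, of "e / 3"] e obtain N where N: "\<And>i j. i \<ge> N \<Longrightarrow> j \<ge> N \<Longrightarrow> norm (x' m i - x' m j) < e / 3" by auto
    show "\<exists>N. \<forall>i\<ge>N. \<forall>j\<ge>N. norm (x i - x j) < e"
    proof (intro exI[of _ "max N 1"] allI impI)
      fix i j assume ij: "max N 1 \<le> i" "max N 1 \<le> j"
      have "norm (x i - x j) = norm ((x i - x' m i) + (x' m i - x' m j) - (x j - x' m j))" by simp
      also have "\<dots> \<le> norm (x i - x' m i) + norm (x' m i - x' m j) + norm (x j - x' m j)"
        by (intro norm_triangle_le_diff add_right_mono norm_triangle_ineq)
      also have "\<dots> < e" using appr[of i m] appr[of j m] N[of i j] ij m by linarith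
      finally show "norm (x i - x j) < e" .
    qed
  qed
  then obtain L where L: "x \<longlonglongrightarrow> L" using Cauchy_convergent_iff convergent_def by blast
  have "norm (l m - L) \<le> \<delta> m" for m
  proof -
    have "(\<lambda>n. norm (x n - x' m n)) \<longlonglongrightarrow> norm (L - l m)" by (intro tendsto_intros L lim)
    then have "norm (L - l m) \<le> \<delta> m" by (rule LIMSEQ_le_const2) (use appr in blast)
    then show ?thesis by (simp add: norm_minus_commute)
  qed
  then have "l \<longlonglongrightarrow> L" by (intro LIM_zero_cancel[OF Lim_null_comparison[OF _ \<delta>]]) auto
  with L show ?thesis by blast
qed

section \<open>The norm of square integrable random variables\<close>

context prob_space
begin

definition L2 :: "('a \<Rightarrow> real) \<Rightarrow> real" where "L2 Y = sqrt (\<integral>\<omega>. (Y \<omega>)\<^sup>2 \<partial>M)"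

lemma L2_nonneg: "L2 Y \<ge> 0" by (simp add: L2_def)

lemma L2_sq: "(\<integral>\<omega>. (Y \<omega>)\<^sup>2 \<partial>M) = (L2 Y)\<^sup>2" by (simp add: L2_def)

lemma L2_triangle:
  assumes "integrable M (\<lambda>\<omega>. (Y \<omega>)\<^sup>2)" "integrable M (\<lambda>\<omega>. (Z \<omega>)\<^sup>2)"
  shows "L2 (\<lambda>\<omega>. Y \<omega> + Z \<omega>) \<le> L2 Y + L2 Z"
proof (rule field_le_epsilon)
  \<comment> \<open>\<open>expectation_square_add\<close> takes positive bounds, so both norms,
    which may vanish, are enlarged by \<open>e / 2\<close>.\<close>
  fix e :: real assume e: "e > 0"
  have "(\<integral>\<omega>. (Y \<omega> + Z \<omega>)\<^sup>2 \<partial>M) \<le> ((L2 Y + e / 2) + (L2 Z + e / 2))\<^sup>2"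
    using e L2_nonneg[of Y] L2_nonneg[of Z]
    by (intro expectation_square_add assms) (auto simp: L2_sq intro!: power_mono)
  also have "(L2 Y + e / 2) + (L2 Z + e / 2) = L2 Y + L2 Z + e" by simp
  finally show "L2 (\<lambda>\<omega>. Y \<omega> + Z \<omega>) \<le> L2 Y + L2 Z + e"
    unfolding L2_def[of "\<lambda>\<omega>. Y \<omega> + Z \<omega>"] using e L2_nonneg[of Y] L2_nonneg[of Z] by (intro real_le_lsqrt) auto
qed

lemma L2_scale: "L2 (\<lambda>\<omega>. c * Y \<omega>) = \<bar>c\<bar> * L2 Y"
  by (simp add: L2_def power_mult_distrib real_sqrt_mult)

lemma L2_diff_le:
  assumes "integrable M (\<lambda>\<omega>. (Y \<omega>)\<^sup>2)" "integrable M (\<lambda>\<omega>. (Z \<omega>)\<^sup>2)" "integrable M (\<lambda>\<omega>. (Y \<omega> - Z \<omega>)\<^sup>2)"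
  shows "\<bar>L2 Y - L2 Z\<bar> \<le> L2 (\<lambda>\<omega>. Y \<omega> - Z \<omega>)"
proof -
  have "L2 Y \<le> L2 (\<lambda>\<omega>. Y \<omega> - Z \<omega>) + L2 Z"
    using L2_triangle[OF assms(3,2)] by simp
  moreover have "L2 (\<lambda>\<omega>. Z \<omega> - Y \<omega>) = L2 (\<lambda>\<omega>. Y \<omega> - Z \<omega>)" by (simp add: L2_def power2_commute)
  moreover have "L2 Z \<le> L2 (\<lambda>\<omega>. Z \<omega> - Y \<omega>) + L2 Y"
    using L2_triangle[of "\<lambda>\<omega>. Z \<omega> - Y \<omega>" Y] assms by (simp add: power2_commute)
  ultimately show ?thesis by linarith
qed

lemma expectation_abs_le_L2:
  assumes [measurable]: "Y \<in> borel_measurable M" and "integrable M (\<lambda>\<omega>. (Y \<omega>)\<^sup>2)"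
  shows "integrable M Y" "(\<integral>\<omega>. \<bar>Y \<omega>\<bar> \<partial>M) \<le> L2 Y"
proof -
  show int: "integrable M Y"
  proof (rule Bochner_Integration.integrable_bound)
    show "integrable M (\<lambda>\<omega>. 1 + (Y \<omega>)\<^sup>2)" using assms by simp
    have "\<bar>y\<bar> \<le> \<bar>1 + y\<^sup>2\<bar>" for y :: real
    proof -
      have "0 \<le> (\<bar>y\<bar> - 1)\<^sup>2 + 1 + y\<^sup>2" by simp
      also have "\<dots> = 2 * (1 + y\<^sup>2 - \<bar>y\<bar>)" by (simp add: power2_eq_square algebra_simps)
      finally show ?thesis by simp
    qed
    then show "AE \<omega> in M. norm (Y \<omega>) \<le> norm (1 + (Y \<omega>)\<^sup>2)" by simp
  qed fact
  show "(\<integral>\<omega>. \<bar>Y \<omega>\<bar> \<partial>M) \<le> L2 Y"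
  proof (rule field_le_epsilon)
    fix e :: real assume e: "e > 0"
    define b where "b = L2 Y + e"
    have b: "b > 0" unfolding b_def using e L2_nonneg[of Y] by linarith
    have "(\<integral>\<omega>. \<bar>Y \<omega>\<bar> \<partial>M) \<le> (\<integral>\<omega>. b / 2 + (Y \<omega>)\<^sup>2 / (2 * b) \<partial>M)"
    proof (rule integral_mono)
      fix \<omega>
      have "0 \<le> (\<bar>Y \<omega>\<bar> - b)\<^sup>2 / (2 * b)" using b by simp
      also have "\<dots> = b / 2 + (Y \<omega>)\<^sup>2 / (2 * b) - \<bar>Y \<omega>\<bar>" using b by (simp add: power2_eq_square field_simps)
      finally show "\<bar>Y \<omega>\<bar> \<le> b / 2 + (Y \<omega>)\<^sup>2 / (2 * b)" by simp
    qed (use int assms in auto)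
    also have "\<dots> = b / 2 + (L2 Y)\<^sup>2 / (2 * b)" using assms by (simp add: prob_space L2_sq)
    also have "(L2 Y)\<^sup>2 \<le> b\<^sup>2" unfolding b_def using e L2_nonneg[of Y] by (intro power_mono) auto
    then have "b / 2 + (L2 Y)\<^sup>2 / (2 * b) \<le> b / 2 + b\<^sup>2 / (2 * b)" using b by (intro add_left_mono divide_right_mono) auto
    also have "\<dots> = b" using b by (simp add: power2_eq_square)
    also have "\<dots> = L2 Y + e" by (rule b_def)
    finally show "(\<integral>\<omega>. \<bar>Y \<omega>\<bar> \<partial>M) \<le> L2 Y + e" .
  qed
qed

lemma iexp_diff_le: "norm (iexp a - iexp b) \<le> \<bar>a - b\<bar>"
proof -
  have "iexp a - iexp b = iexp b * (iexp (a - b) - 1)" by (simp add: algebra_simps exp_diff)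
  then have "norm (iexp a - iexp b) = norm (iexp (a - b) - 1)" by (simp add: norm_mult)
  also have "\<dots> \<le> \<bar>a - b\<bar>" using iexp_approx1[of "a - b" 0] by simp
  finally show ?thesis .
qed

lemma iexp_expectation_diff:
  assumes [measurable]: "Y \<in> borel_measurable M" "Z \<in> borel_measurable M"
    and "integrable M (\<lambda>\<omega>. (Y \<omega> - Z \<omega>)\<^sup>2)"
  shows "norm ((CLINT \<omega>|M. iexp (Y \<omega>)) - (CLINT \<omega>|M. iexp (Z \<omega>))) \<le> L2 (\<lambda>\<omega>. Y \<omega> - Z \<omega>)"
proof -
  have i: "integrable M (\<lambda>\<omega>. iexp (V \<omega>))" if [measurable]: "V \<in> borel_measurable M" for V
    by (rule integrable_iexp) auto
  have m: "(\<lambda>\<omega>. Y \<omega> - Z \<omega>) \<in> borel_measurable M" by measurable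
  have "norm ((CLINT \<omega>|M. iexp (Y \<omega>)) - (CLINT \<omega>|M. iexp (Z \<omega>))) = norm (CLINT \<omega>|M. iexp (Y \<omega>) - iexp (Z \<omega>))"
    using i by simp
  also have "\<dots> \<le> (\<integral>\<omega>. norm (iexp (Y \<omega>) - iexp (Z \<omega>)) \<partial>M)" by (rule integral_norm_bound)
  also have "\<dots> \<le> (\<integral>\<omega>. \<bar>Y \<omega> - Z \<omega>\<bar> \<partial>M)"
    by (intro integral_mono iexp_diff_le) (use expectation_abs_le_L2(1)[OF m assms(3)] i in auto)
  also have "\<dots> \<le> L2 (\<lambda>\<omega>. Y \<omega> - Z \<omega>)" by (rule expectation_abs_le_L2(2)[OF m assms(3)])
  finally show ?thesis .
qed

end

section \<open>Limits of linear combinations of indicators\<close>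

context emp_clt
begin

text \<open>\<open>emp\<close> centres its argument, so the limit theorem for centred functions
  applies to \<open>f\<close> minus its mean. Fourth moments identify the limit variance with the
  limit of the second moments, which is what survives when \<open>f\<close> later approaches
  indicators.\<close>

lemma emp_G_limit:
  assumes f: "f \<in> G" and fB: "\<And>x. \<bar>f x\<bar> \<le> B"
  shows "\<exists>s2\<ge>0. (\<lambda>n. \<integral>\<omega>. (emp f n \<omega>)\<^sup>2 \<partial>M) \<longlonglongrightarrow> s2 \<and>
    (\<lambda>n. CLINT \<omega>|M. iexp (emp f n \<omega>)) \<longlonglongrightarrow> complex_of_real (exp (- s2 / 2))"
proof -
  have [measurable]: "f \<in> borel_measurable borel" by (rule G_meas[OF f])
  have int: "integrable M (\<lambda>\<omega>. f (X 0 \<omega>))" by (rule integrable_bounded_comp[of _ B]) (use fB in auto)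
  define \<mu> where "\<mu> = (\<integral>\<omega>. f (X 0 \<omega>) \<partial>M)"
  define g where "g x = f x + (- \<mu>)" for x
  have gG: "g \<in> G" unfolding g_def[abs_def] by (intro G_add f G_const)
  have "bounded (range g)"
    unfolding bounded_iff
  proof (intro exI[of _ "B + \<bar>\<mu>\<bar>"] ballI)
    fix y assume "y \<in> range g"
    then obtain x where "y = f x - \<mu>" unfolding g_def by auto
    then show "norm y \<le> B + \<bar>\<mu>\<bar>" using fB[of x] by simp
  qed
  moreover have "(\<integral>\<omega>. g (X 0 \<omega>) \<partial>M) = 0" unfolding g_def using int by (simp add: \<mu>_def prob_space)
  ultimately obtain s2 where s2: "s2 \<ge> 0" and wc: "weak_conv_m
              (\<lambda>n. distr M borel (\<lambda>\<omega>. (\<Sum>i\<in>{1..n}. g (X i \<omega>)) / sqrt (real n))) (gauss_law s2)"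
    using clt gG by blast
  have eq: "(\<lambda>\<omega>. (\<Sum>i\<in>{1..n}. g (X i \<omega>)) / sqrt (real n)) = emp f n" for n
    unfolding g_def emp_def \<mu>_def by simp
  define D where "D n = distr M borel (emp f n)" for n
  have wc: "weak_conv_m D (gauss_law s2)" using wc unfolding eq D_def .
  have rD: "real_distribution (D n)" for n unfolding D_def by (rule real_distribution_distr) measurable
  note rG = real_distribution_gauss_law[OF s2]
  have char: "(\<lambda>n. CLINT \<omega>|M. iexp (emp f n \<omega>)) \<longlonglongrightarrow> complex_of_real (exp (- s2 / 2))"
  proof -
    have "(\<lambda>n. char (D n) 1) \<longlonglongrightarrow> char (gauss_law s2) 1" by (rule levy_continuity1[OF rD rG wc])
    moreover have "char (D n) 1 = (CLINT \<omega>|M. iexp (emp f n \<omega>))" for n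
      unfolding char_def D_def by (subst integral_distr) auto
    ultimately show ?thesis using s2 by (simp add: char_gauss_law)
  qed
  obtain C where C: "C \<ge> 0" and mom: "\<And>f n. f \<in> G \<Longrightarrow> (\<forall>x. \<bar>f x\<bar> \<le> 2) \<Longrightarrow> n \<ge> 1 \<Longrightarrow>
     (\<integral>\<omega>. emp f n \<omega> ^ (2 * 2) \<partial>M) \<le> C * (link_size f / real n ^ (2 - 1) + link_size f ^ 2)"
    using emp_moment[of 2] p_ge_2 by auto
  \<comment> \<open>\<open>emp_moment\<close> concerns functions bounded by 2, hence the rescaling;
    the summand 1 keeps \<open>b\<close> positive.\<close>
  define b where "b = \<bar>B\<bar> + 1"
  have b: "b > 0" unfolding b_def by simp
  define h where "h x = (1 / b) * f x" for x
  have hG: "h \<in> G" unfolding h_def[abs_def] by (intro G_scale f)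
  have h2: "\<forall>x. \<bar>h x\<bar> \<le> 2"
  proof
    fix x
    have "\<bar>f x\<bar> \<le> 2 * b" using fB[of x] abs_ge_self[of B] abs_ge_zero[of B] unfolding b_def distrib_left by linarith
    then show "\<bar>h x\<bar> \<le> 2" unfolding h_def using b by (simp add: abs_mult pos_divide_le_eq)
  qed
  have fh: "emp f n \<omega> = b * emp h n \<omega>" for n \<omega>
    unfolding h_def[abs_def] emp_scale using b by simp
  define C4 where "C4 = b ^ 4 * (C * (link_size h + (link_size h)\<^sup>2))"
  have m4: "(\<integral>\<omega>. emp f n \<omega> ^ 4 \<partial>M) \<le> C4" for n
  proof (cases "n = 0")
    case True
    then show ?thesis unfolding C4_def using C b link_size_nonneg[OF hG] by (simp add: emp_def)
  next
    case False
    have "(\<integral>\<omega>. emp f n \<omega> ^ 4 \<partial>M) = b ^ 4 * (\<integral>\<omega>. emp h n \<omega> ^ (2 * 2) \<partial>M)" by (simp add: fh power_mult_distrib)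
    also have "\<dots> \<le> b ^ 4 * (C * (link_size h / real n ^ (2 - 1) + link_size h ^ 2))"
      using False b by (intro mult_left_mono mom hG h2) auto
    also have "\<dots> \<le> C4"
    proof -
      have "link_size h / real n \<le> link_size h / 1"
        using False link_size_nonneg[OF hG] by (intro divide_left_mono) auto
      then show ?thesis unfolding C4_def using C b by (intro mult_left_mono add_right_mono) auto
    qed
    finally show ?thesis .
  qed
  have i4: "integrable M (\<lambda>\<omega>. emp f n \<omega> ^ 4)" for n by (rule integrable_emp_pow[OF _ fB]) measurable
  let ?C = "max C4 (\<integral>y. y ^ 4 \<partial>gauss_law s2)"
  have "(\<lambda>n. \<integral>y. y\<^sup>2 \<partial>D n) \<longlonglongrightarrow> (\<integral>y. y\<^sup>2 \<partial>gauss_law s2)"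
  proof (rule weak_conv_second_moment[OF rD rG wc, where C = ?C])
    show "integrable (D n) (\<lambda>y. y ^ 4)" for n unfolding D_def using i4 by (subst integrable_distr_eq) auto
    show "integrable (gauss_law s2) (\<lambda>y. y ^ 4)" using gauss_law_moment(1)[OF s2, of 2] by simp
    have "(\<integral>y. y ^ 4 \<partial>D n) = (\<integral>\<omega>. emp f n \<omega> ^ 4 \<partial>M)" for n unfolding D_def by (subst integral_distr) auto
    then show "(\<integral>y. y ^ 4 \<partial>D n) \<le> ?C" for n using m4[of n] by (simp add: le_max_iff_disj)
  qed simp
  moreover have "(\<integral>y. y\<^sup>2 \<partial>D n) = (\<integral>\<omega>. (emp f n \<omega>)\<^sup>2 \<partial>M)" for n unfolding D_def by (subst integral_distr) auto
  moreover have "(\<integral>y. y\<^sup>2 \<partial>gauss_law s2) = s2" using gauss_law_moment(2)[OF s2, of 1] by simp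
  ultimately show ?thesis using s2 char by (intro exI[of _ s2]) simp
qed

definition emp_comb :: "'j set \<Rightarrow> ('j \<Rightarrow> ereal^'d) \<Rightarrow> ('j \<Rightarrow> real) \<Rightarrow> nat \<Rightarrow> 'w \<Rightarrow> real" where
  "emp_comb I e c n \<omega> = (\<Sum>j\<in>I. c j * emp (orthant_ind (e j)) n \<omega>)"

lemma emp_comb_meas [measurable]: "emp_comb I e c n \<in> borel_measurable M"
  unfolding emp_comb_def by measurable

lemma integrable_emp_sum_sq:
  fixes f :: "'j \<Rightarrow> real^'d \<Rightarrow> real"
  assumes I: "finite I" and f [measurable]: "\<And>j. j \<in> I \<Longrightarrow> f j \<in> borel_measurable borel" and b: "\<And>j x. j \<in> I \<Longrightarrow> \<bar>f j x\<bar> \<le> 1"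
  shows "integrable M (\<lambda>\<omega>. (\<Sum>j\<in>I. c j * emp (f j) n \<omega>)\<^sup>2)"
proof -
  have eq: "(\<Sum>j\<in>I. c j * emp (f j) n \<omega>) = emp (\<lambda>x. \<Sum>j\<in>I. c j * f j x) n \<omega>" for \<omega>
  proof (subst emp_sum[OF I])
    fix j assume j: "j \<in> I"
    have "integrable M (\<lambda>\<omega>. f j (X 0 \<omega>))" by (rule integrable_bounded_comp[OF f[OF j] b[OF j]])
    then show "integrable M (\<lambda>\<omega>. c j * f j (X 0 \<omega>))" by simp
  qed (simp add: emp_scale)
  show ?thesis unfolding eq
  proof (rule integrable_emp_pow[where B = "\<Sum>j\<in>I. \<bar>c j\<bar>"])
    fix x
    have "\<bar>\<Sum>j\<in>I. c j * f j x\<bar> \<le> (\<Sum>j\<in>I. \<bar>c j * f j x\<bar>)" by (rule sum_abs)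
    also have "\<dots> \<le> (\<Sum>j\<in>I. \<bar>c j\<bar>)"
    proof (rule sum_mono)
      fix j assume "j \<in> I"
      then show "\<bar>c j * f j x\<bar> \<le> \<bar>c j\<bar>" using mult_left_mono[OF b[of j x], of "\<bar>c j\<bar>"] by (simp add: abs_mult)
    qed
    finally show "\<bar>\<Sum>j\<in>I. c j * f j x\<bar> \<le> (\<Sum>j\<in>I. \<bar>c j\<bar>)" .
  qed measurable
qed

lemma L2_sum_le:
  assumes "finite I" "\<And>j. j \<in> I \<Longrightarrow> integrable M (\<lambda>\<omega>. (Y j \<omega>)\<^sup>2)" "\<And>j. j \<in> I \<Longrightarrow> Y j \<in> borel_measurable M"
  shows "integrable M (\<lambda>\<omega>. (\<Sum>j\<in>I. Y j \<omega>)\<^sup>2) \<and> L2 (\<lambda>\<omega>. \<Sum>j\<in>I. Y j \<omega>) \<le> (\<Sum>j\<in>I. L2 (Y j))"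
  using assms
proof (induction I rule: finite_induct)
  case empty
  then show ?case by (simp add: L2_def)
next
  case (insert j I)
  let ?S = "\<lambda>\<omega>. \<Sum>j\<in>I. Y j \<omega>"
  have IH: "integrable M (\<lambda>\<omega>. (?S \<omega>)\<^sup>2)" "L2 ?S \<le> (\<Sum>j\<in>I. L2 (Y j))" using insert by auto
  have m [measurable]: "Y j \<in> borel_measurable M" "?S \<in> borel_measurable M"
    using insert by (auto intro!: borel_measurable_sum)
  have i: "integrable M (\<lambda>\<omega>. (Y j \<omega> + ?S \<omega>)\<^sup>2)"
  proof (rule Bochner_Integration.integrable_bound)
    show "integrable M (\<lambda>\<omega>. 2 * (Y j \<omega>)\<^sup>2 + 2 * (?S \<omega>)\<^sup>2)" using IH insert by simp
    have "(a + b)\<^sup>2 \<le> 2 * a\<^sup>2 + 2 * b\<^sup>2" for a b :: real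
      using zero_le_power2[of "a - b"] by (simp add: power2_eq_square algebra_simps)
    then show "AE \<omega> in M. norm ((Y j \<omega> + ?S \<omega>)\<^sup>2) \<le> norm (2 * (Y j \<omega>)\<^sup>2 + 2 * (?S \<omega>)\<^sup>2)" by simp
  qed measurable
  have "L2 (\<lambda>\<omega>. Y j \<omega> + ?S \<omega>) \<le> L2 (Y j) + L2 ?S" using insert IH by (intro L2_triangle) auto
  then show ?case using insert IH i by simp
qed

text \<open>The indicators are replaced by lower brackets of level \<open>m\<close>, with an error
  \<open>\<delta> m\<close> uniform in \<open>n\<close>. \<open>uniform_approx_limit\<close> is
  applied once to the norms and once to the characteristic functions, and the limit variances
  \<open>q m\<close> tie the two results together.\<close>

theorem fidi_limit:
  assumes I: "finite (I :: 'j set)"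
  shows "\<exists>Q\<ge>0. (\<lambda>n. \<integral>\<omega>. (emp_comb I e c n \<omega>)\<^sup>2 \<partial>M) \<longlonglongrightarrow> Q \<and>
    (\<lambda>n. CLINT \<omega>|M. iexp (emp_comb I e c n \<omega>)) \<longlonglongrightarrow> complex_of_real (exp (- Q / 2))"
proof -
  obtain C where C: "C > 0" and sq: "\<And>m t n. 1 \<le> n \<Longrightarrow>
      (\<integral>\<omega>. (emp (orthant_ind t) n \<omega> - emp (lo m t) n \<omega>)\<^sup>2 \<partial>M) \<le> C * \<rho> ^ m"
    using square_chain by blast
  define f where "f m x = (\<Sum>j\<in>I. c j * lo m (e j) x)" for m x
  have fG: "f m \<in> G" for m unfolding f_def[abs_def] using I
  proof (induction I rule: finite_induct)
    case empty
    then show ?case by (simp add: G_const)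
  next
    case (insert j I)
    then show ?case using G_add[OF G_scale[OF lo_G] insert.IH] by simp
  qed
  have fB: "\<bar>f m x\<bar> \<le> (\<Sum>j\<in>I. \<bar>c j\<bar>)" for m x
  proof -
    have "\<bar>f m x\<bar> \<le> (\<Sum>j\<in>I. \<bar>c j * lo m (e j) x\<bar>)" unfolding f_def by (rule sum_abs)
    also have "\<dots> \<le> (\<Sum>j\<in>I. \<bar>c j\<bar>)"
    proof (rule sum_mono)
      fix j
      have "\<bar>lo m (e j) x\<bar> \<le> 1" using lo_nonneg[of m "e j" x] lo_le_1[of m "e j" x] by linarith
      then show "\<bar>c j * lo m (e j) x\<bar> \<le> \<bar>c j\<bar>" using mult_left_mono[of "\<bar>lo m (e j) x\<bar>" 1 "\<bar>c j\<bar>"] by (simp add: abs_mult)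
    qed
    finally show ?thesis .
  qed
  have [measurable]: "f m \<in> borel_measurable borel" for m by (rule G_meas[OF fG])
  have femp: "emp (f m) n \<omega> = (\<Sum>j\<in>I. c j * emp (lo m (e j)) n \<omega>)" for m n \<omega>
    unfolding f_def[abs_def] using I by (subst emp_sum) (auto simp: emp_scale)
  let ?Y = "\<lambda>n \<omega>. emp_comb I e c n \<omega>"
  define \<delta> where "\<delta> m = (\<Sum>j\<in>I. \<bar>c j\<bar> * sqrt (C * \<rho> ^ m))" for m
  have d: "\<delta> \<longlonglongrightarrow> 0"
  proof -
    have "\<delta> \<longlonglongrightarrow> (\<Sum>j\<in>I. \<bar>c j\<bar> * sqrt (C * 0))" unfolding \<delta>_def
      using rho_bounds by (intro tendsto_intros LIMSEQ_realpow_zero) auto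
    then show ?thesis by simp
  qed
  have idiff: "integrable M (\<lambda>\<omega>. (emp (orthant_ind t) n \<omega> - emp (lo m t) n \<omega>)\<^sup>2)" for t m n
  proof -
    have "integrable M (\<lambda>\<omega>. (emp (\<lambda>x. orthant_ind t x - lo m t x) n \<omega>)\<^sup>2)"
    proof (rule integrable_emp_pow[of _ 1])
      fix x show "\<bar>orthant_ind t x - lo m t x\<bar> \<le> 1"
        using lo_nonneg[of m t x] lo_le[of m t x] orthant_ind_le_1[of t x] by linarith
    qed measurable
    then show ?thesis by (simp add: emp_diff)
  qed
  have diff: "integrable M (\<lambda>\<omega>. (?Y n \<omega> - emp (f m) n \<omega>)\<^sup>2)" "1 \<le> n \<Longrightarrow> L2 (\<lambda>\<omega>. ?Y n \<omega> - emp (f m) n \<omega>) \<le> \<delta> m" for n m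
  proof -
    let ?Z = "\<lambda>j \<omega>. c j * (emp (orthant_ind (e j)) n \<omega> - emp (lo m (e j)) n \<omega>)"
    have eq: "?Y n \<omega> - emp (f m) n \<omega> = (\<Sum>j\<in>I. ?Z j \<omega>)" for \<omega>
      unfolding femp emp_comb_def by (simp add: sum_subtractf[symmetric] right_diff_distrib)
    have *: "integrable M (\<lambda>\<omega>. (\<Sum>j\<in>I. ?Z j \<omega>)\<^sup>2) \<and> L2 (\<lambda>\<omega>. \<Sum>j\<in>I. ?Z j \<omega>) \<le> (\<Sum>j\<in>I. L2 (?Z j))"
      using idiff by (intro L2_sum_le[OF I]) (auto simp: power_mult_distrib)
    then show "integrable M (\<lambda>\<omega>. (?Y n \<omega> - emp (f m) n \<omega>)\<^sup>2)" unfolding eq by blast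
    assume n: "1 \<le> n"
    have "L2 (?Z j) \<le> \<bar>c j\<bar> * sqrt (C * \<rho> ^ m)" for j
      unfolding L2_scale by (intro mult_left_mono) (auto simp: L2_def intro!: sq n)
    then have "(\<Sum>j\<in>I. L2 (?Z j)) \<le> \<delta> m" unfolding \<delta>_def by (intro sum_mono)
    then show "L2 (\<lambda>\<omega>. ?Y n \<omega> - emp (f m) n \<omega>) \<le> \<delta> m" unfolding eq using * by linarith
  qed
  have iY: "integrable M (\<lambda>\<omega>. (?Y n \<omega>)\<^sup>2)" for n
    unfolding emp_comb_def by (rule integrable_emp_sum_sq[OF I]) auto
  have iF: "integrable M (\<lambda>\<omega>. (emp (f m) n \<omega>)\<^sup>2)" for m n by (rule integrable_emp_pow[OF _ fB]) measurable
  have "\<forall>m. \<exists>s2\<ge>0. (\<lambda>n. \<integral>\<omega>. (emp (f m) n \<omega>)\<^sup>2 \<partial>M) \<longlonglongrightarrow> s2 \<and>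
    (\<lambda>n. CLINT \<omega>|M. iexp (emp (f m) n \<omega>)) \<longlonglongrightarrow> complex_of_real (exp (- s2 / 2))"
    using emp_G_limit[OF fG fB] by blast
  then obtain q where q: "\<And>m. q m \<ge> 0" "\<And>m. (\<lambda>n. \<integral>\<omega>. (emp (f m) n \<omega>)\<^sup>2 \<partial>M) \<longlonglongrightarrow> q m"
     "\<And>m. (\<lambda>n. CLINT \<omega>|M. iexp (emp (f m) n \<omega>)) \<longlonglongrightarrow> complex_of_real (exp (- q m / 2))"
    by metis
  have "\<exists>L. (\<lambda>n. L2 (?Y n)) \<longlonglongrightarrow> L \<and> (\<lambda>m. sqrt (q m)) \<longlonglongrightarrow> L"
  proof (rule uniform_approx_limit[where x' = "\<lambda>m n. L2 (emp (f m) n)" and \<delta> = \<delta>])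
    fix m n :: nat assume n: "1 \<le> n"
    have "\<bar>L2 (?Y n) - L2 (emp (f m) n)\<bar> \<le> L2 (\<lambda>\<omega>. ?Y n \<omega> - emp (f m) n \<omega>)"
      by (rule L2_diff_le[OF iY iF diff(1)])
    then show "norm (L2 (?Y n) - L2 (emp (f m) n)) \<le> \<delta> m" using diff(2)[OF n, of m] by simp
  next
    fix m show "(\<lambda>n. L2 (emp (f m) n)) \<longlonglongrightarrow> sqrt (q m)" unfolding L2_def by (intro tendsto_intros q)
  qed (rule d)
  then obtain L where L: "(\<lambda>n. L2 (?Y n)) \<longlonglongrightarrow> L" "(\<lambda>m. sqrt (q m)) \<longlonglongrightarrow> L" by blast
  have "\<exists>L'. (\<lambda>n. CLINT \<omega>|M. iexp (?Y n \<omega>)) \<longlonglongrightarrow> L' \<and> (\<lambda>m. complex_of_real (exp (- q m / 2))) \<longlonglongrightarrow> L'"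
  proof (rule uniform_approx_limit[where x' = "\<lambda>m n. CLINT \<omega>|M. iexp (emp (f m) n \<omega>)" and \<delta> = \<delta>])
    fix m n :: nat assume n: "1 \<le> n"
    have "norm ((CLINT \<omega>|M. iexp (?Y n \<omega>)) - (CLINT \<omega>|M. iexp (emp (f m) n \<omega>))) \<le> L2 (\<lambda>\<omega>. ?Y n \<omega> - emp (f m) n \<omega>)"
      by (rule iexp_expectation_diff[OF _ _ diff(1)]) measurable
    then show "norm ((CLINT \<omega>|M. iexp (?Y n \<omega>)) - (CLINT \<omega>|M. iexp (emp (f m) n \<omega>))) \<le> \<delta> m"
      using diff(2)[OF n, of m] by linarith
  qed (rule d, rule q)
  then obtain L' where L': "(\<lambda>n. CLINT \<omega>|M. iexp (?Y n \<omega>)) \<longlonglongrightarrow> L'" "(\<lambda>m. complex_of_real (exp (- q m / 2))) \<longlonglongrightarrow> L'" by blast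
  have "(\<lambda>m. complex_of_real (exp (- ((sqrt (q m))\<^sup>2) / 2))) \<longlonglongrightarrow> complex_of_real (exp (- (L\<^sup>2) / 2))"
    by (intro tendsto_intros L) simp
  then have "(\<lambda>m. complex_of_real (exp (- q m / 2))) \<longlonglongrightarrow> complex_of_real (exp (- (L\<^sup>2) / 2))" using q(1) by simp
  then have "L' = complex_of_real (exp (- (L\<^sup>2) / 2))" using L'(2) LIMSEQ_unique by blast
  moreover have "(\<lambda>n. \<integral>\<omega>. (?Y n \<omega>)\<^sup>2 \<partial>M) \<longlonglongrightarrow> L\<^sup>2"
    unfolding L2_sq by (intro tendsto_intros L)
  ultimately show ?thesis using L'(1) by (intro exI[of _ "L\<^sup>2"]) simp
qed

end

section \<open>The limiting Gaussian process\<close>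

definition psd_kernel :: "(nat \<Rightarrow> nat \<Rightarrow> real) \<Rightarrow> bool" where
  "psd_kernel K \<longleftrightarrow> (\<forall>n m. K n m = K m n) \<and>
     (\<forall>I c. finite I \<longrightarrow> 0 \<le> (\<Sum>i\<in>I. \<Sum>j\<in>I. c i * c j * K i j))"

text \<open>If \<open>K e e = 0\<close>, the whole row of \<open>e\<close> vanishes by positivity, so division by zero leaves \<open>K\<close> as it is,
  which is the intended step.\<close>

definition schur_step :: "nat \<Rightarrow> (nat \<Rightarrow> nat \<Rightarrow> real) \<Rightarrow> nat \<Rightarrow> nat \<Rightarrow> real" where
  "schur_step e K n m = K n m - K n e * K m e / K e e"

primrec schur_iter :: "(nat \<Rightarrow> nat \<Rightarrow> real) \<Rightarrow> nat \<Rightarrow> nat \<Rightarrow> nat \<Rightarrow> real" where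
  "schur_iter K 0 = K"
| "schur_iter K (Suc i) = schur_step i (schur_iter K i)"

text \<open>The pivot column of elimination step \<open>i\<close>, divided by the square root of the
  pivot; a zero pivot gives a zero column.\<close>

definition cholesky :: "(nat \<Rightarrow> nat \<Rightarrow> real) \<Rightarrow> nat \<Rightarrow> nat \<Rightarrow> real" where
  "cholesky K n i = schur_iter K i n i / sqrt (schur_iter K i i i)"

lemma psd_kernel_sym:
  assumes "psd_kernel K"
  shows "K n m = K m n"
  using assms[unfolded psd_kernel_def, THEN conjunct1] by metis

lemma psd_kernel_form_nonneg:
  assumes "psd_kernel K" "finite I"
  shows "0 \<le> (\<Sum>i\<in>I. \<Sum>j\<in>I. c i * c j * K i j)"
  by (rule assms(1)[unfolded psd_kernel_def, THEN conjunct2, rule_format, OF assms(2)])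

text \<open>This is the quadratic form at \<open>c\<close> minus \<open>t\<close> times the unit
  vector at \<open>e\<close>, expanded. Coefficients are extended by 0 to \<open>insert e I\<close>,
  so that \<open>e\<close> may lie inside or outside \<open>I\<close>.\<close>

lemma psd_kernel_shift:
  assumes K: "psd_kernel K" and I: "finite I"
  shows "0 \<le> (\<Sum>i\<in>I. \<Sum>j\<in>I. c i * c j * K i j) - 2 * t * (\<Sum>i\<in>I. c i * K i e) + t\<^sup>2 * K e e"
proof -
  define J where "J = insert e I"
  define a where "a i = (if i \<in> I then c i else 0)" for i
  define d where "d i = (if i = e then t else 0)" for i
  have J: "finite J" "e \<in> J" "I \<subseteq> J" unfolding J_def using I by auto
  have sym: "K i j = K j i" for i j by (rule psd_kernel_sym[OF K])
  have restr: "(\<Sum>i\<in>J. a i * f i) = (\<Sum>i\<in>I. c i * f i)" for f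
    unfolding a_def using J by (intro sum.mono_neutral_cong_right) auto
  have del: "(\<Sum>i\<in>J. d i * f i) = t * f e" for f
    unfolding d_def using J by (simp add: if_distrib[of "\<lambda>x. x * _"] sum.delta cong: if_cong)
  have "0 \<le> (\<Sum>i\<in>J. \<Sum>j\<in>J. (a i - d i) * (a j - d j) * K i j)"
    by (rule psd_kernel_form_nonneg[OF K J(1)])
  also have "\<dots> = (\<Sum>i\<in>J. (a i - d i) * (\<Sum>j\<in>J. a j * K i j - d j * K i j))"
    by (intro sum.cong refl) (simp add: sum_distrib_left algebra_simps)
  also have "\<dots> = (\<Sum>i\<in>J. (a i - d i) * ((\<Sum>j\<in>I. c j * K i j) - t * K i e))"
    by (simp add: sum_subtractf restr del)
  also have "\<dots> = (\<Sum>i\<in>J. a i * ((\<Sum>j\<in>I. c j * K i j) - t * K i e)) - (\<Sum>i\<in>J. d i * ((\<Sum>j\<in>I. c j * K i j) - t * K i e))"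
    by (simp only: left_diff_distrib sum_subtractf)
  also have "\<dots> = (\<Sum>i\<in>I. c i * ((\<Sum>j\<in>I. c j * K i j) - t * K i e)) - t * ((\<Sum>j\<in>I. c j * K e j) - t * K e e)"
    unfolding restr del ..
  also have "(\<Sum>j\<in>I. c j * K e j) = (\<Sum>j\<in>I. c j * K j e)" by (intro sum.cong refl arg_cong2[where f="(*)"] sym)
  also have "(\<Sum>i\<in>I. c i * ((\<Sum>j\<in>I. c j * K i j) - t * K i e)) = (\<Sum>i\<in>I. \<Sum>j\<in>I. c i * c j * K i j) - t * (\<Sum>i\<in>I. c i * K i e)"
    by (simp add: right_diff_distrib sum_subtractf sum_distrib_left mult_ac)
  finally show ?thesis by (simp add: algebra_simps power2_eq_square)
qed

lemma psd_kernel_diag: "psd_kernel K \<Longrightarrow> 0 \<le> K e e"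
  using psd_kernel_shift[of K "{}" "\<lambda>_. 0" 1 e] by simp

text \<open>If \<open>K e e = 0\<close>, the shifted form is affine in \<open>t\<close>, and an
  affine function that stays nonnegative has slope 0.\<close>

lemma psd_kernel_null:
  assumes K: "psd_kernel K" and z: "K e e = 0"
  shows "K n e = 0"
proof (rule ccontr)
  assume nz: "K n e \<noteq> 0"
  \<comment> \<open>Chosen so that the linear term exceeds the constant term \<open>K n n\<close> by
    1.\<close>
  define t where "t = (K n n + 1) / (2 * K n e)"
  have "0 \<le> K n n - 2 * t * K n e"
    using psd_kernel_shift[OF K, of "{n}" "\<lambda>_. 1" t e] z by simp
  moreover have "2 * t * K n e = K n n + 1" unfolding t_def using nz by simp
  ultimately show False by linarith
qed

text \<open>For a nonzero pivot the new form is the minimum over \<open>t\<close> of the shifted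
  form, attained at \<open>?B / K e e\<close>.\<close>

lemma psd_kernel_schur_step:
  assumes K: "psd_kernel K"
  shows "psd_kernel (schur_step e K)"
  unfolding psd_kernel_def
proof (intro conjI allI impI)
  have sym: "K i j = K j i" for i j by (rule psd_kernel_sym[OF K])
  show "schur_step e K n m = schur_step e K m n" for n m unfolding schur_step_def sym[of n m] by (simp only: mult.commute)
  fix I :: "nat set" and c assume I: "finite I"
  let ?Q = "\<Sum>i\<in>I. \<Sum>j\<in>I. c i * c j * K i j" and ?B = "\<Sum>i\<in>I. c i * K i e"
  have "(\<Sum>i\<in>I. \<Sum>j\<in>I. c i * c j * schur_step e K i j) = (\<Sum>i\<in>I. \<Sum>j\<in>I. c i * c j * K i j - (c i * K i e) * (c j * K j e) / K e e)"
    unfolding schur_step_def by (intro sum.cong refl) (simp add: algebra_simps)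
  also have "\<dots> = ?Q - (\<Sum>i\<in>I. \<Sum>j\<in>I. (c i * K i e) * (c j * K j e)) / K e e"
    by (simp only: sum_subtractf sum_divide_distrib)
  also have "(\<Sum>i\<in>I. \<Sum>j\<in>I. (c i * K i e) * (c j * K j e)) = ?B * ?B" by (rule sum_product[symmetric])
  also have "0 \<le> ?Q - ?B * ?B / K e e"
  proof (cases "K e e = 0")
    case True
    then show ?thesis using psd_kernel_form_nonneg[OF K I, of c] by simp
  next
    case False
    then show ?thesis using psd_kernel_shift[OF K I, of c "?B / K e e" e] by (simp add: power2_eq_square)
  qed
  finally show "0 \<le> (\<Sum>i\<in>I. \<Sum>j\<in>I. c i * c j * schur_step e K i j)" .
qed

lemma psd_kernel_schur_iter: "psd_kernel K \<Longrightarrow> psd_kernel (schur_iter K i)"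
  by (induction i) (simp_all add: psd_kernel_schur_step)

text \<open>Step \<open>i\<close> clears row \<open>i\<close>, and later steps subtract multiples of
  entries of that row, so it stays zero.\<close>

lemma schur_iter_zero:
  assumes K: "psd_kernel K"
  shows "n < i \<Longrightarrow> schur_iter K i n m = 0"
proof (induction i arbitrary: n m)
  case (Suc i)
  let ?K = "schur_iter K i"
  have p: "psd_kernel ?K" by (rule psd_kernel_schur_iter[OF K])
  have sym: "?K a b = ?K b a" for a b by (rule psd_kernel_sym[OF p])
  show ?case
  proof (cases "n = i")
    case True
    have "?K i i = 0 \<Longrightarrow> ?K m i = 0" by (rule psd_kernel_null[OF p])
    then have "?K i m - ?K i i * ?K m i / ?K i i = 0" using sym[of i m] by (cases "?K i i = 0") auto
    then show ?thesis using True by (simp add: schur_step_def)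
  next
    case False
    then have "n < i" using Suc.prems by simp
    then show ?thesis using Suc.IH by (simp add: schur_step_def)
  qed
qed simp

lemma cholesky_zero: "psd_kernel K \<Longrightarrow> n < i \<Longrightarrow> cholesky K n i = 0"
  by (simp add: cholesky_def schur_iter_zero)

text \<open>Each elimination step subtracts exactly the product of the entries in one Cholesky
  column. After \<open>N\<close> steps the remainder in row \<open>n\<close> is zero.\<close>

lemma cholesky_decomp:
  assumes K: "psd_kernel K" and N: "n < N"
  shows "K n m = (\<Sum>i<N. cholesky K n i * cholesky K m i)"
proof -
  have "K n m = (\<Sum>i<k. cholesky K n i * cholesky K m i) + schur_iter K k n m" for k
  proof (induction k)
    case (Suc k)
    have "0 \<le> schur_iter K k k k" by (rule psd_kernel_diag[OF psd_kernel_schur_iter[OF K]])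
    then have "cholesky K n k * cholesky K m k = schur_iter K k n k * schur_iter K k m k / schur_iter K k k k"
      by (simp add: cholesky_def)
    then show ?case using Suc by (simp add: schur_step_def)
  qed simp
  from this[of N] show ?thesis using schur_iter_zero[OF K N] by simp
qed

section \<open>Gaussian white noise\<close>

definition white_noise :: "('i \<Rightarrow> real) measure" where
  "white_noise = PiM UNIV (\<lambda>_. std_normal_distribution)"

lemma prob_space_white_noise: "prob_space white_noise"
  unfolding white_noise_def by (intro prob_space_PiM prob_space_normal_density) simp

lemma white_noise_component [measurable]: "(\<lambda>\<omega>. \<omega> i) \<in> borel_measurable white_noise"
proof -
  have "(\<lambda>\<omega>. \<omega> i) \<in> measurable white_noise std_normal_distribution"
    unfolding white_noise_def by (rule measurable_component_singleton) simp
  then show ?thesis by simp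
qed

lemma white_noise_char:
  fixes \<iota> :: "nat \<Rightarrow> 'i" and d :: "nat \<Rightarrow> real"
  assumes \<iota>: "inj \<iota>"
  shows "(CLINT \<omega>|white_noise. iexp (\<Sum>i<N. d i * \<omega> (\<iota> i))) = complex_of_real (exp (- (\<Sum>i<N. (d i)\<^sup>2) / 2))"
proof -
  interpret W: prob_space "white_noise :: ('i \<Rightarrow> real) measure" by (rule prob_space_white_noise)
  have P: "prob_space std_normal_distribution" by (rule prob_space_normal_density) simp
  have comp: "distr (white_noise :: ('i \<Rightarrow> real) measure) std_normal_distribution (\<lambda>\<omega>. \<omega> i) = std_normal_distribution" for i
    unfolding white_noise_def by (rule distr_PiM_component) (use P in auto)
  have ind0: "W.indep_vars (\<lambda>_. std_normal_distribution) (\<lambda>i \<omega>. \<omega> i) UNIV"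
  proof (subst W.indep_vars_iff_distr_eq_PiM')
    show "distr white_noise (\<Pi>\<^sub>M i\<in>UNIV. std_normal_distribution) (\<lambda>x. \<lambda>i\<in>UNIV. x i)
        = (\<Pi>\<^sub>M i\<in>UNIV. distr white_noise std_normal_distribution (\<lambda>\<omega>. \<omega> (i::'i)))"
      unfolding comp by (simp add: white_noise_def restrict_UNIV distr_id2)
    show "W.random_variable std_normal_distribution (\<lambda>\<omega>. \<omega> i)" for i :: 'i
      using white_noise_component[of i] by simp
  qed simp
  define d' where "d' x = d (the_inv \<iota> x)" for x
  have d': "d' (\<iota> i) = d i" for i unfolding d'_def by (simp add: the_inv_f_f[OF \<iota>])
  define A where "A = \<iota> ` {..<N}"
  have "W.indep_vars (\<lambda>_. std_normal_distribution) (\<lambda>i \<omega>. \<omega> i) A"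
    by (rule W.indep_vars_subset[OF ind0]) simp
  then have ind: "W.indep_vars (\<lambda>_. borel) (\<lambda>i \<omega>. d' i * \<omega> i) A"
    by (rule W.indep_vars_compose2[where Y="\<lambda>i x. d' i * x"]) simp
  have c1: "char (distr white_noise borel (\<lambda>\<omega>. d' i * \<omega> i)) 1 = complex_of_real (exp (- (d' i)\<^sup>2 / 2))" for i
  proof -
    have "char (distr white_noise borel (\<lambda>\<omega>. d' i * \<omega> i)) 1 = (CLINT \<omega>|white_noise. iexp (d' i * \<omega> i))"
      unfolding char_def by (subst integral_distr) auto
    also have "\<dots> = (CLINT x|distr white_noise std_normal_distribution (\<lambda>\<omega>. \<omega> i). iexp (d' i * x))"
      by (subst integral_distr) auto
    also have "\<dots> = char std_normal_distribution (d' i)" unfolding comp char_def ..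
    finally show ?thesis by (simp add: char_std_normal_distribution)
  qed
  have "(\<Sum>i<N. d i * \<omega> (\<iota> i)) = (\<Sum>i\<in>A. d' i * \<omega> i)" for \<omega> :: "'i \<Rightarrow> real"
    unfolding A_def by (subst sum.reindex) (auto intro: inj_on_subset[OF \<iota>] simp: d')
  then have "(CLINT \<omega>|white_noise. iexp (\<Sum>i<N. d i * \<omega> (\<iota> i))) = (CLINT \<omega>|white_noise. iexp (\<Sum>i\<in>A. d' i * \<omega> i))" by (simp only:)
  also have "\<dots> = char (distr white_noise borel (\<lambda>\<omega>. \<Sum>i\<in>A. d' i * \<omega> i)) 1"
    unfolding char_def by (subst integral_distr) auto
  also have "\<dots> = (\<Prod>i\<in>A. char (distr white_noise borel (\<lambda>\<omega>. d' i * \<omega> i)) 1)" by (rule W.char_distr_sum[OF ind])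
  also have "\<dots> = (\<Prod>i\<in>A. complex_of_real (exp (- (d' i)\<^sup>2 / 2)))" unfolding c1 ..
  also have "\<dots> = complex_of_real (exp (\<Sum>i\<in>A. - (d' i)\<^sup>2 / 2))"
    by (subst exp_sum) (auto simp: A_def)
  also have "(\<Sum>i\<in>A. - (d' i)\<^sup>2 / 2) = - (\<Sum>i\<in>A. (d' i)\<^sup>2) / 2"
    by (simp only: sum_divide_distrib[symmetric] sum_negf)
  also have "(\<Sum>i\<in>A. (d' i)\<^sup>2) = (\<Sum>i<N. (d i)\<^sup>2)"
    unfolding A_def by (subst sum.reindex) (auto intro: inj_on_subset[OF \<iota>] simp: d')
  finally show ?thesis .
qed

lemma (in prob_space) distr_eq_gauss_law:
  assumes [measurable]: "Y \<in> borel_measurable M" and q: "q \<ge> 0"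
    and char: "\<And>u. (CLINT \<omega>|M. iexp (u * Y \<omega>)) = complex_of_real (exp (- (q * u\<^sup>2) / 2))"
  shows "distr M borel Y = gauss_law q"
proof (rule Levy_uniqueness)
  show "real_distribution (distr M borel Y)" by (rule real_distribution_distr) measurable
  show "real_distribution (gauss_law q)" by (rule real_distribution_gauss_law[OF q])
  show "char (distr M borel Y) = char (gauss_law q)"
  proof
    fix u
    have "char (distr M borel Y) u = (CLINT \<omega>|M. iexp (u * Y \<omega>))"
      unfolding char_def by (subst integral_distr) auto
    then show "char (distr M borel Y) u = char (gauss_law q) u" by (simp only: char char_gauss_law[OF q])
  qed
qed

section \<open>The limiting covariance kernel\<close>

context emp_clt
begin

lemma emp_ind_sq_integrable: "integrable M (\<lambda>\<omega>. (emp (orthant_ind t) n \<omega>)\<^sup>2)"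
  by (rule integrable_emp_pow[of _ 1]) auto

lemma emp_ind_prod_integrable: "integrable M (\<lambda>\<omega>. emp (orthant_ind s) n \<omega> * emp (orthant_ind t) n \<omega>)"
proof (rule Bochner_Integration.integrable_bound)
  show "integrable M (\<lambda>\<omega>. (emp (orthant_ind s) n \<omega>)\<^sup>2 + (emp (orthant_ind t) n \<omega>)\<^sup>2)"
    by (intro Bochner_Integration.integrable_add emp_ind_sq_integrable)
  have "\<bar>a * b\<bar> \<le> a\<^sup>2 + b\<^sup>2" for a b :: real
  proof -
    have "0 \<le> (\<bar>a\<bar> - \<bar>b\<bar>)\<^sup>2 + a\<^sup>2 + b\<^sup>2" by simp
    also have "\<dots> = 2 * (a\<^sup>2 + b\<^sup>2 - \<bar>a * b\<bar>)" by (simp add: power2_diff abs_mult)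
    finally show ?thesis by simp
  qed
  then show "AE \<omega> in M. norm (emp (orthant_ind s) n \<omega> * emp (orthant_ind t) n \<omega>) \<le> norm ((emp (orthant_ind s) n \<omega>)\<^sup>2 + (emp (orthant_ind t) n \<omega>)\<^sup>2)"
    by simp
qed measurable

definition kern :: "ereal^'d \<Rightarrow> ereal^'d \<Rightarrow> real" where
  "kern s t = lim (\<lambda>n. \<integral>\<omega>. emp (orthant_ind s) n \<omega> * emp (orthant_ind t) n \<omega> \<partial>M)"

lemma emp_comb_sq_expand:
  assumes "finite I"
  shows "(\<integral>\<omega>. (emp_comb I e c n \<omega>)\<^sup>2 \<partial>M) =
    (\<Sum>i\<in>I. \<Sum>j\<in>I. c i * c j * (\<integral>\<omega>. emp (orthant_ind (e i)) n \<omega> * emp (orthant_ind (e j)) n \<omega> \<partial>M))"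
proof -
  have "(emp_comb I e c n \<omega>)\<^sup>2 = (\<Sum>i\<in>I. \<Sum>j\<in>I. c i * c j * (emp (orthant_ind (e i)) n \<omega> * emp (orthant_ind (e j)) n \<omega>))" for \<omega>
    unfolding emp_comb_def power2_eq_square sum_product by (simp add: mult_ac)
  then show ?thesis
    by (simp add: Bochner_Integration.integral_sum emp_ind_prod_integrable)
qed

text \<open>Polarisation: the product is a quarter of the difference of the squares of sum and
  difference, and both second moments converge by \<open>fidi_limit\<close>. Pairs of points are
  families indexed by \<open>bool\<close>.\<close>

lemma kern_limit: "(\<lambda>n. \<integral>\<omega>. emp (orthant_ind s) n \<omega> * emp (orthant_ind t) n \<omega> \<partial>M) \<longlonglongrightarrow> kern s t"
proof -
  let ?e = "case_bool s t"
  obtain Q1 where Q1: "(\<lambda>n. \<integral>\<omega>. (emp_comb UNIV ?e (\<lambda>_. 1) n \<omega>)\<^sup>2 \<partial>M) \<longlonglongrightarrow> Q1"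
    using fidi_limit[of UNIV ?e "\<lambda>_. 1"] by auto
  obtain Q2 where Q2: "(\<lambda>n. \<integral>\<omega>. (emp_comb UNIV ?e (case_bool 1 (-1)) n \<omega>)\<^sup>2 \<partial>M) \<longlonglongrightarrow> Q2"
    using fidi_limit[of UNIV ?e "case_bool 1 (-1)"] by auto
  have eq: "(\<integral>\<omega>. emp (orthant_ind s) n \<omega> * emp (orthant_ind t) n \<omega> \<partial>M) =
    ((\<integral>\<omega>. (emp_comb UNIV ?e (\<lambda>_. 1) n \<omega>)\<^sup>2 \<partial>M) - (\<integral>\<omega>. (emp_comb UNIV ?e (case_bool 1 (-1)) n \<omega>)\<^sup>2 \<partial>M)) / 4" for n
    by (simp add: emp_comb_sq_expand UNIV_bool mult.commute)
  have "(\<lambda>n. \<integral>\<omega>. emp (orthant_ind s) n \<omega> * emp (orthant_ind t) n \<omega> \<partial>M) \<longlonglongrightarrow> (Q1 - Q2) / 4"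
    unfolding eq by (intro tendsto_intros Q1 Q2) simp
  then have "convergent (\<lambda>n. \<integral>\<omega>. emp (orthant_ind s) n \<omega> * emp (orthant_ind t) n \<omega> \<partial>M)"
    by (rule convergentI)
  then show ?thesis unfolding kern_def by (simp add: convergent_LIMSEQ_iff)
qed

lemma kern_sym: "kern s t = kern t s"
  unfolding kern_def by (simp add: mult.commute)

definition quad :: "'j set \<Rightarrow> ('j \<Rightarrow> ereal^'d) \<Rightarrow> ('j \<Rightarrow> real) \<Rightarrow> real" where
  "quad I e c = (\<Sum>i\<in>I. \<Sum>j\<in>I. c i * c j * kern (e i) (e j))"

lemma quad_limit:
  assumes I: "finite I"
  shows "(\<lambda>n. \<integral>\<omega>. (emp_comb I e c n \<omega>)\<^sup>2 \<partial>M) \<longlonglongrightarrow> quad I e c"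
  unfolding emp_comb_sq_expand[OF I] quad_def by (intro tendsto_intros kern_limit)

lemma quad_nonneg: "finite I \<Longrightarrow> 0 \<le> quad I e c"
  by (rule LIMSEQ_le_const[OF quad_limit]) auto

lemma quad_char:
  assumes I: "finite I"
  shows "(\<lambda>n. CLINT \<omega>|M. iexp (emp_comb I e c n \<omega>)) \<longlonglongrightarrow> complex_of_real (exp (- quad I e c / 2))"
proof -
  obtain Q where Q: "(\<lambda>n. \<integral>\<omega>. (emp_comb I e c n \<omega>)\<^sup>2 \<partial>M) \<longlonglongrightarrow> Q"
    "(\<lambda>n. CLINT \<omega>|M. iexp (emp_comb I e c n \<omega>)) \<longlonglongrightarrow> complex_of_real (exp (- Q / 2))"
    using fidi_limit[OF I, of e c] by auto
  have "Q = quad I e c" by (rule LIMSEQ_unique[OF Q(1) quad_limit[OF I]])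
  then show ?thesis using Q(2) by simp
qed

lemma quad_scale: "quad I e (\<lambda>j. u * c j) = quad I e c * u\<^sup>2"
  unfolding quad_def sum_distrib_right by (simp add: power2_eq_square mult_ac)

definition close :: "nat \<Rightarrow> ereal^'d \<Rightarrow> ereal^'d \<Rightarrow> bool" where
  "close k s t \<longleftrightarrow> (\<forall>i. \<bar>marg i (s $ i) - marg i (t $ i)\<bar> \<le> 1 / 2 ^ k)"

lemma quad_modulus: "\<exists>C>0. \<forall>k s t. close k s t \<longrightarrow> quad UNIV (case_bool s t) (case_bool 1 (-1)) \<le> C * \<rho> ^ k"
proof -
  obtain C where C: "C > 0" and le: "\<And>k s t n. 1 \<le> n \<Longrightarrow> (\<forall>i. \<bar>marg i (s $ i) - marg i (t $ i)\<bar> \<le> 1 / 2 ^ k) \<Longrightarrow>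
     (\<integral>\<omega>. (emp (orthant_ind s) n \<omega> - emp (orthant_ind t) n \<omega>)\<^sup>2 \<partial>M) \<le> C * \<rho> ^ k"
    using square_modulus by blast
  show ?thesis
  proof (intro exI[of _ C] conjI C allI impI)
    fix k s t assume st: "close k s t"
    have eq: "emp_comb UNIV (case_bool s t) (case_bool 1 (-1)) n \<omega> = emp (orthant_ind s) n \<omega> - emp (orthant_ind t) n \<omega>" for n \<omega>
      by (simp add: emp_comb_def UNIV_bool)
    have "(\<lambda>n. \<integral>\<omega>. (emp_comb UNIV (case_bool s t) (case_bool 1 (-1)) n \<omega>)\<^sup>2 \<partial>M) \<longlonglongrightarrow> quad UNIV (case_bool s t) (case_bool 1 (-1))"
      by (rule quad_limit) simp
    then show "quad UNIV (case_bool s t) (case_bool 1 (-1)) \<le> C * \<rho> ^ k"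
      unfolding eq by (rule LIMSEQ_le_const2) (use le st in \<open>auto simp: close_def intro!: exI[of _ 1]\<close>)
  qed
qed

lemma close_proj: "close k t (proj k t)"
  unfolding close_def marg_proj using marg_proj_diff by blast

text \<open>By \<open>square_modulus\<close> the projection error is uniform in \<open>n\<close>, so
  the limits in \<open>k\<close> and \<open>n\<close> may be exchanged. This later carries the law
  from grid points to arbitrary ones.\<close>

lemma quad_proj_limit:
  assumes I: "finite I"
  shows "(\<lambda>k. quad I (\<lambda>j. proj k (e j)) c) \<longlonglongrightarrow> quad I e c"
proof -
  obtain C where C: "C > 0" and le: "\<And>k s t n. 1 \<le> n \<Longrightarrow> (\<forall>i. \<bar>marg i (s $ i) - marg i (t $ i)\<bar> \<le> 1 / 2 ^ k) \<Longrightarrow>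
     (\<integral>\<omega>. (emp (orthant_ind s) n \<omega> - emp (orthant_ind t) n \<omega>)\<^sup>2 \<partial>M) \<le> C * \<rho> ^ k"
    using square_modulus by blast
  let ?Y = "\<lambda>n. emp_comb I e c n" and ?Z = "\<lambda>k n. emp_comb I (\<lambda>j. proj k (e j)) c n"
  define \<delta> where "\<delta> k = (\<Sum>j\<in>I. \<bar>c j\<bar> * sqrt (C * \<rho> ^ k))" for k
  have d: "\<delta> \<longlonglongrightarrow> 0"
  proof -
    have "\<delta> \<longlonglongrightarrow> (\<Sum>j\<in>I. \<bar>c j\<bar> * sqrt (C * 0))" unfolding \<delta>_def
      using rho_bounds by (intro tendsto_intros LIMSEQ_realpow_zero) auto
    then show ?thesis by simp
  qed
  have sqi: "integrable M (\<lambda>\<omega>. (emp_comb I e' c n \<omega>)\<^sup>2)" for e' n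
    unfolding emp_comb_def by (rule integrable_emp_sum_sq[OF I]) auto
  have idiff: "integrable M (\<lambda>\<omega>. (emp (orthant_ind s) n \<omega> - emp (orthant_ind t) n \<omega>)\<^sup>2)" for s t n
  proof -
    have "integrable M (\<lambda>\<omega>. (emp (\<lambda>x. orthant_ind s x - orthant_ind t x) n \<omega>)\<^sup>2)"
      by (rule integrable_emp_pow[of _ 1]) (measurable, auto simp: orthant_ind_def)
    then show ?thesis by (simp add: emp_diff)
  qed
  have "\<exists>L. (\<lambda>n. L2 (?Y n)) \<longlonglongrightarrow> L \<and> (\<lambda>k. sqrt (quad I (\<lambda>j. proj k (e j)) c)) \<longlonglongrightarrow> L"
  proof (rule uniform_approx_limit[where x' = "\<lambda>k n. L2 (?Z k n)" and \<delta> = \<delta>])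
    fix k n :: nat assume n: "1 \<le> n"
    let ?D = "\<lambda>j \<omega>. c j * (emp (orthant_ind (e j)) n \<omega> - emp (orthant_ind (proj k (e j))) n \<omega>)"
    have eq: "?Y n \<omega> - ?Z k n \<omega> = (\<Sum>j\<in>I. ?D j \<omega>)" for \<omega>
      unfolding emp_comb_def by (simp add: sum_subtractf[symmetric] right_diff_distrib)
    have *: "integrable M (\<lambda>\<omega>. (\<Sum>j\<in>I. ?D j \<omega>)\<^sup>2) \<and> L2 (\<lambda>\<omega>. \<Sum>j\<in>I. ?D j \<omega>) \<le> (\<Sum>j\<in>I. L2 (?D j))"
      using idiff by (intro L2_sum_le[OF I]) (auto simp: power_mult_distrib)
    have "L2 (?D j) \<le> \<bar>c j\<bar> * sqrt (C * \<rho> ^ k)" for j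
      unfolding L2_scale by (intro mult_left_mono) (auto simp: L2_def intro!: le n close_proj[unfolded close_def])
    then have "(\<Sum>j\<in>I. L2 (?D j)) \<le> \<delta> k" unfolding \<delta>_def by (intro sum_mono)
    moreover have "\<bar>L2 (?Y n) - L2 (?Z k n)\<bar> \<le> L2 (\<lambda>\<omega>. ?Y n \<omega> - ?Z k n \<omega>)"
      by (rule L2_diff_le[OF sqi sqi]) (use * in \<open>simp add: eq\<close>)
    ultimately show "norm (L2 (?Y n) - L2 (?Z k n)) \<le> \<delta> k" using * unfolding eq real_norm_def by linarith
  next
    fix k show "(\<lambda>n. L2 (?Z k n)) \<longlonglongrightarrow> sqrt (quad I (\<lambda>j. proj k (e j)) c)"
      unfolding L2_def by (intro tendsto_intros quad_limit I)
  qed (rule d)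
  then obtain L where L: "(\<lambda>n. L2 (?Y n)) \<longlonglongrightarrow> L" "(\<lambda>k. sqrt (quad I (\<lambda>j. proj k (e j)) c)) \<longlonglongrightarrow> L" by auto
  have "(\<lambda>n. L2 (?Y n)) \<longlonglongrightarrow> sqrt (quad I e c)" unfolding L2_def by (intro tendsto_intros quad_limit I)
  then have Leq: "L = sqrt (quad I e c)" using L(1) LIMSEQ_unique by blast
  have "(\<lambda>k. (sqrt (quad I (\<lambda>j. proj k (e j)) c))\<^sup>2) \<longlonglongrightarrow> (sqrt (quad I e c))\<^sup>2"
    by (rule tendsto_power[OF L(2)[unfolded Leq]])
  then show ?thesis unfolding real_sqrt_pow2[OF quad_nonneg[OF I]] .
qed

section \<open>The process on the grids\<close>

definition grids :: "(ereal^'d) set" where "grids = (\<Union>k. grid k)"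

lemma countable_grids: "countable grids"
  unfolding grids_def by (rule countable_UN[OF countableI_type]) (rule countable_finite[OF grid_finite_card(1)])

definition grid_enum :: "nat \<Rightarrow> ereal^'d" where "grid_enum = from_nat_into grids"

abbreviation grid_num :: "ereal^'d \<Rightarrow> nat" where "grid_num \<equiv> to_nat_on grids"

lemma grid_enum_num: "t \<in> grids \<Longrightarrow> grid_enum (grid_num t) = t"
  unfolding grid_enum_def by (rule from_nat_into_to_nat_on[OF countable_grids])

text \<open>The white noise is indexed by the index space of the process, so that the process is defined on the
  space of paths; these distinct points carry the countably many coordinates that it uses.\<close>

definition coord :: "nat \<Rightarrow> ereal^'d" where "coord i = (\<chi> _. ereal (real i))"

lemma inj_coord: "inj coord"
  by (rule injI) (simp add: coord_def vec_eq_iff)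

abbreviation chol :: "nat \<Rightarrow> nat \<Rightarrow> real" where
  "chol \<equiv> cholesky (\<lambda>n m. kern (grid_enum n) (grid_enum m))"

text \<open>The Cholesky factor is lower triangular, so the sum stops at the number of
  \<open>t\<close>. The formula is meant for points of \<open>grids\<close>, where the number
  identifies the point.\<close>

definition W0 :: "ereal^'d \<Rightarrow> (ereal^'d \<Rightarrow> real) \<Rightarrow> real" where
  "W0 t \<omega> = (\<Sum>i<Suc (grid_num t). chol (grid_num t) i * \<omega> (coord i))"

lemma W0_meas [measurable]: "W0 t \<in> borel_measurable white_noise"
  unfolding W0_def by measurable

lemma psd_kern: "psd_kernel (\<lambda>n m. kern (grid_enum n) (grid_enum m))"
  unfolding psd_kernel_def using kern_sym quad_nonneg[where e=grid_enum] by (auto simp: quad_def)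

text \<open>Padding with zero entries writes all members of the family as linear forms in the same
  \<open>N\<close> coordinates. The variance is then built from inner products of Cholesky rows,
  which are the values of \<open>kern\<close>.\<close>

lemma W0_char:
  assumes I: "finite I" and e: "\<And>j. j \<in> I \<Longrightarrow> e j \<in> grids"
  shows "(CLINT \<omega>|white_noise. iexp (\<Sum>j\<in>I. c j * W0 (e j) \<omega>)) = complex_of_real (exp (- quad I e c / 2))"
proof -
  define N where "N = Suc (Max (insert 0 ((\<lambda>j. grid_num (e j)) ` I)))"
  have N: "grid_num (e j) < N" if "j \<in> I" for j
    unfolding N_def using I that by (auto simp: less_Suc_eq_le intro!: Max_ge)
  define d where "d i = (\<Sum>j\<in>I. c j * chol (grid_num (e j)) i)" for i
  have w: "W0 (e j) \<omega> = (\<Sum>i<N. chol (grid_num (e j)) i * \<omega> (coord i))" if "j \<in> I" for j \<omega>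
    unfolding W0_def using N[OF that] cholesky_zero[OF psd_kern]
    by (intro sum.mono_neutral_left) auto
  have "(\<Sum>j\<in>I. c j * W0 (e j) \<omega>) = (\<Sum>i<N. d i * \<omega> (coord i))" for \<omega>
  proof -
    have "(\<Sum>j\<in>I. c j * W0 (e j) \<omega>) = (\<Sum>j\<in>I. \<Sum>i<N. c j * chol (grid_num (e j)) i * \<omega> (coord i))"
      by (intro sum.cong refl) (simp add: w sum_distrib_left mult.assoc)
    also have "\<dots> = (\<Sum>i<N. \<Sum>j\<in>I. c j * chol (grid_num (e j)) i * \<omega> (coord i))" by (rule sum.swap)
    finally show ?thesis by (simp add: d_def sum_distrib_right)
  qed
  then have "(CLINT \<omega>|white_noise. iexp (\<Sum>j\<in>I. c j * W0 (e j) \<omega>)) = (CLINT \<omega>|white_noise. iexp (\<Sum>i<N. d i * \<omega> (coord i)))" by (simp only:)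
  also have "\<dots> = complex_of_real (exp (- (\<Sum>i<N. (d i)\<^sup>2) / 2))" by (rule white_noise_char[OF inj_coord])
  also have "(\<Sum>i<N. (d i)\<^sup>2) = quad I e c"
  proof -
    have "(\<Sum>i<N. (d i)\<^sup>2) = (\<Sum>i<N. \<Sum>j\<in>I. \<Sum>l\<in>I. c j * c l * (chol (grid_num (e j)) i * chol (grid_num (e l)) i))"
      unfolding d_def power2_eq_square sum_product by (simp add: mult_ac)
    also have "\<dots> = (\<Sum>j\<in>I. \<Sum>i<N. \<Sum>l\<in>I. c j * c l * (chol (grid_num (e j)) i * chol (grid_num (e l)) i))" by (rule sum.swap)
    also have "\<dots> = (\<Sum>j\<in>I. \<Sum>l\<in>I. \<Sum>i<N. c j * c l * (chol (grid_num (e j)) i * chol (grid_num (e l)) i))"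
      by (intro sum.cong refl sum.swap)
    also have "\<dots> = quad I e c" unfolding quad_def
    proof (intro sum.cong refl)
      fix j l assume jl: "j \<in> I" "l \<in> I"
      have "(\<Sum>i<N. chol (grid_num (e j)) i * chol (grid_num (e l)) i) = kern (e j) (e l)"
        using cholesky_decomp[OF psd_kern N[OF jl(1)], of "grid_num (e l)"] jl by (simp add: grid_enum_num e)
      then show "(\<Sum>i<N. c j * c l * (chol (grid_num (e j)) i * chol (grid_num (e l)) i)) = c j * c l * kern (e j) (e l)"
        by (simp only: sum_distrib_left[symmetric])
    qed
    finally show ?thesis .
  qed
  finally show ?thesis .
qed

lemma grid_subset_grids: "t \<in> grid k \<Longrightarrow> t \<in> grids"
  unfolding grids_def by (rule UN_I[OF UNIV_I])

lemma grid_mono_Suc: "grid k \<subseteq> grid (Suc k)"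
proof
  fix t assume "t \<in> grid k"
  then obtain j where j: "\<forall>i. j i \<le> 2 ^ k" "t = gridpt k j" unfolding grid_def by (elim imageE CollectE) (rule that)
  have "t = gridpt (Suc k) (\<lambda>i. 2 * j i)" unfolding j(2) gridpt_def by simp
  moreover have "\<forall>i. 2 * j i \<le> 2 ^ Suc k" using j(1) by simp
  ultimately show "t \<in> grid (Suc k)" unfolding grid_def by (intro image_eqI[of _ _ "\<lambda>i. 2 * j i"] CollectI)
qed

lemma close_proj_Suc: "close (Suc k) (proj (Suc k) t) (proj k t)"
  unfolding close_def
proof
  fix i
  let ?a = "idx (Suc k) t i"
  have m: "marg i (proj k t $ i) = real (2 * (?a div 2)) / 2 ^ Suc k"
    unfolding marg_proj idx_Suc_div[of k] by simp
  have "2 * (?a div 2) \<le> ?a" "?a \<le> 2 * (?a div 2) + 1" by auto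
  then have "real (2 * (?a div 2)) \<le> real ?a" "real ?a \<le> real (2 * (?a div 2) + 1)" by (simp_all only: of_nat_le_iff)
  then have "\<bar>real ?a - real (2 * (?a div 2))\<bar> \<le> 1" unfolding of_nat_add by simp
  then have "\<bar>real ?a - real (2 * (?a div 2))\<bar> / 2 ^ Suc k \<le> 1 / 2 ^ Suc k" by (intro divide_right_mono) simp_all
  then show "\<bar>marg i (proj (Suc k) t $ i) - marg i (proj k t $ i)\<bar> \<le> 1 / 2 ^ Suc k"
    unfolding m marg_proj[of i "Suc k"] by (simp only: diff_divide_distrib[symmetric] abs_divide abs_power2 power_abs abs_numeral)
qed

lemma proj_grid_id:
  assumes "t \<in> grid k"
  shows "proj k t = t"
proof -
  obtain j where j: "\<forall>i. j i \<le> 2 ^ k" "t = gridpt k j" using assms unfolding grid_def by (elim imageE CollectE) (rule that)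
  show ?thesis unfolding proj_def j(2) idx_gridpt[OF j(1)] ..
qed

lemma grid_mono: "k \<le> l \<Longrightarrow> t \<in> grid k \<Longrightarrow> t \<in> grid l"
  by (induction rule: dec_induct) (use grid_mono_Suc in auto)

text \<open>Increments over close points at level \<open>k\<close> have standard deviation of order
  \<open>\<rho> ^ (k / 2)\<close>. A threshold \<open>\<rho> ^ (k / 4)\<close> is summable and still
  larger by a geometric factor.\<close>

definition \<zeta> :: real where "\<zeta> = sqrt (sqrt \<rho>)"

lemma zeta_bounds: "0 < \<zeta>" "\<zeta> < 1"
  unfolding \<zeta>_def using rho_bounds by auto

section \<open>Continuous extension from the grids\<close>

definition bad :: "nat \<Rightarrow> (ereal^'d \<Rightarrow> real) set" where
  "bad k = (\<Union>(s, t)\<in>{(s, t) \<in> grid k \<times> grid k. close k s t}. {\<omega> \<in> space white_noise. \<bar>W0 s \<omega> - W0 t \<omega>\<bar> > \<zeta> ^ k})"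

lemma finite_close_pairs: "finite {(s, t) \<in> grid k \<times> grid k. close k s t}"
  by (rule finite_subset[of _ "grid k \<times> grid k"]) (use grid_finite_card(1) in auto)

lemma bad_meas [measurable]: "bad k \<in> sets white_noise"
  unfolding bad_def
proof (rule sets.finite_UN[OF finite_close_pairs])
  fix z assume "z \<in> {(s, t) \<in> grid k \<times> grid k. close k s t}"
  show "(case z of (s, t) \<Rightarrow> {\<omega> \<in> space white_noise. \<bar>W0 s \<omega> - W0 t \<omega>\<bar> > \<zeta> ^ k}) \<in> sets white_noise"
    unfolding case_prod_beta by measurable
qed

sublocale wn: prob_space "white_noise :: (ereal^'d \<Rightarrow> real) measure"
  by (rule prob_space_white_noise)

lemma W0_comb_distr:
  assumes I: "finite I" and e: "\<And>j. j \<in> I \<Longrightarrow> e j \<in> grids"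
  shows "distr white_noise borel (\<lambda>\<omega>. \<Sum>j\<in>I. c j * W0 (e j) \<omega>) = gauss_law (quad I e c)"
proof (rule wn.distr_eq_gauss_law)
  fix u
  have "(CLINT \<omega>|white_noise. iexp (\<Sum>j\<in>I. (u * c j) * W0 (e j) \<omega>)) = complex_of_real (exp (- quad I e (\<lambda>j. u * c j) / 2))"
    by (rule W0_char[OF I e])
  then show "(CLINT \<omega>|white_noise. iexp (u * (\<Sum>j\<in>I. c j * W0 (e j) \<omega>))) = complex_of_real (exp (- (quad I e c * u\<^sup>2) / 2))"
    unfolding quad_scale by (simp only: sum_distrib_left mult.assoc)
qed (use quad_nonneg[OF I] in \<open>measurable\<close>)

lemma W0_diff_moment:
  assumes st: "s \<in> grids" "t \<in> grids"
  defines "q \<equiv> quad UNIV (case_bool s t) (case_bool 1 (-1))"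
  shows "integrable white_noise (\<lambda>\<omega>. (W0 s \<omega> - W0 t \<omega>) ^ (2 * l))"
    and "(\<integral>\<omega>. (W0 s \<omega> - W0 t \<omega>) ^ (2 * l) \<partial>white_noise) = q ^ l * (fact (2 * l) / (2 ^ l * fact l))"
proof -
  have q: "q \<ge> 0" unfolding q_def by (rule quad_nonneg) simp
  have "distr white_noise borel (\<lambda>\<omega>. \<Sum>j\<in>UNIV. case_bool 1 (-1) j * W0 (case_bool s t j) \<omega>) = gauss_law q"
    unfolding q_def by (rule W0_comb_distr) (use st in \<open>auto split: bool.split\<close>)
  moreover have "(\<Sum>j\<in>UNIV. case_bool 1 (-1) j * W0 (case_bool s t j) \<omega>) = W0 s \<omega> - W0 t \<omega>" for \<omega>
    by (simp add: UNIV_bool)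
  ultimately have d: "gauss_law q = distr white_noise borel (\<lambda>\<omega>. W0 s \<omega> - W0 t \<omega>)" by simp
  show "integrable white_noise (\<lambda>\<omega>. (W0 s \<omega> - W0 t \<omega>) ^ (2 * l))"
    using gauss_law_moment(1)[OF q, of l] unfolding d by (subst (asm) integrable_distr_eq) auto
  show "(\<integral>\<omega>. (W0 s \<omega> - W0 t \<omega>) ^ (2 * l) \<partial>white_noise) = q ^ l * (fact (2 * l) / (2 ^ l * fact l))"
    using gauss_law_moment(2)[OF q, of l] unfolding d by (subst (asm) integral_distr) auto
qed

text \<open>Gaussian increments have moments of every order. At order \<open>2 * l\<close> a single
  pair contributes at most \<open>c * (\<sigma> ^ l) ^ k\<close>, while the number of pairs grows
  like \<open>(b * b) ^ k\<close>, so a large \<open>l\<close> wins.\<close>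

lemma bad_summable: "summable (\<lambda>k. wn.prob (bad k))"
proof -
  obtain C where C: "C > 0" and qm: "\<forall>k s t. close k s t \<longrightarrow> quad UNIV (case_bool s t) (case_bool 1 (-1)) \<le> C * \<rho> ^ k"
    using quad_modulus by (elim exE conjE) (rule that)
  define \<sigma> where "\<sigma> = sqrt \<rho>"
  have \<sigma>: "0 < \<sigma>" "\<sigma> < 1" "\<sigma> * \<sigma> = \<rho>" "\<zeta>\<^sup>2 = \<sigma>" unfolding \<sigma>_def \<zeta>_def using rho_bounds by auto
  define b :: real where "b = 2 ^ CARD('d)"
  have b: "b > 0" unfolding b_def by simp
  \<comment> \<open>The moment order is fixed here: it makes the ratio
    \<open>r0 = b * b * \<sigma> ^ l\<close> less than \<open>1 / 2\<close>.\<close>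
  have "\<exists>l. \<sigma> ^ l < 1 / (2 * (b * b))" by (rule real_arch_pow_inv[OF _ \<sigma>(2)]) (use b in simp)
  then obtain l where l: "\<sigma> ^ l < 1 / (2 * (b * b))" by (elim exE) (rule that)
  define r0 where "r0 = b * b * \<sigma> ^ l"
  have r0: "0 \<le> r0" "r0 < 1"
  proof -
    show "0 \<le> r0" unfolding r0_def using b \<sigma> by simp
    have "r0 < b * b * (1 / (2 * (b * b)))" unfolding r0_def using b l by (intro mult_strict_left_mono) auto
    also have "\<dots> = 1 / 2" using b by simp
    finally show "r0 < 1" by simp
  qed
  define c where "c = C ^ l * (fact (2 * l) / (2 ^ l * fact l))"
  have c: "c \<ge> 0" unfolding c_def using C by simp
  have bound: "wn.prob (bad k) \<le> b * b * c * r0 ^ k" for k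
  proof -
    let ?S = "{(s, t) \<in> grid k \<times> grid k. close k s t}"
    have zk: "\<zeta> ^ k > 0" using zeta_bounds by simp
    have "wn.prob (bad k) \<le> (\<Sum>z\<in>?S. wn.prob (case z of (s, t) \<Rightarrow> {\<omega> \<in> space white_noise. \<bar>W0 s \<omega> - W0 t \<omega>\<bar> > \<zeta> ^ k}))"
      unfolding bad_def
    proof (rule wn.finite_measure_subadditive_finite[OF finite_close_pairs])
      show "(\<lambda>z. case z of (s, t) \<Rightarrow> {\<omega> \<in> space white_noise. \<bar>W0 s \<omega> - W0 t \<omega>\<bar> > \<zeta> ^ k}) ` ?S \<subseteq> sets white_noise"
        unfolding case_prod_beta by (intro image_subsetI) measurable
    qed
    also have "\<dots> \<le> (\<Sum>z\<in>?S. c * (\<sigma> ^ l) ^ k)"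
    proof (rule sum_mono)
      fix z assume z: "z \<in> ?S"
      obtain s t where zst: "z = (s, t)" by (cases z)
      have st: "s \<in> grid k" "t \<in> grid k" "close k s t" using z unfolding zst by simp_all
      note g = grid_subset_grids[OF st(1)] grid_subset_grids[OF st(2)]
      let ?q = "quad UNIV (case_bool s t) (case_bool 1 (-1))"
      have q: "0 \<le> ?q" by (rule quad_nonneg) simp
      have "wn.prob {\<omega> \<in> space white_noise. \<bar>W0 s \<omega> - W0 t \<omega>\<bar> > \<zeta> ^ k} \<le>
        (\<integral>\<omega>. (W0 s \<omega> - W0 t \<omega>) ^ (2 * l) \<partial>white_noise) / (\<zeta> ^ k) ^ (2 * l)"
        by (rule wn.prob_abs_gt_le_moment[OF _ W0_diff_moment(1)[OF g] zk]) measurable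
      also have "\<dots> = ?q ^ l * (fact (2 * l) / (2 ^ l * fact l)) / (\<zeta> ^ k) ^ (2 * l)"
        unfolding W0_diff_moment(2)[OF g] ..
      also have "\<dots> \<le> (C * \<rho> ^ k) ^ l * (fact (2 * l) / (2 ^ l * fact l)) / (\<zeta> ^ k) ^ (2 * l)"
        using zk by (intro divide_right_mono mult_right_mono power_mono qm[rule_format] st q) auto
      also have "\<dots> = c * ((\<rho> ^ k) ^ l / (\<zeta> ^ k) ^ (2 * l))"
      proof -
        have "A * B * F / Z = A * F * (B / Z)" for A B F Z :: real by simp
        then show ?thesis unfolding c_def power_mult_distrib[of C] by this
      qed
      also have "(\<rho> ^ k) ^ l / (\<zeta> ^ k) ^ (2 * l) = (\<sigma> ^ l) ^ k"
      proof -
        have "(\<zeta> ^ k) ^ (2 * l) = (\<zeta>\<^sup>2) ^ (k * l)" by (simp add: power_mult[symmetric] mult_ac)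
        then have e1: "(\<zeta> ^ k) ^ (2 * l) = \<sigma> ^ (k * l)" unfolding \<sigma>(4) .
        have "(\<rho> ^ k) ^ l = (\<sigma> * \<sigma>) ^ (k * l)" unfolding \<sigma>(3) by (simp add: power_mult[symmetric])
        then have e2: "(\<rho> ^ k) ^ l = \<sigma> ^ (k * l) * \<sigma> ^ (k * l)" by (simp only: power_mult_distrib)
        show ?thesis unfolding e1 e2 using \<sigma>(1) by (simp add: power_mult[symmetric] mult.commute)
      qed
      finally show "wn.prob (case z of (s, t) \<Rightarrow> {\<omega> \<in> space white_noise. \<bar>W0 s \<omega> - W0 t \<omega>\<bar> > \<zeta> ^ k}) \<le> c * (\<sigma> ^ l) ^ k"
        unfolding zst by simp
    qed
    also have "\<dots> = real (card ?S) * (c * (\<sigma> ^ l) ^ k)" by (rule sum_constant)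
    also have "\<dots> \<le> (b * b ^ k) * (b * b ^ k) * (c * (\<sigma> ^ l) ^ k)"
    proof (rule mult_right_mono)
      have "card ?S \<le> card (grid k \<times> grid k)" by (rule card_mono) (use grid_finite_card(1) in auto)
      then have "card ?S \<le> card (grid k) * card (grid k)" by (simp only: card_cartesian_product)
      then have "real (card ?S) \<le> real (card (grid k) * card (grid k))" by (simp only: of_nat_le_iff)
      also have "\<dots> = real (card (grid k)) * real (card (grid k))" by (rule of_nat_mult)
      also have "\<dots> \<le> (b * b ^ k) * (b * b ^ k)"
        unfolding b_def by (intro mult_mono grid_finite_card(2)) auto
      finally show "real (card ?S) \<le> (b * b ^ k) * (b * b ^ k)" .
      show "0 \<le> c * (\<sigma> ^ l) ^ k" using c \<sigma> by simp
    qed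
    also have "\<dots> = b * b * c * r0 ^ k" unfolding r0_def by (simp only: power_mult_distrib mult_ac)
    finally show ?thesis .
  qed
  show ?thesis
  proof (rule summable_comparison_test')
    show "summable (\<lambda>k. b * b * c * r0 ^ k)" using r0 by (intro summable_mult summable_geometric) simp
    show "norm (wn.prob (bad k)) \<le> b * b * c * r0 ^ k" if "k \<ge> 0" for k using bound[of k] by simp
  qed
qed

definition good :: "(ereal^'d \<Rightarrow> real) \<Rightarrow> bool" where
  "good \<omega> \<longleftrightarrow> (\<exists>k0. \<forall>k\<ge>k0. \<omega> \<notin> bad k)"

lemma good_pred [measurable]: "Measurable.pred white_noise good"
  unfolding good_def[abs_def] by measurable

lemma AE_good: "AE \<omega> in white_noise. good \<omega>"
proof -
  have "AE \<omega> in white_noise. eventually (\<lambda>k. \<omega> \<in> space white_noise - bad k) sequentially"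
    by (rule borel_cantelli_AE1[OF bad_meas _ bad_summable]) (simp add: wn.emeasure_eq_measure)
  then show ?thesis
    by eventually_elim (auto simp: good_def eventually_sequentially)
qed

text \<open>Setting the process to 0 off the good event makes every path continuous, hence a member
  of \<open>Dspace\<close>.\<close>

definition W :: "ereal^'d \<Rightarrow> (ereal^'d \<Rightarrow> real) \<Rightarrow> real" where
  "W t \<omega> = (if good \<omega> then lim (\<lambda>k. W0 (proj k t) \<omega>) else 0)"

lemma space_white_noise: "space white_noise = UNIV"
  unfolding white_noise_def space_PiM by simp

lemma good_increment:
  assumes "good \<omega>"
  shows "\<exists>k0. \<forall>k\<ge>k0. \<forall>s\<in>grid k. \<forall>t\<in>grid k. close k s t \<longrightarrow> \<bar>W0 s \<omega> - W0 t \<omega>\<bar> \<le> \<zeta> ^ k"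
proof -
  obtain k0 where k0: "\<forall>k\<ge>k0. \<omega> \<notin> bad k" using assms unfolding good_def by (elim exE) (rule that)
  show ?thesis
  proof (intro exI[of _ k0] allI impI ballI)
    fix k s t assume k: "k0 \<le> k" and st: "s \<in> grid k" "t \<in> grid k" "close k s t"
    show "\<bar>W0 s \<omega> - W0 t \<omega>\<bar> \<le> \<zeta> ^ k"
    proof (rule ccontr)
      assume "\<not> \<bar>W0 s \<omega> - W0 t \<omega>\<bar> \<le> \<zeta> ^ k"
      then have "\<omega> \<in> {\<omega> \<in> space white_noise. \<bar>W0 s \<omega> - W0 t \<omega>\<bar> > \<zeta> ^ k}" by (simp add: space_white_noise)
      moreover have "(s, t) \<in> {(s, t) \<in> grid k \<times> grid k. close k s t}" using st by simp
      ultimately have "\<omega> \<in> bad k" unfolding bad_def by (intro UN_I[of "(s, t)"]) simp_all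
      then show False using k0[rule_format, OF k] by simp
    qed
  qed
qed

text \<open>Projections of a point to consecutive levels are close, so their increments are
  dominated by a geometric series from level \<open>k0\<close> on. As \<open>k0\<close> depends on
  the path alone, the error bound is uniform in \<open>t\<close>.\<close>

lemma good_uniform:
  assumes g: "good \<omega>"
  shows "\<exists>k0. (\<forall>k\<ge>k0. \<forall>s\<in>grid k. \<forall>t\<in>grid k. close k s t \<longrightarrow> \<bar>W0 s \<omega> - W0 t \<omega>\<bar> \<le> \<zeta> ^ k) \<and>
    (\<forall>t. (\<lambda>k. W0 (proj k t) \<omega>) \<longlonglongrightarrow> W t \<omega>) \<and>
    (\<forall>k\<ge>k0. \<forall>t. \<bar>W t \<omega> - W0 (proj k t) \<omega>\<bar> \<le> \<zeta> ^ k / (1 - \<zeta>))"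
proof -
  obtain k0 where k0: "\<forall>k\<ge>k0. \<forall>s\<in>grid k. \<forall>t\<in>grid k. close k s t \<longrightarrow> \<bar>W0 s \<omega> - W0 t \<omega>\<bar> \<le> \<zeta> ^ k"
    using good_increment[OF g] by (elim exE) (rule that)
  have step: "\<bar>W0 (proj (Suc k) t) \<omega> - W0 (proj k t) \<omega>\<bar> \<le> \<zeta> ^ k" if "k \<ge> k0" for k t
  proof -
    have "\<bar>W0 (proj (Suc k) t) \<omega> - W0 (proj k t) \<omega>\<bar> \<le> \<zeta> ^ Suc k"
      by (rule k0[rule_format, OF le_SucI[OF that] proj_in_grid subsetD[OF grid_mono_Suc proj_in_grid] close_proj_Suc])
    also have "\<dots> \<le> \<zeta> ^ k" using zeta_bounds by (intro power_decreasing) auto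
    finally show ?thesis .
  qed
  have z1: "0 < 1 - \<zeta>" using zeta_bounds by simp
  have tail: "\<bar>W0 (proj (k + j) t) \<omega> - W0 (proj k t) \<omega>\<bar> \<le> \<zeta> ^ k / (1 - \<zeta>)" if "k \<ge> k0" for k j t
  proof -
    have "W0 (proj (k + j) t) \<omega> - W0 (proj (k + 0) t) \<omega> = (\<Sum>i<j. W0 (proj (k + Suc i) t) \<omega> - W0 (proj (k + i) t) \<omega>)"
      by (rule sum_lessThan_telescope[symmetric])
    then have "\<bar>W0 (proj (k + j) t) \<omega> - W0 (proj k t) \<omega>\<bar> \<le> (\<Sum>i<j. \<bar>W0 (proj (k + Suc i) t) \<omega> - W0 (proj (k + i) t) \<omega>\<bar>)"
      using sum_abs[of "\<lambda>i. W0 (proj (k + Suc i) t) \<omega> - W0 (proj (k + i) t) \<omega>" "{..<j}"] by simp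
    also have "\<dots> \<le> (\<Sum>i<j. \<zeta> ^ k * \<zeta> ^ i)"
    proof (rule sum_mono)
      fix i
      have "\<bar>W0 (proj (k + Suc i) t) \<omega> - W0 (proj (k + i) t) \<omega>\<bar> \<le> \<zeta> ^ (k + i)"
        using step[of "k + i" t] that by simp
      then show "\<bar>W0 (proj (k + Suc i) t) \<omega> - W0 (proj (k + i) t) \<omega>\<bar> \<le> \<zeta> ^ k * \<zeta> ^ i" by (simp only: power_add)
    qed
    also have "\<dots> = \<zeta> ^ k * (\<Sum>i<j. \<zeta> ^ i)" by (simp only: sum_distrib_left)
    also have "\<dots> \<le> \<zeta> ^ k * (1 / (1 - \<zeta>))"
    proof (rule mult_left_mono)
      have "(\<Sum>i<j. \<zeta> ^ i) * (1 - \<zeta>) = 1 - \<zeta> ^ j" by (simp only: one_diff_power_eq mult.commute)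
      also have "\<dots> \<le> 1" using zeta_bounds by simp
      finally show "(\<Sum>i<j. \<zeta> ^ i) \<le> 1 / (1 - \<zeta>)" by (simp only: pos_le_divide_eq[OF z1])
      show "0 \<le> \<zeta> ^ k" using zeta_bounds by simp
    qed
    finally show ?thesis by simp
  qed
  have z0: "(\<lambda>k. \<zeta> ^ k / (1 - \<zeta>)) \<longlonglongrightarrow> 0"
    using zeta_bounds by (intro tendsto_divide_zero LIMSEQ_realpow_zero) auto
  have conv: "(\<lambda>k. W0 (proj k t) \<omega>) \<longlonglongrightarrow> W t \<omega>" for t
  proof -
    have "Cauchy (\<lambda>k. W0 (proj k t) \<omega>)"
    proof (rule CauchyI')
      fix e :: real assume e: "e > 0"
      from order_tendstoD(2)[OF z0 e] obtain m where m: "\<forall>k\<ge>m. \<zeta> ^ k / (1 - \<zeta>) < e"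
        unfolding eventually_sequentially by (elim exE) (rule that)
      show "\<exists>M. \<forall>m\<ge>M. \<forall>n>m. dist (W0 (proj m t) \<omega>) (W0 (proj n t) \<omega>) < e"
      proof (intro exI[of _ "max m k0"] allI impI)
        fix i j assume ij: "max m k0 \<le> i" "i < j"
        have "\<bar>W0 (proj (i + (j - i)) t) \<omega> - W0 (proj i t) \<omega>\<bar> \<le> \<zeta> ^ i / (1 - \<zeta>)" by (rule tail) (use ij in simp)
        moreover have "\<zeta> ^ i / (1 - \<zeta>) < e" by (rule m[rule_format]) (use ij in simp)
        ultimately show "dist (W0 (proj i t) \<omega>) (W0 (proj j t) \<omega>) < e" using ij by (simp add: dist_real_def)
      qed
    qed
    then have "convergent (\<lambda>k. W0 (proj k t) \<omega>)" by (rule Cauchy_convergent)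
    then show ?thesis unfolding W_def using g by (simp add: convergent_LIMSEQ_iff)
  qed
  have "\<bar>W t \<omega> - W0 (proj k t) \<omega>\<bar> \<le> \<zeta> ^ k / (1 - \<zeta>)" if k: "k \<ge> k0" for k t
  proof (rule LIMSEQ_le_const2)
    have "(\<lambda>j. W0 (proj (j + k) t) \<omega>) \<longlonglongrightarrow> W t \<omega>" by (rule LIMSEQ_ignore_initial_segment[OF conv])
    then show "(\<lambda>j. \<bar>W0 (proj (j + k) t) \<omega> - W0 (proj k t) \<omega>\<bar>) \<longlonglongrightarrow> \<bar>W t \<omega> - W0 (proj k t) \<omega>\<bar>" by (intro tendsto_intros)
    show "\<exists>N. \<forall>j\<ge>N. \<bar>W0 (proj (j + k) t) \<omega> - W0 (proj k t) \<omega>\<bar> \<le> \<zeta> ^ k / (1 - \<zeta>)"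
      using tail[OF k] by (simp add: add.commute)
  qed
  then have "\<forall>k\<ge>k0. \<forall>t. \<bar>W t \<omega> - W0 (proj k t) \<omega>\<bar> \<le> \<zeta> ^ k / (1 - \<zeta>)" by simp
  with k0 allI[OF conv] show ?thesis by (intro exI[of _ k0] conjI)
qed

lemma W_grid: "good \<omega> \<Longrightarrow> t \<in> grid m \<Longrightarrow> W t \<omega> = W0 t \<omega>"
proof -
  assume g: "good \<omega>" and t: "t \<in> grid m"
  have "(\<lambda>k. W0 (proj k t) \<omega>) \<longlonglongrightarrow> W t \<omega>" using good_uniform[OF g] by auto
  moreover have "eventually (\<lambda>k. W0 (proj k t) \<omega> = W0 t \<omega>) sequentially"
    unfolding eventually_sequentially
  proof (intro exI[of _ m] allI impI)
    fix k assume "m \<le> k"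
    then show "W0 (proj k t) \<omega> = W0 t \<omega>" using proj_grid_id[OF grid_mono[OF _ t]] by simp
  qed
  then have "(\<lambda>k. W0 (proj k t) \<omega>) \<longlonglongrightarrow> W0 t \<omega>" by (rule tendsto_eventually)
  ultimately show ?thesis by (rule LIMSEQ_unique)
qed

lemma W_proj_uniform:
  assumes e: "e > 0"
  shows "\<exists>k0. \<forall>k\<ge>k0. \<forall>t. \<bar>W t \<omega> - W (proj k t) \<omega>\<bar> \<le> e"
proof (cases "good \<omega>")
  case False
  then show ?thesis using e by (simp add: W_def)
next
  case True
  obtain k0 where k0: "\<forall>k\<ge>k0. \<forall>t. \<bar>W t \<omega> - W0 (proj k t) \<omega>\<bar> \<le> \<zeta> ^ k / (1 - \<zeta>)"
    using good_uniform[OF True] by (elim exE conjE) (rule that)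
  have z0: "(\<lambda>k. \<zeta> ^ k / (1 - \<zeta>)) \<longlonglongrightarrow> 0"
    using zeta_bounds by (intro tendsto_divide_zero LIMSEQ_realpow_zero) auto
  from order_tendstoD(2)[OF z0 e] obtain m where m: "\<forall>k\<ge>m. \<zeta> ^ k / (1 - \<zeta>) < e"
    unfolding eventually_sequentially by (elim exE) (rule that)
  show ?thesis
  proof (intro exI[of _ "max m k0"] allI impI)
    fix k t assume k: "max m k0 \<le> k"
    have "\<bar>W t \<omega> - W0 (proj k t) \<omega>\<bar> \<le> \<zeta> ^ k / (1 - \<zeta>)" by (rule k0[rule_format]) (use k in simp)
    also have "\<dots> < e" by (rule m[rule_format]) (use k in simp)
    finally show "\<bar>W t \<omega> - W (proj k t) \<omega>\<bar> \<le> e" unfolding W_grid[OF True proj_in_grid] by simp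
  qed
qed

lemma W_meas [measurable]: "W t \<in> borel_measurable white_noise"
proof (rule borel_measurable_LIMSEQ_real)
  fix \<omega>
  show "(\<lambda>k. if good \<omega> then W0 (proj k t) \<omega> else 0) \<longlonglongrightarrow> W t \<omega>"
  proof (cases "good \<omega>")
    case True
    then show ?thesis using good_uniform[OF True] by auto
  qed (simp add: W_def)
qed measurable

text \<open>By continuity of the marginals, points near \<open>t\<close> differ from it by less than
  \<open>1 / 2 ^ k\<close> in each marginal. Their level \<open>k\<close> indices then differ by at
  most 1, so the projections are close and the increment bound applies.\<close>

lemma W_continuous: "continuous_on UNIV (\<lambda>t. W t \<omega>)"
proof (cases "good \<omega>")
  case False
  then show ?thesis by (simp add: W_def)
next
  case True
  obtain k0 where inc: "\<forall>k\<ge>k0. \<forall>s\<in>grid k. \<forall>t\<in>grid k. close k s t \<longrightarrow> \<bar>W0 s \<omega> - W0 t \<omega>\<bar> \<le> \<zeta> ^ k"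
    and k0: "\<forall>k\<ge>k0. \<forall>t. \<bar>W t \<omega> - W0 (proj k t) \<omega>\<bar> \<le> \<zeta> ^ k / (1 - \<zeta>)"
    using good_uniform[OF True] by (elim exE conjE) (rule that)
  have "((\<lambda>s. W s \<omega>) \<longlongrightarrow> W t \<omega>) (at t)" for t
  proof (rule tendstoI)
    fix e :: real assume e: "e > 0"
    have z0: "(\<lambda>k. 2 * (\<zeta> ^ k / (1 - \<zeta>)) + \<zeta> ^ k) \<longlonglongrightarrow> 0"
      using zeta_bounds by (intro tendsto_add_zero tendsto_mult_right_zero tendsto_divide_zero LIMSEQ_realpow_zero) auto
    from order_tendstoD(2)[OF z0 e] obtain m where m: "\<forall>k\<ge>m. 2 * (\<zeta> ^ k / (1 - \<zeta>)) + \<zeta> ^ k < e"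
      unfolding eventually_sequentially by (elim exE) (rule that)
    define k where "k = max m k0"
    have k: "k \<ge> m" "k \<ge> k0" unfolding k_def by auto
    have mc: "((\<lambda>s. marg i (s $ i)) \<longlongrightarrow> marg i (t $ i)) (at t)" for i
    proof -
      have "isCont (marg i) (t $ i)" using marg_continuous[of i] by (simp add: continuous_on_eq_continuous_at)
      then show ?thesis by (rule isCont_tendsto_compose) (intro tendsto_vec_nth tendsto_ident_at)
    qed
    have "eventually (\<lambda>s. \<bar>marg i (s $ i) - marg i (t $ i)\<bar> < 1 / 2 ^ k) (at t)" for i
      using tendstoD[OF mc[of i], of "1 / 2 ^ k"] by (simp add: dist_real_def)
    then have "eventually (\<lambda>s. \<forall>i. \<bar>marg i (s $ i) - marg i (t $ i)\<bar> < 1 / 2 ^ k) (at t)"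
      by (rule eventually_all_finite)
    then show "eventually (\<lambda>s. dist (W s \<omega>) (W t \<omega>) < e) (at t)"
    proof eventually_elim
      case (elim s)
      have cl: "close k (proj k s) (proj k t)"
        unfolding close_def marg_proj
      proof
        fix i
        have st: "\<bar>2 ^ k * marg i (s $ i) - 2 ^ k * marg i (t $ i)\<bar> < 1"
        proof -
          have "2 ^ k * \<bar>marg i (s $ i) - marg i (t $ i)\<bar> < 2 ^ k * (1 / 2 ^ k)"
            using elim by (intro mult_strict_left_mono) auto
          then show ?thesis by (simp add: right_diff_distrib[symmetric] abs_mult)
        qed
        have "real (idx k s i) < real (idx k t i) + 2" "real (idx k t i) < real (idx k s i) + 2"
          using st idx_bounds(1)[where k=k and t=s and i=i] idx_bounds(2)[where k=k and t=s and i=i]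
            idx_bounds(1)[where k=k and t=t and i=i] idx_bounds(2)[where k=k and t=t and i=i] by linarith+
        then have "idx k s i < idx k t i + 2" "idx k t i < idx k s i + 2" by linarith+
        then have "\<bar>real (idx k s i) - real (idx k t i)\<bar> \<le> 1" by linarith
        then have "\<bar>real (idx k s i) - real (idx k t i)\<bar> / 2 ^ k \<le> 1 / 2 ^ k" by (intro divide_right_mono) auto
        then show "\<bar>real (idx k s i) / 2 ^ k - real (idx k t i) / 2 ^ k\<bar> \<le> 1 / 2 ^ k"
          by (simp add: diff_divide_distrib[symmetric] abs_divide)
      qed
      have "\<bar>W0 (proj k s) \<omega> - W0 (proj k t) \<omega>\<bar> \<le> \<zeta> ^ k" by (rule inc[rule_format, OF k(2) proj_in_grid proj_in_grid cl])
      with k0[rule_format, OF k(2), of s] k0[rule_format, OF k(2), of t] m[rule_format, OF k(1)]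
      show "dist (W s \<omega>) (W t \<omega>) < e" unfolding dist_real_def by linarith
    qed
  qed
  then show ?thesis by (simp add: continuous_on_def)
qed

lemma W_char:
  assumes I: "finite I"
  shows "(CLINT \<omega>|white_noise. iexp (\<Sum>j\<in>I. c j * W (e j) \<omega>)) = complex_of_real (exp (- quad I e c / 2))"
proof (rule LIMSEQ_unique)
  show "(\<lambda>k. CLINT \<omega>|white_noise. iexp (\<Sum>j\<in>I. c j * W0 (proj k (e j)) \<omega>)) \<longlonglongrightarrow> (CLINT \<omega>|white_noise. iexp (\<Sum>j\<in>I. c j * W (e j) \<omega>))"
  proof (rule integral_dominated_convergence[where w = "\<lambda>_. 1"])
    show "AE \<omega> in white_noise. (\<lambda>k. iexp (\<Sum>j\<in>I. c j * W0 (proj k (e j)) \<omega>)) \<longlonglongrightarrow> iexp (\<Sum>j\<in>I. c j * W (e j) \<omega>)"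
      using AE_good
    proof eventually_elim
      case (elim \<omega>)
      have conv: "(\<lambda>k. W0 (proj k t) \<omega>) \<longlonglongrightarrow> W t \<omega>" for t using good_uniform[OF elim] by auto
      show ?case by (intro tendsto_exp tendsto_mult tendsto_of_real tendsto_sum tendsto_const conv)
    qed
  qed auto
  have "(\<lambda>k. complex_of_real (exp (- quad I (\<lambda>j. proj k (e j)) c / 2))) \<longlonglongrightarrow> complex_of_real (exp (- quad I e c / 2))"
    by (intro tendsto_intros quad_proj_limit I) simp
  then show "(\<lambda>k. CLINT \<omega>|white_noise. iexp (\<Sum>j\<in>I. c j * W0 (proj k (e j)) \<omega>)) \<longlonglongrightarrow> complex_of_real (exp (- quad I e c / 2))"
    using W0_char[OF I, of "\<lambda>j. proj _ (e j)"] grid_subset_grids[OF proj_in_grid] by simp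
qed

lemma W_comb_distr:
  assumes I: "finite I"
  shows "distr white_noise borel (\<lambda>\<omega>. \<Sum>j\<in>I. c j * W (e j) \<omega>) = gauss_law (quad I e c)"
proof (rule wn.distr_eq_gauss_law)
  fix u
  have "(CLINT \<omega>|white_noise. iexp (\<Sum>j\<in>I. (u * c j) * W (e j) \<omega>)) = complex_of_real (exp (- quad I e (\<lambda>j. u * c j) / 2))"
    by (rule W_char[OF I])
  then show "(CLINT \<omega>|white_noise. iexp (u * (\<Sum>j\<in>I. c j * W (e j) \<omega>))) = complex_of_real (exp (- (quad I e c * u\<^sup>2) / 2))"
    unfolding quad_scale by (simp only: sum_distrib_left mult.assoc)
qed (use quad_nonneg[OF I] in \<open>measurable\<close>)

lemma W_gaussian: "centered_gaussian_process white_noise W"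
  unfolding centered_gaussian_process_def
proof (intro conjI allI impI)
  show "prob_space white_noise" by (rule prob_space_white_noise)
  show "W t \<in> borel_measurable white_noise" for t by measurable
  fix T :: "(ereal^'d) set" and c :: "ereal^'d \<Rightarrow> real" assume T: "finite T"
  show "\<exists>s2\<ge>0. distr white_noise borel (\<lambda>\<omega>. \<Sum>t\<in>T. c t * W t \<omega>) = gauss_law s2"
    using W_comb_distr[OF T, of c "\<lambda>t. t"] quad_nonneg[OF T] by (intro exI[of _ "quad T (\<lambda>t. t) c"]) simp
qed

end

section \<open>The Skorokhod distance\<close>

lemma eh_simps [simp]: "eh (ereal x) = x / (1 + \<bar>x\<bar>)" "eh \<infinity> = 1" "eh (-\<infinity>) = -1"
  by (simp_all add: eh_def flip: PInfty_eq_infinity MInfty_eq_minfinity)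

lemma eh_abs_le: "\<bar>eh e\<bar> \<le> 1"
  by (cases e) (auto simp: abs_divide divide_le_eq_1)

text \<open>The slope of \<open>eh\<close> at a real \<open>x\<close> is
  \<open>1 / (1 + \<bar>x\<bar>)\<^sup>2\<close>, at most 1; the argument is algebraic, by cases on
  the signs. Real displacements thus bound the distance of a time change from the identity.\<close>

lemma eh_Lipschitz: "\<bar>eh (ereal x) - eh (ereal y)\<bar> \<le> \<bar>x - y\<bar>"
proof -
  have *: "eh (ereal b) - eh (ereal a) \<le> b - a" "eh (ereal a) \<le> eh (ereal b)" if "a \<le> b" for a b
  proof -
    have d: "0 < (1 + \<bar>a\<bar>) * (1 + \<bar>b\<bar>)" by (intro mult_pos_pos) auto
    have eq: "eh (ereal b) - eh (ereal a) = (b * (1 + \<bar>a\<bar>) - a * (1 + \<bar>b\<bar>)) / ((1 + \<bar>a\<bar>) * (1 + \<bar>b\<bar>))"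
      by (simp add: diff_frac_eq mult.commute)
    have num: "0 \<le> b * (1 + \<bar>a\<bar>) - a * (1 + \<bar>b\<bar>) \<and> b * (1 + \<bar>a\<bar>) - a * (1 + \<bar>b\<bar>) \<le> (b - a) * ((1 + \<bar>a\<bar>) * (1 + \<bar>b\<bar>))"
    proof (cases "0 \<le> a")
      case True
      then have "b * (1 + \<bar>a\<bar>) - a * (1 + \<bar>b\<bar>) = b - a" using that by (simp add: algebra_simps)
      moreover have "1 * 1 \<le> (1 + \<bar>a\<bar>) * (1 + \<bar>b\<bar>)" by (intro mult_mono) auto
      ultimately show ?thesis using that mult_left_mono[of 1 "(1 + \<bar>a\<bar>) * (1 + \<bar>b\<bar>)" "b - a"] by simp
    next
      case False
      show ?thesis
      proof (cases "b \<le> 0")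
        case True
        then have "b * (1 + \<bar>a\<bar>) - a * (1 + \<bar>b\<bar>) = b - a" using False by (simp add: algebra_simps)
        moreover have "1 * 1 \<le> (1 + \<bar>a\<bar>) * (1 + \<bar>b\<bar>)" by (intro mult_mono) auto
        ultimately show ?thesis using that mult_left_mono[of 1 "(1 + \<bar>a\<bar>) * (1 + \<bar>b\<bar>)" "b - a"] by simp
      next
        case b: False
        have n1: "b * (1 + \<bar>a\<bar>) - a * (1 + \<bar>b\<bar>) = b - a + 2 * b * (- a)" using False b by (simp add: algebra_simps)
        have p: "0 \<le> b * (- a)" by (rule mult_nonneg_nonneg) (use False b in auto)
        have "(b - a) * ((1 + \<bar>a\<bar>) * (1 + \<bar>b\<bar>)) = (b - a) + (b - a) * (b - a) + (b - a) * (b * (- a))"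
          using False b by (simp add: algebra_simps)
        moreover have "2 * (b * (- a)) \<le> (b - a) * (b - a)"
          using zero_le_power2[of a] zero_le_power2[of b] by (simp add: algebra_simps power2_eq_square)
        moreover have "0 \<le> (b - a) * (b * (- a))" by (rule mult_nonneg_nonneg[OF _ p]) (use that in simp)
        ultimately show ?thesis unfolding n1 using p that by linarith
      qed
    qed
    show "eh (ereal b) - eh (ereal a) \<le> b - a" unfolding eq pos_divide_le_eq[OF d] using num by blast
    have "0 \<le> eh (ereal b) - eh (ereal a)" unfolding eq using num d by (intro divide_nonneg_pos) auto
    then show "eh (ereal a) \<le> eh (ereal b)" by simp
  qed
  show ?thesis using *[of x y] *[of y x] by (cases "x \<le> y") auto
qed

lemma sk_dist_le:
  assumes tc: "tc \<in> time_changes"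
    and a: "\<And>t i. \<bar>eh (tc t $ i) - eh (t $ i)\<bar> \<le> a" and b: "\<And>t. \<bar>x t - y (tc t)\<bar> \<le> b"
  shows "sk_dist x y \<le> max a b"
proof -
  let ?f = "\<lambda>tc t. Max (range (\<lambda>i. \<bar>eh (tc t $ i) - eh (t $ i)\<bar>))"
  let ?v = "\<lambda>tc. max (SUP t. ?f tc t) (SUP t. \<bar>x t - y (tc t)\<bar>)"
  have "sk_dist x y \<le> ?v tc"
    unfolding sk_dist_def
  proof (rule cInf_lower)
    show "?v tc \<in> {?v tc | tc. tc \<in> time_changes}" using tc by (intro CollectI exI[of _ tc] conjI refl)
    show "bdd_below {?v tc | tc. tc \<in> time_changes}"
    proof (rule bdd_belowI[of _ 0])
      fix z assume "z \<in> {?v tc | tc. tc \<in> time_changes}"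
      then obtain tc' where z: "z = ?v tc'" by (elim CollectE exE conjE) (rule that)
      have le2: "?f tc' t \<le> 2" for t
      proof (rule Max.boundedI)
        fix w assume "w \<in> range (\<lambda>i. \<bar>eh (tc' t $ i) - eh (t $ i)\<bar>)"
        then obtain i where w: "w = \<bar>eh (tc' t $ i) - eh (t $ i)\<bar>" by (elim imageE) (rule that)
        show "w \<le> 2" unfolding w using eh_abs_le[of "tc' t $ i"] eh_abs_le[of "t $ i"] by linarith
      qed auto
      \<comment> \<open>Nonnegativity is read off the first component, because the second may be a
        supremum over an unbounded set.\<close>
      fix i0 :: 'a
      have "0 \<le> \<bar>eh (tc' (\<chi> _. 0) $ i0) - eh ((\<chi> _. 0) $ i0)\<bar>" by simp
      also have "\<dots> \<le> ?f tc' (\<chi> _. 0)" by (rule Max_ge) auto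
      also have "\<dots> \<le> (SUP t. ?f tc' t)" by (rule cSUP_upper) (use le2 in \<open>auto intro!: bdd_aboveI[of _ 2]\<close>)
      finally show "0 \<le> z" unfolding z by simp
    qed
  qed
  also have "\<dots> \<le> max a b"
  proof (rule max.mono)
    show "(SUP t. ?f tc t) \<le> a"
    proof (rule cSUP_least)
      fix t show "?f tc t \<le> a" by (rule Max.boundedI) (use a in auto)
    qed simp
    show "(SUP t. \<bar>x t - y (tc t)\<bar>) \<le> b" by (rule cSUP_least) (use b in auto)
  qed
  finally show ?thesis .
qed

lemma sk_dist_sup_le:
  assumes "\<And>t. \<bar>x t - y t\<bar> \<le> c" "c \<ge> 0"
  shows "sk_dist x y \<le> c"
proof -
  have "(\<lambda>t. \<chi> i. id (t $ i)) \<in> time_changes"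
    unfolding time_changes_def by (intro CollectI exI[of _ "\<lambda>_. id"]) (simp add: strict_mono_def)
  then have "(\<lambda>t. t) \<in> time_changes" by simp
  from sk_dist_le[OF this, of 0 x y c] assms show ?thesis by simp
qed

text \<open>McShane's extension, the minimum of the cones \<open>F i\<close>, truncated to the
  interval from \<open>- \<delta>\<close> to \<open>\<delta>\<close>. Truncation preserves both the
  Lipschitz constant and the prescribed values.\<close>

lemma Lipschitz_interpolation:
  fixes p u :: "'i \<Rightarrow> real"
  assumes I: "finite I" and d: "\<delta> \<ge> 0" and ud: "\<forall>i\<in>I. \<bar>u i\<bar> \<le> \<delta>"
    and Lip: "\<forall>i\<in>I. \<forall>j\<in>I. \<bar>u i - u j\<bar> \<le> \<bar>p i - p j\<bar> / 2"
  shows "\<exists>f::real \<Rightarrow> real. (\<forall>i\<in>I. f (p i) = u i) \<and> (\<forall>s t. \<bar>f s - f t\<bar> \<le> \<bar>s - t\<bar> / 2) \<and> (\<forall>t. \<bar>f t\<bar> \<le> \<delta>)"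
proof (cases "I = {}")
  case True
  then show ?thesis using d by (intro exI[of _ "\<lambda>_. 0"]) simp
next
  case False
  define F where "F i t = u i + \<bar>t - p i\<bar> / 2" for i t
  define m where "m t = Min ((\<lambda>i. F i t) ` I)" for t
  define f where "f t = max (- \<delta>) (min \<delta> (m t))" for t
  have fin: "finite ((\<lambda>i. F i t) ` I)" "(\<lambda>i. F i t) ` I \<noteq> {}" for t using I False by auto
  have step: "m s \<le> m t + \<bar>s - t\<bar> / 2" for s t
  proof -
    have "m t \<in> (\<lambda>i. F i t) ` I" unfolding m_def by (rule Min_in[OF fin])
    then obtain i where i: "i \<in> I" "m t = F i t" by (elim imageE) (rule that)
    have "m s \<le> F i s" unfolding m_def using i fin by (intro Min_le) auto
    also have "\<dots> \<le> F i t + \<bar>s - t\<bar> / 2" unfolding F_def by (simp add: abs_if)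
    finally show ?thesis using i by simp
  qed
  have mL: "\<bar>m s - m t\<bar> \<le> \<bar>s - t\<bar> / 2" for s t
  proof (rule abs_leI)
    show "m s - m t \<le> \<bar>s - t\<bar> / 2" using step[of s t] by simp
    show "- (m s - m t) \<le> \<bar>s - t\<bar> / 2" using step[of t s] unfolding abs_minus_commute[of t s] by simp
  qed
  have mp: "m (p j) = u j" if j: "j \<in> I" for j
  proof (rule antisym)
    have "m (p j) \<le> F j (p j)" unfolding m_def using j fin by (intro Min_le) auto
    then show "m (p j) \<le> u j" by (simp add: F_def)
    show "u j \<le> m (p j)" unfolding m_def
    proof (rule Min.boundedI[OF fin])
      fix z assume "z \<in> (\<lambda>i. F i (p j)) ` I"
      then obtain i where i: "i \<in> I" "z = F i (p j)" by (elim imageE) (rule that)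
      show "u j \<le> z" unfolding i F_def using bspec[OF bspec[OF Lip j] i(1)] abs_ge_self[of "u j - u i"] by linarith
    qed
  qed
  show ?thesis
  proof (intro exI[of _ f] conjI ballI allI)
    show "f (p i) = u i" if "i \<in> I" for i unfolding f_def mp[OF that] using bspec[OF ud that] by (simp add: abs_le_iff min_def max_def)
    show "\<bar>f s - f t\<bar> \<le> \<bar>s - t\<bar> / 2" for s t
    proof -
      have "\<bar>f s - f t\<bar> \<le> \<bar>m s - m t\<bar>" unfolding f_def using d by (simp add: min_def max_def abs_if)
      then show ?thesis using mL[of s t] by linarith
    qed
    show "\<bar>f t\<bar> \<le> \<delta>" for t unfolding f_def using d by (simp add: min_def max_def abs_le_iff)
  qed
qed

text \<open>The change is the identity plus a function with Lipschitz constant \<open>1 / 2\<close>,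
  hence strictly increasing. Being also continuous and within \<open>\<delta>\<close> of the
  identity, it is onto the reals.\<close>

lemma time_change_ex:
  fixes p u :: "'i \<Rightarrow> real"
  assumes I: "finite I" and d: "\<delta> \<ge> 0" and ud: "\<forall>i\<in>I. \<bar>u i\<bar> \<le> \<delta>"
    and Lip: "\<forall>i\<in>I. \<forall>j\<in>I. \<bar>u i - u j\<bar> \<le> \<bar>p i - p j\<bar> / 2"
  shows "\<exists>l. strict_mono l \<and> bij l \<and> (\<forall>i\<in>I. l (ereal (p i)) = ereal (p i + u i)) \<and>
    l \<infinity> = \<infinity> \<and> l (-\<infinity>) = -\<infinity> \<and> (\<forall>t. \<exists>s. l (ereal t) = ereal s \<and> \<bar>s - t\<bar> \<le> \<delta>)"
proof -
  obtain f :: "real \<Rightarrow> real" where f: "\<forall>i\<in>I. f (p i) = u i" "\<forall>s t. \<bar>f s - f t\<bar> \<le> \<bar>s - t\<bar> / 2" "\<forall>t. \<bar>f t\<bar> \<le> \<delta>"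
    using Lipschitz_interpolation[where u=u and p=p, OF I d ud Lip] by (elim exE conjE) (rule that)
  define g where "g t = t + f t" for t
  define l where "l e = (case e of ereal t \<Rightarrow> ereal (g t) | PInfty \<Rightarrow> \<infinity> | MInfty \<Rightarrow> -\<infinity>)" for e
  have l: "l (ereal t) = ereal (g t)" "l \<infinity> = \<infinity>" "l (-\<infinity>) = -\<infinity>" for t
    by (simp_all add: l_def flip: PInfty_eq_infinity MInfty_eq_minfinity)
  have gm: "g s < g t" if "s < t" for s t
  proof -
    have "\<bar>f s - f t\<bar> \<le> \<bar>s - t\<bar> / 2" using f(2) by simp
    then show ?thesis using that unfolding g_def by (simp add: abs_if split: if_splits)
  qed
  have lm: "strict_mono l"
  proof (rule strict_monoI)
    fix x y :: ereal assume "x < y"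
    then show "l x < l y" by (cases x; cases y) (simp_all add: l gm)
  qed
  have gsurj: "\<exists>t. g t = v" for v
  proof -
    have "continuous_on UNIV f"
      unfolding continuous_on_def
    proof
      fix x :: real
      have "((\<lambda>y. \<bar>y - x\<bar> / 2) \<longlongrightarrow> \<bar>x - x\<bar> / 2) (at x)" by (intro tendsto_intros) simp_all
      then have "((\<lambda>y. \<bar>y - x\<bar> / 2) \<longlongrightarrow> 0) (at x)" by simp
      then have "((\<lambda>y. f y - f x) \<longlongrightarrow> 0) (at x)"
        by (rule Lim_null_comparison[rotated]) (use f(2) in simp)
      then show "(f \<longlongrightarrow> f x) (at x)" by (rule LIM_zero_cancel)
    qed
    then have c: "continuous_on UNIV g" unfolding g_def[abs_def] by (intro continuous_on_add continuous_on_id)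
    have "\<bar>f (v - \<delta>)\<bar> \<le> \<delta>" "\<bar>f (v + \<delta>)\<bar> \<le> \<delta>" using f(3) by simp_all
    then have "g (v - \<delta>) \<le> v" "v \<le> g (v + \<delta>)" unfolding g_def by linarith+
    then show ?thesis using IVT'[of g "v - \<delta>" v "v + \<delta>"] d continuous_on_subset[OF c subset_UNIV] by auto
  qed
  have "surj l"
    unfolding surj_def eq_commute[of _ "l _"]
  proof
    fix y :: ereal
    show "\<exists>x. l x = y"
    proof (cases y)
      case (real v)
      obtain t where "g t = v" using gsurj[of v] by (elim exE) (rule that)
      then show ?thesis using real l(1) by (intro exI[of _ "ereal t"]) simp
    next
      case PInf then show ?thesis using l(2) by (intro exI[of _ "\<infinity>"]) simp
    next
      case MInf then show ?thesis using l(3) by (intro exI[of _ "-\<infinity>"]) simp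
    qed
  qed
  then have "bij l" using strict_mono_imp_inj_on[OF lm] by (simp add: bij_def)
  moreover have "\<forall>i\<in>I. l (ereal (p i)) = ereal (p i + u i)" using f(1) by (simp add: l g_def)
  moreover have "\<forall>t. \<exists>s. l (ereal t) = ereal s \<and> \<bar>s - t\<bar> \<le> \<delta>" using f(3) by (simp add: l g_def)
  ultimately show ?thesis using lm l by (intro exI[of _ l] conjI)
qed

lemma continuous_in_Dspace:
  assumes "continuous_on UNIV (x :: ereal^'d \<Rightarrow> real)"
  shows "x \<in> Dspace"
proof -
  have lim: "(x \<longlongrightarrow> x t) (at t within A)" for t A
    using assms by (auto simp: continuous_on_def intro: tendsto_within_subset)
  then show ?thesis unfolding Dspace_def by auto
qed

lemma eventually_quadrant: "eventually (\<lambda>s. s \<in> quadrant S t) (at t within quadrant S t)"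
  by (simp add: eventually_at_filter)

text \<open>For a fixed sample point each coordinate comparison is eventually constant along the
  quadrant. A tie with \<open>t $ i\<close> counts as outside when approached from below and as
  inside otherwise.\<close>

lemma orthant_ind_quadrant_limit:
  fixes t :: "ereal^'d" and x :: "real^'d"
  shows "((\<lambda>s. orthant_ind s x) \<longlongrightarrow> (if \<forall>i. (i \<in> S \<longrightarrow> ereal (x $ i) < t $ i) \<and> (i \<notin> S \<longrightarrow> ereal (x $ i) \<le> t $ i) then 1 else 0))
     (at t within quadrant S t)"
proof (rule tendsto_eventually)
  have ti: "((\<lambda>s. s $ i) \<longlongrightarrow> t $ i) (at t within quadrant S t)" for i by (intro tendsto_vec_nth tendsto_ident_at)
  have "eventually (\<lambda>s. (ereal (x $ i) \<le> s $ i) \<longleftrightarrow> (if i \<in> S then ereal (x $ i) < t $ i else ereal (x $ i) \<le> t $ i)) (at t within quadrant S t)" for i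
  proof (cases "ereal (x $ i) < t $ i")
    case True
    from order_tendstoD(1)[OF ti True] show ?thesis by eventually_elim (use True in auto)
  next
    case le: False
    show ?thesis
    proof (cases "i \<in> S \<or> ereal (x $ i) = t $ i")
      case True
      from eventually_quadrant show ?thesis
      proof eventually_elim
        case (elim s)
        show ?case
        proof (cases "i \<in> S")
          case True
          then have "s $ i < t $ i" using elim by (simp add: quadrant_def)
          then show ?thesis using le True by auto
        next
          case False
          then have "t $ i \<le> s $ i" using elim by (simp add: quadrant_def)
          then show ?thesis using False \<open>i \<in> S \<or> ereal (x $ i) = t $ i\<close> by auto
        qed
      qed
    next
      case False
      then have "t $ i < ereal (x $ i)" using le by auto
      from order_tendstoD(2)[OF ti this] show ?thesis by eventually_elim (use False le in auto)
    qed
  qed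
  then have "eventually (\<lambda>s. \<forall>i. (ereal (x $ i) \<le> s $ i) \<longleftrightarrow> (if i \<in> S then ereal (x $ i) < t $ i else ereal (x $ i) \<le> t $ i)) (at t within quadrant S t)"
    by (rule eventually_all_finite)
  then show "eventually (\<lambda>s. orthant_ind s x = (if \<forall>i. (i \<in> S \<longrightarrow> ereal (x $ i) < t $ i) \<and> (i \<notin> S \<longrightarrow> ereal (x $ i) \<le> t $ i) then 1 else 0)) (at t within quadrant S t)"
    by eventually_elim (auto simp: orthant_ind_def le_ext_iff split: if_splits)
qed

section \<open>Empirical paths as functions of the sample\<close>

context emp_clt
begin

lemma dfun_ext_diff: "\<bar>dfun_ext M X s - dfun_ext M X t\<bar> \<le> (\<Sum>i\<in>UNIV. \<bar>marg i (s $ i) - marg i (t $ i)\<bar>)"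
proof -
  have "\<bar>dfun_ext M X s - dfun_ext M X t\<bar> = \<bar>\<integral>\<omega>. orthant_ind s (X 0 \<omega>) - orthant_ind t (X 0 \<omega>) \<partial>M\<bar>"
    by (simp add: integral_orthant_ind)
  also have "\<dots> \<le> mass (\<lambda>x. orthant_ind s x - orthant_ind t x)" by (rule integral_abs_bound)
  also note mass_orthant_diff
  finally show ?thesis .
qed

lemma dfun_ext_tendsto: "(dfun_ext M X \<longlongrightarrow> dfun_ext M X t) (at t within A)"
proof -
  have mc: "((\<lambda>s. marg i (s $ i)) \<longlongrightarrow> marg i (t $ i)) (at t within A)" for i
  proof -
    have "isCont (marg i) (t $ i)" using marg_continuous[of i] by (simp add: continuous_on_eq_continuous_at)
    then show ?thesis by (rule isCont_tendsto_compose) (intro tendsto_vec_nth tendsto_ident_at)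
  qed
  have "((\<lambda>s. \<Sum>i\<in>UNIV. \<bar>marg i (s $ i) - marg i (t $ i)\<bar>) \<longlongrightarrow> (\<Sum>i\<in>UNIV. \<bar>marg i (t $ i) - marg i (t $ i)\<bar>)) (at t within A)"
    by (intro tendsto_intros mc)
  then have "((\<lambda>s. \<Sum>i\<in>UNIV. \<bar>marg i (s $ i) - marg i (t $ i)\<bar>) \<longlongrightarrow> 0) (at t within A)" by simp
  then have "((\<lambda>s. dfun_ext M X s - dfun_ext M X t) \<longlongrightarrow> 0) (at t within A)"
    by (rule Lim_null_comparison[rotated]) (simp add: dfun_ext_diff)
  then show ?thesis by (rule LIM_zero_cancel)
qed

text \<open>The empirical process as a deterministic function of the sample, so that regularity of
  \<open>h\<close> along it can be studied on the space of samples.\<close>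

definition emp_path :: "nat \<Rightarrow> (nat \<Rightarrow> real^'d) \<Rightarrow> ereal^'d \<Rightarrow> real" where
  "emp_path n x t = (\<Sum>i\<in>{1..n}. orthant_ind t (x i) - dfun_ext M X t) / sqrt (real n)"

lemma emp_path_eq: "emp_path n (\<lambda>i. X i \<omega>) t = emp (orthant_ind t) n \<omega>"
  by (simp add: emp_path_def emp_def integral_orthant_ind)

lemma emp_path_Dspace: "emp_path n x \<in> Dspace"
  unfolding Dspace_def
proof (intro CollectI allI conjI)
  fix t
  define V where "V S i = (if \<forall>c. (c \<in> S \<longrightarrow> ereal (x i $ c) < t $ c) \<and> (c \<notin> S \<longrightarrow> ereal (x i $ c) \<le> t $ c) then 1 else 0 :: real)" for S i
  have l: "((\<lambda>s. orthant_ind s (x i)) \<longlongrightarrow> V S i) (at t within quadrant S t)" for S i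
    unfolding V_def by (rule orthant_ind_quadrant_limit)
  have lim: "(emp_path n x \<longlongrightarrow> (\<Sum>i\<in>{1..n}. V S i - dfun_ext M X t) * inverse (sqrt (real n))) (at t within quadrant S t)" for S
    unfolding emp_path_def[abs_def] divide_inverse
    by (intro tendsto_mult tendsto_sum tendsto_diff tendsto_const l dfun_ext_tendsto)
  then show "\<exists>l. (emp_path n x \<longlongrightarrow> l) (at t within quadrant S t)" for S by (rule exI)
  have "V {} i = orthant_ind t (x i)" for i by (simp add: V_def orthant_ind_def le_ext_iff)
  then have "(\<Sum>i\<in>{1..n}. V {} i - dfun_ext M X t) * inverse (sqrt (real n)) = emp_path n x t"
    by (simp add: emp_path_def divide_inverse)
  then show "(emp_path n x \<longlongrightarrow> emp_path n x t) (at t within quadrant {} t)" using lim[of "{}"] by simp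
qed

text \<open>On a compact interval continuity is uniform; beyond it \<open>marg i\<close> is within
  \<open>e / 2\<close> of 0 or 1. Displacements are measured on the real line because time changes
  move points there.\<close>

lemma marg_uniformly_continuous:
  assumes e: "e > 0"
  shows "\<exists>\<delta>>0. \<forall>u v. \<bar>u - v\<bar> \<le> \<delta> \<longrightarrow> \<bar>marg i (ereal u) - marg i (ereal v)\<bar> \<le> e"
proof (cases "e \<ge> 1")
  case True
  have "\<bar>marg i (ereal u) - marg i (ereal v)\<bar> \<le> e" for u v
    using True marg_nonneg[of i "ereal u"] marg_nonneg[of i "ereal v"] marg_le_1[of i "ereal u"] marg_le_1[of i "ereal v"] by linarith
  then show ?thesis by (intro exI[of _ 1]) simp
next
  case False
  define q where "q = e / 2"
  have q: "0 < q" "q < 1" "0 < 1 - q" "1 - q < 1" unfolding q_def using e False by auto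
  obtain a where a: "marg i (ereal a) = q" using marg_surj[OF q(1,2), of i] by (elim exE) (rule that)
  obtain b where b: "marg i (ereal b) = 1 - q" using marg_surj[OF q(3,4), of i] by (elim exE) (rule that)
  let ?K = "{a - 1..b + 1}"
  have "continuous_on ?K (\<lambda>u. marg i (ereal u))"
    by (rule continuous_on_compose2[OF marg_continuous[of i]]) (auto intro!: continuous_intros)
  then have "uniformly_continuous_on ?K (\<lambda>u. marg i (ereal u))" by (rule compact_uniformly_continuous) simp
  then obtain d where d: "d > 0" "\<forall>u\<in>?K. \<forall>v\<in>?K. dist v u < d \<longrightarrow> dist (marg i (ereal v)) (marg i (ereal u)) < e"
    unfolding uniformly_continuous_on_def using e by (elim allE[of _ e] impE) (assumption, elim exE conjE, rule that)
  define \<delta> where "\<delta> = min 1 (d / 2)"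
  have \<delta>: "\<delta> > 0" "\<delta> \<le> 1" "\<delta> < d" unfolding \<delta>_def using d(1) by auto
  have m: "marg i (ereal u) \<le> marg i (ereal v)" if "u \<le> v" for u v using monoD[OF mono_marg, of "ereal u" "ereal v" i] that by simp
  show ?thesis
  proof (intro exI[of _ \<delta>] conjI \<delta>(1) allI impI)
    fix u v :: real assume uv: "\<bar>u - v\<bar> \<le> \<delta>"
    consider "u < a - 1 \<or> v < a - 1" | "u > b + 1 \<or> v > b + 1" | "u \<in> ?K" "v \<in> ?K" by fastforce
    then show "\<bar>marg i (ereal u) - marg i (ereal v)\<bar> \<le> e"
    proof cases
      case 1
      then have "u \<le> a" "v \<le> a" using uv \<delta>(2) by linarith+
      then have "marg i (ereal u) \<le> q" "marg i (ereal v) \<le> q" using m a by metis+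
      then show ?thesis using marg_nonneg[of i "ereal u"] marg_nonneg[of i "ereal v"] e unfolding q_def by linarith
    next
      case 2
      then have "b \<le> u" "b \<le> v" using uv \<delta>(2) by linarith+
      then have "1 - q \<le> marg i (ereal u)" "1 - q \<le> marg i (ereal v)" using m b by metis+
      then show ?thesis using marg_le_1[of i "ereal u"] marg_le_1[of i "ereal v"] e unfolding q_def by linarith
    next
      case 3
      have "dist u v < d" using uv \<delta>(3) by (simp add: dist_real_def)
      then have "dist (marg i (ereal u)) (marg i (ereal v)) < e" using d(2) 3 by simp
      then show ?thesis by (simp add: dist_real_def)
    qed
  qed
qed

lemma marg_uniformly_continuous_all:
  assumes e: "e > 0"
  shows "\<exists>\<delta>>0. \<forall>i u v. \<bar>u - v\<bar> \<le> \<delta> \<longrightarrow> \<bar>marg i (ereal u) - marg i (ereal v)\<bar> \<le> e"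
proof -
  have "\<forall>i. \<exists>\<delta>>0. \<forall>u v. \<bar>u - v\<bar> \<le> \<delta> \<longrightarrow> \<bar>marg i (ereal u) - marg i (ereal v)\<bar> \<le> e"
    using marg_uniformly_continuous[OF e] by (rule allI)
  then obtain D where D: "\<forall>i. D i > 0 \<and> (\<forall>u v. \<bar>u - v\<bar> \<le> D i \<longrightarrow> \<bar>marg i (ereal u) - marg i (ereal v)\<bar> \<le> e)"
    by (rule exE[OF choice]) (rule that)
  show ?thesis
  proof (intro exI[of _ "Min (range D)"] conjI allI impI)
    show "0 < Min (range D)" using D by (subst Min_gr_iff) auto
    fix i and u v :: real assume "\<bar>u - v\<bar> \<le> Min (range D)"
    then have "\<bar>u - v\<bar> \<le> D i" by (rule order_trans) (rule Min_le, auto)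
    then show "\<bar>marg i (ereal u) - marg i (ereal v)\<bar> \<le> e" using D by simp
  qed
qed

text \<open>A time change that carries every sample coordinate of \<open>x\<close> to that of
  \<open>y\<close> matches all indicators exactly. What remains is the change of the distribution
  function in the centring, multiplied by \<open>sqrt n\<close>.\<close>

lemma emp_path_sk_close:
  fixes x y :: "nat \<Rightarrow> real^'d"
  assumes d: "0 \<le> \<delta>" and e: "0 \<le> e"
    and muc: "\<forall>i u v. \<bar>u - v\<bar> \<le> \<delta> \<longrightarrow> \<bar>marg i (ereal u) - marg i (ereal v)\<bar> \<le> e"
    and xy: "\<forall>c. \<forall>i\<in>{1..n}. \<bar>y i $ c - x i $ c\<bar> \<le> \<delta>"
    and Lip: "\<forall>c. \<forall>i\<in>{1..n}. \<forall>j\<in>{1..n}. \<bar>(y i $ c - x i $ c) - (y j $ c - x j $ c)\<bar> \<le> \<bar>x i $ c - x j $ c\<bar> / 2"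
  shows "sk_dist (emp_path n x) (emp_path n y) \<le> max \<delta> (sqrt (real n) * (real CARD('d) * e))"
proof -
  have "\<forall>c. \<exists>l. strict_mono l \<and> bij l \<and> (\<forall>i\<in>{1..n}. l (ereal (x i $ c)) = ereal (x i $ c + (y i $ c - x i $ c))) \<and>
    l \<infinity> = \<infinity> \<and> l (-\<infinity>) = -\<infinity> \<and> (\<forall>t. \<exists>s. l (ereal t) = ereal s \<and> \<bar>s - t\<bar> \<le> \<delta>)"
  proof
    fix c
    show "\<exists>l. strict_mono l \<and> bij l \<and> (\<forall>i\<in>{1..n}. l (ereal (x i $ c)) = ereal (x i $ c + (y i $ c - x i $ c))) \<and>
      l \<infinity> = \<infinity> \<and> l (-\<infinity>) = -\<infinity> \<and> (\<forall>t. \<exists>s. l (ereal t) = ereal s \<and> \<bar>s - t\<bar> \<le> \<delta>)"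
      by (rule time_change_ex[where p = "\<lambda>i. x i $ c" and u = "\<lambda>i. y i $ c - x i $ c", OF _ d spec[OF xy] spec[OF Lip]]) simp
  qed
  then obtain l where l: "\<forall>c. strict_mono (l c) \<and> bij (l c) \<and> (\<forall>i\<in>{1..n}. l c (ereal (x i $ c)) = ereal (x i $ c + (y i $ c - x i $ c))) \<and>
    l c \<infinity> = \<infinity> \<and> l c (-\<infinity>) = -\<infinity> \<and> (\<forall>t. \<exists>s. l c (ereal t) = ereal s \<and> \<bar>s - t\<bar> \<le> \<delta>)"
    by (rule exE[OF choice]) (rule that)
  define tc where "tc t = (\<chi> c. l c (t $ c))" for t :: "ereal^'d"
  have ereal_cases: "t $ c = \<infinity> \<and> tc t $ c = \<infinity> \<or> t $ c = -\<infinity> \<and> tc t $ c = -\<infinity> \<or> (\<exists>u s. t $ c = ereal u \<and> tc t $ c = ereal s \<and> \<bar>s - u\<bar> \<le> \<delta>)" for t c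
  proof (cases "t $ c")
    case (real u)
    obtain s where "l c (ereal u) = ereal s" "\<bar>s - u\<bar> \<le> \<delta>" using spec[OF l, of c] by (elim conjE allE[of _ u] exE) (rule that)
    then show ?thesis using real by (simp add: tc_def)
  qed (use spec[OF l, of c] in \<open>simp_all add: tc_def\<close>)
  show ?thesis
  proof (rule sk_dist_le)
    show "tc \<in> time_changes" unfolding time_changes_def
    proof (intro CollectI exI[of _ l] conjI allI)
      show "tc = (\<lambda>t. \<chi> i. l i (t $ i))" by (rule ext) (simp add: tc_def)
    qed (use l in simp_all)
    fix t
    show "\<bar>eh (tc t $ i) - eh (t $ i)\<bar> \<le> \<delta>" for i
      using ereal_cases[of t i]
    proof (elim disjE exE conjE)
      fix u s assume "t $ i = ereal u" "tc t $ i = ereal s" "\<bar>s - u\<bar> \<le> \<delta>"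
      then show ?thesis using eh_Lipschitz[of s u] by simp
    qed (use d in simp_all)
    have ind: "orthant_ind t (x i) = orthant_ind (tc t) (y i)" if i: "i \<in> {1..n}" for i
    proof -
      have "ereal (x i $ c) \<le> t $ c \<longleftrightarrow> ereal (y i $ c) \<le> tc t $ c" for c
      proof -
        have "ereal (y i $ c) = l c (ereal (x i $ c))" using spec[OF l, of c] i by simp
        then show ?thesis using strict_mono_less_eq[of "l c" "ereal (x i $ c)" "t $ c"] spec[OF l, of c] by (simp add: tc_def)
      qed
      then show ?thesis by (simp add: orthant_ind_def le_ext_iff)
    qed
    have m: "\<bar>marg i (tc t $ i) - marg i (t $ i)\<bar> \<le> e" for i
      using ereal_cases[of t i]
    proof (elim disjE exE conjE)
      fix u s assume "t $ i = ereal u" "tc t $ i = ereal s" "\<bar>s - u\<bar> \<le> \<delta>"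
      then show ?thesis using muc by simp
    qed (use e in simp_all)
    have "\<bar>dfun_ext M X (tc t) - dfun_ext M X t\<bar> \<le> (\<Sum>i\<in>(UNIV::'d set). e)"
      by (rule order_trans[OF dfun_ext_diff]) (rule sum_mono, rule m)
    then have F: "\<bar>dfun_ext M X (tc t) - dfun_ext M X t\<bar> \<le> real CARD('d) * e" by simp
    have "emp_path n x t - emp_path n y (tc t) = (\<Sum>i\<in>{1..n}. dfun_ext M X (tc t) - dfun_ext M X t) / sqrt (real n)"
      unfolding emp_path_def diff_divide_distrib[symmetric] sum_subtractf[symmetric]
      by (intro arg_cong2[where f="(/)"] sum.cong refl) (simp add: ind)
    also have "\<dots> = sqrt (real n) * (dfun_ext M X (tc t) - dfun_ext M X t)"
    proof -
      have "real n / sqrt (real n) = sqrt (real n)" by (rule real_div_sqrt) simp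
      then show ?thesis by (simp add: times_divide_eq_left[symmetric] del: times_divide_eq_left)
    qed
    finally have "\<bar>emp_path n x t - emp_path n y (tc t)\<bar> = sqrt (real n) * \<bar>dfun_ext M X (tc t) - dfun_ext M X t\<bar>" by (simp add: abs_mult)
    also have "\<dots> \<le> sqrt (real n) * (real CARD('d) * e)" by (rule mult_left_mono[OF F]) simp
    finally show "\<bar>emp_path n x t - emp_path n y (tc t)\<bar> \<le> sqrt (real n) * (real CARD('d) * e)" .
  qed
qed

text \<open>Samples with a prescribed pattern of equal coordinates. A time change is injective and
  cannot separate tied values, so continuity is asserted within each of these finitely many
  cells.\<close>

definition tie_cell :: "nat \<Rightarrow> ('d \<times> nat \<times> nat) set \<Rightarrow> (nat \<Rightarrow> real^'d) set" where
  "tie_cell n R = {x. \<forall>c. \<forall>i\<in>{1..n}. \<forall>j\<in>{1..n}. x i $ c = x j $ c \<longleftrightarrow> (c, i, j) \<in> R}"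

lemma coord_continuous: "continuous_on A (\<lambda>x::nat \<Rightarrow> real^'d. x i $ c)"
proof -
  have "continuous_on A (\<lambda>x::nat \<Rightarrow> real^'d. x i)"
    by (rule continuous_on_subset[OF continuous_on_product_coordinates subset_UNIV])
  then show ?thesis by (rule continuous_on_component)
qed

lemma coord_measurable [measurable]: "(\<lambda>x::nat \<Rightarrow> real^'d. x i $ c) \<in> borel_measurable borel"
  by (rule borel_measurable_continuous_onI[OF coord_continuous])

lemma tie_cell_meas: "tie_cell n R \<in> sets borel"
proof -
  have "Measurable.pred borel (\<lambda>x::nat \<Rightarrow> real^'d. x i $ c = x j $ c)" for i j c
    unfolding pred_def by (rule borel_measurable_eq[OF coord_measurable coord_measurable])
  then have [measurable]: "Measurable.pred borel (\<lambda>x::nat \<Rightarrow> real^'d. x i $ c = x j $ c \<longleftrightarrow> (c, i, j) \<in> R)" for i j c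
    by (cases "(c, i, j) \<in> R") simp_all
  have "Measurable.pred borel (\<lambda>x. x \<in> tie_cell n R)" unfolding tie_cell_def mem_Collect_eq by measurable
  then show ?thesis by (simp add: pred_def)
qed

text \<open>A small perturbation that respects the ties among the coordinates of the sample can be undone
  by a time change close to the identity.\<close>

lemma sk_continuous_on_tie_cell:
  assumes h: "sk_continuous h"
  shows "continuous_on (tie_cell n R) (\<lambda>x. h (emp_path n x))"
  unfolding continuous_on_def
proof
  fix x assume x: "x \<in> tie_cell n R"
  show "((\<lambda>x. h (emp_path n x)) \<longlongrightarrow> h (emp_path n x)) (at x within tie_cell n R)"
  proof (rule tendstoI)
    fix \<epsilon> :: real assume "\<epsilon> > 0"
    have "\<exists>\<delta>>0. \<forall>y\<in>Dspace. sk_dist (emp_path n x) y < \<delta> \<longrightarrow> \<bar>h (emp_path n x) - h y\<bar> < \<epsilon>"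
      using h \<open>\<epsilon> > 0\<close> emp_path_Dspace[of n x] unfolding sk_continuous_def by simp
    then obtain dh where dh: "dh > 0" "\<forall>y\<in>Dspace. sk_dist (emp_path n x) y < dh \<longrightarrow> \<bar>h (emp_path n x) - h y\<bar> < \<epsilon>"
      by (elim exE conjE) (rule that)
    \<comment> \<open>Keeps the centring error \<open>sqrt n * (real CARD('d) * e)\<close> below the
      Skorokhod tolerance \<open>dh\<close>.\<close>
    define e where "e = dh / (2 * (sqrt (real n) * real CARD('d) + 1))"
    have den: "0 < sqrt (real n) * real CARD('d) + 1" by (intro add_nonneg_pos mult_nonneg_nonneg) auto
    have e: "e > 0" unfolding e_def using dh(1) den by simp
    have e2: "sqrt (real n) * (real CARD('d) * e) < dh"
    proof -
      have "sqrt (real n) * (real CARD('d) * e) \<le> (sqrt (real n) * real CARD('d) + 1) * e" using e by (simp add: distrib_right)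
      also have "\<dots> = dh / 2"
        unfolding e_def using den by (simp only: times_divide_eq_right mult.commute[of 2] mult_divide_mult_cancel_left_if) simp
      finally show ?thesis using dh(1) by simp
    qed
    obtain d1 where d1: "d1 > 0" "\<forall>i u v. \<bar>u - v\<bar> \<le> d1 \<longrightarrow> \<bar>marg i (ereal u) - marg i (ereal v)\<bar> \<le> e"
      using marg_uniformly_continuous_all[OF e] by (elim exE conjE) (rule that)
    define Gaps where "Gaps = {\<bar>x i $ c - x j $ c\<bar> | c i j. i \<in> {1..n} \<and> j \<in> {1..n} \<and> x i $ c \<noteq> x j $ c}"
    have "Gaps \<subseteq> (\<lambda>(c, i, j). \<bar>x i $ c - x j $ c\<bar>) ` (UNIV \<times> {1..n} \<times> {1..n})"
    proof
      fix g assume "g \<in> Gaps"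
      then obtain c i j where "g = \<bar>x i $ c - x j $ c\<bar>" "i \<in> {1..n}" "j \<in> {1..n}" unfolding Gaps_def by blast
      then show "g \<in> (\<lambda>(c, i, j). \<bar>x i $ c - x j $ c\<bar>) ` (UNIV \<times> {1..n} \<times> {1..n})"
        by (intro image_eqI[of _ _ "(c, i, j)"]) auto
    qed
    then have Gf: "finite Gaps" by (rule finite_subset) simp
    \<comment> \<open>Two displacements below a quarter of a gap change it by at most half of it,
      the slope that \<open>time_change_ex\<close> allows.\<close>
    define \<delta> where "\<delta> = Min (insert (min d1 (dh / 2)) ((\<lambda>g. g / 4) ` Gaps))"
    have \<delta>0: "\<delta> > 0" unfolding \<delta>_def using Gf d1(1) dh(1) by (subst Min_gr_iff) (auto simp: Gaps_def)
    have "\<delta> \<le> min d1 (dh / 2)" unfolding \<delta>_def using Gf by (intro Min_le) auto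
    then have \<delta>1: "\<delta> \<le> d1" "\<delta> < dh" using dh(1) by auto
    have \<delta>g: "\<delta> \<le> \<bar>x i $ c - x j $ c\<bar> / 4" if "i \<in> {1..n}" "j \<in> {1..n}" "x i $ c \<noteq> x j $ c" for c i j
      unfolding \<delta>_def using that Gf by (intro Min_le) (auto simp: Gaps_def)
    have "eventually (\<lambda>y. \<bar>y i $ c - x i $ c\<bar> < \<delta>) (at x within tie_cell n R)" for i c
    proof -
      have "((\<lambda>y. y i $ c) \<longlongrightarrow> x i $ c) (at x within tie_cell n R)"
        using coord_continuous[of "tie_cell n R" i c] x unfolding continuous_on_def by simp
      from tendstoD[OF this \<delta>0] show ?thesis by (simp add: dist_real_def)
    qed
    then have "eventually (\<lambda>y. \<forall>c. \<bar>y i $ c - x i $ c\<bar> < \<delta>) (at x within tie_cell n R)" for i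
      by (intro eventually_all_finite)
    then have "eventually (\<lambda>y. \<forall>i\<in>{1..n}. \<forall>c. \<bar>y i $ c - x i $ c\<bar> < \<delta>) (at x within tie_cell n R)"
      by (intro eventually_ball_finite) auto
    moreover have "eventually (\<lambda>y. y \<in> tie_cell n R) (at x within tie_cell n R)" by (simp add: eventually_at_filter)
    ultimately show "eventually (\<lambda>y. dist (h (emp_path n y)) (h (emp_path n x)) < \<epsilon>) (at x within tie_cell n R)"
    proof eventually_elim
      case (elim y)
      have "sk_dist (emp_path n x) (emp_path n y) \<le> max \<delta> (sqrt (real n) * (real CARD('d) * e))"
      proof (rule emp_path_sk_close)
        show "0 \<le> \<delta>" "0 \<le> e" using \<delta>0 e by simp_all
        show "\<forall>i u v. \<bar>u - v\<bar> \<le> \<delta> \<longrightarrow> \<bar>marg i (ereal u) - marg i (ereal v)\<bar> \<le> e" using d1(2) \<delta>1(1) by (meson order_trans)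
        show "\<forall>c. \<forall>i\<in>{1..n}. \<bar>y i $ c - x i $ c\<bar> \<le> \<delta>" using elim(1) by (simp add: less_imp_le)
        show "\<forall>c. \<forall>i\<in>{1..n}. \<forall>j\<in>{1..n}. \<bar>(y i $ c - x i $ c) - (y j $ c - x j $ c)\<bar> \<le> \<bar>x i $ c - x j $ c\<bar> / 2"
        proof (intro allI ballI)
          fix c i j assume ij: "i \<in> {1..n}" "j \<in> {1..n}"
          show "\<bar>(y i $ c - x i $ c) - (y j $ c - x j $ c)\<bar> \<le> \<bar>x i $ c - x j $ c\<bar> / 2"
          proof (cases "x i $ c = x j $ c")
            case True
            then have "y i $ c = y j $ c" using x elim(2) ij unfolding tie_cell_def by simp
            then show ?thesis using True by simp
          next
            case False
            have "\<bar>y i $ c - x i $ c\<bar> < \<delta>" "\<bar>y j $ c - x j $ c\<bar> < \<delta>" using elim(1) ij by simp_all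
            then show ?thesis using \<delta>g[OF ij False] by linarith
          qed
        qed
      qed
      also have "\<dots> < dh" using \<delta>1(2) e2 by simp
      finally have "\<bar>h (emp_path n x) - h (emp_path n y)\<bar> < \<epsilon>" using dh(2) emp_path_Dspace[of n y] by simp
      then show ?case by (simp add: dist_real_def abs_minus_commute)
    qed
  qed
qed

text \<open>The integrals in \<open>conv_distr_D\<close> carry information only for integrable
  functions. Measurability is obtained by gluing the finitely many tie cells, on each of which the
  functional is continuous.\<close>

lemma sk_continuous_emp_measurable:
  assumes h: "sk_continuous h"
  shows "(\<lambda>\<omega>. h (\<lambda>t. emp (orthant_ind t) n \<omega>)) \<in> borel_measurable M"
proof -
  have g: "(\<lambda>x. h (emp_path n x)) \<in> borel_measurable borel"
  proof (rule measurable_piecewise_restrict[where C = "tie_cell n ` Pow (UNIV \<times> {1..n} \<times> {1..n})"])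
    show "countable (tie_cell n ` Pow (UNIV \<times> {1..n} \<times> {1..n}))" by (intro countable_finite finite_imageI) simp
    show "c \<inter> space borel \<in> sets borel" if "c \<in> tie_cell n ` Pow (UNIV \<times> {1..n} \<times> {1..n})" for c
      using that tie_cell_meas by auto
    show "space borel \<subseteq> \<Union> (tie_cell n ` Pow (UNIV \<times> {1..n} \<times> {1..n}))"
    proof
      fix x :: "nat \<Rightarrow> real^'d"
      let ?R = "{(c, i, j). i \<in> {1..n} \<and> j \<in> {1..n} \<and> x i $ c = x j $ c}"
      have "x \<in> tie_cell n ?R" unfolding tie_cell_def by simp
      moreover have "?R \<in> Pow (UNIV \<times> {1..n} \<times> {1..n})" by auto
      ultimately show "x \<in> \<Union> (tie_cell n ` Pow (UNIV \<times> {1..n} \<times> {1..n}))" by (rule UN_I[rotated])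
    qed
    show "(\<lambda>x. h (emp_path n x)) \<in> borel_measurable (restrict_space borel c)"
      if "c \<in> tie_cell n ` Pow (UNIV \<times> {1..n} \<times> {1..n})" for c
      using that by (elim imageE) (simp add: borel_measurable_continuous_on_restrict sk_continuous_on_tie_cell[OF h])
  qed
  have "(\<lambda>\<omega> i. X i \<omega>) \<in> measurable M (PiM UNIV (\<lambda>_. borel))" by (rule measurable_PiM_single') auto
  then have "(\<lambda>\<omega> i. X i \<omega>) \<in> borel_measurable M" using sets_PiM_equal_borel measurable_cong_sets by blast
  from measurable_compose[OF this g] show ?thesis by (simp add: emp_path_eq[abs_def])
qed

lemma emp_in_Dspace: "(\<lambda>t. emp (orthant_ind t) n \<omega>) \<in> Dspace"
  using emp_path_Dspace[of n "\<lambda>i. X i \<omega>"] by (simp add: emp_path_eq[abs_def])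

end

section \<open>Convergence in distribution\<close>

text \<open>Inserting the bound \<open>B\<close> keeps the set nonempty for unbounded \<open>x\<close>.\<close>

definition sup_reg :: "((ereal^'d \<Rightarrow> real) \<Rightarrow> real) \<Rightarrow> real \<Rightarrow> real \<Rightarrow> (ereal^'d \<Rightarrow> real) \<Rightarrow> real" where
  "sup_reg h B k x = Inf (insert B {h y + k * c | y c. y \<in> Dspace \<and> 0 \<le> c \<and> (\<forall>t. \<bar>x t - y t\<bar> \<le> c)})"

context
  fixes h :: "(ereal^'d \<Rightarrow> real) \<Rightarrow> real" and B k :: real
  assumes hB: "\<forall>x\<in>Dspace. \<bar>h x\<bar> \<le> B" and k: "0 \<le> k"
begin

lemma zero_in_Dspace: "(\<lambda>_. 0) \<in> Dspace"
  by (rule continuous_in_Dspace) simp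

lemma bound_nonneg: "0 \<le> B"
  using bspec[OF hB zero_in_Dspace] by linarith

lemma sup_reg_greatest:
  assumes "b \<le> B" and "\<And>y c. y \<in> Dspace \<Longrightarrow> 0 \<le> c \<Longrightarrow> \<forall>t. \<bar>x t - y t\<bar> \<le> c \<Longrightarrow> b \<le> h y + k * c"
  shows "b \<le> sup_reg h B k x"
  unfolding sup_reg_def
proof (rule cInf_greatest)
  fix z assume "z \<in> insert B {h y + k * c | y c. y \<in> Dspace \<and> 0 \<le> c \<and> (\<forall>t. \<bar>x t - y t\<bar> \<le> c)}"
  then show "b \<le> z"
  proof (elim insertE CollectE exE conjE)
    fix y c assume "z = h y + k * c" "y \<in> Dspace" "0 \<le> c" "\<forall>t. \<bar>x t - y t\<bar> \<le> c"
    then show ?thesis using assms(2)[of y c] by simp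
  qed (use assms(1) in simp)
qed simp

lemma sup_reg_bdd: "bdd_below (insert B {h y + k * c | y c. y \<in> Dspace \<and> 0 \<le> c \<and> (\<forall>t. \<bar>x t - y t\<bar> \<le> c)})"
proof (rule bdd_belowI[of _ "- B"])
  fix z assume "z \<in> insert B {h y + k * c | y c. y \<in> Dspace \<and> 0 \<le> c \<and> (\<forall>t. \<bar>x t - y t\<bar> \<le> c)}"
  then show "- B \<le> z"
  proof (elim insertE CollectE exE conjE)
    fix y c assume z: "z = h y + k * c" and y: "y \<in> Dspace" and c: "0 \<le> c"
    have "0 \<le> k * c" using k c by simp
    then show ?thesis using bspec[OF hB y] z by linarith
  qed (use bound_nonneg in simp)
qed

lemma sup_reg_le_B: "sup_reg h B k x \<le> B"
  unfolding sup_reg_def by (rule cInf_lower[OF insertI1 sup_reg_bdd])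

lemma sup_reg_le_elem:
  assumes "y \<in> Dspace" "0 \<le> c" "\<forall>t. \<bar>x t - y t\<bar> \<le> c"
  shows "sup_reg h B k x \<le> h y + k * c"
  unfolding sup_reg_def by (intro cInf_lower sup_reg_bdd insertI2 CollectI exI[of _ y] exI[of _ c] conjI refl assms)

lemma sup_reg_abs_le: "\<bar>sup_reg h B k x\<bar> \<le> B"
proof (rule abs_leI[OF sup_reg_le_B])
  have "- B \<le> sup_reg h B k x"
  proof (rule sup_reg_greatest)
    fix y :: "ereal^'d \<Rightarrow> real" and c :: real assume y: "y \<in> Dspace" and c: "0 \<le> c"
    have "0 \<le> k * c" using k c by simp
    then show "- B \<le> h y + k * c" using bspec[OF hB y] by linarith
  qed (use bound_nonneg in simp)
  then show "- sup_reg h B k x \<le> B" by simp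
qed

lemma sup_reg_le: "x \<in> Dspace \<Longrightarrow> sup_reg h B k x \<le> h x"
  using sup_reg_le_elem[of x 0 x] by simp

text \<open>A competitor for \<open>y\<close> at radius \<open>c\<close> is one for \<open>x\<close>
  at radius \<open>c + s\<close>, at the extra cost \<open>k * s\<close>.\<close>

lemma sup_reg_Lipschitz:
  assumes s: "\<forall>t. \<bar>x t - y t\<bar> \<le> s"
  shows "\<bar>sup_reg h B k x - sup_reg h B k y\<bar> \<le> k * s"
proof -
  have s0: "0 \<le> s" using spec[OF s, of undefined] by linarith
  have ks: "0 \<le> k * s" using k s0 by simp
  have *: "sup_reg h B k x - k * s \<le> sup_reg h B k y" if s: "\<forall>t. \<bar>x t - y t\<bar> \<le> s" for x y
  proof (rule sup_reg_greatest)
    show "sup_reg h B k x - k * s \<le> B" using sup_reg_le_B[of x] ks by linarith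
    fix z c assume z: "z \<in> Dspace" "0 \<le> c" "\<forall>t. \<bar>y t - z t\<bar> \<le> c"
    have "\<forall>t. \<bar>x t - z t\<bar> \<le> c + s"
    proof
      fix t show "\<bar>x t - z t\<bar> \<le> c + s" using spec[OF z(3), of t] spec[OF s, of t] by linarith
    qed
    from sup_reg_le_elem[OF z(1) _ this] have "sup_reg h B k x \<le> h z + k * (c + s)" using z(2) s0 by simp
    then show "sup_reg h B k x - k * s \<le> h z + k * c" by (simp add: distrib_left)
  qed
  have "\<forall>t. \<bar>y t - x t\<bar> \<le> s" using s by (simp add: abs_minus_commute)
  from *[OF this] *[OF s] show ?thesis by (intro abs_leI) linarith+
qed

end

text \<open>A competitor at sup distance at least \<open>\<delta>\<close> costs
  \<open>k * \<delta> \<ge> 2 * B\<close> and cannot undercut \<open>h x\<close>. A nearer one is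
  near in the Skorokhod distance too, by the identity time change, so continuity of \<open>h\<close>
  applies.\<close>

lemma sup_reg_tendsto:
  assumes hB: "\<forall>x\<in>Dspace. \<bar>h x\<bar> \<le> B" and h: "sk_continuous h" and x: "x \<in> Dspace"
  shows "(\<lambda>k. sup_reg h B (real k) x) \<longlonglongrightarrow> h x"
proof (rule LIMSEQ_I)
  fix e :: real assume e: "0 < e"
  have "\<exists>\<delta>>0. \<forall>y\<in>Dspace. sk_dist x y < \<delta> \<longrightarrow> \<bar>h x - h y\<bar> < e / 2"
    using spec[OF bspec[OF h[unfolded sk_continuous_def] x], of "e / 2"] half_gt_zero[OF e] by (rule mp)
  then obtain \<delta> where \<delta>: "\<delta> > 0" "\<forall>y\<in>Dspace. sk_dist x y < \<delta> \<longrightarrow> \<bar>h x - h y\<bar> < e / 2"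
    by (elim exE conjE) (rule that)
  obtain K :: nat where K: "2 * B / \<delta> < real K" using reals_Archimedean2[of "2 * B / \<delta>"] by (elim exE) (rule that)
  show "\<exists>K. \<forall>k\<ge>K. norm (sup_reg h B (real k) x - h x) < e"
  proof (intro exI[of _ K] allI impI)
    fix k assume kK: "K \<le> k"
    have B0: "0 \<le> B" and hx: "h x \<le> B" using bspec[OF hB x] by linarith+
    have "2 * B \<le> real k * \<delta>"
    proof -
      have "2 * B / \<delta> < real k" using K kK by linarith
      then show ?thesis using \<delta>(1) by (simp add: pos_divide_less_eq)
    qed
    have "h x - e / 2 \<le> sup_reg h B (real k) x"
    proof (rule sup_reg_greatest[OF hB])
      show "h x - e / 2 \<le> B" using hx e by linarith
      fix y c assume y: "y \<in> Dspace" and c: "0 \<le> c" and yc: "\<forall>t. \<bar>x t - y t\<bar> \<le> c"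
      have kc: "0 \<le> real k * c" using c by simp
      show "h x - e / 2 \<le> h y + real k * c"
      proof (cases "c < \<delta>")
        case True
        have "sk_dist x y \<le> c" by (rule sk_dist_sup_le[OF spec[OF yc] c])
        then have "\<bar>h x - h y\<bar> < e / 2" using \<delta>(2) y True by simp
        then show ?thesis using kc by linarith
      next
        case False
        have "real k * \<delta> \<le> real k * c" using False by (intro mult_left_mono) auto
        then show ?thesis using \<open>2 * B \<le> real k * \<delta>\<close> bspec[OF hB y] hx e by linarith
      qed
    qed simp
    moreover have "sup_reg h B (real k) x \<le> h x" by (rule sup_reg_le[OF hB _ x]) simp
    ultimately show "norm (sup_reg h B (real k) x - h x) < e" using e by simp
  qed
qed

section \<open>Convergence of expectations\<close>

context emp_clt
begin

text \<open>A path composed with \<open>proj m\<close> is determined by its values on the finite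
  grid, so \<open>g\<close> becomes a function of finitely many real coordinates. The inclusion of
  ranges transfers the bound on \<open>g\<close>.\<close>

lemma grid_functional:
  fixes g :: "(ereal^'d \<Rightarrow> real) \<Rightarrow> real"
  assumes Lip: "\<forall>x y s. (\<forall>t. \<bar>x t - y t\<bar> \<le> s) \<longrightarrow> \<bar>g x - g y\<bar> \<le> L * s" and L: "0 \<le> L"
  shows "\<exists>(e :: nat \<Rightarrow> ereal^'d) K f. (\<forall>x y. \<bar>f x - f y\<bar> \<le> L * (\<Sum>i<K. \<bar>x i - y i\<bar>)) \<and>
     (\<forall>F. g (\<lambda>t. F (proj m t)) = f (\<lambda>i. F (e i))) \<and> range f \<subseteq> range g"
proof -
  obtain e :: "nat \<Rightarrow> ereal^'d" where e: "bij_betw e {0..<card (grid m)} (grid m)"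
    using ex_bij_betw_nat_finite[OF grid_finite_card(1)[of m]] by (elim exE) (rule that)
  define num where "num = inv_into {0..<card (grid m)} e"
  have num: "num (proj m t) < card (grid m)" "e (num (proj m t)) = proj m t" for t
    using bij_betw_inv_into_right[OF e proj_in_grid] bij_betwE[OF bij_betw_inv_into[OF e]] proj_in_grid
    unfolding num_def by auto
  define f where "f x = g (\<lambda>t. x (num (proj m t)))" for x :: "nat \<Rightarrow> real"
  show ?thesis
  proof (intro exI[of _ e] exI[of _ "card (grid m)"] exI[of _ f] conjI allI)
    fix x y :: "nat \<Rightarrow> real"
    show "\<bar>f x - f y\<bar> \<le> L * (\<Sum>i<card (grid m). \<bar>x i - y i\<bar>)"
      unfolding f_def
    proof (rule Lip[rule_format])
      fix t
      show "\<bar>x (num (proj m t)) - y (num (proj m t))\<bar> \<le> (\<Sum>i<card (grid m). \<bar>x i - y i\<bar>)"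
        by (rule member_le_sum[of "num (proj m t)" "{..<card (grid m)}" "\<lambda>i. \<bar>x i - y i\<bar>"]) (use num in auto)
    qed
    show "g (\<lambda>t. F (proj m t)) = f (\<lambda>i. F (e i))" for F by (simp add: f_def num)
    show "range f \<subseteq> range g" unfolding f_def by auto
  qed
qed

text \<open>At level 0 any two points are close, so \<open>square_modulus\<close> compares
  \<open>t\<close> with the point at \<open>- \<infinity>\<close>, whose orthant is empty.\<close>

lemma emp_square_bound: "\<exists>C>0. \<forall>t n. (\<integral>\<omega>. (emp (orthant_ind t) n \<omega>)\<^sup>2 \<partial>M) \<le> C"
proof -
  obtain C where C: "C > 0" "\<forall>k s t n. 1 \<le> n \<longrightarrow> (\<forall>i. \<bar>marg i (s $ i) - marg i (t $ i)\<bar> \<le> 1 / 2 ^ k) \<longrightarrow>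
     (\<integral>\<omega>. (emp (orthant_ind s) n \<omega> - emp (orthant_ind t) n \<omega>)\<^sup>2 \<partial>M) \<le> C * \<rho> ^ k"
    using square_modulus by (elim exE conjE) (rule that)
  define b :: "ereal^'d" where "b = (\<chi> _. -\<infinity>)"
  have b: "orthant_ind b = (\<lambda>_. 0)" by (rule ext) (simp add: orthant_ind_def le_ext_def b_def)
  show ?thesis
  proof (intro exI[of _ C] conjI allI C(1))
    fix t n
    show "(\<integral>\<omega>. (emp (orthant_ind t) n \<omega>)\<^sup>2 \<partial>M) \<le> C"
    proof (cases "n = 0")
      case True
      then show ?thesis using C(1) by (simp add: emp_def)
    next
      case False
      have "\<forall>i. \<bar>marg i (t $ i) - marg i (b $ i)\<bar> \<le> 1 / 2 ^ 0"
        using marg_nonneg marg_le_1 by (simp add: b_def marg_bot)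
      then have "(\<integral>\<omega>. (emp (orthant_ind t) n \<omega> - emp (orthant_ind b) n \<omega>)\<^sup>2 \<partial>M) \<le> C * \<rho> ^ 0"
        by (intro C(2)[rule_format]) (use False in auto)
      then show ?thesis unfolding b by (simp add: emp_def)
    qed
  qed
qed

lemma W_square:
  "integrable white_noise (\<lambda>\<omega>. (W t \<omega>)\<^sup>2)" "(\<integral>\<omega>. (W t \<omega>)\<^sup>2 \<partial>white_noise) = kern t t"
proof -
  have q: "quad {()} (\<lambda>_. t) (\<lambda>_. 1) = kern t t" by (simp add: quad_def)
  have q0: "0 \<le> kern t t" using quad_nonneg[of "{()}" "\<lambda>_. t" "\<lambda>_. 1"] unfolding q by simp
  have d: "distr white_noise borel (\<lambda>\<omega>. W t \<omega>) = gauss_law (kern t t)"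
    using W_comb_distr[of "{()}" "\<lambda>_. 1" "\<lambda>_. t"] unfolding q by simp
  have "integrable (distr white_noise borel (\<lambda>\<omega>. W t \<omega>)) (\<lambda>x. x\<^sup>2)"
    unfolding d using gauss_law_moment(1)[OF q0, of 1] by simp
  then show "integrable white_noise (\<lambda>\<omega>. (W t \<omega>)\<^sup>2)" by (subst (asm) integrable_distr_eq) auto
  have "(\<integral>\<omega>. (W t \<omega>)\<^sup>2 \<partial>white_noise) = (\<integral>x. x\<^sup>2 \<partial>distr white_noise borel (\<lambda>\<omega>. W t \<omega>))"
    by (subst integral_distr) auto
  also have "\<dots> = kern t t" unfolding d using gauss_law_moment(2)[OF q0, of 1] by simp
  finally show "(\<integral>\<omega>. (W t \<omega>)\<^sup>2 \<partial>white_noise) = kern t t" .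
qed

lemma grid_weak_conv:
  fixes g :: "(ereal^'d \<Rightarrow> real) \<Rightarrow> real"
  assumes Lip: "\<forall>x y s. (\<forall>t. \<bar>x t - y t\<bar> \<le> s) \<longrightarrow> \<bar>g x - g y\<bar> \<le> L * s" and L: "0 \<le> L"
    and B: "\<And>x. \<bar>g x\<bar> \<le> B"
  shows "(\<lambda>\<omega>. g (\<lambda>t. emp (orthant_ind (proj m t)) n \<omega>)) \<in> borel_measurable M" (is "?m1 n")
    and "(\<lambda>\<omega>. g (\<lambda>t. W (proj m t) \<omega>)) \<in> borel_measurable white_noise" (is ?m2)
    and "(\<lambda>n. \<integral>\<omega>. g (\<lambda>t. emp (orthant_ind (proj m t)) n \<omega>) \<partial>M) \<longlonglongrightarrow>
      (\<integral>\<omega>. g (\<lambda>t. W (proj m t) \<omega>) \<partial>white_noise)" (is ?l)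
proof -
  obtain e :: "nat \<Rightarrow> ereal^'d" and K f where f: "\<forall>x y. \<bar>f x - f y\<bar> \<le> L * (\<Sum>i<K. \<bar>x i - y i\<bar>)"
     "\<forall>F. g (\<lambda>t. F (proj m t)) = f (\<lambda>i. F (e i))" "range f \<subseteq> range g"
    using grid_functional[where m = m, OF Lip L] by (elim exE conjE) (rule that)
  obtain C where C: "C > 0" "\<forall>t n. (\<integral>\<omega>. (emp (orthant_ind t) n \<omega>)\<^sup>2 \<partial>M) \<le> C"
    using emp_square_bound by (elim exE conjE) (rule that)
  have fe: "g (\<lambda>t. emp (orthant_ind (proj m t)) n \<omega>) = f (\<lambda>i. emp (orthant_ind (e i)) n \<omega>)" for n \<omega>
    using spec[OF f(2), of "\<lambda>t. emp (orthant_ind t) n \<omega>"] .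
  have fW: "g (\<lambda>t. W (proj m t) \<omega>) = f (\<lambda>i. W (e i) \<omega>)" for \<omega>
    using spec[OF f(2), of "\<lambda>t. W t \<omega>"] .
  have fB: "\<bar>f x\<bar> \<le> B" for x
  proof -
    have "f x \<in> range g" using f(3) by blast
    then show ?thesis using B by auto
  qed
  note fL = spec[OF spec[OF f(1)]]
  show "?m1 n" unfolding fe by (rule measurable_Lipschitz_coords[OF fL]) measurable
  show ?m2 unfolding fW by (rule measurable_Lipschitz_coords[OF fL]) measurable
  have kern0: "0 \<le> kern t t" for t
    unfolding W_square(2)[symmetric] by simp
  \<comment> \<open>A single constant has to bound the second moments of the empirical process for
    all \<open>n\<close> and those of the limit.\<close>
  define S where "S = C + (\<Sum>i<K. kern (e i) (e i))"
  have S0: "0 \<le> S" "C \<le> S" unfolding S_def using C(1) sum_nonneg[of "{..<K}" "\<lambda>i. kern (e i) (e i)"] kern0 by force+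
  have S1: "kern (e i) (e i) \<le> S" if "i < K" for i
    unfolding S_def using member_le_sum[of i "{..<K}" "\<lambda>i. kern (e i) (e i)"] that kern0 C(1) by force
  show ?l unfolding fe fW
  proof (rule weak_conv_of_char[where h = f and Y = "\<lambda>n \<omega> i. emp (orthant_ind (e i)) n \<omega>" and Z = "\<lambda>\<omega> i. W (e i) \<omega>" and S = S and k = K and C = L and B = B])
    show "prob_space M" by (rule prob_space_axioms)
    show "prob_space white_noise" by (rule prob_space_white_noise)
    show "(\<lambda>\<omega>. emp (orthant_ind (e i)) n \<omega>) \<in> borel_measurable M" for n i by measurable
    show "(\<lambda>\<omega>. W (e i) \<omega>) \<in> borel_measurable white_noise" for i by measurable
    show "(\<lambda>n. CLINT \<omega>|M. iexp (\<Sum>i<K. c i * emp (orthant_ind (e i)) n \<omega>)) \<longlonglongrightarrow> (CLINT \<omega>|white_noise. iexp (\<Sum>i<K. c i * W (e i) \<omega>))" for c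
      using quad_char[of "{..<K}" e c] unfolding emp_comb_def W_char[OF finite_lessThan] by simp
    show "integrable M (\<lambda>\<omega>. (emp (orthant_ind (e i)) n \<omega>)\<^sup>2)" for n i
      by (rule integrable_emp_pow[of _ 1]) auto
    show "(\<integral>\<omega>. (emp (orthant_ind (e i)) n \<omega>)\<^sup>2 \<partial>M) \<le> S" for n i
      using C(2)[rule_format, of "e i" n] S0(2) by linarith
    show "integrable white_noise (\<lambda>\<omega>. (W (e i) \<omega>)\<^sup>2)" for i by (rule W_square)
    show "(\<integral>\<omega>. (W (e i) \<omega>)\<^sup>2 \<partial>white_noise) \<le> S" if "i < K" for i unfolding W_square(2) by (rule S1[OF that])
  qed (use S0 fL fB in auto)
qed

text \<open>\<open>lo m\<close> is the same function at \<open>t\<close> and at its projection, so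
  both values are close to a common one.\<close>

lemma emp_proj_close:
  assumes w: "\<forall>t. \<bar>emp (orthant_ind t) n \<omega> - emp (lo m t) n \<omega>\<bar> \<le> 3 * \<eta>"
  shows "\<bar>emp (orthant_ind t) n \<omega> - emp (orthant_ind (proj m t)) n \<omega>\<bar> \<le> 6 * \<eta>"
  using spec[OF w, of t] spec[OF w, of "proj m t"] unfolding lo_proj by linarith

text \<open>The functional may involve uncountably many coordinates. Paths are uniform limits of
  their projections, so measurability and the integral pass to the limit from the grids.\<close>

lemma W_Lipschitz_integral:
  fixes g :: "(ereal^'d \<Rightarrow> real) \<Rightarrow> real"
  assumes Lip: "\<forall>x y s. (\<forall>t. \<bar>x t - y t\<bar> \<le> s) \<longrightarrow> \<bar>g x - g y\<bar> \<le> L * s" and L: "0 \<le> L"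
    and B: "\<And>x. \<bar>g x\<bar> \<le> B"
  shows "(\<lambda>\<omega>. g (\<lambda>t. W t \<omega>)) \<in> borel_measurable white_noise"
    and "(\<lambda>m. \<integral>\<omega>. g (\<lambda>t. W (proj m t) \<omega>) \<partial>white_noise) \<longlonglongrightarrow> (\<integral>\<omega>. g (\<lambda>t. W t \<omega>) \<partial>white_noise)"
proof -
  have conv: "(\<lambda>m. g (\<lambda>t. W (proj m t) \<omega>)) \<longlonglongrightarrow> g (\<lambda>t. W t \<omega>)" for \<omega>
  proof (rule LIMSEQ_I)
    fix e :: real assume e: "0 < e"
    have e': "0 < e / (L + 1)" using e L by simp
    obtain k0 where k0: "\<forall>k\<ge>k0. \<forall>t. \<bar>W t \<omega> - W (proj k t) \<omega>\<bar> \<le> e / (L + 1)"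
      using W_proj_uniform[OF e', of \<omega>] by (elim exE) (rule that)
    show "\<exists>k0. \<forall>m\<ge>k0. norm (g (\<lambda>t. W (proj m t) \<omega>) - g (\<lambda>t. W t \<omega>)) < e"
    proof (intro exI[of _ k0] allI impI)
      fix m assume m: "k0 \<le> m"
      have "\<bar>g (\<lambda>t. W t \<omega>) - g (\<lambda>t. W (proj m t) \<omega>)\<bar> \<le> L * (e / (L + 1))"
        by (rule Lip[rule_format]) (use k0 m in blast)
      also have "\<dots> < e" using e L by (simp add: pos_divide_less_eq)
      finally show "norm (g (\<lambda>t. W (proj m t) \<omega>) - g (\<lambda>t. W t \<omega>)) < e" by (simp add: abs_minus_commute)
    qed
  qed
  note m2 = grid_weak_conv(2)[OF Lip L B]
  show m: "(\<lambda>\<omega>. g (\<lambda>t. W t \<omega>)) \<in> borel_measurable white_noise"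
    by (rule borel_measurable_LIMSEQ_real[where u = "\<lambda>m \<omega>. g (\<lambda>t. W (proj m t) \<omega>)"]) (rule conv m2)+
  show "(\<lambda>m. \<integral>\<omega>. g (\<lambda>t. W (proj m t) \<omega>) \<partial>white_noise) \<longlonglongrightarrow> (\<integral>\<omega>. g (\<lambda>t. W t \<omega>) \<partial>white_noise)"
    by (rule integral_dominated_convergence[where w = "\<lambda>_. B"]) (use conv m2 m B in auto)
qed

text \<open>Four losses of at most \<open>\<epsilon> / 4\<close>: replacing the process by its
  projection outside \<open>A\<close>, the event \<open>A\<close> itself, weak convergence on the
  grid, and projecting the limit. \<open>m\<close> is fixed before \<open>n\<close> grows.\<close>

lemma emp_integral_lower:
  assumes hB: "\<forall>x\<in>Dspace. \<bar>h x\<bar> \<le> B" and h: "sk_continuous h" and e: "0 < \<epsilon>"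
  shows "eventually (\<lambda>n. (\<integral>\<omega>. sup_reg h B (real k) (\<lambda>t. W t \<omega>) \<partial>white_noise) - \<epsilon>
    \<le> (\<integral>\<omega>. h (\<lambda>t. emp (orthant_ind t) n \<omega>) \<partial>M)) sequentially"
proof -
  let ?g = "sup_reg h B (real k)"
  note reg = hB of_nat_0_le_iff[of k]
  have Lip: "\<forall>x y s. (\<forall>t. \<bar>x t - y t\<bar> \<le> s) \<longrightarrow> \<bar>?g x - ?g y\<bar> \<le> real k * s"
    using sup_reg_Lipschitz[OF reg] by blast
  note gB = sup_reg_abs_le[OF reg]
  have B0: "0 \<le> B" by (rule bound_nonneg[OF reg])
  \<comment> \<open>Projection moves the process by at most \<open>6 * \<eta>\<close> outside
    \<open>A\<close>; the Lipschitz constant \<open>k\<close> turns this into at most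
    \<open>\<epsilon> / 4\<close>.\<close>
  define \<eta> where "\<eta> = \<epsilon> / (24 * (real k + 1))"
  have \<eta>: "0 < \<eta>" unfolding \<eta>_def using e by simp
  have k\<eta>: "real k * (6 * \<eta>) \<le> \<epsilon> / 4"
  proof -
    have "real k * (6 * \<eta>) \<le> (real k + 1) * (6 * \<eta>)" using \<eta> by (intro mult_right_mono) auto
    also have "\<dots> = \<epsilon> / 4" unfolding \<eta>_def by (simp add: field_simps)
    finally show ?thesis .
  qed
  obtain C where C: "\<forall>m. \<exists>N. \<forall>n\<ge>N. \<exists>A\<in>sets M. prob A \<le> C * \<beta> ^ m \<and>
      (\<forall>\<omega>\<in>space M - A. \<forall>t. \<bar>emp (orthant_ind t) n \<omega> - emp (lo m t) n \<omega>\<bar> \<le> 3 * \<eta>)"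
    using chaining[rule_format, OF \<eta>] by (elim exE) (rule that)
  have "(\<lambda>m. 2 * B * (C * \<beta> ^ m)) \<longlonglongrightarrow> 2 * B * (C * 0)"
    using beta_bounds by (intro tendsto_intros LIMSEQ_realpow_zero) auto
  then have ev1: "eventually (\<lambda>m. 2 * B * (C * \<beta> ^ m) < \<epsilon> / 4) sequentially"
    by (rule order_tendstoD(2)) (use e in simp)
  have ev2: "eventually (\<lambda>m. (\<integral>\<omega>. ?g (\<lambda>t. W t \<omega>) \<partial>white_noise) - \<epsilon> / 4 < (\<integral>\<omega>. ?g (\<lambda>t. W (proj m t) \<omega>) \<partial>white_noise)) sequentially"
    by (rule order_tendstoD(1)[OF W_Lipschitz_integral(2)[OF Lip _ gB]]) (use e in simp_all)
  obtain m where m: "2 * B * (C * \<beta> ^ m) < \<epsilon> / 4"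
    "(\<integral>\<omega>. ?g (\<lambda>t. W t \<omega>) \<partial>white_noise) - \<epsilon> / 4 < (\<integral>\<omega>. ?g (\<lambda>t. W (proj m t) \<omega>) \<partial>white_noise)"
    using eventually_happens'[OF sequentially_bot eventually_conj[OF ev1 ev2]] by (elim exE conjE) (rule that)
  obtain N where N: "\<forall>n\<ge>N. \<exists>A\<in>sets M. prob A \<le> C * \<beta> ^ m \<and>
      (\<forall>\<omega>\<in>space M - A. \<forall>t. \<bar>emp (orthant_ind t) n \<omega> - emp (lo m t) n \<omega>\<bar> \<le> 3 * \<eta>)"
    using spec[OF C, of m] by (elim exE) (rule that)
  have "eventually (\<lambda>n. (\<integral>\<omega>. ?g (\<lambda>t. W (proj m t) \<omega>) \<partial>white_noise) - \<epsilon> / 4 <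
      (\<integral>\<omega>. ?g (\<lambda>t. emp (orthant_ind (proj m t)) n \<omega>) \<partial>M)) sequentially"
    by (rule order_tendstoD(1)[OF grid_weak_conv(3)[OF Lip _ gB]]) (use e in simp_all)
  moreover have "eventually (\<lambda>n. n \<ge> N) sequentially" by (rule eventually_ge_at_top)
  ultimately show ?thesis
  proof eventually_elim
    case (elim n)
    let ?U = "\<lambda>\<omega> t. emp (orthant_ind t) n \<omega>"
    let ?P = "\<lambda>\<omega> t. emp (orthant_ind (proj m t)) n \<omega>"
    obtain A where A: "A \<in> sets M" "prob A \<le> C * \<beta> ^ m"
      "\<forall>\<omega>\<in>space M - A. \<forall>t. \<bar>emp (orthant_ind t) n \<omega> - emp (lo m t) n \<omega>\<bar> \<le> 3 * \<eta>"
      using N[rule_format, OF elim(2)] by (elim bexE conjE) (rule that)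
    have pw: "?g (?P \<omega>) - (real k * (6 * \<eta>) + 2 * B * indicator A \<omega>) \<le> h (?U \<omega>)" if w: "\<omega> \<in> space M" for \<omega>
    proof (cases "\<omega> \<in> A")
      case True
      have "\<bar>h (?U \<omega>)\<bar> \<le> B" by (rule bspec[OF hB emp_in_Dspace])
      moreover have "0 \<le> real k * (6 * \<eta>)" using \<eta> by simp
      moreover have "\<bar>?g (?P \<omega>)\<bar> \<le> B" by (rule gB)
      moreover have "2 * B * indicator A \<omega> = 2 * B" using True by simp
      ultimately show ?thesis by linarith
    next
      case False
      have "\<forall>t. \<bar>emp (orthant_ind t) n \<omega> - emp (lo m t) n \<omega>\<bar> \<le> 3 * \<eta>" using A(3) w False by simp
      then have "\<bar>?g (?U \<omega>) - ?g (?P \<omega>)\<bar> \<le> real k * (6 * \<eta>)"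
        by (intro Lip[rule_format] emp_proj_close)
      moreover have "?g (?U \<omega>) \<le> h (?U \<omega>)" by (rule sup_reg_le[OF reg emp_in_Dspace])
      ultimately show ?thesis using False by simp
    qed
    have i1: "integrable M (\<lambda>\<omega>. ?g (?P \<omega>))"
      by (rule integrable_const_bound[of _ B]) (use gB grid_weak_conv(1)[OF Lip _ gB] in auto)
    have i2: "integrable M (\<lambda>\<omega>. real k * (6 * \<eta>) + 2 * B * indicator A \<omega>)"
      by (intro Bochner_Integration.integrable_add integrable_const integrable_mult_right integrable_real_indicator)
        (use A(1) emeasure_finite in \<open>auto simp: less_top[symmetric]\<close>)
    have i3: "integrable M (\<lambda>\<omega>. h (?U \<omega>))"
    proof (rule integrable_const_bound[of _ B])
      show "AE \<omega> in M. norm (h (?U \<omega>)) \<le> B" using bspec[OF hB emp_in_Dspace] by simp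
    qed (rule sk_continuous_emp_measurable[OF h])
    have "(\<integral>\<omega>. ?g (?P \<omega>) - (real k * (6 * \<eta>) + 2 * B * indicator A \<omega>) \<partial>M) \<le> (\<integral>\<omega>. h (?U \<omega>) \<partial>M)"
      by (rule integral_mono[OF Bochner_Integration.integrable_diff[OF i1 i2] i3 pw])
    moreover have "(\<integral>\<omega>. ?g (?P \<omega>) - (real k * (6 * \<eta>) + 2 * B * indicator A \<omega>) \<partial>M) = (\<integral>\<omega>. ?g (?P \<omega>) \<partial>M) - (real k * (6 * \<eta>) + 2 * B * prob A)"
    proof -
      have iA: "integrable M (\<lambda>\<omega>. 2 * B * indicator A \<omega>)"
        by (intro integrable_mult_right integrable_real_indicator) (use A(1) emeasure_finite in \<open>auto simp: less_top[symmetric]\<close>)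
      show ?thesis
        unfolding Bochner_Integration.integral_diff[OF i1 i2] Bochner_Integration.integral_add[OF integrable_const iA]
        using A(1) by (simp add: prob_space)
    qed
    moreover have "2 * B * prob A \<le> 2 * B * (C * \<beta> ^ m)" using B0 A(2) by (intro mult_left_mono) auto
    ultimately show ?case using elim(1) m k\<eta> by linarith
  qed
qed

lemma W_in_Dspace: "(\<lambda>t. W t \<omega>) \<in> Dspace"
  by (rule continuous_in_Dspace[OF W_continuous])

text \<open>First \<open>k\<close> is chosen so that the regularisation loses at most
  \<open>\<epsilon> / 2\<close> in the limit integral; then \<open>n\<close> grows with
  \<open>k\<close> fixed. Continuity of the paths of \<open>W\<close> places them in
  \<open>Dspace\<close>, where the regularisations converge to \<open>h\<close>.\<close>

lemma emp_integral_liminf: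
  assumes hB: "\<forall>x\<in>Dspace. \<bar>h x\<bar> \<le> B" and h: "sk_continuous h" and e: "0 < \<epsilon>"
  shows "eventually (\<lambda>n. (\<integral>\<omega>. h (\<lambda>t. W t \<omega>) \<partial>white_noise) - \<epsilon> < (\<integral>\<omega>. h (\<lambda>t. emp (orthant_ind t) n \<omega>) \<partial>M)) sequentially"
proof -
  have gB: "\<bar>sup_reg h B (real k) x\<bar> \<le> B" for k x by (rule sup_reg_abs_le[OF hB]) simp
  have meas: "(\<lambda>\<omega>. sup_reg h B (real k) (\<lambda>t. W t \<omega>)) \<in> borel_measurable white_noise" for k
  proof (rule W_Lipschitz_integral(1)[OF _ _ gB])
    show "\<forall>x y s. (\<forall>t. \<bar>x t - y t\<bar> \<le> s) \<longrightarrow> \<bar>sup_reg h B (real k) x - sup_reg h B (real k) y\<bar> \<le> real k * s"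
      using sup_reg_Lipschitz[OF hB of_nat_0_le_iff[of k]] by blast
  qed simp
  have conv: "(\<lambda>k. sup_reg h B (real k) (\<lambda>t. W t \<omega>)) \<longlonglongrightarrow> h (\<lambda>t. W t \<omega>)" for \<omega>
    by (rule sup_reg_tendsto[OF hB h W_in_Dspace])
  have "(\<lambda>\<omega>. h (\<lambda>t. W t \<omega>)) \<in> borel_measurable white_noise"
    by (rule borel_measurable_LIMSEQ_real[OF conv meas])
  then have "(\<lambda>k. \<integral>\<omega>. sup_reg h B (real k) (\<lambda>t. W t \<omega>) \<partial>white_noise) \<longlonglongrightarrow> (\<integral>\<omega>. h (\<lambda>t. W t \<omega>) \<partial>white_noise)"
    by (rule integral_dominated_convergence[where w = "\<lambda>_. B"]) (use conv meas gB in auto)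
  then have "eventually (\<lambda>k. (\<integral>\<omega>. h (\<lambda>t. W t \<omega>) \<partial>white_noise) - \<epsilon> / 2 < (\<integral>\<omega>. sup_reg h B (real k) (\<lambda>t. W t \<omega>) \<partial>white_noise)) sequentially"
    by (rule order_tendstoD(1)) (use e in simp)
  then obtain k where k: "(\<integral>\<omega>. h (\<lambda>t. W t \<omega>) \<partial>white_noise) - \<epsilon> / 2 < (\<integral>\<omega>. sup_reg h B (real k) (\<lambda>t. W t \<omega>) \<partial>white_noise)"
    using eventually_happens'[OF sequentially_bot] by blast
  from emp_integral_lower[OF hB h half_gt_zero[OF e], of k] show ?thesis
    by eventually_elim (use k in linarith)
qed

text \<open>The lower bound, applied to \<open>h\<close> and to \<open>- h\<close>, gives both
  halves of the convergence.\<close>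

theorem emp_proc_conv_distr: "conv_distr_D M (emp_proc M X) white_noise (\<lambda>\<omega> t. W t \<omega>)"
  unfolding conv_distr_D_def
proof (intro allI impI, elim conjE exE)
  fix h :: "(ereal^'d \<Rightarrow> real) \<Rightarrow> real" and B
  assume h: "sk_continuous h" and hB: "\<forall>x\<in>Dspace. \<bar>h x\<bar> \<le> B"
  have e: "emp_proc M X n \<omega> = (\<lambda>t. emp (orthant_ind t) n \<omega>)" for n \<omega> by (rule ext) (rule emp_proc_eq)
  have hB': "\<forall>x\<in>Dspace. \<bar>- h x\<bar> \<le> B" using hB by simp
  have "\<bar>- a - - b\<bar> = \<bar>a - b\<bar>" for a b :: real by linarith
  then have h': "sk_continuous (\<lambda>x. - h x)" using h unfolding sk_continuous_def by (simp only:)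
  show "(\<lambda>n. \<integral>\<omega>. h (emp_proc M X n \<omega>) \<partial>M) \<longlonglongrightarrow> (\<integral>\<omega>. h (\<lambda>t. W t \<omega>) \<partial>white_noise)"
    unfolding e
  proof (rule tendstoI)
    fix \<epsilon> :: real assume \<epsilon>: "0 < \<epsilon>"
    from emp_integral_liminf[OF hB h \<epsilon>] emp_integral_liminf[OF hB' h' \<epsilon>]
    show "eventually (\<lambda>n. dist (\<integral>\<omega>. h (\<lambda>t. emp (orthant_ind t) n \<omega>) \<partial>M) (\<integral>\<omega>. h (\<lambda>t. W t \<omega>) \<partial>white_noise) < \<epsilon>) sequentially"
      by eventually_elim (simp add: dist_real_def abs_less_iff)
  qed
qed

end

theorem theorem2:
  fixes M :: "'w measure" and X :: "nat \<Rightarrow> 'w \<Rightarrow> real^'d"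
    and G :: "(real^'d \<Rightarrow> real) set" and nG :: "(real^'d \<Rightarrow> real) \<Rightarrow> real"
    and \<Theta> :: "nat \<Rightarrow> real" and r :: real and p :: nat
    and \<Psi> :: "real \<Rightarrow> real" and \<gamma> :: real
  assumes "prob_space M"
    and "\<And>i. X i \<in> borel_measurable M"
    and "stationary M X"
    and "continuous_on UNIV (dfun M X)"
    and "function_space_with_seminorm G nG"
    and "\<forall>f\<in>G. bounded (range f) \<and> (\<integral>\<omega>. f (X 0 \<omega>) \<partial>M) = 0 \<longrightarrow>
           (\<exists>s2\<ge>0. weak_conv_m
              (\<lambda>n. distr M borel (\<lambda>\<omega>. (\<Sum>i\<in>{1..n}. f (X i \<omega>)) / sqrt (real n)))
              (gauss_law s2))"
    and "multiple_mixing M X G nG \<Theta> r"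
    and "real p > real CARD('d) * r"
    and "summable (\<lambda>i. real i ^ (2 * p - 2) * \<Theta> i)"
    and "control_function M X G nG \<Psi>"
    and "\<Psi> \<in> O[at_top](\<lambda>z. z powr (1 / \<gamma>))"
    and "\<gamma> > r * real p / (real p - r * real CARD('d))"
  shows "\<exists>(N :: (ereal^'d \<Rightarrow> real) measure) (W :: ereal^'d \<Rightarrow> (ereal^'d \<Rightarrow> real) \<Rightarrow> real).
           centered_gaussian_process N W \<and>
           (AE \<omega> in N. continuous_on UNIV (\<lambda>t. W t \<omega>)) \<and>
           conv_distr_D M (emp_proc M X) N (\<lambda>\<omega> t. W t \<omega>)"
proof -
  have "r \<ge> 1" using assms(7) by (simp add: multiple_mixing_def)
  have "0 \<le> real CARD('d) * r" using \<open>r \<ge> 1\<close> by simp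
  then have "0 < real p" using assms(8) by linarith
  then have p: "1 \<le> p" by simp
  interpret emp_clt M X G nG \<Theta> r p \<Psi> \<gamma>
    by (intro emp_clt.intro mixing_process.intro mixing_process_axioms.intro emp_clt_axioms.intro assms p)
  show ?thesis
  proof (intro exI conjI)
    show "centered_gaussian_process white_noise W" by (rule W_gaussian)
    show "AE \<omega> in white_noise. continuous_on UNIV (\<lambda>t. W t \<omega>)" by (simp add: W_continuous)
    show "conv_distr_D M (emp_proc M X) white_noise (\<lambda>\<omega> t. W t \<omega>)" by (rule emp_proc_conv_distr)
  qed
qed

end
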